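(* If $\mu$ and $\lambda$ are strict partitions then $jp_{\lambda/\mu}=jp^{\mathrm{comb}}_{\lambda/\mu}$.
   Context: Strict partitions $\lambda=(\lambda_1>\dots>\lambda_k>0)$, $|\lambda|=\sum\lambda_i$, shifted diagram $\mathsf{SD}_\lambda=\{(i,i+j-1):1\le i\le k,1\le j\le\lambda_i\}$; for strict $\mu\subseteq\lambda$, $\mathsf{SD}_{\lambda/\mu}=\mathsf{SD}_\lambda\setminus\mathsf{SD}_\mu$; diagonal boxes $(i,i)$. Primed numbers $i'=i-\tfrac12$, ordered $1'<1<2'<2<\dots$; $\beta,x_i,y_i$ commuting indeterminates. A semistandard shifted set-valued tableau of shape $\lambda$ fills each box $(i,j)$ with a nonempty finite subset $T_{ij}$ of $\{1'<1<\dots\}$ with $\max T_{ij}\le\min T_{i+1,j}$, $\max T_{ij}\le\min T_{i,j+1}$ (when boxes exist), no unprimed number in two boxes of a column, no primed number in two boxes of a row; $|T|=\sum|T_{ij}|$, ${\bf x}^T=\prod x_i^{(\#i)+(\#i')}$. $GQ_\lambda=\sum\beta^{|\lambda|-|T|}{\bf x}^T$ over all such tableaux; $GP_\lambda$ the same over those with no primed diagonal entries. $gp_\lambda,gq_\lambda$ are the unique power series with $\sum_\lambda GQ_\lambda({\bf x})gp_\lambda({\bf y})=\sum_\lambda GP_\lambda({\bf x})gq_\lambda({\bf y})=\prod_{i,j}\frac{1-\overline{x_i}y_j}{1-x_iy_j}$, $\overline{x}=\frac{-x}{1+\beta x}$. Let $\omega$ be the $\mathbb{Z}[\beta]$-linear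 involution of symmetric functions with $\omega(s_\lambda)=s_{\lambda^\top}$, and $jp_\lambda=\omega(gp_\lambda)$. With $f({\bf x},{\bf y}):=f(x_1,y_1,x_2,y_2,\dots)$, the skew functions $jp_{\lambda/\mu}$ ($\mu$ any strict partition) are defined by $jp_\lambda({\bf x},{\bf y})=\sum_\mu jp_\mu({\bf x})jp_{\lambda/\mu}({\bf y})$. A shifted bar tableau of shape $\lambda/\mu$ is a pair $(V,\Pi)$: $V$ fills each box with one element of $\{1'<1<\dots\}$, no unprimed entry repeated in a column, no primed entry repeated in a row; $\Pi$ partitions the boxes into nonempty bars of contiguous boxes in one row or column with equal entries; semistandard means weakly increasing rows and columns; $|T|$ = number of bars, ${\bf x}^T=\prod x_i^{b_i}$ ($b_i$ = bars containing $i$ or $i'$). $jp^{\mathrm{comb}}_{\lambda/\mu}=\sum(-\beta)^{|\lambda|-|\mu|-|T|}{\bf x}^T$ over semistandard shifted bar tableaux of shape $\lambda/\mu$ with no primed diagonal entries (zero if $\mu\not\subseteq\lambda$).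
   Formalization: GQ_λ is taken with the exponent β^{|T|-|λ|} in place of the printed β^{|λ|-|T|}; with the printed exponent no power series gp_λ over Z[β] (or Z[β,1/β]) satisfy the Cauchy identity, since [y]gp_{(2)} would have to be -(β+1/β)/2. *)

theory Defs
  imports
    "HOL-Library.Multiset"
    "HOL-Library.FuncSet"
    "HOL-Library.Disjoint_Sets"
    "HOL-Library.Nat_Bijection"
    "HOL-Computational_Algebra.Polynomial"
begin

text \<open>
  A monomial in variables indexed by \<open>'v\<close> is a finite multiset over \<open>'v\<close> (the multiplicity of
  \<open>v\<close> is the exponent of the variable \<open>v\<close>), and a power series is an arbitrary function from
  monomials to coefficients.
\<close>

typedef ('v, 'a) mps = "UNIV :: ('v multiset \<Rightarrow> 'a) set"
  morphisms mps_nth Mps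
  by simp

lemma mps_nth_Mps [simp]: "mps_nth (Mps f) = f"
  by (simp add: Mps_inverse)

lemma mps_eqI: "(\<And>M. mps_nth f M = mps_nth g M) \<Longrightarrow> f = g"
  by (metis mps_nth_inject ext)

lemma finite_splits [simp]: "finite {(A, B). A + B = (M :: 'v multiset)}"
proof (induction M)
  case empty
  have "{(A, B). A + B = ({#} :: 'v multiset)} = {({#}, {#})}"
    by auto
  then show ?case by simp
next
  case (add x M)
  let ?S = "{(A, B). A + B = M}"
  have "{(A, B). A + B = add_mset x M} \<subseteq>
      (\<lambda>(A, B). (add_mset x A, B)) ` ?S \<union> (\<lambda>(A, B). (A, add_mset x B)) ` ?S"
  proof (clarify)
    fix A B
    assume eq: "A + B = add_mset x M"
      and "(A, B) \<notin> (\<lambda>(A, B). (A, add_mset x B)) ` ?S"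
    have "x \<notin># B"
    proof
      assume "x \<in># B"
      then obtain B' where "B = add_mset x B'" by (meson mset_add)
      with eq \<open>(A, B) \<notin> _\<close> show False by (auto simp: image_iff)
    qed
    moreover have "x \<in># A + B" using eq by simp
    ultimately have "x \<in># A" by simp
    then obtain A' where "A = add_mset x A'" by (meson mset_add)
    with eq show "(A, B) \<in> (\<lambda>(A, B). (add_mset x A, B)) ` ?S"
      by (auto simp: image_iff)
  qed
  with add show ?case by (meson finite_UnI finite_imageI finite_subset)
qed

lemma finite_splits' [simp]: "finite {p. fst p + snd p = (M :: 'v multiset)}"
  using finite_splits[of M] by (simp add: case_prod_unfold)

instantiation mps :: (type, comm_ring_1) comm_ring_1
begin

definition "0 = Mps (\<lambda>_. 0)"
definition "1 = Mps (\<lambda>M. if M = {#} then 1 else 0)"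
definition "f + g = Mps (\<lambda>M. mps_nth f M + mps_nth g M)"
definition "f - g = Mps (\<lambda>M. mps_nth f M - mps_nth g M)"
definition "- f = Mps (\<lambda>M. - mps_nth f M)"
definition "f * g = Mps (\<lambda>M. \<Sum>(A, B) \<in> {(A, B). A + B = M}. mps_nth f A * mps_nth g B)"

instance
proof
  fix f g h :: "('a, 'b) mps"
  show "f * g * h = f * (g * h)"
  proof (rule mps_eqI)
    fix M
    have "mps_nth (f * g * h) M =
        (\<Sum>p \<in> {(A, B). A + B = M}. \<Sum>q \<in> {(C, D). C + D = fst p}.
           mps_nth f (fst q) * mps_nth g (snd q) * mps_nth h (snd p))"
      by (simp add: times_mps_def sum_distrib_right case_prod_unfold)
    also have "\<dots> = (\<Sum>(p, q) \<in> (SIGMA p:{(A, B). A + B = M}. {(C, D). C + D = fst p}).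
           mps_nth f (fst q) * mps_nth g (snd q) * mps_nth h (snd p))"
      by (subst sum.Sigma) (auto simp: case_prod_unfold)
    also have "\<dots> = (\<Sum>(p, q) \<in> (SIGMA p:{(A, B). A + B = M}. {(C, D). C + D = snd p}).
           mps_nth f (fst p) * (mps_nth g (fst q) * mps_nth h (snd q)))"
      by (rule sum.reindex_bij_witness
          [where i = "\<lambda>(p, q). ((fst p + fst q, snd q), (fst p, fst q))"
             and j = "\<lambda>(p, q). ((fst q, snd q + snd p), (snd q, snd p))"])
         (auto simp: add.assoc mult.assoc)
    also have "\<dots> = (\<Sum>p \<in> {(A, B). A + B = M}. \<Sum>q \<in> {(C, D). C + D = snd p}.
           mps_nth f (fst p) * (mps_nth g (fst q) * mps_nth h (snd q)))"
      by (subst sum.Sigma) (auto simp: case_prod_unfold)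
    also have "\<dots> = mps_nth (f * (g * h)) M"
      by (simp add: times_mps_def sum_distrib_left case_prod_unfold)
    finally show "mps_nth (f * g * h) M = mps_nth (f * (g * h)) M" .
  qed
  show "f * g = g * f"
  proof (rule mps_eqI)
    fix M
    show "mps_nth (f * g) M = mps_nth (g * f) M"
      unfolding times_mps_def mps_nth_Mps
      by (rule sum.reindex_bij_witness[where i = prod.swap and j = prod.swap])
         (auto simp: add.commute mult.commute)
  qed
  show "1 * f = f"
  proof (rule mps_eqI)
    fix M
    have "mps_nth (1 * f) M = (\<Sum>(A, B) \<in> {({#}, M)}. mps_nth 1 A * mps_nth f B)"
      unfolding times_mps_def mps_nth_Mps
    proof (rule sum.mono_neutral_right)
      show "\<forall>p \<in> {(A, B). A + B = M} - {({#}, M)}. (case p of (A, B) \<Rightarrow> mps_nth 1 A * mps_nth f B) = 0"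
      proof
        fix p assume "p \<in> {(A, B). A + B = M} - {({#}, M)}"
        then have "fst p \<noteq> {#}" by auto
        then show "(case p of (A, B) \<Rightarrow> mps_nth 1 A * mps_nth f B) = 0"
          by (simp add: one_mps_def case_prod_unfold)
      qed
    qed simp_all
    then show "mps_nth (1 * f) M = mps_nth f M" by (simp add: one_mps_def)
  qed
  show "(f + g) * h = f * h + g * h"
    by (rule mps_eqI)
       (simp add: times_mps_def plus_mps_def case_prod_unfold distrib_right sum.distrib)
  show "(0 :: ('a, 'b) mps) \<noteq> 1"
  proof
    assume "(0 :: ('a, 'b) mps) = 1"
    then have "mps_nth (0 :: ('a, 'b) mps) {#} = mps_nth 1 {#}" by simp
    then show False by (simp add: zero_mps_def one_mps_def)
  qed
  show "f + g + h = f + (g + h)"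
    by (rule mps_eqI) (simp add: plus_mps_def add.assoc)
  show "f + g = g + f"
    by (rule mps_eqI) (simp add: plus_mps_def add.commute)
  show "0 + f = f"
    by (rule mps_eqI) (simp add: plus_mps_def zero_mps_def)
  show "- f + f = 0"
    by (rule mps_eqI) (simp add: plus_mps_def uminus_mps_def zero_mps_def)
  show "f - g = f + - g"
    by (rule mps_eqI) (simp add: plus_mps_def minus_mps_def uminus_mps_def)
qed

end

definition const :: "'a :: comm_ring_1 \<Rightarrow> ('v, 'a) mps"
  where "const c = Mps (\<lambda>M. if M = {#} then c else 0)"

definition X :: "'v \<Rightarrow> ('v, 'a :: comm_ring_1) mps"
  where "X v = Mps (\<lambda>M. if M = {#v#} then 1 else 0)"

definition mps_inv :: "('v, 'a :: comm_ring_1) mps \<Rightarrow> ('v, 'a) mps"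
  where "mps_inv f = (THE g. f * g = 1)"

text \<open>
  Renaming of the variables along an injective map \<open>h\<close>: variable \<open>v\<close> is replaced by \<open>h v\<close>.
\<close>

definition rename :: "('v \<Rightarrow> 'w) \<Rightarrow> ('v, 'a :: comm_ring_1) mps \<Rightarrow> ('w, 'a) mps"
  where "rename h f = Mps (\<lambda>M. \<Sum>N | image_mset h N = M. mps_nth f N)"

text \<open>
  Infinite sums and products are taken in the usual topology of formal power series: every
  coefficient of the finite partial sums (products) is eventually constant. For sums this means
  that each monomial has a nonzero coefficient in only finitely many terms.
\<close>

definition formal_has_sum :: "('i \<Rightarrow> ('v, 'a :: comm_ring_1) mps) \<Rightarrow> 'i set \<Rightarrow> ('v, 'a) mps \<Rightarrow> bool"
  where "formal_has_sum f I s \<longleftrightarrow>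
    (\<forall>M. \<forall>\<^sub>F F in finite_subsets_at_top I. mps_nth (\<Sum>i\<in>F. f i) M = mps_nth s M)"

definition formal_sum :: "('i \<Rightarrow> ('v, 'a :: comm_ring_1) mps) \<Rightarrow> 'i set \<Rightarrow> ('v, 'a) mps"
  where "formal_sum f I = (THE s. formal_has_sum f I s)"

definition formal_has_prod :: "('i \<Rightarrow> ('v, 'a :: comm_ring_1) mps) \<Rightarrow> 'i set \<Rightarrow> ('v, 'a) mps \<Rightarrow> bool"
  where "formal_has_prod f I p \<longleftrightarrow>
    (\<forall>M. \<forall>\<^sub>F F in finite_subsets_at_top I. mps_nth (\<Prod>i\<in>F. f i) M = mps_nth p M)"

definition formal_prod :: "('i \<Rightarrow> ('v, 'a :: comm_ring_1) mps) \<Rightarrow> 'i set \<Rightarrow> ('v, 'a) mps"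
  where "formal_prod f I = (THE p. formal_has_prod f I p)"

lemma formal_has_sum_unique:
  assumes "formal_has_sum f I s" "formal_has_sum f I t"
  shows "s = t"
proof (rule mps_eqI)
  fix M
  have "\<forall>\<^sub>F F in finite_subsets_at_top I. mps_nth s M = mps_nth t M"
    using assms[unfolded formal_has_sum_def, rule_format, of M]
    by eventually_elim simp
  then show "mps_nth s M = mps_nth t M" by simp
qed

lemma formal_has_prod_unique:
  assumes "formal_has_prod f I s" "formal_has_prod f I t"
  shows "s = t"
proof (rule mps_eqI)
  fix M
  have "\<forall>\<^sub>F F in finite_subsets_at_top I. mps_nth s M = mps_nth t M"
    using assms[unfolded formal_has_prod_def, rule_format, of M]
    by eventually_elim simp
  then show "mps_nth s M = mps_nth t M" by simp
qed

lemma formal_sum_eqI: "formal_has_sum f I s \<Longrightarrow> formal_sum f I = s"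
  unfolding formal_sum_def by (blast intro: formal_has_sum_unique)

lemma formal_prod_eqI: "formal_has_prod f I p \<Longrightarrow> formal_prod f I = p"
  unfolding formal_prod_def by (blast intro: formal_has_prod_unique)

text \<open>
  The coefficient ring \<open>\<int>[\<beta>]\<close> is \<^typ>\<open>int poly\<close>. Everything is indexed from 0: the variable
  \<open>x\<^sub>i\<close> is \<^term>\<open>X (i - 1)\<close>, and the number \<open>i\<close> (or \<open>i'\<close>) in a tableau becomes \<open>Unprimed (i - 1)\<close>
  (or \<open>Primed (i - 1)\<close>). Series in two alphabets \<open>x\<close>, \<open>y\<close> have variables of type \<^typ>\<open>nat + nat\<close>,
  with \<open>Inl\<close> for \<open>x\<close> and \<open>Inr\<close> for \<open>y\<close>.
\<close>

type_synonym series = "(nat, int poly) mps"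
type_synonym series2 = "(nat + nat, int poly) mps"

definition \<beta> :: "int poly"
  where "\<beta> = [:0, 1:]"

definition in_x :: "series \<Rightarrow> series2"
  where "in_x = rename Inl"

definition in_y :: "series \<Rightarrow> series2"
  where "in_y = rename Inr"

text \<open>
  \<open>f(x, y) = f(x\<^sub>1, y\<^sub>1, x\<^sub>2, y\<^sub>2, \<dots>)\<close>: \<^const>\<open>sum_decode\<close> sends \<open>2k\<close> to \<open>Inl k\<close> and \<open>2k + 1\<close> to \<open>Inr k\<close>.
\<close>

definition in_xy :: "series \<Rightarrow> series2"
  where "in_xy = rename sum_decode"

datatype letter = Primed (index: nat) | Unprimed (index: nat)

fun letter_rank :: "letter \<Rightarrow> nat"
  where
    "letter_rank (Primed i) = 2 * i"
  | "letter_rank (Unprimed i) = 2 * i + 1"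

lemma letter_rank_inject: "letter_rank a = letter_rank b \<Longrightarrow> a = b"
  by (cases a; cases b; simp; presburger)

instantiation letter :: linorder
begin

definition "a \<le> b \<longleftrightarrow> letter_rank a \<le> letter_rank b"
definition "a < b \<longleftrightarrow> letter_rank a < letter_rank b"

instance
  by standard (auto simp: less_eq_letter_def less_letter_def letter_rank_inject)

end

definition partitions :: "nat list set"
  where "partitions = {lam. sorted_wrt (\<ge>) lam \<and> 0 \<notin> set lam}"

definition strict_partitions :: "nat list set"
  where "strict_partitions = {lam. sorted_wrt (>) lam \<and> 0 \<notin> set lam}"

text \<open>Boxes are \<open>(row, column)\<close>, both counted from 0.\<close>

definition YD :: "nat list \<Rightarrow> (nat \<times> nat) set"
  where "YD lam = {(i, j) | i j. i < length lam \<and> j < lam ! i}"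

definition SD :: "nat list \<Rightarrow> (nat \<times> nat) set"
  where "SD lam = {(i, i + j) | i j. i < length lam \<and> j < lam ! i}"

definition conjugate :: "nat list \<Rightarrow> nat list"
  where "conjugate lam =
    (case lam of [] \<Rightarrow> [] | k # _ \<Rightarrow> map (\<lambda>j. length (filter (\<lambda>r. j < r) lam)) [0..<k])"

definition SSYT :: "nat list \<Rightarrow> (nat \<times> nat \<Rightarrow> nat) set"
  where "SSYT lam = {T \<in> extensional (YD lam).
    (\<forall>i j. (i, j) \<in> YD lam \<longrightarrow> (i, Suc j) \<in> YD lam \<longrightarrow> T (i, j) \<le> T (i, Suc j)) \<and>
    (\<forall>i j. (i, j) \<in> YD lam \<longrightarrow> (Suc i, j) \<in> YD lam \<longrightarrow> T (i, j) < T (Suc i, j))}"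

definition schur :: "nat list \<Rightarrow> series"
  where "schur lam = formal_sum (\<lambda>T. \<Prod>b\<in>YD lam. X (T b)) (SSYT lam)"

text \<open>
  The Schur functions are a \<open>\<int>[\<beta>]\<close>-basis of the ring of symmetric functions (of bounded degree),
  and \<open>\<omega>\<close> is the linear extension of \<open>s\<^sub>\<lambda> \<mapsto> s\<^sub>\<lambda>\<^sub>\<top>\<close>; its value on other series is irrelevant.
\<close>

definition \<omega> :: "series \<Rightarrow> series"
  where "\<omega> f = (THE g. \<exists>P c. finite P \<and> P \<subseteq> partitions \<and>
    f = (\<Sum>lam\<in>P. const (c lam) * schur lam) \<and>
    g = (\<Sum>lam\<in>P. const (c lam) * schur (conjugate lam)))"

definition SSVT :: "nat list \<Rightarrow> (nat \<times> nat \<Rightarrow> letter set) set"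
  where "SSVT lam = {T \<in> extensional (SD lam).
    (\<forall>b\<in>SD lam. finite (T b) \<and> T b \<noteq> {}) \<and>
    (\<forall>i j. (i, j) \<in> SD lam \<longrightarrow> (Suc i, j) \<in> SD lam \<longrightarrow> Max (T (i, j)) \<le> Min (T (Suc i, j))) \<and>
    (\<forall>i j. (i, j) \<in> SD lam \<longrightarrow> (i, Suc j) \<in> SD lam \<longrightarrow> Max (T (i, j)) \<le> Min (T (i, Suc j))) \<and>
    (\<forall>a i i' j. (i, j) \<in> SD lam \<longrightarrow> (i', j) \<in> SD lam \<longrightarrow> i \<noteq> i' \<longrightarrow>
       \<not> (Unprimed a \<in> T (i, j) \<and> Unprimed a \<in> T (i', j))) \<and>
    (\<forall>a i j j'. (i, j) \<in> SD lam \<longrightarrow> (i, j') \<in> SD lam \<longrightarrow> j \<noteq> j' \<longrightarrow>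
       \<not> (Primed a \<in> T (i, j) \<and> Primed a \<in> T (i, j')))}"

text \<open>
  The exponent of \<open>\<beta>\<close> is \<open>|T| - |\<lambda>| \<ge> 0\<close>, the number of surplus entries of \<open>T\<close>.
\<close>

definition GQ :: "nat list \<Rightarrow> series"
  where "GQ lam = formal_sum
    (\<lambda>T. const (\<beta> ^ ((\<Sum>b\<in>SD lam. card (T b)) - sum_list lam)) *
         (\<Prod>b\<in>SD lam. \<Prod>a\<in>T b. X (index a)))
    (SSVT lam)"

definition bar :: "('v, int poly) mps \<Rightarrow> ('v, int poly) mps"
  where "bar x = - x * mps_inv (1 + const \<beta> * x)"

definition cauchy_kernel :: series2
  where "cauchy_kernel = formal_prod
    (\<lambda>(i, j). (1 - bar (X (Inl i)) * X (Inr j)) * mps_inv (1 - X (Inl i) * X (Inr j))) UNIV"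

text \<open>
  The families below are indexed by all lists; outside the strict partitions they are set to 0 in
  order that the defining identity determine them.
\<close>

definition gp :: "nat list \<Rightarrow> series"
  where "gp = (THE g. (\<forall>lam. lam \<notin> strict_partitions \<longrightarrow> g lam = 0) \<and>
    formal_has_sum (\<lambda>lam. in_x (GQ lam) * in_y (g lam)) strict_partitions cauchy_kernel)"

definition jp :: "nat list \<Rightarrow> series"
  where "jp lam = \<omega> (gp lam)"

definition jp_skew :: "nat list \<Rightarrow> nat list \<Rightarrow> series"
  where "jp_skew lam = (THE J. (\<forall>mu. mu \<notin> strict_partitions \<longrightarrow> J mu = 0) \<and>
    formal_has_sum (\<lambda>mu. in_x (jp mu) * in_y (J mu)) strict_partitions (in_xy (jp lam)))"

definition is_bar :: "(nat \<times> nat \<Rightarrow> letter) \<Rightarrow> (nat \<times> nat) set \<Rightarrow> bool"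
  where "is_bar V B \<longleftrightarrow>
    (\<exists>i j n. B = {(i, j + k) | k. k < n} \<or> B = {(i + k, j) | k. k < n}) \<and>
    (\<forall>b\<in>B. \<forall>b'\<in>B. V b = V b')"

definition shifted_bar_tableaux ::
    "(nat \<times> nat) set \<Rightarrow> ((nat \<times> nat \<Rightarrow> letter) \<times> (nat \<times> nat) set set) set"
  where "shifted_bar_tableaux D = {(V, Bs). V \<in> extensional D \<and>
    (\<forall>a i i' j. (i, j) \<in> D \<longrightarrow> (i', j) \<in> D \<longrightarrow> i \<noteq> i' \<longrightarrow>
       \<not> (V (i, j) = Unprimed a \<and> V (i', j) = Unprimed a)) \<and>
    (\<forall>a i j j'. (i, j) \<in> D \<longrightarrow> (i, j') \<in> D \<longrightarrow> j \<noteq> j' \<longrightarrow>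
       \<not> (V (i, j) = Primed a \<and> V (i, j') = Primed a)) \<and>
    partition_on D Bs \<and> (\<forall>B\<in>Bs. is_bar V B)}"

definition semistandard :: "(nat \<times> nat) set \<Rightarrow> (nat \<times> nat \<Rightarrow> letter) \<Rightarrow> bool"
  where "semistandard D V \<longleftrightarrow>
    (\<forall>i j j'. (i, j) \<in> D \<longrightarrow> (i, j') \<in> D \<longrightarrow> j \<le> j' \<longrightarrow> V (i, j) \<le> V (i, j')) \<and>
    (\<forall>i i' j. (i, j) \<in> D \<longrightarrow> (i', j) \<in> D \<longrightarrow> i \<le> i' \<longrightarrow> V (i, j) \<le> V (i', j))"

definition no_primed_diagonal :: "(nat \<times> nat) set \<Rightarrow> (nat \<times> nat \<Rightarrow> letter) \<Rightarrow> bool"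
  where "no_primed_diagonal D V \<longleftrightarrow> (\<forall>i a. (i, i) \<in> D \<longrightarrow> V (i, i) \<noteq> Primed a)"

definition jp_comb :: "nat list \<Rightarrow> nat list \<Rightarrow> series"
  where "jp_comb lam mu =
    (if SD mu \<subseteq> SD lam
     then formal_sum
       (\<lambda>(V, Bs). const ((- \<beta>) ^ (sum_list lam - sum_list mu - card Bs)) *
                 (\<Prod>B\<in>Bs. X (index (the_elem (V ` B)))))
       {(V, Bs) \<in> shifted_bar_tableaux (SD lam - SD mu).
          semistandard (SD lam - SD mu) V \<and> no_primed_diagonal (SD lam - SD mu) V}
     else 0)"

end

theory Submission
  imports Defs "HOL-Computational_Algebra.Formal_Power_Series"
begin

text \<open>
  A shifted tableau is read one index at a time: the boxes carrying \<open>i\<close> or \<open>i'\<close> fill a skew shape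
  between two strict partitions. Encoding a strict partition by the lengths of its diagonals, the sum
  over the fillings of such a layer is a product of transfer matrices along the diagonals, which gives
  an operator \<open>U(x)\<close> for \<open>GQ\<close> and an operator \<open>D(y)\<close> for the combinatorial \<open>jp\<close>. They commute up to
  a scalar factor and a remainder of high degree in \<open>x\<close>, so multiplication by the coefficients of
  \<open>Q'(t) = E(t) H(t/(1 + \<beta>t))\<close> acts on the combinatorial \<open>jp\<close> by the coefficients of \<open>U\<close>, and
  \<open>\<Prod>\<^sub>i Q'(x\<^sub>i)\<close> expands as \<open>\<Sum>\<^sub>\<lambda> GQ\<^sub>\<lambda>(x) jp\<^sub>\<lambda>(y)\<close>. By the Pieri rules \<open>\<omega>\<close> exchanges the \<open>e\<^sub>k\<close> and \<open>h\<^sub>k\<close>; it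
  therefore turns this product into \<open>\<Prod>\<^sub>i H(x\<^sub>i) E(x\<^sub>i/(1 + \<beta>x\<^sub>i))\<close>, the Cauchy kernel, which
  identifies \<open>gp\<^sub>\<lambda>\<close>. Finally the layer recursion splits a tableau into its entries from \<open>x\<close> and from
  \<open>y\<close>, and the leading monomials of the \<open>jp\<^sub>\<mu>\<close> make the coefficients of this expansion unique.
\<close>

section \<open>Multivariate power series\<close>

text \<open>Up to the remainder, the two transfer operators commute with the ratio (1 + xy)(1 +
  \<beta>x) / (1 + \<beta>x - xy). This is 1 + xy divided by 1 - xy/(1 + \<beta>x), that is
  \<open>Qp\<close> for the single variable y, and every further variable of \<open>jp\<close>
  multiplies the eigenvalue by one such factor. Diagrams with at most M diagonals keep all sums
  finite; the price is a boundary term in which the diagonals 0 to M all carry boxes, and its order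
  in x exceeds that of every coefficient extracted later. In the kernel, \<open>bar\<close> of x is
  -x/(1 + \<beta>x), which is where the substitution t/(1 + \<beta>t) comes from. Two obstacles
  shape the end. The lowest coefficient of \<open>GQ\<close> is a positive integer but not always a
  unit, so solving the expansion for \<open>jp\<close> needs a division, which is legitimate because
  Schur functions have lowest coefficient 1. And \<open>jp\<close> has terms of smaller degree than
  its shape, so a monomial does not bound the shapes in which it occurs; uniqueness of the skew
  coefficients first bounds the number of rows, which leaves finitely many candidates, and then
  compares terms of top degree.\<close>

locale rhom =
  fixes h :: "'a :: comm_ring_1 \<Rightarrow> 'b :: comm_ring_1"
  assumes one: "h 1 = 1" and add: "h (a + b) = h a + h b" and mult: "h (a * b) = h a * h b"
begin

lemma zero: "h 0 = 0"
  using add[of 0 0] by simp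

lemma uminus: "h (- a) = - h a"
  using add[of a "- a"] zero by (simp add: eq_neg_iff_add_eq_0 add.commute)

lemma diff: "h (a - b) = h a - h b"
  using add[of a "- b"] uminus by simp

lemma sum: "h (sum f A) = (\<Sum>x\<in>A. h (f x))"
  by (induction A rule: infinite_finite_induct) (simp_all add: zero add)

lemma prod: "h (prod f A) = (\<Prod>x\<in>A. h (f x))"
  by (induction A rule: infinite_finite_induct) (simp_all add: one mult)

lemma power: "h (a ^ n) = h a ^ n"
  by (induction n) (simp_all add: one mult)

lemmas hom = zero one uminus add diff mult sum prod power

end

lemma mps_nth_zero [simp]: "mps_nth 0 M = 0"
  and mps_nth_one: "mps_nth 1 M = (if M = {#} then 1 else 0)"
  and mps_nth_add [simp]: "mps_nth (f + g) M = mps_nth f M + mps_nth g M"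
  and mps_nth_diff [simp]: "mps_nth (f - g) M = mps_nth f M - mps_nth g M"
  and mps_nth_uminus [simp]: "mps_nth (- f) M = - mps_nth f M"
  and mps_nth_const: "mps_nth (const c) M = (if M = {#} then c else 0)"
  and mps_nth_X: "mps_nth (X v) M = (if M = {#v#} then 1 else 0)"
  by (simp_all add: zero_mps_def one_mps_def plus_mps_def minus_mps_def uminus_mps_def
      const_def X_def)

lemma mps_nth_mult: "mps_nth (f * g) M = (\<Sum>p | fst p + snd p = M. mps_nth f (fst p) * mps_nth g (snd p))"
  by (simp add: times_mps_def case_prod_unfold)

lemma mps_nth_sum [simp]: "mps_nth (sum f A) M = (\<Sum>x\<in>A. mps_nth (f x) M)"
  by (induction A rule: infinite_finite_induct) simp_all

lemma mps_nth_mult_cong: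
  assumes "\<And>A B. A + B = M \<Longrightarrow> mps_nth f A = mps_nth f' A \<and> mps_nth g B = mps_nth g' B"
  shows "mps_nth (f * g) M = mps_nth (f' * g') M"
  unfolding mps_nth_mult using assms by (intro sum.cong) auto

lemma mps_nth_mult_single:
  assumes "A + B = M"
    and "\<And>A' B'. A' + B' = M \<Longrightarrow> (A', B') \<noteq> (A, B) \<Longrightarrow> mps_nth f A' * mps_nth g B' = 0"
  shows "mps_nth (f * g) M = mps_nth f A * mps_nth g B"
proof -
  have "mps_nth (f * g) M = (\<Sum>p\<in>{(A, B)}. mps_nth f (fst p) * mps_nth g (snd p))"
    unfolding mps_nth_mult using assms by (intro sum.mono_neutral_right) force+
  then show ?thesis by simp
qed

lemma mps_nth_const_mult [simp]: "mps_nth (const c * f) M = c * mps_nth f M"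
  by (subst mps_nth_mult_single[of "{#}" M]) (auto simp: mps_nth_const)

lemma mps_nth_X_mult:
  "mps_nth (X v * f) M = (if v \<in># M then mps_nth f (M - {#v#}) else 0)"
proof (cases "v \<in># M")
  case True
  then show ?thesis
    by (subst mps_nth_mult_single[of "{#v#}" "M - {#v#}"]) (auto simp: mps_nth_X)
next
  case False
  then show ?thesis
    by (auto simp: mps_nth_mult mps_nth_X intro!: sum.neutral)
qed

lemma mps_nth_mult_empty [simp]: "mps_nth (f * g) {#} = mps_nth f {#} * mps_nth g {#}"
  by (rule mps_nth_mult_single) auto

lemma rhom_const: "rhom (const :: 'a \<Rightarrow> ('v, 'a :: comm_ring_1) mps)"
proof
  fix a b :: 'a
  show "const (a * b) = (const a * const b :: ('v, 'a) mps)"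
    by (rule mps_eqI) (simp add: mps_nth_const)
qed (rule mps_eqI; simp add: mps_nth_const mps_nth_one)+

definition mon :: "'v multiset \<Rightarrow> ('v, 'a :: comm_ring_1) mps"
  where "mon N = Mps (\<lambda>M. if M = N then 1 else 0)"

lemma mps_nth_mon: "mps_nth (mon N) M = (if M = N then 1 else 0)"
  by (simp add: mon_def)

lemma mon_empty [simp]: "mon {#} = 1"
  by (rule mps_eqI) (simp add: mps_nth_mon mps_nth_one)

lemma X_times_mon: "X v * mon N = mon (add_mset v N)"
  by (rule mps_eqI) (auto simp: mps_nth_X_mult mps_nth_mon)

lemma mon_mult: "mon M * mon N = (mon (M + N) :: ('v, 'a :: comm_ring_1) mps)"
proof (induction M)
  case (add v M)
  have "mon (add_mset v M) * mon N = X v * (mon M * mon N :: ('v, 'a) mps)"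
    by (simp only: X_times_mon[symmetric] mult.assoc)
  also have "\<dots> = mon (add_mset v M + N)"
    by (simp only: add X_times_mon add_mset_add_single[symmetric] union_mset_add_mset_left)
  finally show ?case .
qed simp

lemma X_eq_mon: "X v = mon {#v#}"
  by (rule mps_eqI) (simp add: mps_nth_X mps_nth_mon)

lemma prod_mon: "(\<Prod>x\<in>A. mon (f x)) = mon (\<Sum>x\<in>A. f x)"
  by (induction A rule: infinite_finite_induct) (simp_all add: mon_mult)

subsection \<open>Killing variables and renaming\<close>

text \<open>Sets the variables outside \<open>V\<close> to 0. As a ring homomorphism it reduces
  identities in infinitely many variables to finitely many, where generating functions become finite
  products.\<close>

definition res :: "'v set \<Rightarrow> ('v, 'a :: comm_ring_1) mps \<Rightarrow> ('v, 'a) mps"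
  where "res V f = Mps (\<lambda>M. if set_mset M \<subseteq> V then mps_nth f M else 0)"

lemma mps_nth_res: "mps_nth (res V f) M = (if set_mset M \<subseteq> V then mps_nth f M else 0)"
  by (simp add: res_def)

lemma rhom_res: "rhom (res V :: ('v, 'a :: comm_ring_1) mps \<Rightarrow> _)"
proof
  fix f g :: "('v, 'a) mps"
  show "res V (f * g) = res V f * res V g"
  proof (rule mps_eqI)
    fix M
    show "mps_nth (res V (f * g)) M = mps_nth (res V f * res V g) M"
    proof (cases "set_mset M \<subseteq> V")
      case True
      then show ?thesis
        by (simp add: mps_nth_res) (rule mps_nth_mult_cong, auto simp: mps_nth_res)
    next
      case False
      have "mps_nth (res V f) A * mps_nth (res V g) B = 0" if "A + B = M" for A B
        using False that by (auto simp: mps_nth_res)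
      then show ?thesis
        using False by (auto simp: mps_nth_res mps_nth_mult intro!: sum.neutral[symmetric])
    qed
  qed
qed (rule mps_eqI; simp add: mps_nth_res mps_nth_one)+

lemma res_X: "res V (X v) = (if v \<in> V then X v else 0)"
  by (rule mps_eqI) (auto simp: mps_nth_res mps_nth_X)

lemma res_const [simp]: "res V (const c) = const c"
  by (rule mps_eqI) (auto simp: mps_nth_res mps_nth_const)

text \<open>Each monomial involves only finitely many variables, so some truncation already sees
  it.\<close>

lemma mps_eqI_res:
  assumes "\<And>n. res {..<n :: nat} f = res {..<n} g"
  shows "f = g"
proof (rule mps_eqI)
  fix M :: "nat multiset"
  obtain n where "set_mset M \<subseteq> {..<n}"
    using finite_nat_iff_bounded finite_set_mset by blast
  then show "mps_nth f M = mps_nth g M"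
    using assms[of n, THEN arg_cong[of _ _ "\<lambda>f. mps_nth f M"]] by (simp add: mps_nth_res)
qed

lemma image_mset_inj_iff: "inj h \<Longrightarrow> image_mset h M = image_mset h N \<longleftrightarrow> M = N"
  using multiset.inj_map[of h] by (auto dest: injD)

lemma mps_nth_rename_image:
  assumes "inj h"
  shows "mps_nth (rename h f) (image_mset h N) = mps_nth f N"
proof -
  have "{N'. image_mset h N' = image_mset h N} = {N}"
    using image_mset_inj_iff[OF assms] by auto
  then show ?thesis by (simp add: rename_def)
qed

lemma mps_nth_rename_notin:
  assumes "\<not> set_mset M \<subseteq> range h"
  shows "mps_nth (rename h f) M = 0"
proof -
  have "{N. image_mset h N = M} = {}" using assms by auto
  then show ?thesis by (simp add: rename_def)
qed

lemma image_mset_ex: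
  assumes "set_mset M \<subseteq> range h"
  obtains N where "M = image_mset h N"
proof -
  have "\<exists>N. M = image_mset h N" using assms
  proof (induction M)
    case (add v M)
    then obtain N a where "M = image_mset h N" "v = h a" by auto
    then have "add_mset v M = image_mset h (add_mset a N)" by simp
    then show ?case by blast
  qed simp
  then show thesis using that by blast
qed

text \<open>By injectivity, every splitting of \<open>image_mset h N\<close> is the image of exactly
  one splitting of \<open>N\<close>; a monomial outside the range has a factor outside the range in
  each of its splittings.\<close>

lemma rhom_rename:
  assumes "inj (h :: 'a \<Rightarrow> 'b)"
  shows "rhom (rename h :: ('a, 'c :: comm_ring_1) mps \<Rightarrow> _)"
proof
  fix f g :: "('a, 'c) mps"
  show "rename h 1 = (1 :: ('b, 'c) mps)"
  proof (rule mps_eqI)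
    fix M
    show "mps_nth (rename h 1) M = mps_nth (1 :: ('b, 'c) mps) M"
    proof (cases "set_mset M \<subseteq> range h")
      case True
      then obtain N where "M = image_mset h N" by (rule image_mset_ex)
      then show ?thesis by (simp add: mps_nth_rename_image[OF assms] mps_nth_one)
    qed (auto simp: mps_nth_rename_notin mps_nth_one)
  qed
  show "rename h (f + g) = rename h f + rename h g"
    by (rule mps_eqI) (simp add: rename_def sum.distrib)
  show "rename h (f * g) = rename h f * rename h g"
  proof (rule mps_eqI)
    fix M
    show "mps_nth (rename h (f * g)) M = mps_nth (rename h f * rename h g) M"
    proof (cases "set_mset M \<subseteq> range h")
      case True
      then obtain N where M: "M = image_mset h N" by (rule image_mset_ex)
      have "mps_nth (rename h f * rename h g) M =
          (\<Sum>p\<in>(\<lambda>p. (image_mset h (fst p), image_mset h (snd p))) ` {p. fst p + snd p = N}.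
            mps_nth (rename h f) (fst p) * mps_nth (rename h g) (snd p))"
        unfolding mps_nth_mult
      proof (rule sum.mono_neutral_cong_right)
        show "(\<lambda>p. (image_mset h (fst p), image_mset h (snd p))) ` {p. fst p + snd p = N}
            \<subseteq> {p. fst p + snd p = M}" using M by auto
        show "\<forall>p\<in>{p. fst p + snd p = M} -
            (\<lambda>p. (image_mset h (fst p), image_mset h (snd p))) ` {p. fst p + snd p = N}.
            mps_nth (rename h f) (fst p) * mps_nth (rename h g) (snd p) = 0"
        proof
          fix p assume p: "p \<in> {p. fst p + snd p = M} -
            (\<lambda>p. (image_mset h (fst p), image_mset h (snd p))) ` {p. fst p + snd p = N}"
          have False if s: "set_mset (fst p) \<subseteq> range h" "set_mset (snd p) \<subseteq> range h"
          proof -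
            obtain A where A: "fst p = image_mset h A" using image_mset_ex[OF s(1)] by blast
            obtain B where B: "snd p = image_mset h B" using image_mset_ex[OF s(2)] by blast
            have "image_mset h (A + B) = image_mset h N" using A B p M by simp
            then have "A + B = N" using image_mset_inj_iff[OF assms] by metis
            then have "p \<in> (\<lambda>p. (image_mset h (fst p), image_mset h (snd p))) ` {p. fst p + snd p = N}"
              using A B by (intro image_eqI[of _ _ "(A, B)"]) (auto simp: prod_eq_iff)
            with p show False by simp
          qed
          then show "mps_nth (rename h f) (fst p) * mps_nth (rename h g) (snd p) = 0"
            using mps_nth_rename_notin[of "fst p" h f] mps_nth_rename_notin[of "snd p" h g]
            by fastforce
        qed
      qed simp_all
      also have "\<dots> = (\<Sum>p | fst p + snd p = N. mps_nth f (fst p) * mps_nth g (snd p))"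
        by (subst sum.reindex)
          (auto simp: inj_on_def image_mset_inj_iff[OF assms] mps_nth_rename_image[OF assms])
      finally show ?thesis
        by (simp add: M mps_nth_rename_image[OF assms] mps_nth_mult)
    next
      case False
      have "mps_nth (rename h f) (fst p) * mps_nth (rename h g) (snd p) = 0"
        if p: "fst p + snd p = M" for p
      proof -
        have "\<not> set_mset (fst p) \<subseteq> range h \<or> \<not> set_mset (snd p) \<subseteq> range h"
          using False p by auto
        then show ?thesis
          using mps_nth_rename_notin[of "fst p" h f] mps_nth_rename_notin[of "snd p" h g]
          by fastforce
      qed
      then have "mps_nth (rename h f * rename h g) M = 0"
        unfolding mps_nth_mult by (intro sum.neutral) simp
      then show ?thesis using mps_nth_rename_notin[OF False] by simp
    qed
  qed
qed

lemma rename_const: "inj h \<Longrightarrow> rename h (const c) = const c"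
proof (rule mps_eqI)
  fix M assume h: "inj h"
  show "mps_nth (rename h (const c)) M = mps_nth (const c) M"
  proof (cases "set_mset M \<subseteq> range h")
    case True
    then obtain N where "M = image_mset h N" by (rule image_mset_ex)
    then show ?thesis by (simp add: mps_nth_rename_image[OF h] mps_nth_const)
  qed (auto simp: mps_nth_rename_notin mps_nth_const)
qed

lemma rename_X: "inj h \<Longrightarrow> rename h (X v) = X (h v)"
proof (rule mps_eqI)
  fix M assume h: "inj h"
  show "mps_nth (rename h (X v)) M = mps_nth (X (h v)) M"
  proof (cases "set_mset M \<subseteq> range h")
    case True
    then obtain N where N: "M = image_mset h N" by (rule image_mset_ex)
    have "image_mset h N = {#h v#} \<longleftrightarrow> N = {#v#}"
      using image_mset_inj_iff[OF h, of N "{#v#}"] by simp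
    then show ?thesis by (simp add: N mps_nth_rename_image[OF h] mps_nth_X)
  next
    case False
    then show ?thesis by (auto simp: mps_nth_rename_notin mps_nth_X)
  qed
qed

subsection \<open>Two alphabets\<close>

text \<open>Normal form of monomials in two alphabets: each one is \<open>two A B\<close> for
  exactly one pair.\<close>

definition two :: "'v multiset \<Rightarrow> 'w multiset \<Rightarrow> ('v + 'w) multiset"
  where "two A B = image_mset Inl A + image_mset Inr B"

lemma two_add: "two A B + two A' B' = two (A + A') (B + B')"
  by (simp add: two_def)

lemma two_eq_iff: "two A B = two A' B' \<longleftrightarrow> A = A' \<and> B = B'"
proof
  assume eq: "two A B = two A' B'"
  have 1: "filter_mset isl (image_mset Inl A) = image_mset Inl A"
    "filter_mset (\<lambda>x. \<not> isl x) (image_mset Inl A) = {#}" for A :: "'a multiset"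
    by (induction A) simp_all
  have 2: "filter_mset isl (image_mset Inr B) = {#}"
    "filter_mset (\<lambda>x. \<not> isl x) (image_mset Inr B) = image_mset Inr B" for B :: "'b multiset"
    by (induction B) simp_all
  have "image_mset Inl A = filter_mset isl (two A B)" for A :: "'a multiset" and B :: "'b multiset"
    by (simp add: two_def 1 2)
  moreover have "image_mset Inr B = filter_mset (\<lambda>x. \<not> isl x) (two A B)"
    for A :: "'a multiset" and B :: "'b multiset"
    by (simp add: two_def 1 2)
  ultimately have "image_mset (Inl :: _ \<Rightarrow> 'a + 'b) A = image_mset Inl A'"
    "image_mset (Inr :: _ \<Rightarrow> 'a + 'b) B = image_mset Inr B'"
    using eq by metis+
  then show "A = A' \<and> B = B'"
    by (simp add: image_mset_inj_iff)
qed simp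

lemma two_ex: obtains A B where "M = two A B"
proof -
  have "\<exists>A B. M = two A B"
  proof (induction M)
    case empty
    show ?case by (rule exI[of _ "{#}"], rule exI[of _ "{#}"]) (simp add: two_def)
  next
    case (add v M)
    then obtain A B where M: "M = two A B" by auto
    show ?case
    proof (cases v)
      case (Inl a)
      then have "add_mset v M = two (add_mset a A) B" by (simp add: M two_def)
      then show ?thesis by blast
    next
      case (Inr a)
      then have "add_mset v M = two A (add_mset a B)" by (simp add: M two_def)
      then show ?thesis by blast
    qed
  qed
  then show thesis using that by blast
qed

text \<open>Reads a series in x and y as a series in x whose coefficients are series in y. The
  coefficient of the Cauchy kernel at a fixed monomial in x thereby becomes a symmetric function of
  y, to which \<omega> can be related.\<close>

definition curry_mps :: "('v + 'w, 'a :: comm_ring_1) mps \<Rightarrow> ('v, ('w, 'a) mps) mps"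
  where "curry_mps f = Mps (\<lambda>A. Mps (\<lambda>B. mps_nth f (two A B)))"

lemma mps_nth_curry: "mps_nth (mps_nth (curry_mps f) A) B = mps_nth f (two A B)"
  by (simp add: curry_mps_def)

lemma rhom_curry: "rhom (curry_mps :: ('v + 'w, 'a :: comm_ring_1) mps \<Rightarrow> _)"
proof
  fix f g :: "('v + 'w, 'a) mps"
  show "curry_mps (f * g) = curry_mps f * curry_mps g"
  proof (intro mps_eqI)
    fix A :: "'v multiset" and B :: "'w multiset"
    have "mps_nth (mps_nth (curry_mps (f * g)) A) B =
      (\<Sum>p | fst p + snd p = two A B. mps_nth f (fst p) * mps_nth g (snd p))"
      by (simp add: mps_nth_curry mps_nth_mult)
    also have "\<dots> = (\<Sum>p\<in>(\<lambda>(p, q). (two (fst p) (fst q), two (snd p) (snd q))) `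
        ({p. fst p + snd p = A} \<times> {q. fst q + snd q = B}). mps_nth f (fst p) * mps_nth g (snd p))"
    proof (rule sum.cong)
      show "{p. fst p + snd p = two A B} = (\<lambda>(p, q). (two (fst p) (fst q), two (snd p) (snd q))) `
        ({p. fst p + snd p = A} \<times> {q. fst q + snd q = B})" (is "?L = ?R")
      proof
        show "?L \<subseteq> ?R"
        proof
          fix p assume p: "p \<in> ?L"
          obtain A1 B1 where 1: "fst p = two A1 B1" by (rule two_ex)
          obtain A2 B2 where 2: "snd p = two A2 B2" by (rule two_ex)
          from p 1 2 have "A1 + A2 = A \<and> B1 + B2 = B"
            by (simp add: two_add two_eq_iff)
          with 1 2 show "p \<in> ?R"
            by (intro image_eqI[of _ _ "((A1, A2), (B1, B2))"]) (auto simp: prod_eq_iff)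
        qed
        show "?R \<subseteq> ?L" by (auto simp: two_add)
      qed
    qed simp
    also have "\<dots> = (\<Sum>x\<in>{p. fst p + snd p = A} \<times> {q. fst q + snd q = B}.
        mps_nth f (two (fst (fst x)) (fst (snd x))) * mps_nth g (two (snd (fst x)) (snd (snd x))))"
      by (subst sum.reindex) (auto simp: inj_on_def two_eq_iff intro!: sum.cong)
    also have "\<dots> = mps_nth (mps_nth (curry_mps f * curry_mps g) A) B"
      by (simp add: mps_nth_mult[of _ _ A] mps_nth_mult[of _ _ B] mps_nth_curry
          sum.cartesian_product case_prod_unfold)
    finally show "mps_nth (mps_nth (curry_mps (f * g)) A) B =
      mps_nth (mps_nth (curry_mps f * curry_mps g) A) B" .
  qed
next
  show "curry_mps 1 = (1 :: ('v, ('w, 'a) mps) mps)"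
    using two_eq_iff[of _ _ "{#}" "{#}"]
    by (intro mps_eqI) (auto simp: mps_nth_curry mps_nth_one two_def)
qed (intro mps_eqI; simp add: mps_nth_curry)

lemma curry_const: "curry_mps (const c) = const (const c)"
  using two_eq_iff[of _ _ "{#}" "{#}"]
  by (intro mps_eqI) (auto simp: mps_nth_curry mps_nth_const two_def)

lemma curry_X_Inl: "curry_mps (X (Inl v) :: ('a + 'b, 'c :: comm_ring_1) mps) = X v"
proof (intro mps_eqI)
  fix A :: "'a multiset" and B :: "'b multiset"
  have "two A B = {#Inl v#} \<longleftrightarrow> A = {#v#} \<and> B = {#}"
    using two_eq_iff[of A B "{#v#}" "{#}"] by (simp add: two_def)
  then show "mps_nth (mps_nth (curry_mps (X (Inl v))) A) B = mps_nth (mps_nth (X v) A) B"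
    by (auto simp: mps_nth_curry mps_nth_X mps_nth_one)
qed

lemma curry_X_Inr: "curry_mps (X (Inr v) :: ('b + 'a, 'c :: comm_ring_1) mps) = const (X v)"
proof (intro mps_eqI)
  fix A :: "'b multiset" and B :: "'a multiset"
  have "two A B = {#Inr v#} \<longleftrightarrow> A = {#} \<and> B = {#v#}"
    using two_eq_iff[of A B "{#}" "{#v#}"] by (simp add: two_def)
  then show "mps_nth (mps_nth (curry_mps (X (Inr v))) A) B = mps_nth (mps_nth (const (X v)) A) B"
    by (auto simp: mps_nth_curry mps_nth_X mps_nth_const)
qed

lemma mps_nth_in_x: "mps_nth (in_x f) (two A B) = (if B = {#} then mps_nth f A else 0)"
proof (cases "B = {#}")
  case True
  then show ?thesis
    using mps_nth_rename_image[of Inl f A] by (simp add: in_x_def two_def)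
next
  case False
  then obtain b where "b \<in># B" by (meson multiset_nonemptyE)
  then have "Inr b \<in># two A B" by (simp add: two_def)
  then have "\<not> set_mset (two A B) \<subseteq> range Inl" by blast
  then show ?thesis using False by (simp add: in_x_def mps_nth_rename_notin)
qed

lemma mps_nth_in_y: "mps_nth (in_y f) (two A B) = (if A = {#} then mps_nth f B else 0)"
proof (cases "A = {#}")
  case True
  then show ?thesis
    using mps_nth_rename_image[of Inr f B] by (simp add: in_y_def two_def)
next
  case False
  then obtain a where "a \<in># A" by (meson multiset_nonemptyE)
  then have "Inl a \<in># two A B" by (simp add: two_def)
  then have "\<not> set_mset (two A B) \<subseteq> range Inr" by blast
  then show ?thesis using False by (simp add: in_y_def mps_nth_rename_notin)
qed

lemma mps_nth_in_x_in_y: "mps_nth (in_x f * in_y g) (two A B) = mps_nth f A * mps_nth g B"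
proof -
  have "mps_nth (in_x f * in_y g) (two A B) =
      mps_nth (in_x f) (two A {#}) * mps_nth (in_y g) (two {#} B)"
  proof (rule mps_nth_mult_single)
    show "two A {#} + two {#} B = two A B" by (simp add: two_add)
    fix M N assume eq: "M + N = two A B" and ne: "(M, N) \<noteq> (two A {#}, two {#} B)"
    obtain A1 B1 where 1: "M = two A1 B1" by (rule two_ex)
    obtain A2 B2 where 2: "N = two A2 B2" by (rule two_ex)
    show "mps_nth (in_x f) M * mps_nth (in_y g) N = 0"
      using eq ne by (auto simp: 1 2 mps_nth_in_x mps_nth_in_y two_add two_eq_iff)
  qed
  then show ?thesis by (simp add: mps_nth_in_x mps_nth_in_y)
qed

subsection \<open>Univariate series in one of the variables\<close>

definition uni :: "'v \<Rightarrow> 'a :: comm_ring_1 fps \<Rightarrow> ('v, 'a) mps"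
  where "uni i F = Mps (\<lambda>M. if set_mset M \<subseteq> {i} then fps_nth F (size M) else 0)"

lemma mps_nth_uni: "mps_nth (uni i F) M = (if set_mset M \<subseteq> {i} then fps_nth F (size M) else 0)"
  by (simp add: uni_def)

lemma replicate_mset_size: "set_mset M \<subseteq> {i} \<longleftrightarrow> M = replicate_mset (size M) i"
proof
  assume "set_mset M \<subseteq> {i}"
  then show "M = replicate_mset (size M) i" by (induction M) auto
next
  assume "M = replicate_mset (size M) i"
  then have "set_mset M = set_mset (replicate_mset (size M) i)" by simp
  then show "set_mset M \<subseteq> {i}" by (auto split: if_splits)
qed

lemma rhom_uni: "rhom (uni i :: 'a :: comm_ring_1 fps \<Rightarrow> _)"
proof
  fix F G :: "'a fps"
  show "uni i (F * G) = uni i F * uni i G"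
  proof (rule mps_eqI)
    fix M
    show "mps_nth (uni i (F * G)) M = mps_nth (uni i F * uni i G) M"
    proof (cases "set_mset M \<subseteq> {i}")
      case True
      define n where "n = size M"
      have M: "M = replicate_mset n i" using True replicate_mset_size n_def by metis
      have set: "{p. fst p + snd p = M} = (\<lambda>k. (replicate_mset k i, replicate_mset (n - k) i)) ` {0..n}"
        (is "?L = ?R")
      proof
        show "?L \<subseteq> ?R"
        proof
          fix p assume p: "p \<in> ?L"
          have s: "set_mset (fst p) \<subseteq> {i}" "set_mset (snd p) \<subseteq> {i}"
            using p True by auto
          have "fst p = replicate_mset (size (fst p)) i" "snd p = replicate_mset (size (snd p)) i"
            using s replicate_mset_size by metis+
          moreover have "size (fst p) + size (snd p) = n" using p n_def by auto
          ultimately show "p \<in> ?R"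
            by (intro image_eqI[of _ _ "size (fst p)"]) (auto simp: prod_eq_iff)
        qed
        show "?R \<subseteq> ?L"
          by (auto simp: M multiset_eq_iff)
      qed
      have "mps_nth (uni i F * uni i G) M = (\<Sum>k=0..n. fps_nth F k * fps_nth G (n - k))"
        unfolding mps_nth_mult set
        by (subst sum.reindex) (auto simp: inj_on_def mps_nth_uni intro!: sum.cong, metis size_replicate_mset)
      then show ?thesis using True by (simp add: mps_nth_uni fps_mult_nth n_def)
    next
      case False
      have "mps_nth (uni i F) (fst p) * mps_nth (uni i G) (snd p) = 0" if "fst p + snd p = M" for p
        using False that by (auto simp: mps_nth_uni)
      then show ?thesis
        using False by (auto simp: mps_nth_uni mps_nth_mult intro!: sum.neutral[symmetric])
    qed
  qed
qed (rule mps_eqI; auto simp: mps_nth_uni mps_nth_one)+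

lemma uni_const: "uni i (fps_const c) = const c"
  by (rule mps_eqI) (auto simp: mps_nth_uni mps_nth_const)

lemma uni_X: "uni i fps_X = X i"
proof (rule mps_eqI)
  fix M
  have "set_mset M \<subseteq> {i} \<and> size M = 1 \<longleftrightarrow> M = {#i#}"
    using replicate_mset_size[of M i] by auto
  then show "mps_nth (uni i fps_X) M = mps_nth (X i) M"
    by (auto simp: mps_nth_uni mps_nth_X)
qed

text \<open>As \<open>f\<close> does not contain the variable \<open>i\<close>, the whole exponent
  of \<open>i\<close> comes from the second factor. This is how the last variable is split off from
  \<open>GQ\<close>.\<close>

lemma mps_nth_mult_uni:
  assumes "\<And>N. i \<in># N \<Longrightarrow> mps_nth f N = 0"
  shows "mps_nth (f * uni i F) M = mps_nth f (filter_mset (\<lambda>j. j \<noteq> i) M) * fps_nth F (count M i)"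
proof -
  have "mps_nth (f * uni i F) M =
      mps_nth f (filter_mset (\<lambda>j. j \<noteq> i) M) * mps_nth (uni i F) (replicate_mset (count M i) i)"
  proof (rule mps_nth_mult_single)
    show sp: "filter_mset (\<lambda>j. j \<noteq> i) M + replicate_mset (count M i) i = M"
      by (metis add.commute filter_eq_replicate_mset multiset_partition)
    fix A B assume eq: "A + B = M"
      and ne: "(A, B) \<noteq> (filter_mset (\<lambda>j. j \<noteq> i) M, replicate_mset (count M i) i)"
    show "mps_nth f A * mps_nth (uni i F) B = 0"
    proof (cases "i \<notin># A \<and> set_mset B \<subseteq> {i}")
      case True
      then have B: "B = replicate_mset (size B) i" using replicate_mset_size by metis
      have "filter_mset (\<lambda>j. j \<noteq> i) B = {#}" using True by (auto simp: multiset_eq_iff not_in_iff[symmetric])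
      moreover have "filter_mset (\<lambda>j. j \<noteq> i) A = A"
        using True by (auto simp: multiset_eq_iff not_in_iff[symmetric])
      ultimately have "A = filter_mset (\<lambda>j. j \<noteq> i) M" using eq by auto
      with sp eq have "B = replicate_mset (count M i) i" by (metis add_left_cancel)
      with \<open>A = _\<close> ne show ?thesis by simp
    next
      case False
      then show ?thesis using assms by (auto simp: mps_nth_uni)
    qed
  qed
  then show ?thesis by (auto simp: mps_nth_uni)
qed

lemma mps_nth_prod_uni:
  assumes "finite I" "set_mset M \<subseteq> I"
  shows "mps_nth (\<Prod>i\<in>I. uni i (F i)) M = (\<Prod>i\<in>I. fps_nth (F i) (count M i))"
  using assms
proof (induction I arbitrary: M rule: finite_induct)
  case empty
  then show ?case by (simp add: mps_nth_one)
next
  case (insert i I)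
  interpret r: rhom "res I" by (rule rhom_res)
  have "res I (uni j (F j)) = uni j (F j)" if "j \<in> I" for j
    using that by (intro mps_eqI) (auto simp: mps_nth_res mps_nth_uni)
  then have res: "(\<Prod>i\<in>I. uni i (F i)) = res I (\<Prod>i\<in>I. uni i (F i))"
    by (simp add: r.prod)
  have z: "mps_nth (\<Prod>i\<in>I. uni i (F i)) N = 0" if "i \<in># N" for N
    using that insert.hyps by (subst res) (auto simp: mps_nth_res)
  have "mps_nth (\<Prod>i\<in>insert i I. uni i (F i)) M =
      mps_nth ((\<Prod>i\<in>I. uni i (F i)) * uni i (F i)) M"
    using insert.hyps by (simp add: mult.commute)
  also have "\<dots> = mps_nth (\<Prod>i\<in>I. uni i (F i)) (filter_mset (\<lambda>j. j \<noteq> i) M) * fps_nth (F i) (count M i)"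
    by (rule mps_nth_mult_uni) (rule z)
  also have "mps_nth (\<Prod>i\<in>I. uni i (F i)) (filter_mset (\<lambda>j. j \<noteq> i) M) =
      (\<Prod>k\<in>I. fps_nth (F k) (count (filter_mset (\<lambda>j. j \<noteq> i) M) k))"
    using insert.prems by (intro insert.IH) auto
  also have "\<dots> = (\<Prod>k\<in>I. fps_nth (F k) (count M k))"
    using insert.hyps by (intro prod.cong) auto
  finally show ?case using insert.hyps by (simp add: mult.commute)
qed

subsection \<open>Inverses\<close>

lemma mps_nth_power_small:
  assumes "mps_nth g {#} = 0" "size M < k"
  shows "mps_nth (g ^ k) M = 0"
  using assms(2)
proof (induction k arbitrary: M)
  case (Suc k)
  have "mps_nth g (fst p) * mps_nth (g ^ k) (snd p) = 0" if "fst p + snd p = M" for p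
  proof (cases "fst p = {#}")
    case False
    then have "size (fst p) > 0" by (simp add: nonempty_has_size)
    moreover have "size (fst p) + size (snd p) = size M" using that by auto
    ultimately have "size (snd p) < k" using Suc.prems by linarith
    then show ?thesis using Suc.IH by simp
  qed (simp add: assms)
  then show ?case by (auto simp: mps_nth_mult intro!: sum.neutral)
qed simp

lemma inverse_unique_comm:
  assumes "a * b = 1" "a * c = (1 :: 'a :: comm_monoid_mult)"
  shows "b = c"
proof -
  have "b = b * (a * c)" using assms by simp
  also have "\<dots> = (a * b) * c" by (simp add: ac_simps)
  finally show ?thesis using assms by simp
qed

text \<open>The inverse is the geometric series in 1 - f. Since 1 - f has no constant term, its
  powers beyond \<open>size M\<close> do not reach the monomial \<open>M\<close>, so each
  coefficient is a finite sum; commutativity makes the inverse unique.\<close>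

lemma mps_inv_works:
  assumes "mps_nth f {#} = 1"
  shows "f * mps_inv f = 1"
proof -
  define g where "g = 1 - f"
  have g0: "mps_nth g {#} = 0" by (simp add: g_def assms mps_nth_one)
  define S where "S = Mps (\<lambda>M. mps_nth (\<Sum>k\<le>size M. g ^ k) M)"
  have S: "mps_nth S M = mps_nth (\<Sum>k\<le>n. g ^ k) M" if "size M \<le> n" for M n
  proof -
    have "mps_nth (\<Sum>k\<le>n. g ^ k) M = mps_nth (\<Sum>k\<le>size M. g ^ k) M"
      unfolding mps_nth_sum using that
      by (intro sum.mono_neutral_right) (auto simp: mps_nth_power_small[OF g0])
    then show ?thesis by (simp add: S_def)
  qed
  have "f * S = 1"
  proof (rule mps_eqI)
    fix M
    have "mps_nth (f * S) M = mps_nth (f * (\<Sum>k\<le>size M. g ^ k)) M"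
      by (rule mps_nth_mult_cong) (auto intro!: S simp del: mps_nth_sum)
    also have "f * (\<Sum>k\<le>size M. g ^ k) = 1 - g ^ Suc (size M)"
      using one_diff_power_eq[of g "Suc (size M)"] unfolding g_def
      by (simp add: lessThan_Suc_atMost)
    also have "mps_nth \<dots> M = mps_nth 1 M"
      using mps_nth_power_small[OF g0, of M "Suc (size M)"] by (simp del: power_Suc)
    finally show "mps_nth (f * S) M = mps_nth 1 M" .
  qed
  moreover from this have "mps_inv f = S"
    unfolding mps_inv_def using inverse_unique_comm by (blast intro: the_equality)
  ultimately show ?thesis by simp
qed

subsection \<open>Formal sums and products\<close>

text \<open>Beyond the threshold set, adding a single index leaves the partial sum unchanged, so the
  coefficient of that term is 0.\<close>

lemma formal_has_sum_finite:
  assumes "formal_has_sum f I s"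
  shows "finite {i \<in> I. mps_nth (f i) M \<noteq> 0}"
proof -
  from assms obtain F0 where F0: "finite F0" "F0 \<subseteq> I"
    "\<And>F. finite F \<Longrightarrow> F0 \<subseteq> F \<Longrightarrow> F \<subseteq> I \<Longrightarrow> mps_nth (sum f F) M = mps_nth s M"
    unfolding formal_has_sum_def eventually_finite_subsets_at_top by meson
  have "mps_nth (f i) M = 0" if "i \<in> I - F0" for i
    using F0(3)[of F0] F0(3)[of "insert i F0"] that F0(1,2)
    by (auto simp: subset_insertI)
  then have "{i \<in> I. mps_nth (f i) M \<noteq> 0} \<subseteq> F0" by auto
  then show ?thesis using F0(1) finite_subset by blast
qed

lemma formal_has_sum_nth:
  assumes "formal_has_sum f I s" "finite F" "F \<subseteq> I" "\<And>i. i \<in> I - F \<Longrightarrow> mps_nth (f i) M = 0"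
  shows "mps_nth s M = (\<Sum>i\<in>F. mps_nth (f i) M)"
proof -
  from assms(1) obtain F0 where F0: "finite F0" "F0 \<subseteq> I"
    "\<And>F. finite F \<Longrightarrow> F0 \<subseteq> F \<Longrightarrow> F \<subseteq> I \<Longrightarrow> mps_nth (sum f F) M = mps_nth s M"
    unfolding formal_has_sum_def eventually_finite_subsets_at_top by meson
  have "mps_nth s M = mps_nth (sum f (F0 \<union> F)) M"
    using F0 assms by (intro F0(3)[symmetric]) auto
  also have "\<dots> = (\<Sum>i\<in>F. mps_nth (f i) M)"
    unfolding mps_nth_sum using F0 assms by (intro sum.mono_neutral_right) auto
  finally show ?thesis .
qed

lemma formal_has_sumI:
  assumes "\<And>M. \<exists>F. finite F \<and> F \<subseteq> I \<and> (\<forall>i\<in>I - F. mps_nth (f i) M = 0) \<and>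
      mps_nth s M = (\<Sum>i\<in>F. mps_nth (f i) M)"
  shows "formal_has_sum f I s"
  unfolding formal_has_sum_def eventually_finite_subsets_at_top
proof (intro allI)
  fix M
  obtain F where F: "finite F" "F \<subseteq> I" "\<forall>i\<in>I - F. mps_nth (f i) M = 0"
      "mps_nth s M = (\<Sum>i\<in>F. mps_nth (f i) M)"
    using assms by blast
  have "mps_nth (sum f G) M = mps_nth s M" if "finite G" "F \<subseteq> G" "G \<subseteq> I" for G
    unfolding mps_nth_sum F(4) using that F by (intro sum.mono_neutral_right) auto
  then show "\<exists>X. finite X \<and> X \<subseteq> I \<and> (\<forall>Y. finite Y \<and> X \<subseteq> Y \<and> Y \<subseteq> I \<longrightarrow>
      mps_nth (sum f Y) M = mps_nth s M)"
    using F by blast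
qed

lemma mps_nth_formal_sum:
  assumes "\<And>M. finite {i \<in> I. mps_nth (f i) M \<noteq> 0}"
  shows "formal_has_sum f I (formal_sum f I)"
proof -
  have "formal_has_sum f I (Mps (\<lambda>M. \<Sum>i\<in>{i \<in> I. mps_nth (f i) M \<noteq> 0}. mps_nth (f i) M))"
  proof (rule formal_has_sumI)
    fix M
    show "\<exists>F. finite F \<and> F \<subseteq> I \<and> (\<forall>i\<in>I - F. mps_nth (f i) M = 0) \<and>
      mps_nth (Mps (\<lambda>M. \<Sum>i\<in>{i \<in> I. mps_nth (f i) M \<noteq> 0}. mps_nth (f i) M)) M = (\<Sum>i\<in>F. mps_nth (f i) M)"
      using assms[of M] by (intro exI[of _ "{i \<in> I. mps_nth (f i) M \<noteq> 0}"]) auto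
  qed
  then show ?thesis by (simp add: formal_sum_eqI)
qed

lemma formal_has_prodI:
  assumes "\<And>M. \<exists>F. finite F \<and> F \<subseteq> I \<and>
      (\<forall>G. finite G \<longrightarrow> F \<subseteq> G \<longrightarrow> G \<subseteq> I \<longrightarrow> mps_nth (prod f G) M = mps_nth p M)"
  shows "formal_has_prod f I p"
  unfolding formal_has_prod_def eventually_finite_subsets_at_top using assms by meson

section \<open>Transfer operators\<close>

text \<open>Profiles of diagonal lengths: consecutive diagonals of a shifted diagram differ by 0 or
  1. The constant tail \<open>l\<close> is kept general so that sums over profiles can be built up
  one diagonal at a time; with tail 0 these are the shifted diagrams with at most \<open>d\<close>
  nonempty diagonals.\<close>

definition paths :: "nat \<Rightarrow> int \<Rightarrow> (nat \<Rightarrow> int) set"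
  where "paths d l = {c. (\<forall>e<d. c e - c (Suc e) \<in> {0, 1}) \<and> (\<forall>e\<ge>d. c e = l)}"

lemma paths_0: "paths 0 l = {\<lambda>_. l}"
  by (auto simp: paths_def)

definition cut :: "nat \<Rightarrow> int \<Rightarrow> (nat \<Rightarrow> int) \<Rightarrow> nat \<Rightarrow> int"
  where "cut d l c = (\<lambda>e. if e \<le> d then c e else l)"

text \<open>A profile with tail \<open>l\<close> reaches diagonal \<open>d\<close> either at height
  \<open>l\<close> or at \<open>l + 1\<close>; in the second case \<open>cut\<close> lowers the
  tail.\<close>

lemma paths_Suc: "paths (Suc d) l = paths d l \<union> cut d l ` paths d (l + 1)"
proof
  show "paths (Suc d) l \<subseteq> paths d l \<union> cut d l ` paths d (l + 1)"
  proof
    fix c assume c: "c \<in> paths (Suc d) l"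
    have "c (Suc d) = l" using c by (simp add: paths_def)
    moreover have "c d - c (Suc d) \<in> {0, 1}" using c unfolding paths_def by blast
    ultimately consider "c d = l" | "c d = l + 1" by force
    then show "c \<in> paths d l \<union> cut d l ` paths d (l + 1)"
    proof cases
      case 1
      have "c e = l" if "e \<ge> d" for e
        using that c 1 by (cases "e = d") (auto simp: paths_def)
      then show ?thesis using c by (auto simp: paths_def)
    next
      case 2
      have "cut d l (cut d (l + 1) c) = c"
        using c by (auto simp: cut_def paths_def fun_eq_iff)
      moreover have "cut d (l + 1) c \<in> paths d (l + 1)"
        using c 2 by (auto simp: cut_def paths_def Suc_le_eq)
      ultimately show ?thesis by (metis UnCI image_eqI)
    qed
  qed
  have "c \<in> paths (Suc d) l" if c: "c \<in> paths d l" for c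
  proof -
    have "c e - c (Suc e) \<in> {0, 1}" if "e < Suc d" for e
      using that c by (cases "e = d") (auto simp: paths_def)
    then show ?thesis using c by (simp add: paths_def)
  qed
  moreover have "cut d l c \<in> paths (Suc d) l" if c: "c \<in> paths d (l + 1)" for c
  proof -
    have "cut d l c e - cut d l c (Suc e) \<in> {0, 1}" if "e < Suc d" for e
      using that c by (cases "e = d") (auto simp: paths_def cut_def)
    then show ?thesis by (simp add: paths_def cut_def)
  qed
  ultimately show "paths d l \<union> cut d l ` paths d (l + 1) \<subseteq> paths (Suc d) l"
    by blast
qed

lemma finite_paths [simp]: "finite (paths d l)"
  by (induction d arbitrary: l) (simp_all add: paths_0 paths_Suc)

lemma sum_paths_Suc:
  "(\<Sum>c\<in>paths (Suc d) l. f c) = (\<Sum>c\<in>paths d l. f c) + (\<Sum>c\<in>paths d (l + 1). f (cut d l c))"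
proof -
  have d: "c d = l" if "c \<in> paths d l" for c l using that by (simp add: paths_def)
  have "cut d l c \<notin> paths d l" if "c \<in> paths d (l + 1)" for c
    using d[OF that] d[of "cut d l c" l] by (auto simp: cut_def)
  then have "paths d l \<inter> cut d l ` paths d (l + 1) = {}" by blast
  moreover have "inj_on (cut d l) (paths d (l + 1))"
  proof
    fix c c' assume c: "c \<in> paths d (l + 1)" "c' \<in> paths d (l + 1)" and eq: "cut d l c = cut d l c'"
    show "c = c'"
    proof
      fix e show "c e = c' e"
        using fun_cong[OF eq, of e] c by (cases "e \<le> d") (auto simp: cut_def paths_def)
    qed
  qed
  ultimately show ?thesis by (simp add: paths_Suc sum.union_disjoint sum.reindex)
qed

lemma paths_antimono:
  assumes "c \<in> paths d l" "e \<le> e'"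
  shows "c e' \<le> c e"
  using assms(2)
proof (induction e' rule: dec_induct)
  case (step n)
  have "c (Suc n) \<le> c n"
    using assms(1) by (cases "n < d") (auto simp: paths_def)
  then show ?case using step by simp
qed simp

lemma paths_step:
  assumes "c \<in> paths d l"
  shows "c e - c (Suc e) \<in> {0, 1}"
  using assms by (cases "e < d") (auto simp: paths_def)

lemma paths_ge:
  assumes "c \<in> paths d l"
  shows "l \<le> c e"
proof -
  have "c (max e d) \<le> c e" using assms by (rule paths_antimono) simp
  moreover have "c (max e d) = l" using assms by (simp add: paths_def)
  ultimately show ?thesis by simp
qed

text \<open>
  Diagonals \<open>0, 1, \<dots>\<close> of a one-variable layer \<open>\<lambda>/\<mu>\<close> are read one at a time. In both machines
  the states \<open>UO\<close>, \<open>DP\<close>, \<open>DU\<close> say that the current diagonal has a box of the layer (primed or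
  unprimed in the last two cases). When it has none, the set-valued machine must still remember
  whether the last box of \<open>\<mu>\<close> on this diagonal is a corner that may receive additional entries;
  only two linear functionals of that information matter, which are carried by \<open>UT\<close> and \<open>UM\<close>.
\<close>

datatype ust = UT | UM | UO
datatype dst = DZ | DP | DU

text \<open>Here \<open>p\<close> and \<open>q\<close> are the drops of the outer and of the inner
  profile. A layer box contributes x and an optional additional entry contributes z = 1 + \<beta>x.
  The corner of the inner shape has one of the weights 1, z, z^2, depending on the past; it is z^2 -
  \<beta>x c for c = z + 1, z, 0, and \<open>UM\<close> carries the value of \<open>UT\<close>
  multiplied by c. All entries thus stay polynomial in x.\<close>

definition uK :: "'a :: comm_ring_1 \<Rightarrow> 'a \<Rightarrow> int \<Rightarrow> int \<Rightarrow> ust \<Rightarrow> ust \<Rightarrow> 'a"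
  where "uK x b p q s s' = (let z = 1 + b * x in
    if p = 0 \<and> q = 0 then (case (s, s') of (UT, UT) \<Rightarrow> 1 | (UO, UO) \<Rightarrow> x | _ \<Rightarrow> 0)
    else if p = 1 \<and> q = 1 then (case (s, s') of (UT, UT) \<Rightarrow> z * z | (UM, UT) \<Rightarrow> - (b * x)
      | (UT, UM) \<Rightarrow> (z + 1) * (z * z) | (UM, UM) \<Rightarrow> - ((z + 1) * (b * x)) | (UO, UO) \<Rightarrow> x | _ \<Rightarrow> 0)
    else if p = 0 \<and> q = 1 then (case (s, s') of (UT, UO) \<Rightarrow> x * z * (z + 1)
      | (UM, UO) \<Rightarrow> - (x * b * x) | _ \<Rightarrow> 0)
    else if p = 1 \<and> q = 0 then (case (s, s') of (UO, UT) \<Rightarrow> 1 | (UO, UM) \<Rightarrow> z | _ \<Rightarrow> 0)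
    else 0)"

text \<open>After a horizontal step the next letter must be unprimed, after a vertical step it must
  be primed. A letter that repeats the preceding one has weight y - \<beta>: the box either opens a
  new bar (y) or prolongs the old one (-\<beta>).\<close>

definition dK :: "'a :: comm_ring_1 \<Rightarrow> 'a \<Rightarrow> int \<Rightarrow> int \<Rightarrow> dst \<Rightarrow> dst \<Rightarrow> 'a"
  where "dK y b p q s s' = (
    if p = 0 \<and> q = 0 then (case (s, s') of (DZ, DZ) \<Rightarrow> 1 | (DP, DU) \<Rightarrow> y | (DU, DU) \<Rightarrow> y - b | _ \<Rightarrow> 0)
    else if p = 1 \<and> q = 1 then (case (s, s') of (DZ, DZ) \<Rightarrow> 1 | (DU, DP) \<Rightarrow> y | (DP, DP) \<Rightarrow> y - b | _ \<Rightarrow> 0)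
    else if p = 0 \<and> q = 1 then (case (s, s') of (DZ, DP) \<Rightarrow> y | (DZ, DU) \<Rightarrow> y | _ \<Rightarrow> 0)
    else if p = 1 \<and> q = 0 then (case (s, s') of (DP, DZ) \<Rightarrow> 1 | (DU, DZ) \<Rightarrow> 1 | _ \<Rightarrow> 0)
    else 0)"

text \<open>The initial value x(2 + \<beta>x) is x((1 + \<beta>x) + 1): a box on the main diagonal
  is primed, with an optional additional unprimed entry, or it is unprimed. In \<open>dvec\<close>
  the state \<open>DP\<close> starts with 0, since primed diagonal entries are forbidden
  there.\<close>

fun uvec :: "'a :: comm_ring_1 \<Rightarrow> 'a \<Rightarrow> (nat \<Rightarrow> int) \<Rightarrow> (nat \<Rightarrow> int) \<Rightarrow> nat \<Rightarrow> ust \<Rightarrow> 'a"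
  where
    "uvec x b l m 0 s = (case s of UT \<Rightarrow> if l 0 = m 0 then 1 else 0 | UM \<Rightarrow> 0
       | UO \<Rightarrow> if l 0 = m 0 + 1 then x * (2 + b * x) else 0)"
  | "uvec x b l m (Suc d) s' =
       (\<Sum>s\<in>{UT, UM, UO}. uvec x b l m d s * uK x b (l d - l (Suc d)) (m d - m (Suc d)) s s')"

fun dvec :: "'a :: comm_ring_1 \<Rightarrow> 'a \<Rightarrow> (nat \<Rightarrow> int) \<Rightarrow> (nat \<Rightarrow> int) \<Rightarrow> nat \<Rightarrow> dst \<Rightarrow> 'a"
  where
    "dvec y b l m 0 s = (case s of DZ \<Rightarrow> if l 0 = m 0 then 1 else 0 | DP \<Rightarrow> 0
       | DU \<Rightarrow> if l 0 = m 0 + 1 then y else 0)"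
  | "dvec y b l m (Suc d) s' =
       (\<Sum>s\<in>{DZ, DP, DU}. dvec y b l m d s * dK y b (l d - l (Suc d)) (m d - m (Suc d)) s s')"

section \<open>Locality, support and divisibility of the transfer vectors\<close>

lemma uvec_cong:
  "(\<And>e. e \<le> d \<Longrightarrow> l e = l' e) \<Longrightarrow> (\<And>e. e \<le> d \<Longrightarrow> m e = m' e) \<Longrightarrow> uvec x b l m d s = uvec x b l' m' d s"
  by (induction d arbitrary: s) (auto split: ust.split)

lemma dvec_cong:
  "(\<And>e. e \<le> d \<Longrightarrow> l e = l' e) \<Longrightarrow> (\<And>e. e \<le> d \<Longrightarrow> m e = m' e) \<Longrightarrow> dvec y b l m d s = dvec y b l' m' d s"
  by (induction d arbitrary: s) (auto split: dst.split)

lemma uvec_support: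
  "uvec x b l m d s \<noteq> 0 \<Longrightarrow> l d = m d + (if s = UO then 1 else 0) \<and> (\<forall>e\<le>d. l e - m e \<in> {0, 1})"
proof (induction d arbitrary: s)
  case 0
  then show ?case by (cases s) (auto split: if_splits)
next
  case (Suc d)
  obtain s0 where "uvec x b l m d s0 * uK x b (l d - l (Suc d)) (m d - m (Suc d)) s0 s \<noteq> 0"
    using sum.not_neutral_contains_not_neutral[OF Suc.prems[unfolded uvec.simps]] by blast
  then have s0: "uvec x b l m d s0 \<noteq> 0" "uK x b (l d - l (Suc d)) (m d - m (Suc d)) s0 s \<noteq> 0"
    by auto
  have 1: "l d = m d + (if s0 = UO then 1 else 0)" "\<forall>e\<le>d. l e - m e \<in> {0, 1}"
    using Suc.IH[OF s0(1)] by auto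
  have "l (Suc d) = m (Suc d) + (if s = UO then 1 else 0)"
    using s0(2) 1(1) by (cases s0; cases s) (auto simp: uK_def Let_def split: if_splits)
  then show ?case using 1 by (auto simp: le_Suc_eq)
qed

lemma dvec_support:
  "dvec x b l m d s \<noteq> 0 \<Longrightarrow> l d = m d + (if s = DZ then 0 else 1) \<and> (\<forall>e\<le>d. l e - m e \<in> {0, 1})"
proof (induction d arbitrary: s)
  case 0
  then show ?case by (cases s) (auto split: if_splits)
next
  case (Suc d)
  obtain s0 where "dvec x b l m d s0 * dK x b (l d - l (Suc d)) (m d - m (Suc d)) s0 s \<noteq> 0"
    using sum.not_neutral_contains_not_neutral[OF Suc.prems[unfolded dvec.simps]] by blast
  then have s0: "dvec x b l m d s0 \<noteq> 0" "dK x b (l d - l (Suc d)) (m d - m (Suc d)) s0 s \<noteq> 0"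
    by auto
  have 1: "l d = m d + (if s0 = DZ then 0 else 1)" "\<forall>e\<le>d. l e - m e \<in> {0, 1}"
    using Suc.IH[OF s0(1)] by auto
  have "l (Suc d) = m (Suc d) + (if s = DZ then 0 else 1)"
    using s0(2) 1(1) by (cases s0; cases s) (auto simp: dK_def Let_def split: if_splits)
  then show ?case using 1 by (auto simp: le_Suc_eq)
qed

text \<open>Each box of the layer contributes a factor x. This is what pushes the boundary term of
  \<open>commutation\<close> into high order.\<close>

lemma uvec_dvd:
  "x ^ (if s = UO then card {e. e \<le> d \<and> l e = m e + 1} else card {e. e < d \<and> l e = m e + 1})
    dvd uvec x b l m d s"
proof (induction d arbitrary: s)
  case 0
  have c: "card {e. e \<le> 0 \<and> l e = m e + 1} \<le> 1"
    using card_mono[of "{0}" "{e. e \<le> 0 \<and> l e = m e + 1}"] by auto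
  show ?case
  proof (cases "s = UO \<and> l 0 = m 0 + 1")
    case True
    have "x ^ card {e. e \<le> 0 \<and> l e = m e + 1} dvd x ^ 1"
      using c by (rule le_imp_power_dvd)
    then show ?thesis using True by (simp add: dvd_mult2)
  next
    case False
    then have "s \<noteq> UO \<or> uvec x b l m 0 s = 0" by auto
    then show ?thesis by (elim disjE) (simp_all only: if_False dvd_0_right, simp_all)
  qed
next
  case (Suc d)
  define H where "H = {e. e < d \<and> l e = m e + 1}"
  have H1: "{e. e \<le> d \<and> l e = m e + 1} = (if l d = m d + 1 then insert d H else H)"
    "{e. e < Suc d \<and> l e = m e + 1} = (if l d = m d + 1 then insert d H else H)"
    "{e. e \<le> Suc d \<and> l e = m e + 1} =
      (if l (Suc d) = m (Suc d) + 1 then insert (Suc d) (if l d = m d + 1 then insert d H else H)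
       else (if l d = m d + 1 then insert d H else H))"
    by (auto simp: H_def le_less less_Suc_eq)
  have H2: "d \<notin> H" "Suc d \<notin> H" "finite H" by (auto simp: H_def)
  note card = H1 H2 card_insert_disjoint
  have T: "x ^ card H dvd uvec x b l m d UT" "x ^ card H dvd uvec x b l m d UM"
    and O: "x ^ card (if l d = m d + 1 then insert d H else H) dvd uvec x b l m d UO"
    using Suc[of UT] Suc[of UM] Suc[of UO] unfolding H1 H_def by simp_all
  have TM0: "uvec x b l m d UT = 0" "uvec x b l m d UM = 0" if "l d = m d + 1"
    using uvec_support[of x b l m d UT] uvec_support[of x b l m d UM] that by force+
  have O0: "uvec x b l m d UO = 0" if "l d \<noteq> m d + 1"
    using uvec_support[of x b l m d UO] that by force
  have TM: "x ^ card (if l d = m d + 1 then insert d H else H) dvd uvec x b l m d UT"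
    "x ^ card (if l d = m d + 1 then insert d H else H) dvd uvec x b l m d UM"
    using T TM0 by auto
  have c: "card {e. e \<le> Suc d \<and> l e = m e + 1} \<le> Suc (card (if l d = m d + 1 then insert d H else H))"
    by (simp add: card)
  have K: "x dvd uK x b p q s UO" for p q s
    by (cases s) (auto simp: uK_def Let_def)
  show ?case
  proof (cases "s = UO")
    case True
    have TMO: "x ^ card (if l d = m d + 1 then insert d H else H) dvd uvec x b l m d s0" for s0
      using TM O by (cases s0) auto
    have "x ^ Suc (card (if l d = m d + 1 then insert d H else H)) dvd uvec x b l m (Suc d) UO"
      unfolding uvec.simps power_Suc2 by (intro dvd_sum mult_dvd_mono TMO K)
    with le_imp_power_dvd[OF c] have "x ^ card {e. e \<le> Suc d \<and> l e = m e + 1} dvd uvec x b l m (Suc d) UO"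
      by (rule dvd_trans)
    then show ?thesis unfolding True by (simp only: simp_thms if_True)
  next
    case False
    have "x ^ card (if l d = m d + 1 then insert d H else H) dvd uvec x b l m (Suc d) s"
      using TM O by (auto intro!: dvd_add)
    then show ?thesis using False by (simp add: H1)
  qed
qed

lemma uvec_stable:
  assumes "\<And>e. e \<ge> d \<Longrightarrow> l e = k \<and> m e = k" "d \<le> d'"
  shows "uvec x b l m d' UT = uvec x b l m d UT"
  using assms(2)
proof (induction d' rule: dec_induct)
  case (step n)
  then show ?case using assms(1)[of n] assms(1)[of "Suc n"] by (simp add: uK_def)
qed simp

lemma uvec_refl: "uvec x b (\<lambda>_. k) (\<lambda>_. k) d UT = 1"
  using uvec_stable[of 0 "\<lambda>_. k" k "\<lambda>_. k" d x b] by simp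

lemma rhom_uvec:
  assumes "rhom h"
  shows "h (uvec x b l m d s) = uvec (h x) (h b) l m d s"
proof -
  interpret rhom h by fact
  have 2: "h 2 = 2" using add[of 1 1] one by simp
  show ?thesis
    by (induction d arbitrary: s) (auto simp: hom 2 uK_def Let_def split: ust.split)
qed

subsection \<open>Commutation\<close>

text \<open>Matrix entries, restricted to the diagonals 0 to d, of the two compositions of
  operators: the intermediate shape lies above both \<open>nu\<close> and \<open>mu\<close> here,
  and below both in \<open>Rsum\<close>. The length of the last diagonal and the two final states
  stay open for the recursion.\<close>

definition Lsum where
  "Lsum x y b nu mu d l s t = (\<Sum>lam\<in>paths d l. uvec x b lam nu d s * dvec y b lam mu d t)"

definition Rsum where
  "Rsum x y b nu mu d k s t = (\<Sum>kap\<in>paths d k. uvec x b mu kap d s * dvec y b nu kap d t)"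

lemma sum_prod3:
  "(\<Sum>c\<in>A. (\<Sum>s\<in>S. f c s * k s) * (\<Sum>t\<in>T. g c t * k' t)) =
    (\<Sum>s\<in>S. \<Sum>t\<in>T. (\<Sum>c\<in>A. f c s * g c t) * k s * (k' t :: 'a :: comm_ring_1))"
proof -
  have "(\<Sum>c\<in>A. (\<Sum>s\<in>S. f c s * k s) * (\<Sum>t\<in>T. g c t * k' t)) =
      (\<Sum>c\<in>A. \<Sum>s\<in>S. \<Sum>t\<in>T. f c s * g c t * k s * k' t)"
    by (simp add: sum_product mult.assoc mult.left_commute mult.commute)
  also have "\<dots> = (\<Sum>s\<in>S. \<Sum>c\<in>A. \<Sum>t\<in>T. f c s * g c t * k s * k' t)" by (rule sum.swap)
  also have "\<dots> = (\<Sum>s\<in>S. \<Sum>t\<in>T. \<Sum>c\<in>A. f c s * g c t * k s * k' t)"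
    by (intro sum.cong refl sum.swap)
  finally show ?thesis by (simp add: sum_distrib_right)
qed

lemma Lsum_Suc:
  "Lsum x y b nu mu (Suc d) l s' t' =
    (\<Sum>s\<in>{UT, UM, UO}. \<Sum>t\<in>{DZ, DP, DU}. Lsum x y b nu mu d l s t *
       uK x b 0 (nu d - nu (Suc d)) s s' * dK y b 0 (mu d - mu (Suc d)) t t') +
    (\<Sum>s\<in>{UT, UM, UO}. \<Sum>t\<in>{DZ, DP, DU}. Lsum x y b nu mu d (l + 1) s t *
       uK x b 1 (nu d - nu (Suc d)) s s' * dK y b 1 (mu d - mu (Suc d)) t t')"
proof -
  have 1: "uvec x b (cut d l c) nu d s = uvec x b c nu d s" for c s
    by (rule uvec_cong) (auto simp: cut_def)
  have 2: "dvec y b (cut d l c) mu d s = dvec y b c mu d s" for c s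
    by (rule dvec_cong) (auto simp: cut_def)
  have 3: "c d = l" "c (Suc d) = l" if "c \<in> paths d l" for c l
    using that by (auto simp: paths_def)
  have 4: "cut d l c d = c d" "cut d l c (Suc d) = l" for c by (auto simp: cut_def)
  show ?thesis
    unfolding Lsum_def sum_paths_Suc uvec.simps dvec.simps 1 2 4
    by (simp only: sum_prod3[symmetric]) (simp add: 3 cong: sum.cong)
qed

lemma Rsum_Suc:
  "Rsum x y b nu mu (Suc d) l s' t' =
    (\<Sum>s\<in>{UT, UM, UO}. \<Sum>t\<in>{DZ, DP, DU}. Rsum x y b nu mu d l s t *
       uK x b (mu d - mu (Suc d)) 0 s s' * dK y b (nu d - nu (Suc d)) 0 t t') +
    (\<Sum>s\<in>{UT, UM, UO}. \<Sum>t\<in>{DZ, DP, DU}. Rsum x y b nu mu d (l + 1) s t *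
       uK x b (mu d - mu (Suc d)) 1 s s' * dK y b (nu d - nu (Suc d)) 1 t t')"
proof -
  have 1: "uvec x b mu (cut d l c) d s = uvec x b mu c d s" for c s
    by (rule uvec_cong) (auto simp: cut_def)
  have 2: "dvec y b nu (cut d l c) d s = dvec y b nu c d s" for c s
    by (rule dvec_cong) (auto simp: cut_def)
  have 3: "c d = l" "c (Suc d) = l" if "c \<in> paths d l" for c l
    using that by (auto simp: paths_def)
  have 4: "cut d l c d = c d" "cut d l c (Suc d) = l" for c by (auto simp: cut_def)
  show ?thesis
    unfolding Rsum_def sum_paths_Suc uvec.simps dvec.simps 1 2 4
    by (simp only: sum_prod3[symmetric]) (simp add: 3 cong: sum.cong)
qed

text \<open>
  These relations between the partial sums over the first \<open>d\<close> diagonals are the ones that survive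
  the passage to the next diagonal. The witness \<open>m\<close> replaces a quotient by \<open>z\<close>, which need not be
  invertible, and \<open>k\<close> and \<open>G\<close> are unknowns that get eliminated once \<open>nu\<close> and \<open>mu\<close> agree again.
\<close>

lemma commutation_invariant:
  fixes x y b :: "'a :: comm_ring_1"
  assumes nu: "\<And>e. nu e - nu (Suc e) \<in> {0, 1}" and mu: "\<And>e. mu e - mu (Suc e) \<in> {0, 1}"
  defines "z \<equiv> 1 + b * x" and "w \<equiv> 1 + b * x - x * y"
    and "L \<equiv> Lsum x y b nu mu" and "R \<equiv> Rsum x y b nu mu"
  shows "(mu d = nu d \<longrightarrow> (\<exists>m. R d (nu d) UM DZ = z * m \<and>
      L d (nu d + 1) UO DP = x * y * m \<and>
      L d (nu d + 1) UO DU = (1 + x * y) * z * R d (nu d) UT DZ - w * L d (nu d) UT DZ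
         - x * y * z * m \<and>
      R d (nu d - 1) UO DU = x * y * ((1 + z) * L d (nu d) UT DZ - L d (nu d) UM DZ) \<and>
      R d (nu d - 1) UO DP = w * (b * x * m - z * R d (nu d) UT DZ
         + z * L d (nu d) UT DZ) + x * (y - b) * L d (nu d) UM DZ)) \<and>
    (mu d = nu d + 1 \<longrightarrow> L d (nu d + 1) UO DZ = R d (nu d) UO DZ) \<and>
    (nu d = mu d + 1 \<longrightarrow> (\<exists>k G.
      L d (mu d + 1) UT DU = R d (mu d) UT DU + x * y * k \<and>
      L d (mu d + 1) UT DP = R d (mu d) UT DP + x * (b - y) * k \<and>
      L d (mu d + 1) UM DP = z * z * k + G \<and>
      L d (mu d + 1) UM DU = - (x * y * z * z * k) - z * G + z * (1 + z) * R d (mu d) UT DP \<and>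
      (b - y) * R d (mu d) UM DP - y * R d (mu d) UM DU + y * z * (1 + z) * R d (mu d) UT DP
        = (1 + x * y) * (b * G + y * z * z * k)))"
proof (induction d)
  case 0
  have L: "L 0 l s t = uvec x b (\<lambda>_. l) nu 0 s * dvec y b (\<lambda>_. l) mu 0 t" for l s t
    by (simp add: L_def Lsum_def paths_0)
  have R: "R 0 l s t = uvec x b mu (\<lambda>_. l) 0 s * dvec y b nu (\<lambda>_. l) 0 t" for l s t
    by (simp add: R_def Rsum_def paths_0)
  show ?case
  proof (intro conjI impI, goal_cases)
    case 1
    then show ?case
      by (intro exI[of _ 0]) (simp add: L R z_def w_def algebra_simps)
  next
    case 2
    then show ?case by (simp add: L R)
  next
    case 3
    then show ?case
      by (intro exI[of _ 0]) (simp add: L R z_def w_def algebra_simps)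
  qed
next
  case (Suc d)
  note LS = Lsum_Suc[of x y b nu mu d, folded L_def]
  note RS = Rsum_Suc[of x y b nu mu d, folded R_def]
  from nu[of d] mu[of d] consider
      (ee) "nu (Suc d) = nu d" "mu (Suc d) = mu d"
    | (dd) "nu (Suc d) = nu d - 1" "mu (Suc d) = mu d - 1"
    | (ed) "nu (Suc d) = nu d" "mu (Suc d) = mu d - 1"
    | (de) "nu (Suc d) = nu d - 1" "mu (Suc d) = mu d"
    by force
  then show ?case
  proof cases
    case ee
    show ?thesis
    proof (intro conjI impI, goal_cases)
      case 1
      with ee have eq: "mu d = nu d" by simp
      with Suc obtain m where m: "R d (nu d) UM DZ = z * m"
        "L d (nu d + 1) UO DP = x * y * m"
        "L d (nu d + 1) UO DU = (1 + x * y) * z * R d (nu d) UT DZ - w * L d (nu d) UT DZ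
         - x * y * z * m"
        "R d (nu d - 1) UO DU = x * y * ((1 + z) * L d (nu d) UT DZ - L d (nu d) UM DZ)"
        "R d (nu d - 1) UO DP = w * (b * x * m - z * R d (nu d) UT DZ
         + z * L d (nu d) UT DZ) + x * (y - b) * L d (nu d) UM DZ" by blast
      show ?case
        by (intro exI[of _ 0])
          (simp add: LS RS ee eq uK_def dK_def m Let_def, simp add: z_def w_def algebra_simps)
    next
      case 2
      with ee Suc have "L d (nu d + 1) UO DZ = R d (nu d) UO DZ" "mu d = nu d + 1" by auto
      then show ?case by (simp add: LS RS ee uK_def dK_def Let_def)
    next
      case 3
      with ee have eq: "nu d = mu d + 1" by simp
      with Suc obtain k G where k:
        "L d (mu d + 1) UT DU = R d (mu d) UT DU + x * y * k"
        "L d (mu d + 1) UT DP = R d (mu d) UT DP + x * (b - y) * k"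
        "L d (mu d + 1) UM DP = z * z * k + G"
        "L d (mu d + 1) UM DU = - (x * y * z * z * k) - z * G + z * (1 + z) * R d (mu d) UT DP"
        "(b - y) * R d (mu d) UM DP - y * R d (mu d) UM DU + y * z * (1 + z) * R d (mu d) UT DP
        = (1 + x * y) * (b * G + y * z * z * k)" by blast
      show ?case
        by (intro exI[of _ 0] exI[of _ 0])
          (simp add: LS RS ee eq uK_def dK_def k(1-4) Let_def, simp add: z_def w_def algebra_simps)
    qed
  next
    case dd
    show ?thesis
    proof (intro conjI impI, goal_cases)
      case 1
      with dd have eq: "mu d = nu d" by simp
      with Suc obtain m where m: "R d (nu d) UM DZ = z * m"
        "L d (nu d + 1) UO DP = x * y * m"
        "L d (nu d + 1) UO DU = (1 + x * y) * z * R d (nu d) UT DZ - w * L d (nu d) UT DZ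
         - x * y * z * m"
        "R d (nu d - 1) UO DU = x * y * ((1 + z) * L d (nu d) UT DZ - L d (nu d) UM DZ)"
        "R d (nu d - 1) UO DP = w * (b * x * m - z * R d (nu d) UT DZ
         + z * L d (nu d) UT DZ) + x * (y - b) * L d (nu d) UM DZ" by blast
      show ?case
        \<comment> \<open>The witness is the new \<open>R (Suc d)\<close> in state
          \<open>UM\<close>, \<open>DZ\<close> with its factor z removed; the hypothesis
          \<open>R d (nu d) UM DZ = z * m\<close> makes that factor visible.\<close>
        by (intro exI[of _ "R d (nu d - 1) UO DP + R d (nu d - 1) UO DU
              + (z + 1) * (z * R d (nu d) UT DZ - b * x * m)"])
          (simp add: LS RS dd eq uK_def dK_def m Let_def, simp add: z_def w_def algebra_simps)
    next
      case 2
      with dd Suc have "L d (nu d + 1) UO DZ = R d (nu d) UO DZ" "mu d = nu d + 1" by auto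
      then show ?case by (simp add: LS RS dd uK_def dK_def Let_def)
    next
      case 3
      with dd have eq: "nu d = mu d + 1" by simp
      with Suc obtain k G where k:
        "L d (mu d + 1) UT DU = R d (mu d) UT DU + x * y * k"
        "L d (mu d + 1) UT DP = R d (mu d) UT DP + x * (b - y) * k"
        "L d (mu d + 1) UM DP = z * z * k + G"
        "L d (mu d + 1) UM DU = - (x * y * z * z * k) - z * G + z * (1 + z) * R d (mu d) UT DP"
        "(b - y) * R d (mu d) UM DP - y * R d (mu d) UM DU + y * z * (1 + z) * R d (mu d) UT DP
        = (1 + x * y) * (b * G + y * z * z * k)" by blast
      \<comment> \<open>\<open>A\<close> is the new value of \<open>L\<close> in state
        \<open>UT\<close>, \<open>DP\<close>, and \<open>A'\<close> identifies it with the
        corresponding value of \<open>R\<close>. The passage from \<open>L\<close> to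
        \<open>R\<close> is one of the two places that need the fifth relation of the
        invariant.\<close>
      define A where "A = y * (z * z * L d (mu d + 1) UT DU - b * x * L d (mu d + 1) UM DU)
          + (y - b) * (z * z * L d (mu d + 1) UT DP - b * x * L d (mu d + 1) UM DP)"
      have A': "A = y * (z * z * R d (mu d) UT DU - b * x * R d (mu d) UM DU)
          + (y - b) * (z * z * R d (mu d) UT DP - b * x * R d (mu d) UM DP)"
          (is "_ = ?A'")
      proof -
        have "A - ?A' = - (b * x) * ((b - y) * R d (mu d) UM DP - y * R d (mu d) UM DU
            + y * z * (1 + z) * R d (mu d) UT DP - (1 + x * y) * (b * G + y * z * z * k))"
          unfolding A_def k(1-4) by (simp add: z_def algebra_simps)
        then show ?thesis using k(5) by simp
      qed
      have "L (Suc d) (mu d) UT DP = A" "L (Suc d) (mu d) UT DU = 0"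
        "L (Suc d) (mu d) UM DP = (z + 1) * A" "L (Suc d) (mu d) UM DU = 0"
        by (simp_all add: LS dd eq uK_def dK_def Let_def A_def z_def algebra_simps)
      moreover have "R (Suc d) (mu d - 1) UT DP = A" "R (Suc d) (mu d - 1) UT DU = 0"
        "R (Suc d) (mu d - 1) UM DP = (z + 1) * A" "R (Suc d) (mu d - 1) UM DU = 0"
        unfolding A' by (simp_all add: RS dd eq uK_def dK_def Let_def z_def algebra_simps)
      ultimately show ?case
        by (intro exI[of _ 0] exI[of _ "(z + 1) * A"])
          (simp add: dd eq, simp add: z_def algebra_simps)
    qed
  next
    case ed
    show ?thesis
    proof (intro conjI impI, goal_cases)
      case 1
      with ed have eq: "mu d = nu d + 1" by simp
      with Suc have "L d (nu d + 1) UO DZ = R d (nu d) UO DZ" by auto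
      then show ?case
        by (intro exI[of _ "R d (nu d) UO DZ"])
          (simp add: LS RS ed eq uK_def dK_def Let_def, simp add: z_def w_def algebra_simps)
    next
      case 2
      with ed have "mu d = nu d + 2" by simp
      then show ?case by (simp add: LS RS ed uK_def dK_def Let_def)
    next
      case 3
      with ed have eq: "mu d = nu d" by simp
      with Suc obtain m where m: "R d (nu d) UM DZ = z * m"
        "L d (nu d + 1) UO DP = x * y * m"
        "L d (nu d + 1) UO DU = (1 + x * y) * z * R d (nu d) UT DZ - w * L d (nu d) UT DZ
         - x * y * z * m"
        "R d (nu d - 1) UO DU = x * y * ((1 + z) * L d (nu d) UT DZ - L d (nu d) UM DZ)"
        "R d (nu d - 1) UO DP = w * (b * x * m - z * R d (nu d) UT DZ
         + z * L d (nu d) UT DZ) + x * (y - b) * L d (nu d) UM DZ" by blast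
      \<comment> \<open>\<open>k\<close> is read off from the required relation for
        \<open>UT\<close>, \<open>DU\<close>, where the hypothesis exposes the factor xy;
        \<open>G\<close> is then what the relation for \<open>UM\<close>, \<open>DP\<close>
        demands.\<close>
      define k where "k = - (y * (L d (nu d) UT DZ + z * R d (nu d) UT DZ - b * x * m))"
      define G where "G = z * (y * L d (nu d + 1) UO DU + (y - b) * L d (nu d + 1) UO DP) - z * z * k"
      show ?case
        by (intro exI[of _ k] exI[of _ G])
          (simp add: LS RS ed eq uK_def dK_def Let_def m k_def G_def, simp add: z_def w_def algebra_simps)
    qed
  next
    case de
    show ?thesis
    proof (intro conjI impI, goal_cases)
      case 1
      with de have eq: "nu d = mu d + 1" by simp
      with Suc obtain k G where k:
        "L d (mu d + 1) UT DU = R d (mu d) UT DU + x * y * k"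
        "L d (mu d + 1) UT DP = R d (mu d) UT DP + x * (b - y) * k"
        "L d (mu d + 1) UM DP = z * z * k + G"
        "L d (mu d + 1) UM DU = - (x * y * z * z * k) - z * G + z * (1 + z) * R d (mu d) UT DP"
        "(b - y) * R d (mu d) UM DP - y * R d (mu d) UM DU + y * z * (1 + z) * R d (mu d) UT DP
        = (1 + x * y) * (b * G + y * z * z * k)" by blast
      have e: "mu d - 1 + 1 = mu d" by simp
      show ?case
      proof (intro exI[of _ 0] conjI, goal_cases)
        case 1
        show ?case by (simp add: RS de eq uK_def dK_def Let_def)
      next
        case 2
        show ?case by (simp add: LS de eq uK_def dK_def Let_def)
      next
        case 3
        show ?case
          by (simp add: LS RS de eq uK_def dK_def Let_def k(1-4), simp add: z_def w_def algebra_simps)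
      next
        case 4
        show ?case by (simp add: LS RS de eq uK_def dK_def Let_def, simp add: z_def algebra_simps)
      next
        case 5
        show ?case (is "?l = ?r")
        proof -
          \<comment> \<open>The two sides differ by a multiple of the fifth relation of the
            hypothesis.\<close>
          have "?l - ?r = b * x * x * ((b - y) * R d (mu d) UM DP - y * R d (mu d) UM DU
            + y * z * (1 + z) * R d (mu d) UT DP - (1 + x * y) * (b * G + y * z * z * k))"
            by (simp add: LS RS de eq uK_def dK_def Let_def k(1-4), simp add: z_def w_def algebra_simps)
          then show ?thesis using k(5) by simp
        qed
      qed
    next
      case 2
      with de have "mu d = nu d" by simp
      with Suc obtain m where m: "R d (nu d) UM DZ = z * m"
        "L d (nu d + 1) UO DP = x * y * m"
        "L d (nu d + 1) UO DU = (1 + x * y) * z * R d (nu d) UT DZ - w * L d (nu d) UT DZ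
         - x * y * z * m"
        "R d (nu d - 1) UO DU = x * y * ((1 + z) * L d (nu d) UT DZ - L d (nu d) UM DZ)"
        "R d (nu d - 1) UO DP = w * (b * x * m - z * R d (nu d) UT DZ
         + z * L d (nu d) UT DZ) + x * (y - b) * L d (nu d) UM DZ" by blast
      then show ?case
        by (simp add: LS RS de uK_def dK_def Let_def \<open>mu d = nu d\<close>, simp add: z_def w_def algebra_simps)
    next
      case 3
      with de have "nu d = mu d + 2" by simp
      then show ?case
        by (intro exI[of _ 0] exI[of _ 0]) (simp add: LS RS de uK_def dK_def Let_def)
    qed
  qed
qed

text \<open>On diagonal \<open>M\<close> both profiles are 0, so the first clause of the invariant
  applies, and its unknown \<open>m\<close> is eliminated between the two relations for state
  \<open>UO\<close>. The subtracted sum is the boundary effect: shapes \<open>lam\<close> that still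
  have a box on diagonal \<open>M\<close>.\<close>

lemma commutation:
  fixes x y b :: "'a :: comm_ring_1"
  assumes "nu \<in> paths M 0" "mu \<in> paths M 0"
  shows "(1 + b * x - x * y) * (\<Sum>lam\<in>paths M 0. uvec x b lam nu M UT * dvec y b lam mu M DZ) =
    (1 + x * y) * (1 + b * x) * (\<Sum>kap\<in>paths M 0. uvec x b mu kap M UT * dvec y b nu kap M DZ)
    - (\<Sum>lam\<in>paths M 1. uvec x b lam nu M UO *
        ((1 + b * x) * dvec y b lam mu M DP + dvec y b lam mu M DU))"
proof -
  have M: "mu M = nu M" "nu M = 0" using assms by (auto simp: paths_def)
  let ?L = "Lsum x y b nu mu" and ?R = "Rsum x y b nu mu"
  from commutation_invariant[where d = M and x = x and y = y and b = b, of nu mu] paths_step[OF assms(1)] paths_step[OF assms(2)] M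
  obtain m where m: "?L M 1 UO DP = x * y * m"
      "?L M 1 UO DU = (1 + x * y) * (1 + b * x) * ?R M 0 UT DZ - (1 + b * x - x * y) * ?L M 0 UT DZ
         - x * y * (1 + b * x) * m"
    by auto
  have err: "(\<Sum>lam\<in>paths M 1. uvec x b lam nu M UO *
        ((1 + b * x) * dvec y b lam mu M DP + dvec y b lam mu M DU)) =
      (1 + b * x) * ?L M 1 UO DP + ?L M 1 UO DU"
    by (simp add: Lsum_def sum_distrib_left sum.distrib[symmetric] algebra_simps)
  show ?thesis
    unfolding err m Lsum_def[symmetric] Rsum_def[symmetric] by (simp add: algebra_simps)
qed

text \<open>With tail 1, \<open>lam\<close> has at least one box on each of the M + 1 diagonals 0 to
  M. The layer above \<open>nu\<close> therefore has at least M + 1 minus the size of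
  \<open>nu\<close> boxes, each contributing a factor x.\<close>

lemma uvec_UO_dvd:
  assumes "lam \<in> paths M 1" "nu \<in> paths M 0"
  shows "x ^ nat (int M + 1 - (\<Sum>e<M. nu e)) dvd uvec x b lam nu M UO"
proof (cases "uvec x b lam nu M UO = 0")
  case False
  then have h: "lam e - nu e \<in> {0, 1}" if "e \<le> M" for e
    using that uvec_support by blast
  define H where "H = {e. e \<le> M \<and> lam e = nu e + 1}"
  have "int M + 1 = (\<Sum>e\<le>M. 1)" by simp
  also have "\<dots> \<le> (\<Sum>e\<le>M. lam e)" by (intro sum_mono paths_ge[OF assms(1)])
  also have "\<dots> = (\<Sum>e\<le>M. nu e + (if lam e = nu e + 1 then 1 else 0))"
    using h by (intro sum.cong) force+
  also have "\<dots> = (\<Sum>e\<le>M. nu e) + int (card H)"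
    by (simp add: sum.distrib H_def sum.inter_filter[symmetric])
  also have "(\<Sum>e\<le>M. nu e) = (\<Sum>e<M. nu e)"
    using assms(2) by (simp add: lessThan_Suc_atMost[symmetric] paths_def)
  finally have "nat (int M + 1 - (\<Sum>e<M. nu e)) \<le> card H" by simp
  then have "x ^ nat (int M + 1 - (\<Sum>e<M. nu e)) dvd x ^ card H"
    by (rule le_imp_power_dvd)
  also have "\<dots> dvd uvec x b lam nu M UO"
    using uvec_dvd[where s = UO and d = M and l = lam and m = nu] by (simp add: H_def)
  finally show ?thesis .
qed simp

text \<open>
  The functions \<open>\<lambda> \<mapsto> B m \<lambda>\<close> are joint eigenvectors of the set-valued transfer operators, up to
  an error coming from the truncation to diagrams with at most \<open>M\<close> diagonals.
\<close>

lemma eigenvector: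
  fixes x b :: "'a :: comm_ring_1" and y :: "nat \<Rightarrow> 'a" and B :: "nat \<Rightarrow> (nat \<Rightarrow> int) \<Rightarrow> 'a"
  assumes B0: "\<And>l. l \<in> paths M 0 \<Longrightarrow> B 0 l = (if l = (\<lambda>_. 0) then 1 else 0)"
    and BS: "\<And>j l. l \<in> paths M 0 \<Longrightarrow>
      B (Suc j) l = (\<Sum>mu\<in>paths M 0. dvec (y j) b l mu M DZ * B j mu)"
    and "nu \<in> paths M 0"
  shows "x ^ nat (int M + 1 - (\<Sum>e<M. nu e)) dvd
    (\<Prod>j<m. 1 + b * x - x * y j) * (\<Sum>l\<in>paths M 0. uvec x b l nu M UT * B m l)
    - (\<Prod>j<m. (1 + x * y j) * (1 + b * x)) * B m nu"
  using assms(3)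
proof (induction m arbitrary: nu)
  case 0
  let ?z = "\<lambda>_ :: nat. 0 :: int"
  have z: "?z \<in> paths M 0" by (simp add: paths_def)
  have "uvec x b ?z nu M UT = (if nu = ?z then 1 else 0)"
  proof (cases "nu = ?z")
    case False
    have "uvec x b ?z nu M UT = 0"
    proof (rule ccontr)
      assume "uvec x b ?z nu M UT \<noteq> 0"
      then have 1: "- nu e \<in> {0, 1}" if "e \<le> M" for e
        using that uvec_support[of x b ?z nu M UT] by simp
      have "nu e = 0" if "e \<le> M" for e
        using 1[OF that] paths_ge[OF 0, of e] by auto
      moreover have "nu e = 0" if "e \<ge> M" for e using that 0 by (simp add: paths_def)
      ultimately show False using False by (metis linear ext)
    qed
    then show ?thesis using False by simp
  qed (simp add: uvec_refl)
  moreover have "(\<Sum>l\<in>paths M 0. uvec x b l nu M UT * B 0 l) = uvec x b ?z nu M UT"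
    using z by (simp add: B0 if_distrib[of "\<lambda>t. _ * t"] cong: sum.cong if_cong)
  ultimately show ?case using 0 by (simp add: B0)
next
  case (Suc m)
  let ?P = "paths M 0"
  let ?U = "\<lambda>l nu. uvec x b l nu M UT" and ?D = "\<lambda>l mu. dvec (y m) b l mu M DZ"
  define w where "w = 1 + b * x - x * y m"
  define z where "z = (1 + x * y m) * (1 + b * x)"
  define W where "W = (\<Prod>j<m. 1 + b * x - x * y j)"
  define Z where "Z = (\<Prod>j<m. (1 + x * y j) * (1 + b * x))"
  define err where "err mu = (\<Sum>lam\<in>paths M 1. uvec x b lam nu M UO *
        ((1 + b * x) * dvec (y m) b lam mu M DP + dvec (y m) b lam mu M DU))" for mu
  define k where "k nu = nat (int M + 1 - (\<Sum>e<M. nu e))" for nu :: "nat \<Rightarrow> int"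
  have "w * (\<Sum>l\<in>?P. ?U l nu * B (Suc m) l) =
      w * (\<Sum>l\<in>?P. \<Sum>mu\<in>?P. ?U l nu * ?D l mu * B m mu)"
    by (simp add: BS sum_distrib_left mult.assoc)
  also have "\<dots> = (\<Sum>mu\<in>?P. w * (\<Sum>l\<in>?P. ?U l nu * ?D l mu) * B m mu)"
    by (subst sum.swap) (simp add: sum_distrib_left sum_distrib_right mult.assoc)
  also have "\<dots> = (\<Sum>mu\<in>?P. (z * (\<Sum>kap\<in>?P. ?U mu kap * ?D nu kap) - err mu) * B m mu)"
    using Suc.prems by (intro sum.cong refl) (simp add: w_def z_def err_def commutation)
  also have "\<dots> = (\<Sum>mu\<in>?P. \<Sum>kap\<in>?P. z * ?D nu kap * (?U mu kap * B m mu))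
      - (\<Sum>mu\<in>?P. err mu * B m mu)"
    by (simp only: left_diff_distrib sum_subtractf) (simp add: sum_distrib_left sum_distrib_right ac_simps)
  also have "(\<Sum>mu\<in>?P. \<Sum>kap\<in>?P. z * ?D nu kap * (?U mu kap * B m mu)) =
      (\<Sum>kap\<in>?P. z * ?D nu kap * (\<Sum>mu\<in>?P. ?U mu kap * B m mu))"
    by (subst sum.swap) (simp add: sum_distrib_left)
  finally have S: "w * (\<Sum>l\<in>?P. ?U l nu * B (Suc m) l) =
      (\<Sum>kap\<in>?P. z * ?D nu kap * (\<Sum>mu\<in>?P. ?U mu kap * B m mu)) - (\<Sum>mu\<in>?P. err mu * B m mu)" .
  \<comment> \<open>Multiplication by \<open>W\<close> turns the inner sums into those of the
    induction hypothesis.\<close>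
  have "W * w * (\<Sum>l\<in>?P. ?U l nu * B (Suc m) l) - Z * z * B (Suc m) nu =
      W * (w * (\<Sum>l\<in>?P. ?U l nu * B (Suc m) l)) - Z * z * (\<Sum>kap\<in>?P. ?D nu kap * B m kap)"
    using Suc.prems by (simp add: BS mult.assoc)
  also have "\<dots> = (\<Sum>kap\<in>?P. z * ?D nu kap * (W * (\<Sum>mu\<in>?P. ?U mu kap * B m mu) - Z * B m kap))
      - W * (\<Sum>mu\<in>?P. err mu * B m mu)"
    unfolding S by (simp only: right_diff_distrib sum_subtractf) (simp add: sum_distrib_left ac_simps)
  finally have eq: "W * w * (\<Sum>l\<in>?P. ?U l nu * B (Suc m) l) - Z * z * B (Suc m) nu =
      (\<Sum>kap\<in>?P. z * ?D nu kap * (W * (\<Sum>mu\<in>?P. ?U mu kap * B m mu) - Z * B m kap))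
      - W * (\<Sum>mu\<in>?P. err mu * B m mu)" .
  \<comment> \<open>\<open>?D nu kap\<close> is nonzero only if \<open>kap\<close> is contained in
    \<open>nu\<close>; then \<open>kap\<close> has no more boxes than \<open>nu\<close>, and its
    error exponent is at least as large.\<close>
  have 1: "x ^ k nu dvd z * ?D nu kap * (W * (\<Sum>mu\<in>?P. ?U mu kap * B m mu) - Z * B m kap)"
    if kap: "kap \<in> ?P" for kap
  proof (cases "?D nu kap = 0")
    case False
    then have "kap e \<le> nu e" if "e \<le> M" for e
      using dvec_support[OF False] that by force
    then have "(\<Sum>e<M. kap e) \<le> (\<Sum>e<M. nu e)" by (intro sum_mono) simp
    then have "k nu \<le> k kap" by (simp add: k_def)
    then have "x ^ k nu dvd x ^ k kap" by (rule le_imp_power_dvd)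
    also have "\<dots> dvd W * (\<Sum>mu\<in>?P. ?U mu kap * B m mu) - Z * B m kap"
      using Suc.IH[OF kap] by (simp add: k_def W_def Z_def)
    finally show ?thesis by (rule dvd_mult)
  qed simp
  have 2: "x ^ k nu dvd err mu" for mu
    unfolding err_def k_def using uvec_UO_dvd[OF _ Suc.prems] by (intro dvd_sum dvd_mult2)
  have "x ^ k nu dvd W * w * (\<Sum>l\<in>?P. ?U l nu * B (Suc m) l) - Z * z * B (Suc m) nu"
    unfolding eq by (intro dvd_diff dvd_sum dvd_mult 1 2 dvd_mult2[OF 2])
  then show ?case by (simp add: k_def W_def Z_def w_def z_def)
qed

section \<open>Shapes\<close>

text \<open>Order ideals of a region, described by single steps to the left and up. The region is
  \<open>SQ\<close> for shifted diagrams and \<open>UNIV\<close> for ordinary ones, so that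
  \<open>sum_layers\<close> serves both.\<close>

definition ideal :: "(nat \<times> nat) set \<Rightarrow> (nat \<times> nat) set \<Rightarrow> bool"
  where "ideal Q I \<longleftrightarrow> I \<subseteq> Q \<and>
    (\<forall>i j. (i, Suc j) \<in> I \<longrightarrow> (i, j) \<in> Q \<longrightarrow> (i, j) \<in> I) \<and>
    (\<forall>i j. (Suc i, j) \<in> I \<longrightarrow> (i, j) \<in> Q \<longrightarrow> (i, j) \<in> I)"

definition SQ :: "(nat \<times> nat) set"
  where "SQ = {(i, j). i \<le> j}"

text \<open>A strict partition is encoded by the lengths of the diagonals of its shifted diagram.\<close>

definition Prof :: "(nat \<Rightarrow> int) set"
  where "Prof = (\<Union>M. paths M 0)"

definition SDc :: "(nat \<Rightarrow> int) \<Rightarrow> (nat \<times> nat) set"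
  where "SDc c = {(i, j). i \<le> j \<and> int i < c (j - i)}"

lemma mem_SDc: "(i, i + d) \<in> SDc c \<longleftrightarrow> int i < c d"
  by (simp add: SDc_def)

lemma SDc_subset_iff:
  assumes "\<And>e. 0 \<le> c e"
  shows "SDc c \<subseteq> SDc c' \<longleftrightarrow> (\<forall>e. c e \<le> c' e \<or> c e = 0)"
proof
  assume sub: "SDc c \<subseteq> SDc c'"
  show "\<forall>e. c e \<le> c' e \<or> c e = 0"
  proof
    fix e
    show "c e \<le> c' e \<or> c e = 0"
    proof (cases "c e = 0")
      case False
      with assms[of e] have "(nat (c e - 1), nat (c e - 1) + e) \<in> SDc c" by (simp add: mem_SDc)
      with sub have "int (nat (c e - 1)) < c' e" by (metis mem_SDc subsetD)
      with assms[of e] False show ?thesis by simp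
    qed simp
  qed
next
  assume le: "\<forall>e. c e \<le> c' e \<or> c e = 0"
  have "int i < c' d" if "int i < c d" for i d
    using le[rule_format, of d] that by auto
  then show "SDc c \<subseteq> SDc c'" by (auto simp: SDc_def)
qed

lemma Prof_ge: "c \<in> Prof \<Longrightarrow> 0 \<le> c e"
  unfolding Prof_def using paths_ge by blast

lemma Prof_step: "c \<in> Prof \<Longrightarrow> c e - c (Suc e) \<in> {0, 1}"
  unfolding Prof_def using paths_step by blast

lemma SDc_inj:
  assumes "c \<in> Prof" "c' \<in> Prof" "SDc c = SDc c'"
  shows "c = c'"
proof
  fix e
  have "c e \<le> c' e \<or> c e = 0" "c' e \<le> c e \<or> c' e = 0"
    using SDc_subset_iff[of c c'] SDc_subset_iff[of c' c] assms Prof_ge by auto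
  then show "c e = c' e" using Prof_ge[OF assms(1), of e] Prof_ge[OF assms(2), of e] by auto
qed

lemma ideal_SDc:
  assumes "c \<in> Prof"
  shows "ideal SQ (SDc c)"
proof -
  have "int i < c (j - i)" if "i \<le> Suc j" "int i < c (Suc j - i)" "i \<le> j" for i j
    using that Prof_step[OF assms, of "j - i"] by (simp add: Suc_diff_le) linarith
  moreover have "int i < c (j - i)" if "Suc i \<le> j" "int (Suc i) < c (j - Suc i)" for i j
  proof -
    have "j - i = Suc (j - Suc i)" using that by simp
    then show ?thesis using that Prof_step[OF assms, of "j - Suc i"] by simp linarith
  qed
  ultimately show ?thesis by (auto simp: ideal_def SDc_def SQ_def)
qed

lemma SDc_eq_image:
  assumes "c \<in> paths M 0"
  shows "SDc c = (\<lambda>(d, i). (i, i + d)) ` (SIGMA d:{..<M}. {..<nat (c d)})"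
proof -
  have "(i, j) \<in> (\<lambda>(d, i). (i, i + d)) ` (SIGMA d:{..<M}. {..<nat (c d)})"
    if "i \<le> j" "int i < c (j - i)" for i j
  proof -
    have "j - i < M"
      using that assms by (rule_tac ccontr) (simp add: paths_def)
    then show ?thesis using that by (intro image_eqI[of _ _ "(j - i, i)"]) auto
  qed
  then show ?thesis by (auto simp: SDc_def)
qed

lemma finite_SDc [simp]: "c \<in> Prof \<Longrightarrow> finite (SDc c)"
  unfolding Prof_def by (auto simp: SDc_eq_image)

lemma sum_SDc:
  assumes "c \<in> paths M 0"
  shows "(\<Sum>b\<in>SDc c. f b) = (\<Sum>d<M. \<Sum>i<nat (c d). f (i, i + d))"
  unfolding SDc_eq_image[OF assms]
  by (subst sum.reindex) (auto simp: inj_on_def sum.Sigma intro!: sum.cong)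

lemma prod_SDc:
  assumes "c \<in> paths M 0"
  shows "(\<Prod>b\<in>SDc c. f b) = (\<Prod>d<M. \<Prod>i<nat (c d). f (i, i + d))"
  unfolding SDc_eq_image[OF assms]
  by (subst prod.reindex) (auto simp: inj_on_def prod.Sigma intro!: prod.cong)

lemma card_SDc:
  assumes "c \<in> paths M 0"
  shows "int (card (SDc c)) = (\<Sum>d<M. c d)"
proof -
  have "card (SDc c) = (\<Sum>d<M. nat (c d))"
    using sum_SDc[OF assms, of "\<lambda>_. 1 :: nat"] by simp
  then have "int (card (SDc c)) = (\<Sum>d<M. int (nat (c d)))" by simp
  also have "\<dots> = (\<Sum>d<M. c d)"
    using paths_ge[OF assms] by (intro sum.cong) auto
  finally show ?thesis .
qed

lemma paths_eq_Prof: "paths M 0 = {c \<in> Prof. \<forall>e\<ge>M. c e = 0}"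
proof
  show "paths M 0 \<subseteq> {c \<in> Prof. \<forall>e\<ge>M. c e = 0}" by (auto simp: Prof_def paths_def)
  show "{c \<in> Prof. \<forall>e\<ge>M. c e = 0} \<subseteq> paths M 0"
    using Prof_step by (auto simp: paths_def[of M])
qed

text \<open>If diagonal e is nonempty, then so are all diagonals before it, which gives at least e +
  1 boxes.\<close>

lemma paths_card:
  assumes "c \<in> Prof" "card (SDc c) \<le> M"
  shows "c \<in> paths M 0"
proof -
  obtain N where N: "c \<in> paths N 0" using assms(1) by (auto simp: Prof_def)
  have "c e = 0" if "e \<ge> M" for e
  proof (rule ccontr)
    assume "c e \<noteq> 0"
    then have e: "1 \<le> c e" using Prof_ge[OF assms(1), of e] by simp
    then have "e < N" using N by (rule_tac ccontr) (simp add: paths_def)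
    have "int (Suc e) = (\<Sum>d<Suc e. 1)" by simp
    also have "\<dots> \<le> (\<Sum>d<Suc e. c d)"
    proof (rule sum_mono)
      fix d assume "d \<in> {..<Suc e}"
      then show "1 \<le> c d" using paths_antimono[OF N, of d e] e by simp
    qed
    also have "\<dots> \<le> (\<Sum>d<N. c d)"
      using \<open>e < N\<close> Prof_ge[OF assms(1)] by (intro sum_mono2) auto
    also have "\<dots> = int (card (SDc c))" using card_SDc[OF N] by simp
    finally show False using assms(2) that by simp
  qed
  then show ?thesis using assms(1) paths_eq_Prof by blast
qed

lemma downset_nat:
  fixes A :: "nat set"
  assumes "finite A" "\<And>i. Suc i \<in> A \<Longrightarrow> i \<in> A"
  shows "A = {..<card A}"
proof (cases "A = {}")
  case False
  have "i \<in> A" if "j \<in> A" "i \<le> j" for i j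
    using that(2,1) by (induction i rule: inc_induct) (auto intro: assms(2))
  then have "{..Max A} \<subseteq> A" using Max_in[OF assms(1) False] by blast
  moreover have "A \<subseteq> {..Max A}" using Max_ge[OF assms(1)] by blast
  ultimately have "A = {..<Suc (Max A)}" by (simp add: lessThan_Suc_atMost)
  then show ?thesis using card_lessThan by metis
qed simp

lemma ideal_eq_SDc:
  assumes "ideal SQ I" "finite I"
  obtains c where "c \<in> Prof" "SDc c = I"
proof
  define A where "A d = {i. (i, i + d) \<in> I}" for d
  define c where "c d = int (card (A d))" for d
  have finA: "finite (A d)" for d
    using finite_vimageI[OF assms(2), of "\<lambda>i. (i, i + d)"]
    by (simp add: inj_on_def vimage_def A_def)
  have left: "(i, j) \<in> I" if "(i, Suc j) \<in> I" "i \<le> j" for i j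
    using assms(1) that unfolding ideal_def SQ_def by blast
  have up: "(i, j) \<in> I" if "(Suc i, j) \<in> I" for i j
  proof -
    have "(Suc i, j) \<in> SQ" using assms(1) that unfolding ideal_def by blast
    then have "(i, j) \<in> SQ" by (simp add: SQ_def)
    then show ?thesis using assms(1) that unfolding ideal_def by blast
  qed
  have A: "A d = {..<card (A d)}" for d
  proof (rule downset_nat[OF finA])
    fix i assume "Suc i \<in> A d"
    then have "(i, Suc (i + d)) \<in> I" by (auto simp: A_def intro: up)
    then show "i \<in> A d" by (auto simp: A_def intro: left)
  qed
  have IA: "(i, i + d) \<in> I \<longleftrightarrow> int i < c d" for i d
    using A[of d] unfolding c_def A_def by auto
  have step: "c d - c (Suc d) \<in> {0, 1}" for d
  proof -
    have "A (Suc d) \<subseteq> A d" by (auto simp: A_def intro: left)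
    then have "c (Suc d) \<le> c d" using finA by (simp add: c_def card_mono)
    \<comment> \<open>Moving up from a box on diagonal \<open>d\<close> leads to the next diagonal,
      so every box of diagonal \<open>d\<close> except the one in row 0 has a partner there.\<close>
    moreover have "c d \<le> c (Suc d) + 1"
    proof (rule ccontr)
      assume "\<not> ?thesis"
      then have "int (Suc (nat (c (Suc d)))) < c d" by (simp add: c_def)
      then have "(Suc (nat (c (Suc d))), Suc (nat (c (Suc d))) + d) \<in> I" by (simp only: IA)
      then have "(nat (c (Suc d)), nat (c (Suc d)) + Suc d) \<in> I" using up by simp
      then show False unfolding IA by (simp add: c_def)
    qed
    ultimately show ?thesis by auto
  qed
  obtain N where N: "snd ` I \<subseteq> {..<N}"
    using assms(2) by (meson finite_imageI finite_nat_iff_bounded)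
  have "c e = 0" if "e \<ge> N" for e
  proof -
    have "A e = {}" using N that by (force simp: A_def)
    then show ?thesis by (simp add: c_def)
  qed
  then show "c \<in> Prof" using step by (auto simp: Prof_def paths_def)
  show "SDc c = I"
  proof -
    have "I \<subseteq> SQ" using assms(1) by (simp add: ideal_def)
    then have "(i, j) \<in> I \<longleftrightarrow> i \<le> j \<and> int i < c (j - i)" for i j
      using IA[of i "j - i"] by (auto simp: SQ_def)
    then show ?thesis by (auto simp: SDc_def)
  qed
qed

subsection \<open>Strict partitions\<close>

text \<open>Row i of the shifted diagram occupies the diagonals 0 to \<open>lam ! i - 1\<close>, so
  diagonal \<open>d\<close> meets exactly the rows longer than \<open>d\<close>.\<close>

definition prof :: "nat list \<Rightarrow> nat \<Rightarrow> int"
  where "prof lam d = int (length (filter (\<lambda>r. d < r) lam))"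

lemma prof_gt_iff:
  assumes "sorted_wrt (>) lam"
  shows "int i < prof lam d \<longleftrightarrow> i < length lam \<and> d < lam ! i"
  using assms
proof (induction lam arbitrary: i)
  case (Cons a lam)
  show ?case
  proof (cases "d < a")
    case True
    then show ?thesis using Cons by (cases i) (simp_all add: prof_def)
  next
    case False
    then have "filter (\<lambda>r. d < r) (a # lam) = []"
      using Cons.prems by (auto simp: filter_empty_conv)
    moreover have "\<not> d < (a # lam) ! i" if "i < length (a # lam)"
    proof -
      have "(a # lam) ! i \<in> set (a # lam)" using that nth_mem by blast
      then show ?thesis using False Cons.prems by auto
    qed
    ultimately show ?thesis by (auto simp: prof_def)
  qed
qed (simp add: prof_def)

lemma SD_eq_SDc:
  assumes "lam \<in> strict_partitions"
  shows "SD lam = SDc (prof lam)"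
proof -
  have s: "sorted_wrt (>) lam" using assms by (simp add: strict_partitions_def)
  have "(i, j) \<in> SD lam \<longleftrightarrow> i \<le> j \<and> i < length lam \<and> j - i < lam ! i" for i j
    by (force simp: SD_def)
  then show ?thesis by (auto simp: SDc_def prof_gt_iff[OF s])
qed

lemma ideal_SD: "lam \<in> strict_partitions \<Longrightarrow> ideal SQ (SD lam)"
proof -
  assume "lam \<in> strict_partitions"
  then have s: "sorted_wrt (>) lam" by (simp add: strict_partitions_def)
  have "(i, j) \<in> SD lam \<longleftrightarrow> i \<le> j \<and> i < length lam \<and> j - i < lam ! i" for i j
    by (force simp: SD_def)
  moreover have "j - i < lam ! i" if "Suc i \<le> j" "Suc i < length lam" "j - Suc i < lam ! Suc i" for i j
    using sorted_wrt_nth_less[OF s, of i "Suc i"] that by simp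
  ultimately show ?thesis by (auto simp: ideal_def SQ_def)
qed

lemma finite_SD [simp]: "finite (SD lam)"
proof -
  have "SD lam = (\<lambda>(i, j). (i, i + j)) ` (SIGMA i:{..<length lam}. {..<lam ! i})"
    by (force simp: SD_def)
  then show ?thesis by simp
qed

lemma card_SD: "card (SD lam) = sum_list lam"
proof -
  have "SD lam = (\<lambda>(i, j). (i, i + j)) ` (SIGMA i:{..<length lam}. {..<lam ! i})"
    by (force simp: SD_def)
  then have "card (SD lam) = card (SIGMA i:{..<length lam}. {..<lam ! i})"
    by (simp add: card_image inj_on_def)
  also have "\<dots> = sum_list lam"
    by (simp add: sum_list_sum_nth atLeast0LessThan)
  finally show ?thesis .
qed

lemma prof_in_Prof:
  assumes "lam \<in> strict_partitions"
  shows "prof lam \<in> Prof"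
proof -
  obtain c where c: "c \<in> Prof" "SDc c = SD lam"
    using ideal_eq_SDc[OF ideal_SD[OF assms] finite_SD] by blast
  then have eq: "SDc c = SDc (prof lam)" using SD_eq_SDc[OF assms] by simp
  have "c = prof lam"
  proof
    fix e
    have "0 \<le> c e" "0 \<le> prof lam e" for e using Prof_ge[OF c(1)] by (simp_all add: prof_def)
    then have "c e \<le> prof lam e \<or> c e = 0" "prof lam e \<le> c e \<or> prof lam e = 0"
      using SDc_subset_iff[of c "prof lam"] SDc_subset_iff[of "prof lam" c] eq by auto
    then show "c e = prof lam e" using \<open>\<And>e. 0 \<le> c e\<close> \<open>\<And>e. 0 \<le> prof lam e\<close> by (smt (verit))
  qed
  then show ?thesis using c(1) by simp
qed

lemma prof_inj: "inj_on prof strict_partitions"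
proof
  fix l l' assume l: "l \<in> strict_partitions" "l' \<in> strict_partitions" "prof l = prof l'"
  have s: "sorted_wrt (>) l" "sorted_wrt (>) l'" using l by (auto simp: strict_partitions_def)
  have pos: "l ! i > 0" if "i < length l" "l \<in> strict_partitions" for i l
  proof (rule gr0I)
    assume "l ! i = 0"
    then have "0 \<in> set l" using that(1) nth_mem[of i l] by simp
    then show False using that(2) by (simp add: strict_partitions_def)
  qed
  have iff: "i < length l \<and> d < l ! i \<longleftrightarrow> i < length l' \<and> d < l' ! i" for i d
    using prof_gt_iff[OF s(1), of i d] prof_gt_iff[OF s(2), of i d] l(3) by simp
  have len: "i < length l \<longleftrightarrow> i < length l'" for i
    using iff[of i 0] pos l(1,2) by blast
  from this[of "length l"] this[of "length l'"] have "length l = length l'" by simp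
  moreover have "l ! i = l' ! i" if "i < length l" for i
    using iff[of i "l ! i"] iff[of i "l' ! i"] len[of i] that by simp
  ultimately show "l = l'" by (simp add: list_eq_iff_nth_eq)
qed

lemma prof_surj:
  assumes "c \<in> Prof"
  obtains lam where "lam \<in> strict_partitions" "prof lam = c"
proof -
  obtain M where M: "c \<in> paths M 0" using assms by (auto simp: Prof_def)
  \<comment> \<open>Row i consists of one box on each diagonal with more than i boxes, so
    \<open>k i\<close> is its length.\<close>
  define k where "k i = card {d. int i < c d}" for i :: nat
  have k: "{d. int i < c d} = {..<k i}" for i
    unfolding k_def
  proof (rule downset_nat)
    have "{d. int i < c d} \<subseteq> {..<M}"
    proof
      fix d assume d: "d \<in> {d. int i < c d}"
      show "d \<in> {..<M}"
      proof (rule ccontr)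
        assume "d \<notin> {..<M}"
        then have "c d = 0" using M by (simp add: paths_def)
        with d show False by simp
      qed
    qed
    then show "finite {d. int i < c d}" using finite_subset by blast
    show "d \<in> {d. int i < c d}" if "Suc d \<in> {d. int i < c d}" for d
      using that Prof_step[OF assms, of d] by auto
  qed
  have kc: "d < k i \<longleftrightarrow> int i < c d" for i d using k[of i] by blast
  have kdec: "k (Suc i) < k i" if "int (Suc i) < c 0" for i
  proof -
    have "0 < k (Suc i)" using that by (simp add: kc)
    then have "int (Suc i) < c (k (Suc i) - 1)" by (subst kc[symmetric]) simp
    then have "int i < c (k (Suc i))"
      using Prof_step[OF assms, of "k (Suc i) - 1"] \<open>0 < k (Suc i)\<close> by auto
    then show ?thesis by (simp add: kc)
  qed
  define lam where "lam = map k [0..<nat (c 0)]"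
  have kdec': "k j < k i" if "i < j" "int j < c 0" for i j
    using that
  proof (induction j)
    case (Suc j)
    then show ?case using kdec[of j] by (cases "i = j") auto
  qed simp
  have srt: "sorted_wrt (>) lam"
    unfolding sorted_wrt_iff_nth_less lam_def using kdec' by simp
  have "k i \<noteq> 0" if "i < nat (c 0)" for i
  proof -
    have "0 < k i" using that by (simp add: kc)
    then show ?thesis by simp
  qed
  then have "0 \<notin> set lam" by (auto simp: lam_def image_iff)
  then have "lam \<in> strict_partitions" using srt by (simp add: strict_partitions_def)
  moreover have "prof lam = c"
  proof
    fix d
    have "int i < prof lam d \<longleftrightarrow> int i < c d" for i
    proof -
      have "c d \<le> c 0" by (rule paths_antimono[OF M]) simp
      then show ?thesis unfolding prof_gt_iff[OF srt] by (auto simp: lam_def kc)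
    qed
    from this[of "nat (c d)"] this[of "nat (prof lam d)"] show "prof lam d = c d"
      using Prof_ge[OF assms, of d] by (simp add: prof_def not_less)
  qed
  ultimately show thesis using that by blast
qed

lemma bij_prof: "bij_betw prof strict_partitions Prof"
proof -
  have "prof ` strict_partitions = Prof"
    using prof_in_Prof by (auto elim!: prof_surj)
  then show ?thesis using prof_inj by (simp add: bij_betw_def)
qed

section \<open>Tableaux and their layers\<close>

text \<open>Fillings constrained only between neighbouring boxes. The relations are parameters
  because marked tableaux (\<open>mh\<close>, \<open>mv\<close>) and semistandard ones are both
  peeled by the same lemma.\<close>

definition tabs :: "('l \<Rightarrow> 'l \<Rightarrow> bool) \<Rightarrow> ('l \<Rightarrow> 'l \<Rightarrow> bool) \<Rightarrow> (nat \<times> nat) set \<Rightarrow> 'l set \<Rightarrow> (nat \<times> nat \<Rightarrow> 'l) set"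
  where "tabs Rh Rv D A = {V \<in> D \<rightarrow>\<^sub>E A.
    (\<forall>i j. (i, j) \<in> D \<longrightarrow> (i, Suc j) \<in> D \<longrightarrow> Rh (V (i, j)) (V (i, Suc j))) \<and>
    (\<forall>i j. (i, j) \<in> D \<longrightarrow> (Suc i, j) \<in> D \<longrightarrow> Rv (V (i, j)) (V (Suc i, j)))}"

lemma finite_tabs [simp]: "finite D \<Longrightarrow> finite A \<Longrightarrow> finite (tabs Rh Rv D A)"
  unfolding tabs_def by (simp add: finite_PiE)

lemma tabs_empty [simp]: "tabs Rh Rv {} A = {\<lambda>_. undefined}"
  by (auto simp: tabs_def)

lemma tabs_undef: "V \<in> tabs Rh Rv D A \<Longrightarrow> b \<notin> D \<Longrightarrow> V b = undefined"
  and tabs_mem: "V \<in> tabs Rh Rv D A \<Longrightarrow> b \<in> D \<Longrightarrow> V b \<in> A"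
  and tabs_h: "V \<in> tabs Rh Rv D A \<Longrightarrow> (i, j) \<in> D \<Longrightarrow> (i, Suc j) \<in> D \<Longrightarrow> Rh (V (i, j)) (V (i, Suc j))"
  and tabs_v: "V \<in> tabs Rh Rv D A \<Longrightarrow> (i, j) \<in> D \<Longrightarrow> (Suc i, j) \<in> D \<Longrightarrow> Rv (V (i, j)) (V (Suc i, j))"
  unfolding tabs_def by (auto elim: PiE_arb PiE_mem)

lemma tabsI:
  assumes "\<And>b. b \<in> D \<Longrightarrow> V b \<in> A" "\<And>b. b \<notin> D \<Longrightarrow> V b = undefined"
    and "\<And>i j. (i, j) \<in> D \<Longrightarrow> (i, Suc j) \<in> D \<Longrightarrow> Rh (V (i, j)) (V (i, Suc j))"
    and "\<And>i j. (i, j) \<in> D \<Longrightarrow> (Suc i, j) \<in> D \<Longrightarrow> Rv (V (i, j)) (V (Suc i, j))"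
  shows "V \<in> tabs Rh Rv D A"
  unfolding tabs_def using assms by (auto intro!: PiE_I)

text \<open>The boxes with index below \<open>n\<close>, together with \<open>M\<close>, form an
  ideal \<open>R\<close>. Across its border the index strictly increases, so the relations hold
  there automatically and the two parts can be filled independently.\<close>

lemma sum_layers:
  assumes "ideal Q L" "ideal Q M" "M \<subseteq> L" "finite L"
    and idx: "\<And>a b. Rh a b \<Longrightarrow> idx a \<le> idx b" "\<And>a b. idx a < idx b \<Longrightarrow> Rh a b"
      "\<And>a b. Rv a b \<Longrightarrow> idx a \<le> idx b" "\<And>a b. idx a < idx b \<Longrightarrow> Rv a b"
    and fin: "\<And>n :: nat. finite {a. idx a < n}"
  shows "(\<Sum>V\<in>tabs Rh Rv (L - M) {a. idx a < Suc n}. f V) =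
    (\<Sum>R | ideal Q R \<and> M \<subseteq> R \<and> R \<subseteq> L. \<Sum>V\<in>tabs Rh Rv (R - M) {a. idx a < n}.
       \<Sum>W\<in>tabs Rh Rv (L - R) {a. idx a = n}. f (\<lambda>b. if b \<in> R then V b else W b))"
proof -
  let ?R = "{R. ideal Q R \<and> M \<subseteq> R \<and> R \<subseteq> L}"
  let ?V = "\<lambda>R. tabs Rh Rv (R - M) {a. idx a < n}" and ?W = "\<lambda>R. tabs Rh Rv (L - R) {a. idx a = n}"
  have finR: "finite ?R" by (rule finite_subset[of _ "Pow L"]) (use assms(4) in auto)
  have finV: "finite (?V R)" if "R \<in> ?R" for R
    using that assms(4) fin finite_subset by (intro finite_tabs) auto
  have finW: "finite (?W R)" for R
    using assms(4) by (intro finite_tabs finite_subset[OF _ fin[of "Suc n"]]) auto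
  have "(\<Sum>R\<in>?R. \<Sum>V\<in>?V R. \<Sum>W\<in>?W R. f (\<lambda>b. if b \<in> R then V b else W b)) =
      (\<Sum>(R, V, W)\<in>(SIGMA R:?R. ?V R \<times> ?W R). f (\<lambda>b. if b \<in> R then V b else W b))"
    using finR finV finW
    by (simp add: sum.cartesian_product sum.Sigma case_prod_unfold)
  also have "\<dots> = (\<Sum>V\<in>tabs Rh Rv (L - M) {a. idx a < Suc n}. f V)"
  proof (rule sum.reindex_bij_witness
      [where i = "\<lambda>V. (M \<union> {b \<in> L - M. idx (V b) < n},
              restrict V {b \<in> L - M. idx (V b) < n},
              restrict V (L - (M \<union> {b \<in> L - M. idx (V b) < n})))"
        and j = "\<lambda>(R, V, W) b. if b \<in> R then V b else W b"])
    fix t assume t: "t \<in> (SIGMA R:?R. ?V R \<times> ?W R)"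
    obtain R V W where tt [simp]: "t = (R, V, W)" by (cases t) auto
    have R: "ideal Q R" "M \<subseteq> R" "R \<subseteq> L" and V: "V \<in> ?V R" and W: "W \<in> ?W R"
      using t by auto
    have Vi: "idx (V b) < n" if "b \<in> R - M" for b using tabs_mem[OF V that] by simp
    have Wi: "idx (W b) = n" if "b \<in> L - R" for b using tabs_mem[OF W that] by simp
    note Vu = tabs_undef[OF V] and Wu = tabs_undef[OF W]
    let ?T = "\<lambda>b. if b \<in> R then V b else W b"
    have S: "{b \<in> L - M. idx (?T b) < n} = R - M"
    proof (intro equalityI subsetI)
      fix b assume b: "b \<in> {b \<in> L - M. idx (?T b) < n}"
      then show "b \<in> R - M" using Wi[of b] by (cases "b \<in> R") auto
    next
      fix b assume "b \<in> R - M"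
      then show "b \<in> {b \<in> L - M. idx (?T b) < n}" using Vi[of b] R by auto
    qed
    have "M \<union> (R - M) = R" using R by auto
    moreover have "restrict ?T (R - M) = V" using Vu by (auto simp: restrict_def fun_eq_iff)
    moreover have "restrict ?T (L - R) = W" using Wu by (auto simp: restrict_def fun_eq_iff)
    ultimately show "(\<lambda>V. (M \<union> {b \<in> L - M. idx (V b) < n},
              restrict V {b \<in> L - M. idx (V b) < n},
              restrict V (L - (M \<union> {b \<in> L - M. idx (V b) < n}))))
         ((\<lambda>(R, V, W) b. if b \<in> R then V b else W b) t) = t"
      unfolding tt prod.case S by simp
    have "?T \<in> tabs Rh Rv (L - M) {a. idx a < Suc n}"
    proof (rule tabsI)
      fix b assume "b \<in> L - M"
      then show "?T b \<in> {a. idx a < Suc n}" using Vi[of b] Wi[of b] by auto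
    next
      fix b assume "b \<notin> L - M"
      then show "?T b = undefined" using Vu[of b] Wu[of b] R by auto
    next
      fix i j assume b: "(i, j) \<in> L - M" "(i, Suc j) \<in> L - M"
      show "Rh (?T (i, j)) (?T (i, Suc j))"
      proof (cases "(i, Suc j) \<in> R")
        case True
        then have "(i, j) \<in> R" using R b assms(1) unfolding ideal_def by blast
        then show ?thesis using tabs_h[OF V, of i j] b True by simp
      next
        case False
        show ?thesis
        proof (cases "(i, j) \<in> R")
          case True
          then show ?thesis using b False Wi[of "(i, Suc j)"] Vi[of "(i, j)"] idx(2) by simp
        next
          case False
          then show ?thesis using tabs_h[OF W, of i j] b \<open>(i, Suc j) \<notin> R\<close> by simp
        qed
      qed
    next
      fix i j assume b: "(i, j) \<in> L - M" "(Suc i, j) \<in> L - M"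
      show "Rv (?T (i, j)) (?T (Suc i, j))"
      proof (cases "(Suc i, j) \<in> R")
        case True
        then have "(i, j) \<in> R" using R b assms(1) unfolding ideal_def by blast
        then show ?thesis using tabs_v[OF V, of i j] b True by simp
      next
        case False
        show ?thesis
        proof (cases "(i, j) \<in> R")
          case True
          then show ?thesis using b False Wi[of "(Suc i, j)"] Vi[of "(i, j)"] idx(4) by simp
        next
          case False
          then show ?thesis using tabs_v[OF W, of i j] b \<open>(Suc i, j) \<notin> R\<close> by simp
        qed
      qed
    qed
    then show "(\<lambda>(R, V, W) b. if b \<in> R then V b else W b) t \<in> tabs Rh Rv (L - M) {a. idx a < Suc n}"
      by simp
    show "f ((\<lambda>(R, V, W) b. if b \<in> R then V b else W b) t) =
       (case t of (R, V, W) \<Rightarrow> f (\<lambda>b. if b \<in> R then V b else W b))" by simp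
  next
    fix V assume V: "V \<in> tabs Rh Rv (L - M) {a. idx a < Suc n}"
    define S where "S = {b \<in> L - M. idx (V b) < n}"
    note Vu = tabs_undef[OF V]
    have Vi: "idx (V b) < Suc n" if "b \<in> L - M" for b using tabs_mem[OF V that] by simp
    have SM: "(M \<union> S) - M = S" "L - (M \<union> S) = {b \<in> L - M. idx (V b) = n}"
      using Vi by (fastforce simp: S_def less_Suc_eq)+
    have "(\<lambda>b. if b \<in> M \<union> S then restrict V S b else restrict V (L - (M \<union> S)) b) = V"
      using Vu by (auto simp: fun_eq_iff S_def)
    then show "(\<lambda>(R, V, W) b. if b \<in> R then V b else W b)
         (M \<union> {b \<in> L - M. idx (V b) < n}, restrict V {b \<in> L - M. idx (V b) < n},
          restrict V (L - (M \<union> {b \<in> L - M. idx (V b) < n}))) = V"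
      unfolding S_def[symmetric] by simp
    note Vh = tabs_h[OF V] and Vv = tabs_v[OF V]
    have "ideal Q (M \<union> S)"
    proof -
      have "(i, j) \<in> M \<union> S" if "(i, Suc j) \<in> M \<union> S" "(i, j) \<in> Q" for i j
      proof (cases "(i, Suc j) \<in> M \<or> (i, j) \<in> M")
        case True
        then show ?thesis using that assms(2) unfolding ideal_def by blast
      next
        case False
        then have "(i, Suc j) \<in> S" using that by auto
        moreover from this have "(i, j) \<in> L - M" using False that assms(1) unfolding ideal_def S_def by blast
        ultimately show ?thesis using idx(1)[OF Vh] by (fastforce simp: S_def)
      qed
      moreover have "(i, j) \<in> M \<union> S" if "(Suc i, j) \<in> M \<union> S" "(i, j) \<in> Q" for i j
      proof (cases "(Suc i, j) \<in> M \<or> (i, j) \<in> M")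
        case True
        then show ?thesis using that assms(2) unfolding ideal_def by blast
      next
        case False
        then have "(Suc i, j) \<in> S" using that by auto
        moreover from this have "(i, j) \<in> L - M" using False that assms(1) unfolding ideal_def S_def by blast
        ultimately show ?thesis using idx(3)[OF Vv] by (fastforce simp: S_def)
      qed
      moreover have "M \<union> S \<subseteq> Q" using assms(1,2) by (auto simp: ideal_def S_def)
      ultimately show ?thesis unfolding ideal_def by blast
    qed
    moreover have "restrict V S \<in> tabs Rh Rv (M \<union> S - M) {a. idx a < n}"
      unfolding SM using Vh Vv by (intro tabsI) (auto simp: S_def)
    moreover have "restrict V (L - (M \<union> S)) \<in> tabs Rh Rv (L - (M \<union> S)) {a. idx a = n}"
      unfolding SM using Vh Vv by (intro tabsI) auto
    ultimately show "(M \<union> {b \<in> L - M. idx (V b) < n}, restrict V {b \<in> L - M. idx (V b) < n},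
          restrict V (L - (M \<union> {b \<in> L - M. idx (V b) < n}))) \<in> (SIGMA R:?R. ?V R \<times> ?W R)"
      unfolding S_def[symmetric] using assms(3) by (auto simp: S_def)
  qed
  finally show ?thesis ..
qed

section \<open>Marked tableaux\<close>

definition unp :: "letter \<Rightarrow> bool"
  where "unp a \<longleftrightarrow> a = Unprimed (index a)"

lemma unp_simps [simp]: "unp (Unprimed n)" "\<not> unp (Primed n)"
  by (simp_all add: unp_def)

definition mh :: "letter \<Rightarrow> letter \<Rightarrow> bool"
  where "mh a b \<longleftrightarrow> a < b \<or> (a = b \<and> unp a)"

definition mv :: "letter \<Rightarrow> letter \<Rightarrow> bool"
  where "mv a b \<longleftrightarrow> a < b \<or> (a = b \<and> \<not> unp a)"

lemma less_letter_simps [simp]: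
  "Primed m < Primed n \<longleftrightarrow> m < n" "Unprimed m < Unprimed n \<longleftrightarrow> m < n"
  "Primed m < Unprimed n \<longleftrightarrow> m \<le> n" "Unprimed m < Primed n \<longleftrightarrow> m < n"
  by (auto simp: less_letter_def)

lemma le_letter_simps [simp]:
  "Primed m \<le> Primed n \<longleftrightarrow> m \<le> n" "Unprimed m \<le> Unprimed n \<longleftrightarrow> m \<le> n"
  "Primed m \<le> Unprimed n \<longleftrightarrow> m \<le> n" "Unprimed m \<le> Primed n \<longleftrightarrow> m < n"
  by (auto simp: less_eq_letter_def)

lemma mh_idx: "mh a b \<Longrightarrow> index a \<le> index b" "index a < index b \<Longrightarrow> mh a b"
  and mv_idx: "mv a b \<Longrightarrow> index a \<le> index b" "index a < index b \<Longrightarrow> mv a b"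
  by (cases a; cases b; force simp: mh_def mv_def)+

lemma letters_lt: "{a. index a < n} = Primed ` {..<n} \<union> Unprimed ` {..<n}"
  and letters_eq: "{a. index a = n} = {Primed n, Unprimed n}"
  by (auto, metis letter.exhaust_sel image_iff lessThan_iff) (metis letter.exhaust_sel)+

lemma finite_letters [simp]: "finite {a. index a < n}" "finite {a. index a = n}"
  by (simp_all add: letters_lt letters_eq)

lemma mh_trans: "mh a b \<Longrightarrow> mh b c \<Longrightarrow> mh a c" and mv_trans: "mv a b \<Longrightarrow> mv b c \<Longrightarrow> mv a c"
  by (auto simp: mh_def mv_def)

lemma mh_le: "mh a b \<Longrightarrow> b \<le> c \<Longrightarrow> mh a c" and mv_le: "mv a b \<Longrightarrow> b \<le> c \<Longrightarrow> mv a c"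
  by (auto simp: mh_def mv_def)

lemma mh_imp_le: "mh a b \<Longrightarrow> a \<le> b" and mv_imp_le: "mv a b \<Longrightarrow> a \<le> b"
  by (auto simp: mh_def mv_def)

text \<open>Rows and columns without gaps: there the transitive relations \<open>mh\<close> and
  \<open>mv\<close> between neighbours extend to boxes at any distance.\<close>

definition convex_region :: "(nat \<times> nat) set \<Rightarrow> bool"
  where "convex_region D \<longleftrightarrow>
    (\<forall>i j k l. (i, j) \<in> D \<longrightarrow> (i, l) \<in> D \<longrightarrow> j \<le> k \<longrightarrow> k \<le> l \<longrightarrow> (i, k) \<in> D) \<and>
    (\<forall>i k l j. (i, j) \<in> D \<longrightarrow> (l, j) \<in> D \<longrightarrow> i \<le> k \<longrightarrow> k \<le> l \<longrightarrow> (k, j) \<in> D)"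

lemma ideal_left:
  assumes "ideal SQ I" "(i, l) \<in> I" "i \<le> k" "k \<le> l"
  shows "(i, k) \<in> I"
  using assms(4,3,2)
proof (induction k rule: inc_induct)
  case (step k)
  then have "(i, Suc k) \<in> I" by simp
  moreover have "(i, k) \<in> SQ" using step by (simp add: SQ_def)
  ultimately show ?case using assms(1) unfolding ideal_def by blast
qed simp

lemma ideal_up:
  assumes "ideal SQ I" "(l, j) \<in> I" "k \<le> l"
  shows "(k, j) \<in> I"
  using assms(3)
proof (induction k rule: inc_induct)
  case (step k)
  have "(Suc k, j) \<in> SQ" using step(3) assms(1) unfolding ideal_def by blast
  then have "(k, j) \<in> SQ" by (simp add: SQ_def)
  then show ?case using assms(1) step(3) unfolding ideal_def by blast
qed (use assms in simp)

lemma convex_diff: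
  assumes "ideal SQ L" "ideal SQ M"
  shows "convex_region (L - M)"
  unfolding convex_region_def
proof (intro conjI allI impI)
  fix i j k l assume b: "(i, j) \<in> L - M" "(i, l) \<in> L - M" "j \<le> k" "k \<le> l"
  have "(i, j) \<in> SQ" using b(1) assms(1) unfolding ideal_def by blast
  then have "i \<le> j" by (simp add: SQ_def)
  then have "(i, k) \<in> L" using ideal_left[OF assms(1), of i l k] b by simp
  moreover have "(i, k) \<notin> M" using ideal_left[OF assms(2), of i k j] b \<open>i \<le> j\<close> by auto
  ultimately show "(i, k) \<in> L - M" by simp
next
  fix i k l j assume b: "(i, j) \<in> L - M" "(l, j) \<in> L - M" "i \<le> k" "k \<le> l"
  then show "(k, j) \<in> L - M"
    using ideal_up[OF assms(1), of l j k] ideal_up[OF assms(2), of k j i] by auto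
qed

lemma convex_ideal: "ideal SQ L \<Longrightarrow> convex_region L"
proof -
  assume "ideal SQ L"
  moreover have "ideal SQ {}" by (simp add: ideal_def)
  ultimately show ?thesis using convex_diff[of L "{}"] by (simp only: Diff_empty)
qed

lemma tabs_row:
  assumes "convex_region D" "V \<in> tabs mh mv D A" "(i, j) \<in> D" "(i, l) \<in> D" "j < l"
  shows "mh (V (i, j)) (V (i, l))"
proof -
  have D: "(i, k) \<in> D" if "j \<le> k" "k \<le> l" for k
    using assms that unfolding convex_region_def by blast
  have "Suc j \<le> l" using assms(5) by simp
  then show ?thesis using D
  proof (induction l rule: dec_induct)
    case base
    then show ?case using tabs_h[OF assms(2)] by simp
  next
    case (step n)
    have "mh (V (i, n)) (V (i, Suc n))" using tabs_h[OF assms(2)] step.prems step.hyps by simp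
    then show ?case using step by (auto intro: mh_trans)
  qed
qed

lemma tabs_col:
  assumes "convex_region D" "V \<in> tabs mh mv D A" "(i, j) \<in> D" "(l, j) \<in> D" "i < l"
  shows "mv (V (i, j)) (V (l, j))"
proof -
  have D: "(k, j) \<in> D" if "i \<le> k" "k \<le> l" for k
    using assms that unfolding convex_region_def by blast
  have "Suc i \<le> l" using assms(5) by simp
  then show ?thesis using D
  proof (induction l rule: dec_induct)
    case base
    then show ?case using tabs_v[OF assms(2)] by simp
  next
    case (step n)
    have "mv (V (n, j)) (V (Suc n, j))" using tabs_v[OF assms(2)] step.prems step.hyps by simp
    then show ?case using step by (auto intro: mv_trans)
  qed
qed

text \<open>\<open>mh\<close> is the weak order with equality only for unprimed letters,
  \<open>mv\<close> with equality only for primed ones; each merges monotonicity with the ban on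
  repetitions.\<close>

lemma semistandard_iff:
  assumes "convex_region D"
  shows "V \<in> extensional D \<and>
    (\<forall>a i i' j. (i, j) \<in> D \<longrightarrow> (i', j) \<in> D \<longrightarrow> i \<noteq> i' \<longrightarrow>
       \<not> (V (i, j) = Unprimed a \<and> V (i', j) = Unprimed a)) \<and>
    (\<forall>a i j j'. (i, j) \<in> D \<longrightarrow> (i, j') \<in> D \<longrightarrow> j \<noteq> j' \<longrightarrow>
       \<not> (V (i, j) = Primed a \<and> V (i, j') = Primed a)) \<and> semistandard D V
    \<longleftrightarrow> V \<in> tabs mh mv D UNIV" (is "?l \<longleftrightarrow> ?r")
proof
  assume l: ?l
  show ?r
  proof (rule tabsI)
    fix i j assume b: "(i, j) \<in> D" "(i, Suc j) \<in> D"
    then have "V (i, j) \<le> V (i, Suc j)" using l by (auto simp: semistandard_def)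
    moreover have "unp (V (i, j))" if "V (i, j) = V (i, Suc j)"
    proof (cases "V (i, j)")
      case (Primed a)
      moreover have "\<not> (V (i, j) = Primed a \<and> V (i, Suc j) = Primed a)"
        using l b n_not_Suc_n[of j] by blast
      ultimately show ?thesis using that by simp
    qed simp
    ultimately show "mh (V (i, j)) (V (i, Suc j))" by (auto simp: mh_def)
  next
    fix i j assume b: "(i, j) \<in> D" "(Suc i, j) \<in> D"
    then have "V (i, j) \<le> V (Suc i, j)" using l by (auto simp: semistandard_def)
    moreover have "\<not> unp (V (i, j))" if "V (i, j) = V (Suc i, j)"
    proof (cases "V (i, j)")
      case (Unprimed a)
      moreover have "\<not> (V (i, j) = Unprimed a \<and> V (Suc i, j) = Unprimed a)"
        using l b n_not_Suc_n[of i] by blast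
      ultimately show ?thesis using that by simp
    qed simp
    ultimately show "mv (V (i, j)) (V (Suc i, j))" by (auto simp: mv_def)
  qed (use l in \<open>auto simp: extensional_def\<close>)
next
  assume r: ?r
  have row: "V (i, j) \<le> V (i, l)" if "(i, j) \<in> D" "(i, l) \<in> D" "j \<le> l" for i j l
    using tabs_row[OF assms r that(1,2)] that(3) mh_imp_le by (cases "j = l") auto
  have col: "V (i, j) \<le> V (l, j)" if "(i, j) \<in> D" "(l, j) \<in> D" "i \<le> l" for i j l
    using tabs_col[OF assms r that(1,2)] that(3) mv_imp_le by (cases "i = l") auto
  have 1: "\<not> (V (i, j) = Unprimed a \<and> V (i', j) = Unprimed a)"
    if "(i, j) \<in> D" "(i', j) \<in> D" "i \<noteq> i'" for a i i' j
    using tabs_col[OF assms r that(1,2)] tabs_col[OF assms r that(2,1)] that(3)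
    by (cases i i' rule: linorder_cases) (auto simp: mv_def)
  have 2: "\<not> (V (i, j) = Primed a \<and> V (i, j') = Primed a)"
    if "(i, j) \<in> D" "(i, j') \<in> D" "j \<noteq> j'" for a i j j'
    using tabs_row[OF assms r that(1,2)] tabs_row[OF assms r that(2,1)] that(3)
    by (cases j j' rule: linorder_cases) (auto simp: mh_def)
  have "V \<in> extensional D" using tabs_undef[OF r] by (auto simp: extensional_def)
  then show ?l using row col 1 2 unfolding semistandard_def by blast
qed

subsection \<open>Generating functions of weighted objects\<close>

lemma prod_X_eq_mon: "(\<Prod>x\<in>A. X (f x)) = mon (\<Sum>x\<in>A. {#f x#})"
  by (simp add: X_eq_mon prod_mon)

lemma formal_has_sum_weighted:
  assumes "\<And>M. finite {i \<in> I. wt i = M}"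
  shows "formal_has_sum (\<lambda>i. const (c i) * mon (wt i)) I (formal_sum (\<lambda>i. const (c i) * mon (wt i)) I)"
proof (rule mps_nth_formal_sum)
  fix M
  show "finite {i \<in> I. mps_nth (const (c i) * mon (wt i)) M \<noteq> 0}"
    by (rule finite_subset[OF _ assms[of M]]) (auto simp: mps_nth_mon split: if_splits)
qed

lemma mps_nth_weighted:
  assumes "\<And>M. finite {i \<in> I. wt i = M}"
  shows "mps_nth (formal_sum (\<lambda>i. const (c i) * mon (wt i)) I) M = (\<Sum>i | i \<in> I \<and> wt i = M. c i)"
proof -
  have "mps_nth (formal_sum (\<lambda>i. const (c i) * mon (wt i)) I) M =
      (\<Sum>i | i \<in> I \<and> wt i = M. mps_nth (const (c i) * mon (wt i)) M)"
    by (rule formal_has_sum_nth[OF formal_has_sum_weighted])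
      (use assms in \<open>auto simp: mps_nth_mon\<close>)
  also have "\<dots> = (\<Sum>i | i \<in> I \<and> wt i = M. c i)"
    by (intro sum.cong) (auto simp: mps_nth_mon)
  finally show ?thesis .
qed

text \<open>Lets an infinite tableau sum be evaluated at \<open>M\<close> over any finite set that
  contains all tableaux of weight \<open>M\<close>, in practice those whose indices stay below a
  bound.\<close>

lemma mps_nth_weighted_subset:
  assumes "\<And>M. finite {i \<in> I. wt i = M}" "finite J" "J \<subseteq> I" "{i \<in> I. wt i = M} \<subseteq> J"
  shows "mps_nth (formal_sum (\<lambda>i. const (c i) * mon (wt i)) I) M =
    mps_nth (\<Sum>i\<in>J. const (c i) * mon (wt i)) M"
proof -
  have "mps_nth (formal_sum (\<lambda>i. const (c i) * mon (wt i)) I) M = (\<Sum>i | i \<in> I \<and> wt i = M. c i)"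
    by (rule mps_nth_weighted) (rule assms(1))
  also have "\<dots> = (\<Sum>i | i \<in> I \<and> wt i = M. mps_nth (const (c i) * mon (wt i)) M)"
    by (intro sum.cong) (auto simp: mps_nth_mon)
  also have "\<dots> = (\<Sum>i\<in>J. mps_nth (const (c i) * mon (wt i)) M)"
    using assms by (intro sum.mono_neutral_left) (auto simp: mps_nth_mon)
  finally show ?thesis by simp
qed

subsection \<open>Set-valued tableaux\<close>

text \<open>The letters that can join a box whose minimum is \<open>V b\<close>. Only the minima of
  the right and lower neighbours matter, so the boxes choose their additional entries independently
  of each other.\<close>

definition Ext :: "(nat \<times> nat) set \<Rightarrow> (nat \<times> nat \<Rightarrow> letter) \<Rightarrow> letter set \<Rightarrow> nat \<times> nat \<Rightarrow> letter set"
  where "Ext D V A b = {a \<in> A. V b < a \<and>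
    ((fst b, Suc (snd b)) \<in> D \<longrightarrow> mh a (V (fst b, Suc (snd b)))) \<and>
    ((Suc (fst b), snd b) \<in> D \<longrightarrow> mv a (V (Suc (fst b), snd b)))}"

text \<open>The comparison of maxima with minima and the ban on repetitions together say that all
  entries of neighbouring boxes are related by \<open>mh\<close> or \<open>mv\<close>. Boxes further
  apart are linked by transitivity through an arbitrary entry of each box in between.\<close>

lemma SSVT_iff:
  assumes D: "D = SD lam" and conv: "convex_region D"
  shows "T \<in> SSVT lam \<longleftrightarrow> T \<in> extensional D \<and> (\<forall>b\<in>D. finite (T b) \<and> T b \<noteq> {}) \<and>
    (\<forall>i j a c. (i, j) \<in> D \<longrightarrow> (i, Suc j) \<in> D \<longrightarrow> a \<in> T (i, j) \<longrightarrow> c \<in> T (i, Suc j) \<longrightarrow> mh a c) \<and>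
    (\<forall>i j a c. (i, j) \<in> D \<longrightarrow> (Suc i, j) \<in> D \<longrightarrow> a \<in> T (i, j) \<longrightarrow> c \<in> T (Suc i, j) \<longrightarrow> mv a c)"
    (is "?l \<longleftrightarrow> ?r")
proof
  assume l: ?l
  then have fin: "finite (T b)" "T b \<noteq> {}" if "b \<in> D" for b
    using that D by (auto simp: SSVT_def)
  have "mh a c" if b: "(i, j) \<in> D" "(i, Suc j) \<in> D" "a \<in> T (i, j)" "c \<in> T (i, Suc j)" for i j a c
  proof -
    have "Max (T (i, j)) \<le> Min (T (i, Suc j))" using l b(1,2) by (auto simp: SSVT_def D)
    moreover have "a \<le> Max (T (i, j))" "Min (T (i, Suc j)) \<le> c" using fin b by auto
    ultimately have "a \<le> c" by simp
    moreover have "\<not> (Primed n \<in> T (i, j) \<and> Primed n \<in> T (i, Suc j))" for n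
      using l b(1,2) n_not_Suc_n[of j] unfolding SSVT_def D by blast
    then have "unp a" if "a = c" using b that by (cases a) auto
    ultimately show ?thesis by (auto simp: mh_def)
  qed
  moreover have "mv a c" if b: "(i, j) \<in> D" "(Suc i, j) \<in> D" "a \<in> T (i, j)" "c \<in> T (Suc i, j)" for i j a c
  proof -
    have "Max (T (i, j)) \<le> Min (T (Suc i, j))" using l b(1,2) by (auto simp: SSVT_def D)
    moreover have "a \<le> Max (T (i, j))" "Min (T (Suc i, j)) \<le> c" using fin b by auto
    ultimately have "a \<le> c" by simp
    moreover have "\<not> (Unprimed n \<in> T (i, j) \<and> Unprimed n \<in> T (Suc i, j))" for n
      using l b(1,2) n_not_Suc_n[of i] unfolding SSVT_def D by blast
    then have "\<not> unp a" if "a = c" using b that by (cases a) auto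
    ultimately show ?thesis by (auto simp: mv_def)
  qed
  moreover have "T \<in> extensional D" using l by (auto simp: SSVT_def D)
  ultimately show ?r using fin by blast
next
  assume r: ?r
  then have fin: "finite (T b)" "T b \<noteq> {}" if "b \<in> D" for b using that by auto
  have h: "mh a c" if "(i, j) \<in> D" "(i, Suc j) \<in> D" "a \<in> T (i, j)" "c \<in> T (i, Suc j)" for i j a c
    using r that by blast
  have v: "mv a c" if "(i, j) \<in> D" "(Suc i, j) \<in> D" "a \<in> T (i, j)" "c \<in> T (Suc i, j)" for i j a c
    using r that by blast
  have row: "mh a c" if b: "(i, j) \<in> D" "(i, l) \<in> D" "j < l" "a \<in> T (i, j)" "c \<in> T (i, l)" for i j l a c
  proof -
    have DD: "(i, k) \<in> D" if "j \<le> k" "k \<le> l" for k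
      using conv b that unfolding convex_region_def by blast
    have "Suc j \<le> l" using b(3) by simp
    then show ?thesis using DD b(5)
    proof (induction l arbitrary: c rule: dec_induct)
      case base
      then show ?case using h[OF b(1) _ b(4), of c] by simp
    next
      case (step n)
      have n: "(i, n) \<in> D" "(i, Suc n) \<in> D" using step by auto
      obtain c' where c': "c' \<in> T (i, n)" using fin(2)[OF n(1)] by blast
      have "mh c' c" using h[OF n c'] step.prems by simp
      moreover have "mh a c'" using step.IH[of c'] step.prems c' by simp
      ultimately show ?case by (rule mh_trans[rotated])
    qed
  qed
  have col: "mv a c" if b: "(i, j) \<in> D" "(l, j) \<in> D" "i < l" "a \<in> T (i, j)" "c \<in> T (l, j)" for i j l a c
  proof -
    have DD: "(k, j) \<in> D" if "i \<le> k" "k \<le> l" for k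
      using conv b that unfolding convex_region_def by blast
    have "Suc i \<le> l" using b(3) by simp
    then show ?thesis using DD b(5)
    proof (induction l arbitrary: c rule: dec_induct)
      case base
      then show ?case using v[OF b(1) _ b(4), of c] by simp
    next
      case (step n)
      have n: "(n, j) \<in> D" "(Suc n, j) \<in> D" using step by auto
      obtain c' where c': "c' \<in> T (n, j)" using fin(2)[OF n(1)] by blast
      have "mv c' c" using v[OF n c'] step.prems by simp
      moreover have "mv a c'" using step.IH[of c'] step.prems c' by simp
      ultimately show ?case by (rule mv_trans[rotated])
    qed
  qed
  have e1: "Max (T (i, j)) \<le> Min (T (Suc i, j))" if "(i, j) \<in> D" "(Suc i, j) \<in> D" for i j
    using mv_imp_le[OF v[OF that]] fin[OF that(1)] fin[OF that(2)] by simp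
  have e2: "Max (T (i, j)) \<le> Min (T (i, Suc j))" if "(i, j) \<in> D" "(i, Suc j) \<in> D" for i j
    using mh_imp_le[OF h[OF that]] fin[OF that(1)] fin[OF that(2)] by simp
  have e3: "\<not> (Unprimed a \<in> T (i, j) \<and> Unprimed a \<in> T (i', j))"
    if "(i, j) \<in> D" "(i', j) \<in> D" "i \<noteq> i'" for a i i' j
    using col[OF that(1,2), of "Unprimed a" "Unprimed a"] col[OF that(2,1), of "Unprimed a" "Unprimed a"]
      that(3) by (cases i i' rule: linorder_cases) (auto simp: mv_def)
  have e4: "\<not> (Primed a \<in> T (i, j) \<and> Primed a \<in> T (i, j'))"
    if "(i, j) \<in> D" "(i, j') \<in> D" "j \<noteq> j'" for a i j j'
    using row[OF that(1,2), of "Primed a" "Primed a"] row[OF that(2,1), of "Primed a" "Primed a"]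
      that(3) by (cases j j' rule: linorder_cases) (auto simp: mh_def)
  show ?l unfolding SSVT_def D[symmetric] mem_Collect_eq
  proof (intro conjI, goal_cases)
    case 1 then show ?case using r by (elim conjE)
  next
    case 2 then show ?case using r by (elim conjE)
  next
    case 3 then show ?case using e1 by simp
  next
    case 4 then show ?case using e2 by simp
  next
    case 5 then show ?case using e3 by simp
  next
    case 6 then show ?case using e4 by simp
  qed
qed

definition SSVTn :: "nat \<Rightarrow> nat list \<Rightarrow> (nat \<times> nat \<Rightarrow> letter set) set"
  where "SSVTn n lam = {T \<in> SSVT lam. \<forall>b\<in>SD lam. T b \<subseteq> {a. index a < n}}"

definition join :: "(nat \<times> nat) set \<Rightarrow> (nat \<times> nat \<Rightarrow> letter) \<Rightarrow> (nat \<times> nat \<Rightarrow> letter set) \<Rightarrow> nat \<times> nat \<Rightarrow> letter set"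
  where "join D V E = restrict (\<lambda>b. insert (V b) (E b)) D"

text \<open>A set-valued tableau is split into the minima of its boxes and the remaining entries.\<close>

lemma bij_SSVTn:
  fixes n :: nat
  assumes lam: "lam \<in> strict_partitions"
  defines "D \<equiv> SD lam" and "A \<equiv> {a. index a < n}"
  shows "bij_betw (\<lambda>(V, E). join D V E)
    (SIGMA V:tabs mh mv D A. PiE D (\<lambda>b. Pow (Ext D V A b))) (SSVTn n lam)"
proof (rule bij_betw_byWitness[where f' = "\<lambda>T. (restrict (\<lambda>b. Min (T b)) D, restrict (\<lambda>b. T b - {Min (T b)}) D)"])
  have conv: "convex_region D" unfolding D_def by (rule convex_ideal[OF ideal_SD[OF lam]])
  note iff = SSVT_iff[OF D_def[THEN meta_eq_to_obj_eq] conv]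
  have finA: "finite A" by (simp add: A_def)
  have fE: "finite (E b)" if "E \<in> PiE D (\<lambda>b. Pow (Ext D V A b))" "b \<in> D" for E V b
  proof -
    have "E b \<subseteq> A" using that by (auto simp: Ext_def dest: PiE_mem)
    then show ?thesis using finA finite_subset by blast
  qed
  have Min: "Min (insert (V b) (E b)) = V b" and Vnot: "V b \<notin> E b"
    if "E \<in> PiE D (\<lambda>b. Pow (Ext D V A b))" "b \<in> D" for V E b
  proof -
    have lt: "V b < a" if "a \<in> E b" for a
      using that \<open>E \<in> _\<close> \<open>b \<in> D\<close> by (auto simp: Ext_def dest!: PiE_mem)
    then show "Min (insert (V b) (E b)) = V b"
      using fE[OF that] by (intro Min_eqI) (auto intro: less_imp_le)
    show "V b \<notin> E b" using lt by blast
  qed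
  show "\<forall>t\<in>(SIGMA V:tabs mh mv D A. PiE D (\<lambda>b. Pow (Ext D V A b))).
      (\<lambda>T. (restrict (\<lambda>b. Min (T b)) D, restrict (\<lambda>b. T b - {Min (T b)}) D)) ((\<lambda>(V, E). join D V E) t) = t"
  proof
    fix t assume t: "t \<in> (SIGMA V:tabs mh mv D A. PiE D (\<lambda>b. Pow (Ext D V A b)))"
    obtain V E where tt: "t = (V, E)" by (cases t)
    have V: "V \<in> tabs mh mv D A" and E: "E \<in> PiE D (\<lambda>b. Pow (Ext D V A b))" using t tt by auto
    have "restrict (\<lambda>b. Min (join D V E b)) D = V"
      using tabs_undef[OF V] Min[OF E] by (auto simp: join_def fun_eq_iff restrict_def)
    moreover have "restrict (\<lambda>b. join D V E b - {Min (join D V E b)}) D = E"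
      using PiE_arb[OF E] Min[OF E] Vnot[OF E] by (auto simp: join_def fun_eq_iff restrict_def)
    ultimately show "(\<lambda>T. (restrict (\<lambda>b. Min (T b)) D, restrict (\<lambda>b. T b - {Min (T b)}) D)) ((\<lambda>(V, E). join D V E) t) = t"
      by (simp add: tt)
  qed
  show "(\<lambda>(V, E). join D V E) ` (SIGMA V:tabs mh mv D A. PiE D (\<lambda>b. Pow (Ext D V A b))) \<subseteq> SSVTn n lam"
  proof (clarify)
    fix V E assume V: "V \<in> tabs mh mv D A" and E: "E \<in> PiE D (\<lambda>b. Pow (Ext D V A b))"
    have EE: "a \<in> Ext D V A b" if "b \<in> D" "a \<in> E b" for a b using PiE_mem[OF E that(1)] that(2) by auto
    have ge: "V b \<le> c" if "b \<in> D" "c \<in> insert (V b) (E b)" for b c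
      using EE[OF that(1)] that(2) by (auto simp: Ext_def intro: less_imp_le)
    have "mh a c" if "(i, j) \<in> D" "(i, Suc j) \<in> D" "a \<in> join D V E (i, j)" "c \<in> join D V E (i, Suc j)" for i j a c
    proof -
      have "mh a (V (i, Suc j))"
        using that tabs_h[OF V, of i j] EE[of "(i, j)" a] by (auto simp: join_def Ext_def)
      moreover have "V (i, Suc j) \<le> c" using ge[of "(i, Suc j)" c] that by (simp add: join_def)
      ultimately show ?thesis by (rule mh_le)
    qed
    moreover have "mv a c" if "(i, j) \<in> D" "(Suc i, j) \<in> D" "a \<in> join D V E (i, j)" "c \<in> join D V E (Suc i, j)" for i j a c
    proof -
      have "mv a (V (Suc i, j))"
        using that tabs_v[OF V, of i j] EE[of "(i, j)" a] by (auto simp: join_def Ext_def)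
      moreover have "V (Suc i, j) \<le> c" using ge[of "(Suc i, j)" c] that by (simp add: join_def)
      ultimately show ?thesis by (rule mv_le)
    qed
    moreover have "join D V E \<in> extensional D" by (simp add: join_def)
    moreover have "finite (join D V E b) \<and> join D V E b \<noteq> {}" if "b \<in> D" for b
      using that fE[OF E] by (simp add: join_def)
    ultimately have "join D V E \<in> SSVT lam" unfolding iff by blast
    moreover have "join D V E b \<subseteq> A" if b: "b \<in> D" for b
    proof
      fix a assume "a \<in> join D V E b"
      then have "a = V b \<or> a \<in> E b" using b by (simp add: join_def)
      then show "a \<in> A" using EE[OF b, of a] tabs_mem[OF V b] by (auto simp: Ext_def)
    qed
    ultimately show "join D V E \<in> SSVTn n lam" by (simp add: SSVTn_def D_def A_def)
  qed
  have T: "T \<in> extensional D" "\<And>b. b \<in> D \<Longrightarrow> finite (T b) \<and> T b \<noteq> {} \<and> T b \<subseteq> A"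
    "\<And>i j a c. (i, j) \<in> D \<Longrightarrow> (i, Suc j) \<in> D \<Longrightarrow> a \<in> T (i, j) \<Longrightarrow> c \<in> T (i, Suc j) \<Longrightarrow> mh a c"
    "\<And>i j a c. (i, j) \<in> D \<Longrightarrow> (Suc i, j) \<in> D \<Longrightarrow> a \<in> T (i, j) \<Longrightarrow> c \<in> T (Suc i, j) \<Longrightarrow> mv a c"
    if "T \<in> SSVTn n lam" for T
    using that iff[of T] unfolding SSVTn_def D_def[symmetric] A_def[symmetric] by blast+
  show "\<forall>T\<in>SSVTn n lam. (\<lambda>(V, E). join D V E)
      ((\<lambda>T. (restrict (\<lambda>b. Min (T b)) D, restrict (\<lambda>b. T b - {Min (T b)}) D)) T) = T"
  proof
    fix T assume TT: "T \<in> SSVTn n lam"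
    have "join D (restrict (\<lambda>b. Min (T b)) D) (restrict (\<lambda>b. T b - {Min (T b)}) D) b = T b" for b
      using T(2)[OF TT, of b] extensional_arb[OF T(1)[OF TT], of b]
      by (cases "b \<in> D") (simp_all add: join_def insert_absorb)
    then show "(\<lambda>(V, E). join D V E)
      ((\<lambda>T. (restrict (\<lambda>b. Min (T b)) D, restrict (\<lambda>b. T b - {Min (T b)}) D)) T) = T"
      by (simp add: fun_eq_iff)
  qed
  show "(\<lambda>T. (restrict (\<lambda>b. Min (T b)) D, restrict (\<lambda>b. T b - {Min (T b)}) D)) ` SSVTn n lam
      \<subseteq> (SIGMA V:tabs mh mv D A. PiE D (\<lambda>b. Pow (Ext D V A b)))"
  proof (rule image_subsetI)
    fix T assume TT: "T \<in> SSVTn n lam"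
    note T = T[OF TT]
    have M: "Min (T b) \<in> T b" if "b \<in> D" for b using T(2)[OF that] by simp
    have "restrict (\<lambda>b. Min (T b)) D \<in> tabs mh mv D A"
    proof (rule tabsI, goal_cases)
      case (1 b)
      then have "Min (T b) \<in> A" using M[of b] T(2)[of b] by blast
      then show ?case using 1 by simp
    next
      case (2 b)
      then show ?case by simp
    next
      case (3 i j)
      then show ?case using T(3)[OF _ _ M M] by simp
    next
      case (4 i j)
      then show ?case using T(4)[OF _ _ M M] by simp
    qed
    moreover have "restrict (\<lambda>b. T b - {Min (T b)}) D \<in>
        PiE D (\<lambda>b. Pow (Ext D (restrict (\<lambda>b. Min (T b)) D) A b))"
    proof (rule PiE_I)
      fix b assume b: "b \<in> D"
      have "Min (T b) < a" if "a \<in> T b" "a \<noteq> Min (T b)" for a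
        using T(2)[OF b] that by (metis Min_le order_le_less)
      then have "T b - {Min (T b)} \<subseteq> Ext D (restrict (\<lambda>b. Min (T b)) D) A b"
        using T(2)[OF b] T(3)[of "fst b" "snd b"] T(4)[of "fst b" "snd b"] M b by (auto simp: Ext_def)
      then show "restrict (\<lambda>b. T b - {Min (T b)}) D b \<in>
          Pow (Ext D (restrict (\<lambda>b. Min (T b)) D) A b)" using b by simp
    qed simp
    ultimately show "(\<lambda>T. (restrict (\<lambda>b. Min (T b)) D, restrict (\<lambda>b. T b - {Min (T b)}) D)) T
       \<in> (SIGMA V:tabs mh mv D A. PiE D (\<lambda>b. Pow (Ext D V A b)))" by simp
  qed
qed

lemma finite_SSVTn: "lam \<in> strict_partitions \<Longrightarrow> finite (SSVTn n lam)"
proof -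
  assume lam: "lam \<in> strict_partitions"
  let ?D = "SD lam" and ?A = "{a. index a < n}"
  have "finite (Ext ?D V ?A b)" for V b
    by (rule finite_subset[of _ ?A]) (auto simp: Ext_def)
  then have "finite (SIGMA V:tabs mh mv ?D ?A. PiE ?D (\<lambda>b. Pow (Ext ?D V ?A b)))"
    by (intro finite_SigmaI finite_tabs finite_PiE) auto
  then show ?thesis using bij_betw_finite[OF bij_SSVTn[OF lam, of n]] by blast
qed

text \<open>\<open>GQ\<close> in \<open>n\<close> variables with the additional entries summed out:
  by the independence of the boxes, each letter that may be added contributes a factor 1 +
  \<beta>x.\<close>

definition GT :: "'a \<Rightarrow> (nat \<Rightarrow> 'a :: comm_ring_1) \<Rightarrow> nat \<Rightarrow> (nat \<times> nat) set \<Rightarrow> 'a"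
  where "GT bt x n D = (\<Sum>V\<in>tabs mh mv D {a. index a < n}.
    \<Prod>b\<in>D. x (index (V b)) * (\<Prod>a\<in>Ext D V {a. index a < n} b. 1 + bt * x (index a)))"

definition wtS :: "nat list \<Rightarrow> (nat \<times> nat \<Rightarrow> letter set) \<Rightarrow> nat multiset"
  where "wtS lam T = (\<Sum>b\<in>SD lam. \<Sum>a\<in>T b. {#index a#})"

lemma GQ_eq:
  "GQ lam = formal_sum (\<lambda>T. const (\<beta> ^ (size (wtS lam T) - sum_list lam)) * mon (wtS lam T)) (SSVT lam)"
  by (simp add: GQ_def prod_X_eq_mon prod_mon wtS_def size_multiset_sum)

lemma wtS_mem: "T \<in> SSVT lam \<Longrightarrow> b \<in> SD lam \<Longrightarrow> a \<in> T b \<Longrightarrow> index a \<in># wtS lam T"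
proof -
  assume T: "T \<in> SSVT lam" "b \<in> SD lam" "a \<in> T b"
  then have "finite (T b)" by (simp add: SSVT_def)
  then have "index a \<in># (\<Sum>a\<in>T b. {#index a#})" using T(3) by (auto simp: set_mset_sum)
  then show ?thesis using T(2) by (auto simp: wtS_def set_mset_sum)
qed

lemma SSVTn_superset:
  assumes "set_mset M \<subseteq> {..<n}"
  shows "{T \<in> SSVT lam. wtS lam T = M} \<subseteq> SSVTn n lam"
proof
  fix T assume T: "T \<in> {T \<in> SSVT lam. wtS lam T = M}"
  have "index a < n" if "b \<in> SD lam" "a \<in> T b" for a b
    using wtS_mem[of T lam b a] T that assms by auto
  then show "T \<in> SSVTn n lam" using T by (auto simp: SSVTn_def)
qed

lemma finite_SSVT_wt:
  assumes "lam \<in> strict_partitions"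
  shows "finite {T \<in> SSVT lam. wtS lam T = M}"
proof -
  obtain n where "set_mset M \<subseteq> {..<n}" using finite_nat_iff_bounded finite_set_mset by blast
  then show ?thesis by (rule finite_subset[OF SSVTn_superset finite_SSVTn[OF assms]])
qed

lemma mps_nth_GQ:
  assumes "lam \<in> strict_partitions"
  shows "mps_nth (GQ lam) M = of_nat (card {T \<in> SSVT lam. wtS lam T = M}) * \<beta> ^ (size M - sum_list lam)"
  unfolding GQ_eq by (subst mps_nth_weighted[OF finite_SSVT_wt[OF assms]]) simp

text \<open>Expanding the product of the factors 1 + \<beta>x over \<open>Ext\<close> selects the
  set of additional entries of each box, and \<open>bij_SSVTn\<close> reassembles the
  tableau.\<close>

lemma mps_nth_GQ_eq_GT:
  assumes lam: "lam \<in> strict_partitions" and M: "set_mset M \<subseteq> {..<n}"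
  shows "mps_nth (GQ lam) M = mps_nth (GT (const \<beta>) X n (SD lam)) M"
proof -
  let ?D = "SD lam" and ?A = "{a. index a < n}"
  interpret c: rhom "const :: int poly \<Rightarrow> series" by (rule rhom_const)
  have finE: "finite (Ext ?D V ?A b)" for V b
    by (rule finite_subset[of _ ?A]) (auto simp: Ext_def)
  have "mps_nth (GQ lam) M = mps_nth (\<Sum>T\<in>SSVTn n lam.
      const (\<beta> ^ (size (wtS lam T) - sum_list lam)) * mon (wtS lam T)) M"
    unfolding GQ_eq
    by (rule mps_nth_weighted_subset)
      (use lam M finite_SSVT_wt finite_SSVTn SSVTn_superset in \<open>auto simp: SSVTn_def\<close>)
  also have "(\<Sum>T\<in>SSVTn n lam. const (\<beta> ^ (size (wtS lam T) - sum_list lam)) * mon (wtS lam T)) =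
    (\<Sum>(V, E)\<in>(SIGMA V:tabs mh mv ?D ?A. PiE ?D (\<lambda>b. Pow (Ext ?D V ?A b))).
      \<Prod>b\<in>?D. X (index (V b)) * (\<Prod>a\<in>E b. const \<beta> * X (index a)))"
  proof (rule sum.reindex_bij_betw[OF bij_SSVTn[OF lam], symmetric, THEN trans], rule sum.cong[OF refl])
    fix t assume t: "t \<in> (SIGMA V:tabs mh mv ?D ?A. PiE ?D (\<lambda>b. Pow (Ext ?D V ?A b)))"
    obtain V E where tt: "t = (V, E)" by (cases t)
    have V: "V \<in> tabs mh mv ?D ?A" and E: "E \<in> PiE ?D (\<lambda>b. Pow (Ext ?D V ?A b))"
      using t tt by auto
    have Eb: "finite (E b) \<and> V b \<notin> E b" if "b \<in> ?D" for b
    proof -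
      have sub: "E b \<subseteq> Ext ?D V ?A b" using PiE_mem[OF E that] by simp
      then have "finite (E b)" by (rule finite_subset[OF _ finE])
      moreover have "V b \<notin> E b" using sub by (auto simp: Ext_def)
      ultimately show ?thesis by simp
    qed
    have wt: "wtS lam (join ?D V E) = (\<Sum>b\<in>?D. {#index (V b)#} + (\<Sum>a\<in>E b. {#index a#}))"
      unfolding wtS_def by (intro sum.cong refl) (simp add: join_def Eb)
    have sz: "size (wtS lam (join ?D V E)) - sum_list lam = (\<Sum>b\<in>?D. card (E b))"
      unfolding wt by (simp add: size_multiset_sum sum_Suc card_SD[symmetric])
    have mon_wt: "mon (wtS lam (join ?D V E)) =
        (\<Prod>b\<in>?D. X (index (V b)) * (\<Prod>a\<in>E b. X (index a)))"
      unfolding wt by (simp add: X_eq_mon prod_mon mon_mult)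
    show "const (\<beta> ^ (size (wtS lam ((\<lambda>(V, E). join ?D V E) t)) - sum_list lam)) *
        mon (wtS lam ((\<lambda>(V, E). join ?D V E) t)) =
        (case t of (V, E) \<Rightarrow> \<Prod>b\<in>?D. X (index (V b)) * (\<Prod>a\<in>E b. const \<beta> * X (index a)))"
      unfolding tt prod.case sz mon_wt
      by (simp add: c.power c.prod power_sum prod.distrib ac_simps)
  qed
  also have "\<dots> = (\<Sum>V\<in>tabs mh mv ?D ?A. \<Sum>E\<in>PiE ?D (\<lambda>b. Pow (Ext ?D V ?A b)).
      \<Prod>b\<in>?D. X (index (V b)) * (\<Prod>a\<in>E b. const \<beta> * X (index a)))"
    using finE by (intro sum.Sigma[symmetric]) (auto intro!: finite_PiE)
  also have "\<dots> = GT (const \<beta>) X n ?D"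
    unfolding GT_def
  proof (intro sum.cong refl)
    fix V
    have "(\<Sum>E\<in>PiE ?D (\<lambda>b. Pow (Ext ?D V ?A b)).
        \<Prod>b\<in>?D. X (index (V b)) * (\<Prod>a\<in>E b. const \<beta> * X (index a))) =
        (\<Prod>b\<in>?D. \<Sum>S\<in>Pow (Ext ?D V ?A b). X (index (V b)) * (\<Prod>a\<in>S. const \<beta> * X (index a)) :: series)"
      using finE by (subst prod_sum_PiE) auto
    also have "\<dots> = (\<Prod>b\<in>?D. X (index (V b)) * (\<Prod>a\<in>Ext ?D V ?A b. const \<beta> * X (index a) + 1))"
      using finE by (simp add: prod_add sum_distrib_left)
    finally show "(\<Sum>E\<in>PiE ?D (\<lambda>b. Pow (Ext ?D V ?A b)).
        \<Prod>b\<in>?D. X (index (V b)) * (\<Prod>a\<in>E b. const \<beta> * X (index a))) =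
        (\<Prod>b\<in>?D. X (index (V b)) * (\<Prod>a\<in>Ext ?D V ?A b. 1 + const \<beta> * X (index a)) :: series)"
      by (simp add: add.commute)
  qed
  finally show ?thesis .
qed

subsection \<open>Bar tableaux\<close>

definition bars :: "(nat \<times> nat) set \<Rightarrow> (nat \<times> nat \<Rightarrow> letter) \<Rightarrow> (nat \<times> nat) set set set"
  where "bars D V = {Bs. partition_on D Bs \<and> (\<forall>B\<in>Bs. is_bar V B)}"

text \<open>
  A bar of unprimed letters is traversed from left to right and a bar of primed ones from bottom to
  top, so that the diagonal index increases; \<open>pre\<close> is the preceding box.
\<close>

definition pre :: "(nat \<times> nat \<Rightarrow> letter) \<Rightarrow> nat \<times> nat \<Rightarrow> nat \<times> nat"
  where "pre V b = (if unp (V b) then (fst b, snd b - 1) else (Suc (fst b), snd b))"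

text \<open>Whether b can be joined to the bar of its preceding box. The guard on the column
  excludes the truncated subtraction in \<open>pre\<close>.\<close>

definition link :: "(nat \<times> nat) set \<Rightarrow> (nat \<times> nat \<Rightarrow> letter) \<Rightarrow> nat \<times> nat \<Rightarrow> bool"
  where "link D V b \<longleftrightarrow> (unp (V b) \<longrightarrow> snd b > 0) \<and> pre V b \<in> D \<and> V (pre V b) = V b"

definition diag :: "nat \<times> nat \<Rightarrow> int"
  where "diag b = int (snd b) - int (fst b)"

lemma diag_pre: "link D V b \<Longrightarrow> diag (pre V b) = diag b - 1"
  by (auto simp: link_def pre_def diag_def)

definition nonrep :: "(nat \<times> nat) set \<Rightarrow> (nat \<times> nat \<Rightarrow> letter) \<Rightarrow> bool"
  where "nonrep D V \<longleftrightarrow>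
    (\<forall>i i' j. (i, j) \<in> D \<longrightarrow> (i', j) \<in> D \<longrightarrow> i \<noteq> i' \<longrightarrow> V (i, j) = V (i', j) \<longrightarrow> \<not> unp (V (i, j))) \<and>
    (\<forall>i j j'. (i, j) \<in> D \<longrightarrow> (i, j') \<in> D \<longrightarrow> j \<noteq> j' \<longrightarrow> V (i, j) = V (i, j') \<longrightarrow> unp (V (i, j)))"

lemma nonrep_subset: "nonrep D V \<Longrightarrow> D' \<subseteq> D \<Longrightarrow> nonrep D' V"
  unfolding nonrep_def by blast

text \<open>A box of maximal diagonal can only be the last box of its bar. If the bar has more
  boxes, its letter determines its direction and the preceding box belongs to it.\<close>

lemma bar_remove_last:
  assumes "nonrep D V" "is_bar V B" "B \<subseteq> D" "b \<in> B" "B \<noteq> {b}" "\<And>c. c \<in> D \<Longrightarrow> diag c \<le> diag b"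
  shows "link D V b \<and> pre V b \<in> B \<and> is_bar V (B - {b})"
proof -
  have eqV: "V c = V c'" if "c \<in> B" "c' \<in> B" for c c' using assms(2) that unfolding is_bar_def by blast
  from assms(2) obtain i j n where "B = {(i, j + k) | k. k < n} \<or> B = {(i + k, j) | k. k < n}"
    by (auto simp: is_bar_def)
  then show ?thesis
  proof
    assume B: "B = {(i, j + k) | k. k < n}"
    then obtain k where k: "b = (i, j + k)" "k < n" using assms(4) by auto
    have mB: "(i, j + l) \<in> B" if "l < n" for l using that B by blast
    have "(i, j + (n - 1)) \<in> D" using mB[of "n - 1"] k assms(3) by (auto simp del: add_diff_assoc)
    from assms(6)[OF this] k have kn: "k = n - 1" by (simp add: diag_def)
    have "n \<noteq> 1" using B k assms(5) by auto
    with k have n: "n \<ge> 2" by simp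
    have p: "(i, j + (k - 1)) \<in> B" using mB[of "k - 1"] k by (simp del: add_diff_assoc)
    have "unp (V b)"
    proof -
      have "(i, j + k) \<in> D" "(i, j + (k - 1)) \<in> D" using p assms(3,4) k by blast+
      moreover have "j + k \<noteq> j + (k - 1)" using n kn by simp
      moreover have "V (i, j + k) = V (i, j + (k - 1))" using eqV p assms(4) k by blast
      ultimately show ?thesis using assms(1) k(1) unfolding nonrep_def by blast
    qed
    then have pre: "pre V b = (i, j + (k - 1))" using k(1) kn n by (simp add: pre_def)
    have "B - {b} = {(i, j + k) | k. k < n - 1}" using B k kn by auto
    then have "is_bar V (B - {b})" using eqV unfolding is_bar_def by blast
    moreover have "link D V b"
      unfolding link_def pre using eqV[OF p assms(4)] subsetD[OF assms(3) p] k(1) kn n by simp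
    ultimately show ?thesis using p pre by simp
  next
    assume B: "B = {(i + k, j) | k. k < n}"
    then obtain k where k: "b = (i + k, j)" "k < n" using assms(4) by auto
    have mB: "(i + l, j) \<in> B" if "l < n" for l using that B by blast
    have "(i + 0, j) \<in> D" using mB[of 0] k assms(3) by auto
    from assms(6)[OF this] k have k0: "k = 0" by (simp add: diag_def)
    have "n \<noteq> 1" using B k assms(5) by auto
    with k have n: "n \<ge> 2" by simp
    have p: "(Suc i, j) \<in> B" using mB[of 1] n by simp
    have "\<not> unp (V b)"
    proof -
      have "(i, j) \<in> D" "(Suc i, j) \<in> D" "i \<noteq> Suc i" using p assms(3,4) k k0 by auto
      moreover have "V (i, j) = V (Suc i, j)" using eqV[OF assms(4) p] k(1) k0 by simp
      ultimately have "\<not> unp (V (i, j))" using assms(1) unfolding nonrep_def by blast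
      then show ?thesis using k(1) k0 by simp
    qed
    then have pre: "pre V b = (Suc i, j)" using k k0 by (simp add: pre_def)
    have "B - {b} = {(Suc i + k, j) | k. k < n - 1}"
    proof (intro equalityI subsetI)
      fix c assume c: "c \<in> B - {b}"
      then obtain l where l: "c = (i + l, j)" "l < n" using B by blast
      moreover have "l \<noteq> 0" using c k(1) k0 l(1) by auto
      ultimately show "c \<in> {(Suc i + k, j) | k. k < n - 1}" by (intro CollectI exI[of _ "l - 1"]) auto
    next
      fix c assume "c \<in> {(Suc i + k, j) | k. k < n - 1}"
      then obtain l where "c = (Suc i + l, j)" "l < n - 1" by blast
      then show "c \<in> B - {b}" using mB[of "Suc l"] k(1) k0 by auto
    qed
    then have "is_bar V (B - {b})" using eqV unfolding is_bar_def by blast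
    moreover have "link D V b"
      unfolding link_def pre using eqV[OF p assms(4)] subsetD[OF assms(3) p] \<open>\<not> unp (V b)\<close> by simp
    ultimately show ?thesis using p pre by simp
  qed
qed

text \<open>A bar with at least two boxes already has the direction prescribed by its letter, so the
  new box continues it straight; a single box accepts either direction.\<close>

lemma bar_extend:
  assumes "nonrep D V" "is_bar V B" "B \<subseteq> D" "b \<in> D" "b \<notin> B" "link D V b" "pre V b \<in> B"
  shows "is_bar V (insert b B)"
proof -
  have eqV: "V c = V c'" if "c \<in> B" "c' \<in> B" for c c' using assms(2) that unfolding is_bar_def by blast
  have eqb: "V c = V b" if "c \<in> B" for c using eqV[OF that assms(7)] assms(6) by (simp add: link_def)
  have const: "\<forall>c\<in>insert b B. \<forall>c'\<in>insert b B. V c = V c'" using eqb by auto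
  obtain r s where b: "b = (r, s)" by (cases b)
  from assms(2) obtain i j n where "B = {(i, j + k) | k. k < n} \<or> B = {(i + k, j) | k. k < n}"
    by (auto simp: is_bar_def)
  then have "\<exists>i j n. insert b B = {(i, j + k) | k. k < n} \<or> insert b B = {(i + k, j) | k. k < n}"
  proof
    assume B: "B = {(i, j + k) | k. k < n}"
    then obtain k where k: "pre V b = (i, j + k)" "k < n" using assms(7) by auto
    have mB: "(i, j + l) \<in> B" if "l < n" for l using that B by blast
    show ?thesis
    proof (cases "unp (V b)")
      case True
      then have bb: "b = (i, j + Suc k)" using k assms(6) b by (auto simp: pre_def link_def)
      then have "Suc k = n" using assms(5) B k(2) by (rule_tac ccontr) auto
      then have "insert b B = {(i, j + k) | k. k < Suc n}" using B bb by (auto simp: less_Suc_eq)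
      then show ?thesis by blast
    next
      case False
      have "n = 1"
      proof (rule ccontr)
        assume "n \<noteq> 1"
        then have "1 < n" using k(2) by simp
        then have "(i, j + 0) \<in> B" "(i, j + 1) \<in> B" using mB[of 0] mB[of 1] by auto
        then have "(i, j) \<in> D" "(i, Suc j) \<in> D" "V (i, j) = V (i, Suc j)"
          using assms(3) eqV[of "(i, j + 0)" "(i, j + 1)"] by auto
        then have "unp (V (i, j))" using assms(1) n_not_Suc_n[of j] unfolding nonrep_def by blast
        then show False using False eqb[of "(i, j + 0)"] \<open>(i, j + 0) \<in> B\<close> by simp
      qed
      then have "B = {(i, j)}" "k = 0" using B k by auto
      moreover have "i = Suc r" "j = s" using k \<open>k = 0\<close> False b by (auto simp: pre_def)
      moreover have "{(r + k, s) | k. k < 2} = {(r, s), (Suc r, s)}"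
        by (auto simp: less_2_cases_iff)
      ultimately have "insert b B = {(r + k, s) | k. k < 2}" using b by auto
      then show ?thesis by blast
    qed
  next
    assume B: "B = {(i + k, j) | k. k < n}"
    then obtain k where k: "pre V b = (i + k, j)" "k < n" using assms(7) by auto
    have mB: "(i + l, j) \<in> B" if "l < n" for l using that B by blast
    show ?thesis
    proof (cases "unp (V b)")
      case False
      then have r: "Suc r = i + k" "s = j" using k b by (auto simp: pre_def)
      have "k = 0"
      proof (rule ccontr)
        assume "k \<noteq> 0"
        then have "b = (i + (k - 1), j)" using r b by simp
        moreover have "(i + (k - 1), j) \<in> B" unfolding B using k by (intro CollectI exI[of _ "k - 1"]) auto
        ultimately show False using assms(5) by simp
      qed
      then have "insert b B = {(r + k, j) | k. k < Suc n}"
      proof (intro equalityI subsetI)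
        fix c assume c: "c \<in> insert b B"
        show "c \<in> {(r + k, j) | k. k < Suc n}"
        proof (cases "c = b")
          case True
          then show ?thesis using b r by (intro CollectI exI[of _ 0]) simp
        next
          case False
          then obtain l where "c = (i + l, j)" "l < n" using c B by auto
          then show ?thesis using r \<open>k = 0\<close> by (intro CollectI exI[of _ "Suc l"]) auto
        qed
      next
        fix c assume "c \<in> {(r + k, j) | k. k < Suc n}"
        then obtain l where l: "c = (r + l, j)" "l < Suc n" by blast
        then show "c \<in> insert b B"
        proof (cases l)
          case (Suc l')
          then have "c = (i + l', j)" "l' < n" using l r \<open>k = 0\<close> by auto
          then show ?thesis using B by blast
        qed (use b r in simp)
      qed
      then show ?thesis by blast
    next
      case True
      have "n = 1"
      proof (rule ccontr)
        assume "n \<noteq> 1"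
        then have "1 < n" using k(2) by simp
        then have "(i + 0, j) \<in> B" "(i + 1, j) \<in> B" using mB[of 0] mB[of 1] by auto
        then have "(i, j) \<in> D" "(Suc i, j) \<in> D" "V (i, j) = V (Suc i, j)"
          using assms(3) eqV[of "(i + 0, j)" "(i + 1, j)"] by auto
        then have "\<not> unp (V (i, j))" using assms(1) n_not_Suc_n[of i] unfolding nonrep_def by blast
        then show False using True eqb[of "(i + 0, j)"] \<open>(i + 0, j) \<in> B\<close> by simp
      qed
      then have "B = {(i, j)}" "k = 0" using B k by auto
      moreover have "i = r" "Suc j = s" using k \<open>k = 0\<close> True b assms(6) by (auto simp: pre_def link_def)
      moreover have "{(r, j + k) | k. k < 2} = {(r, j), (r, Suc j)}"
        by (auto simp: less_2_cases_iff)
      ultimately have "insert b B = {(r, j + k) | k. k < 2}" using b by auto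
      then show ?thesis by blast
    qed
  qed
  then show ?thesis using const unfolding is_bar_def by blast
qed

lemma card_partition_le:
  assumes "finite D" "partition_on D P"
  shows "card P \<le> card D"
proof -
  have fin: "finite p" "p \<noteq> {}" if "p \<in> P" for p
    using assms that partition_onD1[OF assms(2)] partition_onD3[OF assms(2)] by (auto intro: finite_subset)
  have "card P = (\<Sum>p\<in>P. 1)" by simp
  also have "\<dots> \<le> (\<Sum>p\<in>P. card p)"
    using fin by (intro sum_mono) (simp add: Suc_le_eq card_gt_0_iff)
  also have "\<dots> = card D" using fin(1) product_partition[OF assms(2)] by simp
  finally show ?thesis .
qed

lemma finite_bars: "finite D \<Longrightarrow> finite (bars D V)"
  unfolding bars_def by (rule finite_subset[OF _ finitely_many_partition_on[of D]]) auto

text \<open>Boxes are removed in order of decreasing diagonal. The last box either forms a bar of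
  its own, with factor x, or prolongs the bar of its predecessor, with factor -\<beta>, and the
  latter is possible exactly if \<open>link\<close> holds.\<close>

lemma sum_bars:
  fixes x :: "nat \<Rightarrow> 'a :: comm_ring_1"
  assumes "finite D" "nonrep D V"
  shows "(\<Sum>Bs\<in>bars D V. (- bt) ^ (card D - card Bs) * (\<Prod>B\<in>Bs. x (index (the_elem (V ` B))))) =
    (\<Prod>b\<in>D. x (index (V b)) - (if link D V b then bt else 0))"
  using assms
proof (induction "card D" arbitrary: D)
  case 0
  then have "D = {}" by simp
  have "bars {} V = {{}}" by (auto simp: bars_def partition_on_empty)
  then show ?case by (simp add: \<open>D = {}\<close>)
next
  case (Suc n)
  define m where "m = Max (diag ` D)"
  have "D \<noteq> {}" using Suc.hyps(2) by auto
  then have "m \<in> diag ` D" unfolding m_def using Suc.prems(1) by (intro Max_in) auto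
  then obtain b where b: "b \<in> D" "diag b = m" by auto
  have bmax: "diag c \<le> diag b" if "c \<in> D" for c
    using that Suc.prems(1) unfolding b(2) m_def by (intro Max_ge) auto
  define D' where "D' = D - {b}"
  have cD: "card D = Suc (card D')" using Suc.prems(1) b(1) unfolding D'_def
    by (simp only: card_Suc_Diff1)
  have finD': "finite D'" and nonD': "nonrep D' V"
    using Suc.prems nonrep_subset unfolding D'_def by auto
  define t where "t B = x (index (the_elem (V ` B)))" for B
  define p where "p = pre V b"
  have pb: "p \<in> D' \<and> p \<noteq> b \<and> V p = V b" if "link D V b"
    using that diag_pre[OF that] unfolding D'_def p_def by (auto simp: link_def)
  have link': "link D' V c = link D V c" if "c \<in> D'" for c
  proof -
    have "pre V c \<noteq> b" if "link D V c"
      using diag_pre[OF that] bmax[of c] \<open>c \<in> D'\<close> by (auto simp: D'_def)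
    then show ?thesis unfolding link_def D'_def by auto
  qed
  have IH: "(\<Sum>Bs\<in>bars D' V. (- bt) ^ (card D' - card Bs) * (\<Prod>B\<in>Bs. t B)) =
    (\<Prod>c\<in>D'. x (index (V c)) - (if link D V c then bt else 0))"
    unfolding t_def using Suc.hyps(1)[OF _ finD' nonD'] Suc.hyps(2) cD link'
    by (simp cong: prod.cong)
  have part: "partition_on D Bs" "\<And>B. B \<in> Bs \<Longrightarrow> is_bar V B" "\<And>B. B \<in> Bs \<Longrightarrow> B \<subseteq> D"
    "\<And>B C. B \<in> Bs \<Longrightarrow> C \<in> Bs \<Longrightarrow> B \<noteq> C \<Longrightarrow> B \<inter> C = {}" "{} \<notin> Bs" "finite Bs" "card Bs \<le> card D"
    if "Bs \<in> bars D V" "finite D" for Bs D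
  proof -
    show P: "partition_on D Bs" and "\<And>B. B \<in> Bs \<Longrightarrow> is_bar V B" using that(1) by (auto simp: bars_def)
    show "\<And>B. B \<in> Bs \<Longrightarrow> B \<subseteq> D" using partition_onD1[OF P] by blast
    show "\<And>B C. B \<in> Bs \<Longrightarrow> C \<in> Bs \<Longrightarrow> B \<noteq> C \<Longrightarrow> B \<inter> C = {}"
      using partition_onD2[OF P] unfolding disjoint_def by blast
    show "{} \<notin> Bs" by (rule partition_onD3[OF P])
    show "finite Bs" by (rule finite_elements[OF that(2) P])
    show "card Bs \<le> card D" by (rule card_partition_le[OF that(2) P])
  qed
  have S1: "(\<Sum>Bs | Bs \<in> bars D V \<and> {b} \<in> Bs. (- bt) ^ (card D - card Bs) * (\<Prod>B\<in>Bs. t B)) =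
    (\<Sum>Bs\<in>bars D' V. x (index (V b)) * ((- bt) ^ (card D' - card Bs) * (\<Prod>B\<in>Bs. t B)))"
  proof (rule sum.reindex_bij_witness[where i = "insert {b}" and j = "\<lambda>Bs. Bs - {{b}}"])
    fix Bs assume Bs: "Bs \<in> {Bs. Bs \<in> bars D V \<and> {b} \<in> Bs}"
    note P = part[of Bs D, OF _ Suc.prems(1)]
    have BsV: "Bs \<in> bars D V" using Bs by simp
    show eq: "insert {b} (Bs - {{b}}) = Bs" using Bs by auto
    have "disjnt {b} (\<Union>(Bs - {{b}}))"
      using P(4)[OF BsV, of "{b}"] Bs by (auto simp: disjnt_def)
    from partition_on_insert[OF this, of D] have "partition_on D' (Bs - {{b}})"
      using P(1)[OF BsV] eq unfolding D'_def by simp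
    then show mem: "Bs - {{b}} \<in> bars D' V" using P(2)[OF BsV] by (auto simp: bars_def)
    have "card Bs = Suc (card (Bs - {{b}}))" using Bs P(6)[OF BsV]
      by (simp only: mem_Collect_eq card_Suc_Diff1)
    moreover have "(\<Prod>B\<in>Bs. t B) = t {b} * (\<Prod>B\<in>Bs - {{b}}. t B)"
      using Bs P(6)[OF BsV] by (intro prod.remove) auto
    ultimately show "x (index (V b)) * ((- bt) ^ (card D' - card (Bs - {{b}})) * (\<Prod>B\<in>Bs - {{b}}. t B)) =
        (- bt) ^ (card D - card Bs) * (\<Prod>B\<in>Bs. t B)"
      using cD by (simp add: t_def ac_simps)
  next
    fix Bs assume Bs: "Bs \<in> bars D' V"
    note P = part[OF Bs finD']
    have bn: "b \<notin> B" if "B \<in> Bs" for B using P(3)[OF that] by (auto simp: D'_def)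
    then show "insert {b} Bs - {{b}} = Bs" by blast
    have "disjnt {b} (\<Union>Bs)" using bn by (auto simp: disjnt_def)
    from partition_on_insert[OF this, of D] have "partition_on D (insert {b} Bs)"
      using P(1) b(1) unfolding D'_def by simp
    moreover have "is_bar V {b}"
    proof -
      have "{b} = {(fst b, snd b + k) | k. k < 1}" by auto
      then show ?thesis unfolding is_bar_def by blast
    qed
    ultimately show "insert {b} Bs \<in> {Bs. Bs \<in> bars D V \<and> {b} \<in> Bs}"
      using P(2) by (auto simp: bars_def)
  qed
  \<comment> \<open>\<open>h\<close> attaches b to the bar that contains its predecessor; deleting b
    from its bar is the inverse.\<close>
  define h where "h B = (if p \<in> B then insert b B else B)" for B
  have S2: "(\<Sum>Bs | Bs \<in> bars D V \<and> {b} \<notin> Bs. (- bt) ^ (card D - card Bs) * (\<Prod>B\<in>Bs. t B)) =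
    (\<Sum>Bs\<in>bars D' V. - bt * ((- bt) ^ (card D' - card Bs) * (\<Prod>B\<in>Bs. t B)))"
    if lk: "link D V b"
  proof (rule sum.reindex_bij_witness[where i = "(`) h" and j = "(`) (\<lambda>B. B - {b})"])
    fix Bs assume Bs: "Bs \<in> {Bs. Bs \<in> bars D V \<and> {b} \<notin> Bs}"
    then have BsV: "Bs \<in> bars D V" by simp
    note P = part[OF BsV Suc.prems(1)]
    obtain B0 where B0: "B0 \<in> Bs" "b \<in> B0" using partition_onD1[OF P(1)] b(1) by blast
    have "B0 \<noteq> {b}" using B0 Bs by auto
    from bar_remove_last[OF Suc.prems(2) P(2)[OF B0(1)] P(3)[OF B0(1)] B0(2) this bmax]
    have r: "p \<in> B0" "is_bar V (B0 - {b})" by (simp_all add: p_def)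
    have other: "b \<notin> B \<and> p \<notin> B" if "B \<in> Bs" "B \<noteq> B0" for B
      using P(4)[OF that(1) B0(1) that(2)] B0(2) r(1) by blast
    have hg: "h (B - {b}) = B" if "B \<in> Bs" for B
      using other[OF that] pb[OF lk] r(1) B0(2) by (cases "B = B0") (auto simp: h_def)
    then show eq: "h ` (\<lambda>B. B - {b}) ` Bs = Bs" by (auto simp: image_image)
    have inj: "inj_on (\<lambda>B. B - {b}) Bs" using hg by (intro inj_on_inverseI[where g = h])
    have "partition_on D' ((\<lambda>B. B - {b}) ` Bs)"
    proof (rule partition_onI)
      show "\<Union> ((\<lambda>B. B - {b}) ` Bs) = D'" using partition_onD1[OF P(1)] by (auto simp: D'_def)
      show "{} \<notin> (\<lambda>B. B - {b}) ` Bs" using P(5) Bs by (auto simp: subset_singleton_iff)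
      show "disjnt B C" if "B \<in> (\<lambda>B. B - {b}) ` Bs" "C \<in> (\<lambda>B. B - {b}) ` Bs" "B \<noteq> C" for B C
        using that P(4) unfolding disjnt_def by blast
    qed
    moreover have "is_bar V (B - {b})" if "B \<in> Bs" for B
      using r(2) P(2)[OF that] other[OF that] by (cases "B = B0") auto
    ultimately show "(\<lambda>B. B - {b}) ` Bs \<in> bars D' V" by (auto simp: bars_def)
    have ct: "card ((\<lambda>B. B - {b}) ` Bs) = card Bs" by (rule card_image[OF inj])
    have "card ((\<lambda>B. B - {b}) ` Bs) \<le> card D'"
      by (rule card_partition_le[OF finD']) fact
    then have "card D - card Bs = Suc (card D' - card ((\<lambda>B. B - {b}) ` Bs))" using cD ct by simp
    moreover have "t (B - {b}) = t B" if "B \<in> Bs" for B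
    proof (cases "B = B0")
      case True
      have "V b \<in> V ` (B0 - {b})" using pb[OF lk] r(1) by (intro image_eqI[of _ _ p]) auto
      moreover have "V ` B0 = insert (V b) (V ` (B0 - {b}))" using B0(2) by blast
      ultimately have "V ` (B0 - {b}) = V ` B0" by (simp add: insert_absorb)
      then show ?thesis by (simp add: t_def True)
    qed (use other[OF that] in simp)
    then have "(\<Prod>B\<in>(\<lambda>B. B - {b}) ` Bs. t B) = (\<Prod>B\<in>Bs. t B)"
      by (subst prod.reindex[OF inj]) simp
    ultimately show "- bt * ((- bt) ^ (card D' - card ((\<lambda>B. B - {b}) ` Bs)) * (\<Prod>B\<in>(\<lambda>B. B - {b}) ` Bs. t B)) =
        (- bt) ^ (card D - card Bs) * (\<Prod>B\<in>Bs. t B)"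
      by (simp add: ac_simps)
  next
    fix Bs assume Bs: "Bs \<in> bars D' V"
    note P = part[OF Bs finD']
    have bn: "b \<notin> B" if "B \<in> Bs" for B using P(3)[OF that] by (auto simp: D'_def)
    have gh: "h B - {b} = B" if "B \<in> Bs" for B using bn[OF that] by (auto simp: h_def)
    then show "(\<lambda>B. B - {b}) ` h ` Bs = Bs" by (auto simp: image_image)
    obtain B0 where B0: "B0 \<in> Bs" "p \<in> B0" using partition_onD1[OF P(1)] pb[OF lk] by blast
    have other: "p \<notin> B" if "B \<in> Bs" "B \<noteq> B0" for B
      using P(4)[OF that(1) B0(1) that(2)] B0(2) by blast
    have hB: "h B = (if B = B0 then insert b B else B)" if "B \<in> Bs" for B
      using other[OF that] B0(2) by (auto simp: h_def)
    have "partition_on D (h ` Bs)"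
    proof (rule partition_onI)
      have "\<Union> (h ` Bs) = insert b (\<Union>Bs)" using hB B0(1) by (auto split: if_splits)
      then show "\<Union> (h ` Bs) = D" using partition_onD1[OF P(1)] b(1) by (auto simp: D'_def)
      show "{} \<notin> h ` Bs" using P(5) by (auto simp: h_def)
      show "disjnt B C" if BC: "B \<in> h ` Bs" "C \<in> h ` Bs" "B \<noteq> C" for B C
      proof -
        obtain B' C' where 1: "B' \<in> Bs" "C' \<in> Bs" "B = h B'" "C = h C'" using BC(1,2) by auto
        then have "B' \<noteq> C'" using BC(3) by auto
        then have "B' \<inter> C' = {}" using P(4) 1 by simp
        then show ?thesis using bn[OF 1(1)] bn[OF 1(2)] hB[OF 1(1)] hB[OF 1(2)] 1(3,4) \<open>B' \<noteq> C'\<close>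
          by (auto simp: disjnt_def)
      qed
    qed
    moreover have "is_bar V (h B)" if "B \<in> Bs" for B
    proof (cases "B = B0")
      case True
      have "B0 \<subseteq> D" using P(3)[OF B0(1)] by (auto simp: D'_def)
      from bar_extend[OF Suc.prems(2) P(2)[OF B0(1)] this b(1) bn[OF B0(1)] lk] B0(2)
      show ?thesis using hB[OF that] True by (simp add: p_def)
    qed (use hB[OF that] P(2)[OF that] in simp)
    moreover have "{b} \<notin> h ` Bs"
    proof
      assume "{b} \<in> h ` Bs"
      then obtain B where B: "B \<in> Bs" "h B = {b}" by auto
      then have "B = {}" using gh[OF B(1)] by auto
      then show False using B(1) P(5) by simp
    qed
    ultimately show "h ` Bs \<in> {Bs. Bs \<in> bars D V \<and> {b} \<notin> Bs}" by (auto simp: bars_def)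
  qed
  have S2': "{Bs. Bs \<in> bars D V \<and> {b} \<notin> Bs} = {}" if nlk: "\<not> link D V b"
  proof (rule ccontr)
    assume "\<not> ?thesis"
    then obtain Bs where BsV: "Bs \<in> bars D V" "{b} \<notin> Bs" by blast
    note P = part[OF BsV(1) Suc.prems(1)]
    obtain B0 where B0: "B0 \<in> Bs" "b \<in> B0" using partition_onD1[OF P(1)] b(1) by blast
    have "B0 \<noteq> {b}" using B0 BsV by auto
    from bar_remove_last[OF Suc.prems(2) P(2)[OF B0(1)] P(3)[OF B0(1)] B0(2) this bmax] nlk
    show False by simp
  qed
  have "(\<Sum>Bs\<in>bars D V. (- bt) ^ (card D - card Bs) * (\<Prod>B\<in>Bs. t B)) =
    (\<Sum>Bs | Bs \<in> bars D V \<and> {b} \<in> Bs. (- bt) ^ (card D - card Bs) * (\<Prod>B\<in>Bs. t B)) +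
    (\<Sum>Bs | Bs \<in> bars D V \<and> {b} \<notin> Bs. (- bt) ^ (card D - card Bs) * (\<Prod>B\<in>Bs. t B))"
  proof -
    have "bars D V = {Bs. Bs \<in> bars D V \<and> {b} \<in> Bs} \<union> {Bs. Bs \<in> bars D V \<and> {b} \<notin> Bs}" by blast
    then show ?thesis
      using finite_bars[OF Suc.prems(1), of V] by (subst sum.union_disjoint[symmetric]) auto
  qed
  also have "\<dots> = (x (index (V b)) - (if link D V b then bt else 0)) *
      (\<Sum>Bs\<in>bars D' V. (- bt) ^ (card D' - card Bs) * (\<Prod>B\<in>Bs. t B))"
  proof (cases "link D V b")
    case True
    show ?thesis unfolding S1 S2[OF True] sum_distrib_left[symmetric] using True
      by (simp add: algebra_simps)
  next
    case False
    show ?thesis unfolding S1 S2'[OF False] sum_distrib_left[symmetric] using False by simp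
  qed
  also have "\<dots> = (\<Prod>c\<in>D. x (index (V c)) - (if link D V c then bt else 0))"
    unfolding IH unfolding D'_def by (rule prod.remove[OF Suc.prems(1) b(1), symmetric])
  finally show ?case by (simp add: t_def)
qed

text \<open>The tableau sum for \<open>jp\<close> with the bars summed out by
  \<open>sum_bars\<close>. The letter set is a parameter because full tableaux and layers of a
  single index are both needed.\<close>

definition JT :: "'a \<Rightarrow> (nat \<Rightarrow> 'a :: comm_ring_1) \<Rightarrow> letter set \<Rightarrow> (nat \<times> nat) set \<Rightarrow> 'a"
  where "JT bt y A D = (\<Sum>V | V \<in> tabs mh mv D A \<and> no_primed_diagonal D V.
    \<Prod>b\<in>D. y (index (V b)) - (if link D V b then bt else 0))"

definition SBT :: "(nat \<times> nat) set \<Rightarrow> ((nat \<times> nat \<Rightarrow> letter) \<times> (nat \<times> nat) set set) set"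
  where "SBT D = (SIGMA V:{V. V \<in> tabs mh mv D UNIV \<and> no_primed_diagonal D V}. bars D V)"

definition wtB :: "(nat \<times> nat \<Rightarrow> letter) \<times> (nat \<times> nat) set set \<Rightarrow> nat multiset"
  where "wtB t = (\<Sum>B\<in>snd t. {#index (the_elem (fst t ` B))#})"

lemma size_wtB: "size (wtB t) = card (snd t)"
  by (simp add: wtB_def size_multiset_sum)

lemma jp_comb_eq:
  assumes "lam \<in> strict_partitions" "mu \<in> strict_partitions" "SD mu \<subseteq> SD lam"
  shows "jp_comb lam mu = formal_sum (\<lambda>t. const ((- \<beta>) ^ (card (SD lam - SD mu) - size (wtB t))) * mon (wtB t))
    (SBT (SD lam - SD mu))"
proof -
  let ?D = "SD lam - SD mu"
  have "convex_region ?D" using assms by (intro convex_diff ideal_SD)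
  note iff = semistandard_iff[OF this]
  have "{(V, Bs) \<in> shifted_bar_tableaux ?D. semistandard ?D V \<and> no_primed_diagonal ?D V} = SBT ?D"
    unfolding SBT_def shifted_bar_tableaux_def iff[symmetric] bars_def by blast
  moreover have "sum_list lam - sum_list mu = card ?D"
    using assms(3) by (simp add: card_SD[symmetric] card_Diff_subset)
  ultimately show ?thesis using assms(3)
    by (simp add: jp_comb_def prod_X_eq_mon wtB_def size_multiset_sum case_prod_unfold)
qed

lemma wtB_mem:
  assumes "finite D" "t \<in> SBT D" "b \<in> D"
  shows "index (fst t b) \<in># wtB t"
proof -
  have P: "partition_on D (snd t)" and bar: "\<And>B. B \<in> snd t \<Longrightarrow> is_bar (fst t) B"
    using assms(2) by (auto simp: SBT_def bars_def)
  obtain B where B: "B \<in> snd t" "b \<in> B" using partition_onD1[OF P] assms(3) by blast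
  have "fst t c = fst t b" if "c \<in> B" for c using bar[OF B(1)] B(2) that unfolding is_bar_def by blast
  then have "fst t ` B = {fst t b}" using B(2) by blast
  then have e: "the_elem (fst t ` B) = fst t b" by simp
  have "finite (snd t)" by (rule finite_elements[OF assms(1) P])
  then show ?thesis unfolding wtB_def by (subst set_mset_sum) (use e in \<open>auto intro!: bexI[OF _ B(1)]\<close>)
qed

lemma SBT_bounded:
  assumes "finite D" "set_mset M \<subseteq> {..<n}"
  shows "{t \<in> SBT D. wtB t = M} \<subseteq>
    (SIGMA V:{V. V \<in> tabs mh mv D {a. index a < n} \<and> no_primed_diagonal D V}. bars D V)"
proof
  fix t assume t: "t \<in> {t \<in> SBT D. wtB t = M}"
  then have "index (fst t b) < n" if "b \<in> D" for b
    using wtB_mem[OF assms(1) _ that, of t] assms(2) by auto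
  then have "fst t \<in> tabs mh mv D {a. index a < n}"
    using t by (auto simp: SBT_def tabs_def)
  then show "t \<in> (SIGMA V:{V. V \<in> tabs mh mv D {a. index a < n} \<and> no_primed_diagonal D V}. bars D V)"
    using t by (auto simp: SBT_def)
qed

lemma finite_SBT_wt:
  assumes "finite D"
  shows "finite {t \<in> SBT D. wtB t = M}"
proof -
  obtain n where n: "set_mset M \<subseteq> {..<n}" using finite_nat_iff_bounded finite_set_mset by blast
  have "finite (SIGMA V:{V. V \<in> tabs mh mv D {a. index a < n} \<and> no_primed_diagonal D V}. bars D V)"
    using assms by (intro finite_SigmaI finite_bars) simp_all
  then show ?thesis by (rule finite_subset[OF SBT_bounded[OF assms n]])
qed

lemma mps_nth_jp_comb:
  assumes "lam \<in> strict_partitions" "mu \<in> strict_partitions" "SD mu \<subseteq> SD lam"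
  shows "mps_nth (jp_comb lam mu) M =
    of_nat (card {t \<in> SBT (SD lam - SD mu). wtB t = M}) * (- \<beta>) ^ (card (SD lam - SD mu) - size M)"
  unfolding jp_comb_eq[OF assms] by (subst mps_nth_weighted) (simp_all add: finite_SBT_wt)

lemma tabs_nonrep:
  assumes "convex_region D" "V \<in> tabs mh mv D A"
  shows "nonrep D V"
  unfolding nonrep_def
proof (intro conjI allI impI)
  fix i i' j assume b: "(i, j) \<in> D" "(i', j) \<in> D" "i \<noteq> i'" "V (i, j) = V (i', j)"
  show "\<not> unp (V (i, j))"
    using tabs_col[OF assms b(1,2)] tabs_col[OF assms b(2,1)] b(3,4)
    by (cases i i' rule: linorder_cases) (auto simp: mv_def)
next
  fix i j j' assume b: "(i, j) \<in> D" "(i, j') \<in> D" "j \<noteq> j'" "V (i, j) = V (i, j')"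
  show "unp (V (i, j))"
    using tabs_row[OF assms b(1,2)] tabs_row[OF assms b(2,1)] b(3,4)
    by (cases j j' rule: linorder_cases) (auto simp: mh_def)
qed

lemma mps_nth_jp_comb_eq_JT:
  assumes lm: "lam \<in> strict_partitions" "mu \<in> strict_partitions" "SD mu \<subseteq> SD lam"
    and M: "set_mset M \<subseteq> {..<n}"
  shows "mps_nth (jp_comb lam mu) M = mps_nth (JT (const \<beta>) X {a. index a < n} (SD lam - SD mu)) M"
proof -
  let ?D = "SD lam - SD mu"
  let ?T = "{V. V \<in> tabs mh mv ?D {a. index a < n} \<and> no_primed_diagonal ?D V}"
  interpret c: rhom "const :: int poly \<Rightarrow> series" by (rule rhom_const)
  have conv: "convex_region ?D" using lm by (intro convex_diff ideal_SD)
  have finD: "finite ?D" by simp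
  have sub: "tabs mh mv ?D {a. index a < n} \<subseteq> tabs mh mv ?D UNIV" by (auto simp: tabs_def)
  have "mps_nth (jp_comb lam mu) M = mps_nth (\<Sum>t\<in>(SIGMA V:?T. bars ?D V).
      const ((- \<beta>) ^ (card ?D - size (wtB t))) * mon (wtB t)) M"
    unfolding jp_comb_eq[OF lm]
  proof (rule mps_nth_weighted_subset)
    show "finite {t \<in> SBT ?D. wtB t = M}" for M by (rule finite_SBT_wt[OF finD])
    show "finite (SIGMA V:?T. bars ?D V)" by (intro finite_SigmaI finite_bars) simp_all
    show "(SIGMA V:?T. bars ?D V) \<subseteq> SBT ?D" using sub by (auto simp: SBT_def)
    show "{t \<in> SBT ?D. wtB t = M} \<subseteq> (SIGMA V:?T. bars ?D V)" by (rule SBT_bounded[OF finD M])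
  qed
  also have "(\<Sum>t\<in>(SIGMA V:?T. bars ?D V). const ((- \<beta>) ^ (card ?D - size (wtB t))) * mon (wtB t)) =
      (\<Sum>V\<in>?T. \<Sum>Bs\<in>bars ?D V. const ((- \<beta>) ^ (card ?D - size (wtB (V, Bs)))) * mon (wtB (V, Bs)))"
    by (subst sum.Sigma) (auto intro!: finite_bars sum.cong)
  also have "\<dots> = JT (const \<beta>) X {a. index a < n} ?D"
    unfolding JT_def
  proof (rule sum.cong[OF refl])
    fix V assume "V \<in> ?T"
    then have "nonrep ?D V" using tabs_nonrep[OF conv] by blast
    from sum_bars[OF finD this, of "const \<beta>" X, symmetric]
    show "(\<Sum>Bs\<in>bars ?D V. const ((- \<beta>) ^ (card ?D - size (wtB (V, Bs)))) * mon (wtB (V, Bs))) =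
        (\<Prod>b\<in>?D. X (index (V b)) - (if link ?D V b then const \<beta> else 0) :: series)"
      by (simp add: size_wtB wtB_def prod_X_eq_mon c.power c.uminus)
  qed
  finally show ?thesis .
qed

section \<open>One-variable layers\<close>

text \<open>The new box has neither a right nor an upper neighbour in the region, so only the left
  and lower ones impose conditions. This is the situation when diagonals are added in increasing
  order.\<close>

lemma sum_tabs_insert:
  assumes "b \<notin> D" "finite D" "finite A" "(fst b, Suc (snd b)) \<notin> D"
    and up: "\<And>i. Suc i = fst b \<Longrightarrow> (i, snd b) \<notin> D"
  shows "(\<Sum>W\<in>tabs Rh Rv (insert b D) A. f W) = (\<Sum>W\<in>tabs Rh Rv D A. \<Sum>a\<in>A.
    if (\<forall>j. Suc j = snd b \<longrightarrow> (fst b, j) \<in> D \<longrightarrow> Rh (W (fst b, j)) a) \<and>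
       ((Suc (fst b), snd b) \<in> D \<longrightarrow> Rv a (W (Suc (fst b), snd b))) then f (W(b := a)) else 0)"
proof -
  define ok where "ok W a \<longleftrightarrow> (\<forall>j. Suc j = snd b \<longrightarrow> (fst b, j) \<in> D \<longrightarrow> Rh (W (fst b, j)) a) \<and>
       ((Suc (fst b), snd b) \<in> D \<longrightarrow> Rv a (W (Suc (fst b), snd b)))" for W a
  have nb: "(fst b, Suc (snd b)) \<noteq> b" "(Suc (fst b), snd b) \<noteq> b"
    by (metis fst_conv snd_conv n_not_Suc_n)+
  have "(\<Sum>W\<in>tabs Rh Rv (insert b D) A. f W) =
      (\<Sum>(W, a)\<in>(SIGMA W:tabs Rh Rv D A. {a \<in> A. ok W a}). f (W(b := a)))"
  proof (rule sum.reindex_bij_witness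
      [where i = "\<lambda>(W, a). W(b := a)" and j = "\<lambda>W. (W(b := undefined), W b)"])
    fix W assume W: "W \<in> tabs Rh Rv (insert b D) A"
    show "(\<lambda>(W, a). W(b := a)) (W(b := undefined), W b) = W" by simp
    have "W(b := undefined) \<in> tabs Rh Rv D A"
      using tabs_mem[OF W] tabs_undef[OF W] tabs_h[OF W] tabs_v[OF W] assms(1)
      by (intro tabsI) auto
    moreover have "ok (W(b := undefined)) (W b)"
    proof -
      have "Rh (W (fst b, j)) (W b)" if "Suc j = snd b" "(fst b, j) \<in> D" for j
        using tabs_h[OF W, of "fst b" j] that by simp
      moreover have "(fst b, j) \<noteq> b" if "(fst b, j) \<in> D" for j using that assms(1) by auto
      moreover have "Rv (W b) (W (Suc (fst b), snd b))" if "(Suc (fst b), snd b) \<in> D"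
        using tabs_v[OF W, of "fst b" "snd b"] that by simp
      ultimately show ?thesis using nb(2) unfolding ok_def by simp
    qed
    moreover have "W b \<in> A" using tabs_mem[OF W] by simp
    ultimately show "(W(b := undefined), W b) \<in> (SIGMA W:tabs Rh Rv D A. {a \<in> A. ok W a})" by simp
    show "(case (W(b := undefined), W b) of (W, a) \<Rightarrow> f (W(b := a))) = f W" by simp
  next
    fix t assume t: "t \<in> (SIGMA W:tabs Rh Rv D A. {a \<in> A. ok W a})"
    obtain W a where tt: "t = (W, a)" by (cases t)
    have W: "W \<in> tabs Rh Rv D A" and a: "a \<in> A" "ok W a" using t tt by auto
    have "W(b := undefined) = W" using tabs_undef[OF W assms(1)] by auto
    then show "(((\<lambda>(W, a). W(b := a)) t)(b := undefined), (\<lambda>(W, a). W(b := a)) t b) = t"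
      by (simp add: tt)
    have "W(b := a) \<in> tabs Rh Rv (insert b D) A"
    proof (rule tabsI)
      fix c assume "c \<in> insert b D"
      then show "(W(b := a)) c \<in> A" using tabs_mem[OF W, of c] a by (cases "c = b") auto
    next
      fix c assume "c \<notin> insert b D"
      then show "(W(b := a)) c = undefined" using tabs_undef[OF W] by auto
    next
      fix i j assume c: "(i, j) \<in> insert b D" "(i, Suc j) \<in> insert b D"
      consider "(i, j) = b" | "(i, Suc j) = b" | "(i, j) \<noteq> b" "(i, Suc j) \<noteq> b" by blast
      then show "Rh ((W(b := a)) (i, j)) ((W(b := a)) (i, Suc j))"
      proof cases
        case 1
        then have "(i, Suc j) = (fst b, Suc (snd b))" by auto
        then show ?thesis using c(2) assms(4) nb(1) by auto
      next
        case 2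
        then have b: "b = (i, Suc j)" and ne: "(i, j) \<noteq> b" by auto
        then have "(i, j) \<in> D" using c(1) by simp
        then show ?thesis using a(2) unfolding ok_def b by simp
      next
        case 3
        then show ?thesis using tabs_h[OF W, of i j] c by simp
      qed
    next
      fix i j assume c: "(i, j) \<in> insert b D" "(Suc i, j) \<in> insert b D"
      consider "(i, j) = b" | "(Suc i, j) = b" | "(i, j) \<noteq> b" "(Suc i, j) \<noteq> b" by blast
      then show "Rv ((W(b := a)) (i, j)) ((W(b := a)) (Suc i, j))"
      proof cases
        case 1
        then have b: "b = (i, j)" and ne: "(Suc i, j) \<noteq> b" by auto
        then have "(Suc i, j) \<in> D" using c(2) by simp
        then show ?thesis using a(2) unfolding ok_def b by simp
      next
        case 2
        then have b: "b = (Suc i, j)" and "(i, j) \<noteq> b" by auto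
        then have "(i, j) \<in> D" using c(1) by simp
        then show ?thesis using up[of i] b by simp
      next
        case 3
        then show ?thesis using tabs_v[OF W, of i j] c by simp
      qed
    qed
    then show "(\<lambda>(W, a). W(b := a)) t \<in> tabs Rh Rv (insert b D) A" by (simp add: tt)
  qed
  also have "\<dots> = (\<Sum>W\<in>tabs Rh Rv D A. \<Sum>a\<in>{a \<in> A. ok W a}. f (W(b := a)))"
    using assms by (intro sum.Sigma[symmetric]) auto
  also have "\<dots> = (\<Sum>W\<in>tabs Rh Rv D A. \<Sum>a\<in>A. if ok W a then f (W(b := a)) else 0)"
    using assms(3) by (simp add: sum.inter_filter)
  finally show ?thesis unfolding ok_def .
qed

lemma letter_idx_cases: "index a = n \<longleftrightarrow> a = Primed n \<or> a = Unprimed n"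
  by (cases a) auto

text \<open>A layer with at most one box on each diagonal. On diagonal e this box can only be
  \<open>box e\<close>, right after the \<open>mm e\<close> boxes of the inner shape, so a filling
  of the layer is a word indexed by diagonals.\<close>

locale layer =
  fixes l m :: "nat \<Rightarrow> int" and n :: nat
  assumes l: "l \<in> Prof" and m: "m \<in> Prof" and lm: "\<And>e. l e - m e \<in> {0, 1}"
begin

definition H :: "nat \<Rightarrow> bool" where "H e \<longleftrightarrow> l e = m e + 1"
definition mm :: "nat \<Rightarrow> nat" where "mm e = nat (m e)"
definition box :: "nat \<Rightarrow> nat \<times> nat" where "box e = (mm e, mm e + e)"
definition D :: "nat \<Rightarrow> (nat \<times> nat) set" where "D d = box ` {e. e \<le> d \<and> H e}"
abbreviation A :: "letter set" where "A \<equiv> {a. index a = n}"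

lemma m_eq: "m e = int (mm e)"
  using Prof_ge[OF m, of e] by (simp add: mm_def)

lemma l_eq: "l e = int (mm e) + (if H e then 1 else 0)"
  using lm[of e] by (auto simp: H_def m_eq)

lemma mm_step: "mm e = mm (Suc e) \<or> mm e = Suc (mm (Suc e))"
  using Prof_step[OF m, of e] by (auto simp: m_eq)

lemma l_step: "l e - l (Suc e) = 0 \<or> l e - l (Suc e) = 1"
  using Prof_step[OF l, of e] by auto

lemma mem_D: "(i, j) \<in> D d \<longleftrightarrow> i \<le> j \<and> j - i \<le> d \<and> H (j - i) \<and> i = mm (j - i)"
  by (auto simp: D_def box_def)

lemma box_in_D: "box e \<in> D d \<longleftrightarrow> e \<le> d \<and> H e"
  by (auto simp: mem_D box_def)

lemma box_inj: "box e = box e' \<longleftrightarrow> e = e'"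
  by (auto simp: box_def)

lemma D_Suc: "D (Suc d) = (if H (Suc d) then insert (box (Suc d)) (D d) else D d)"
  by (auto simp: D_def le_Suc_eq)

lemma D_0: "D 0 = (if H 0 then {box 0} else {})"
  by (auto simp: D_def)

lemma finite_D [simp]: "finite (D d)"
  by (simp add: D_def)

lemma box_notin [simp]: "box (Suc d) \<notin> D d"
  by (simp add: box_in_D)

lemma diff_eq_D:
  assumes "\<And>e. e \<ge> M \<Longrightarrow> l e = 0" "\<And>e. e \<ge> M \<Longrightarrow> m e = 0"
  shows "SDc l - SDc m = D M"
proof -
  have "e \<le> M" if "H e" for e using that assms[of e] by (cases "e \<le> M") (auto simp: H_def)
  then have "(i, j) \<in> SDc l - SDc m \<longleftrightarrow> (i, j) \<in> D M" for i j
    by (auto simp: SDc_def mem_D l_eq m_eq split: if_splits)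
  then show ?thesis by auto
qed

text \<open>\<open>box d\<close> is the left neighbour of \<open>box (Suc d)\<close> if the inner
  diagonals have equal length and its lower neighbour if the earlier one is longer by 1.\<close>

lemma sum_tabs_Suc:
  assumes "H (Suc d)"
  shows "(\<Sum>W\<in>tabs mh mv (D (Suc d)) A. f W) = (\<Sum>W\<in>tabs mh mv (D d) A. \<Sum>a\<in>A.
    if (H d \<and> mm d = mm (Suc d) \<longrightarrow> mh (W (box d)) a) \<and>
       (H d \<and> mm d = Suc (mm (Suc d)) \<longrightarrow> mv a (W (box d)))
    then f (W(box (Suc d) := a)) else 0)"
proof -
  let ?b = "box (Suc d)"
  have 1: "(fst ?b, Suc (snd ?b)) \<notin> D d" "\<And>i. Suc i = fst ?b \<Longrightarrow> (i, snd ?b) \<notin> D d"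
    by (auto simp: mem_D box_def)
  have 2: "(\<forall>j. Suc j = snd ?b \<longrightarrow> (fst ?b, j) \<in> D d \<longrightarrow> mh (W (fst ?b, j)) a) \<longleftrightarrow>
      (H d \<and> mm d = mm (Suc d) \<longrightarrow> mh (W (box d)) a)" for W a
    by (auto simp: mem_D box_def)
  have 3: "((Suc (fst ?b), snd ?b) \<in> D d \<longrightarrow> mv a (W (Suc (fst ?b), snd ?b))) \<longleftrightarrow>
      (H d \<and> mm d = Suc (mm (Suc d)) \<longrightarrow> mv a (W (box d)))" for W a
    by (auto simp: mem_D box_def)
  show ?thesis
    using assms unfolding D_Suc by (simp only: if_True sum_tabs_insert[OF box_notin finite_D finite_letters(2) 1] 2 3)
qed

lemma W_box: "W \<in> tabs mh mv (D d) A \<Longrightarrow> e \<le> d \<Longrightarrow> H e \<Longrightarrow> W (box e) = Primed n \<or> W (box e) = Unprimed n"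
  using tabs_mem[of W mh mv "D d" A "box e"] by (simp add: box_in_D letter_idx_cases)

subsubsection \<open>Bar layers\<close>

definition stt :: "(nat \<times> nat \<Rightarrow> letter) \<Rightarrow> nat \<Rightarrow> dst"
  where "stt W d = (if H d then (if W (box d) = Primed n then DP else DU) else DZ)"

definition wD :: "'a :: comm_ring_1 \<Rightarrow> 'a \<Rightarrow> nat \<Rightarrow> (nat \<times> nat \<Rightarrow> letter) \<Rightarrow> 'a"
  where "wD y bt d W = (if no_primed_diagonal (D d) W then \<Prod>b\<in>D d. y - (if link (D d) W b then bt else 0) else 0)"

text \<open>Links point to the preceding diagonal, so the new box does not affect the links of
  earlier boxes; being off the main diagonal, it may also be primed.\<close>

lemma wD_Suc:
  assumes "H (Suc d)"
  shows "wD y bt (Suc d) (W(box (Suc d) := a)) = wD y bt d W *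
    (y - (if (unp a \<longrightarrow> H d \<and> mm d = mm (Suc d)) \<and> (\<not> unp a \<longrightarrow> H d \<and> mm d = Suc (mm (Suc d))) \<and> W (box d) = a
          then bt else 0))"
proof -
  let ?b = "box (Suc d)" and ?W = "W(box (Suc d) := a)"
  have dg: "diag c < diag ?b" if "c \<in> D d" for c
    using that by (auto simp: D_def box_def diag_def)
  have nd: "no_primed_diagonal (D (Suc d)) ?W \<longleftrightarrow> no_primed_diagonal (D d) W"
  proof -
    have "(i, i) \<noteq> ?b" for i by (auto simp: box_def)
    then show ?thesis using assms by (auto simp: no_primed_diagonal_def D_Suc)
  qed
  have lk: "link (D (Suc d)) ?W c = link (D d) W c" if c: "c \<in> D d" for c
  proof -
    have cb: "c \<noteq> ?b" using c by auto
    have p: "pre ?W c = pre W c" using cb by (simp add: pre_def)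
    show ?thesis
    proof (cases "unp (W c) \<longrightarrow> 0 < snd c")
      case True
      then have "diag (pre W c) = diag c - 1" by (auto simp: pre_def diag_def)
      then have "pre W c \<noteq> ?b" using dg[OF c] by auto
      then show ?thesis using cb assms by (simp add: link_def D_Suc p)
    next
      case False
      then show ?thesis using cb by (simp add: link_def)
    qed
  qed
  have lb: "link (D (Suc d)) ?W ?b \<longleftrightarrow> (unp a \<longrightarrow> H d \<and> mm d = mm (Suc d)) \<and>
      (\<not> unp a \<longrightarrow> H d \<and> mm d = Suc (mm (Suc d))) \<and> W (box d) = a"
  proof (cases "unp a")
    case True
    then have "pre ?W ?b = (mm (Suc d), mm (Suc d) + d)" by (simp add: pre_def box_def)
    moreover have "(mm (Suc d), mm (Suc d) + d) \<in> D (Suc d) \<longleftrightarrow> H d \<and> mm d = mm (Suc d)"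
      by (auto simp: mem_D)
    moreover have "(mm (Suc d), mm (Suc d) + d) = box d" if "mm d = mm (Suc d)" using that by (simp add: box_def)
    moreover have "(mm (Suc d), mm (Suc d) + d) \<noteq> ?b" by (simp add: box_def)
    moreover have "snd ?b > 0" by (simp add: box_def)
    ultimately show ?thesis using True unfolding link_def by auto
  next
    case False
    then have "pre ?W ?b = (Suc (mm (Suc d)), mm (Suc d) + Suc d)" by (simp add: pre_def box_def)
    moreover have "(Suc (mm (Suc d)), mm (Suc d) + Suc d) \<in> D (Suc d) \<longleftrightarrow> H d \<and> mm d = Suc (mm (Suc d))"
      by (auto simp: mem_D)
    moreover have "(Suc (mm (Suc d)), mm (Suc d) + Suc d) = box d" if "mm d = Suc (mm (Suc d))"
      using that by (simp add: box_def)
    moreover have "(Suc (mm (Suc d)), mm (Suc d) + Suc d) \<noteq> ?b" by (simp add: box_def)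
    ultimately show ?thesis using False unfolding link_def by auto
  qed
  have "(\<Prod>c\<in>D (Suc d). y - (if link (D (Suc d)) ?W c then bt else 0)) =
      (y - (if link (D (Suc d)) ?W ?b then bt else 0)) * (\<Prod>c\<in>D d. y - (if link (D d) W c then bt else 0))"
  proof -
    have "D (Suc d) = insert ?b (D d)" using assms by (simp add: D_Suc)
    then have "(\<Prod>c\<in>D (Suc d). y - (if link (D (Suc d)) ?W c then bt else 0)) =
        (y - (if link (D (Suc d)) ?W ?b then bt else 0)) * (\<Prod>c\<in>D d. y - (if link (D (Suc d)) ?W c then bt else 0))"
      using prod.insert[OF finite_D box_notin] by metis
    then show ?thesis by (simp add: lk cong: prod.cong)
  qed
  then show ?thesis unfolding wD_def nd lb by (simp add: mult.commute)
qed

lemma sum_letters: "(\<Sum>a\<in>A. g a) = g (Primed n) + g (Unprimed n)"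
  by (simp add: letters_eq)

lemma bar_step:
  assumes W: "W \<in> tabs mh mv (D d) A" and "H (Suc d)"
  shows "(\<Sum>a\<in>A. if (H d \<and> mm d = mm (Suc d) \<longrightarrow> mh (W (box d)) a) \<and>
       (H d \<and> mm d = Suc (mm (Suc d)) \<longrightarrow> mv a (W (box d)))
    then (if stt (W(box (Suc d) := a)) (Suc d) = s' then wD y bt (Suc d) (W(box (Suc d) := a)) else 0) else 0) =
    wD y bt d W * dK y bt (l d - l (Suc d)) (m d - m (Suc d)) (stt W d) s'"
proof (cases "H d")
  case True
  from W_box[OF W order_refl True] have "W (box d) = Primed n \<or> W (box d) = Unprimed n" .
  then show ?thesis
    using True assms(2) mm_step[of d]
    by (cases s') (auto simp: sum_letters wD_Suc stt_def dK_def l_eq m_eq mh_def mv_def)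
next
  case False
  have "mm d = Suc (mm (Suc d))"
    using l_step[of d] mm_step[of d] False assms(2) by (auto simp: l_eq)
  then show ?thesis
    using False assms(2)
    by (cases s') (auto simp: sum_letters wD_Suc stt_def dK_def l_eq m_eq)
qed

text \<open>The weight of a new box depends on the earlier ones only through the letter on the
  preceding diagonal. Grouping the fillings by this letter yields the recursion with matrix
  \<open>dK\<close>.\<close>

lemma bar_layer_state:
  "(\<Sum>W\<in>tabs mh mv (D d) A. if stt W d = s then wD y bt d W else 0) = dvec y bt l m d s"
proof (induction d arbitrary: s)
  case 0
  show ?case
  proof (cases "H 0")
    case True
    have t: "tabs mh mv {box 0} A = (\<lambda>a. (\<lambda>_. undefined)(box 0 := a)) ` A"
      by (auto simp: tabs_def PiE_def extensional_def box_def image_iff fun_eq_iff)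
    have nl: "\<not> link {box 0} W (box 0)" for W
    proof
      assume "link {box 0} W (box 0)"
      then show False using diag_pre[of "{box 0}" W "box 0"] by (auto simp: link_def)
    qed
    have "(\<Sum>W\<in>tabs mh mv (D 0) A. if stt W 0 = s then wD y bt 0 W else 0) =
       (\<Sum>a\<in>A. if stt ((\<lambda>_. undefined)(box 0 := a)) 0 = s then wD y bt 0 ((\<lambda>_. undefined)(box 0 := a)) else 0)"
      using True unfolding D_0 by (simp only: if_True t) (subst sum.reindex, auto simp: inj_on_def dest: fun_upd_eqD)
    also have "\<dots> = dvec y bt l m 0 s"
      using True by (cases s)
        (auto simp: sum_letters stt_def wD_def D_0 nl nl[unfolded box_def, simplified] no_primed_diagonal_def
           box_def l_eq[of 0] m_eq[of 0])
    finally show ?thesis .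
  next
    case False
    then show ?thesis by (cases s) (auto simp: D_0 stt_def wD_def no_primed_diagonal_def l_eq[of 0] m_eq[of 0])
  qed
next
  case (Suc d)
  have fib: "(\<Sum>W\<in>tabs mh mv (D d) A. wD y bt d W * f (stt W d)) = (\<Sum>s\<in>{DZ, DP, DU}. dvec y bt l m d s * f s)" for f
  proof -
    have "wD y bt d W * f (stt W d) = (\<Sum>s\<in>{DZ, DP, DU}. (if stt W d = s then wD y bt d W else 0) * f s)" for W
      by (cases "stt W d") auto
    then have "(\<Sum>W\<in>tabs mh mv (D d) A. wD y bt d W * f (stt W d)) =
        (\<Sum>s\<in>{DZ, DP, DU}. (\<Sum>W\<in>tabs mh mv (D d) A. if stt W d = s then wD y bt d W else 0) * f s)"
      by (simp only: sum_distrib_right) (rule sum.swap)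
    then show ?thesis by (simp only: Suc.IH)
  qed
  show ?case
  proof (cases "H (Suc d)")
    case True
    have "(\<Sum>W\<in>tabs mh mv (D (Suc d)) A. if stt W (Suc d) = s then wD y bt (Suc d) W else 0) =
        (\<Sum>W\<in>tabs mh mv (D d) A. wD y bt d W * dK y bt (l d - l (Suc d)) (m d - m (Suc d)) (stt W d) s)"
      unfolding sum_tabs_Suc[OF True] by (intro sum.cong refl bar_step True)
    then show ?thesis
      using fib[of "\<lambda>t. dK y bt (l d - l (Suc d)) (m d - m (Suc d)) t s"] by simp
  next
    case False
    have "(\<Sum>W\<in>tabs mh mv (D (Suc d)) A. if stt W (Suc d) = s then wD y bt (Suc d) W else 0) =
        (\<Sum>W\<in>tabs mh mv (D d) A. wD y bt d W * dK y bt (l d - l (Suc d)) (m d - m (Suc d)) (stt W d) s)"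
    proof (rule sum.cong)
      show "tabs mh mv (D (Suc d)) A = tabs mh mv (D d) A" using False by (simp add: D_Suc)
      fix W assume "W \<in> tabs mh mv (D d) A"
      have "wD y bt (Suc d) W = wD y bt d W" using False by (simp add: D_Suc wD_def)
      then show "(if stt W (Suc d) = s then wD y bt (Suc d) W else 0) =
          wD y bt d W * dK y bt (l d - l (Suc d)) (m d - m (Suc d)) (stt W d) s"
        using False l_step[of d] mm_step[of d]
        by (cases s; cases "H d") (auto simp: stt_def dK_def l_eq m_eq)
    qed
    then show ?thesis
      using fib[of "\<lambda>t. dK y bt (l d - l (Suc d)) (m d - m (Suc d)) t s"] by simp
  qed
qed

lemma bar_layer:
  assumes "\<And>e. e \<ge> M \<Longrightarrow> l e = 0" "\<And>e. e \<ge> M \<Longrightarrow> m e = 0"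
  shows "JT bt y A (SDc l - SDc m) = dvec (y n) bt l m M DZ"
proof -
  have nH: "\<not> H M" using assms[of M] by (simp add: H_def)
  have "JT bt y A (SDc l - SDc m) =
    (\<Sum>W\<in>tabs mh mv (D M) A. if no_primed_diagonal (D M) W
       then \<Prod>b\<in>D M. y (index (W b)) - (if link (D M) W b then bt else 0) else 0)"
  proof -
    have "SDc l - SDc m = D M" using assms by (rule diff_eq_D)
    then show ?thesis by (simp only: JT_def) (simp add: sum.inter_filter[symmetric])
  qed
  also have "\<dots> = (\<Sum>W\<in>tabs mh mv (D M) A. if stt W M = DZ then wD (y n) bt M W else 0)"
  proof (rule sum.cong[OF refl])
    fix W assume W: "W \<in> tabs mh mv (D M) A"
    have "index (W b) = n" if "b \<in> D M" for b using tabs_mem[OF W that] by simp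
    then show "(if no_primed_diagonal (D M) W
       then \<Prod>b\<in>D M. y (index (W b)) - (if link (D M) W b then bt else 0) else 0) =
       (if stt W M = DZ then wD (y n) bt M W else 0)"
      using nH by (simp add: stt_def wD_def cong: prod.cong)
  qed
  finally show ?thesis by (simp only: bar_layer_state)
qed

subsubsection \<open>Set-valued layers\<close>

text \<open>The box directly below \<open>box e\<close> belongs to the layer.\<close>

definition Bel :: "nat \<Rightarrow> bool"
  where "Bel e \<longleftrightarrow> e > 0 \<and> H (e - 1) \<and> mm (e - 1) = Suc (mm e)"

text \<open>
  The number of additional entries available on diagonal \<open>e\<close>: in the second branch they go to the
  corner of \<open>\<mu>\<close> on that diagonal.
\<close>

definition kk :: "(nat \<times> nat \<Rightarrow> letter) \<Rightarrow> nat \<Rightarrow> nat"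
  where "kk W e = (if H e then (if W (box e) = Primed n \<and> \<not> Bel e then 1 else 0)
    else if mm e > 0 \<and> Suc (mm (Suc e)) = mm e \<and> (e = 0 \<or> mm (e - 1) = mm e) \<and>
        \<not> (H (Suc e) \<and> W (box (Suc e)) = Primed n)
      then (if e > 0 \<and> H (e - 1) then 1 else 2) else 0)"

text \<open>On a diagonal without a layer box the exponent \<open>kk\<close> depends on the letter
  of the following diagonal, so for the last diagonal that factor is postponed.\<close>

definition wU :: "'a :: comm_ring_1 \<Rightarrow> 'a \<Rightarrow> nat \<Rightarrow> (nat \<times> nat \<Rightarrow> letter) \<Rightarrow> 'a"
  where "wU x z d W = x ^ card (D d) * (\<Prod>e<d. z ^ kk W e) * (if H d then z ^ kk W d else 1)"

lemma kk_upd: "e < d \<Longrightarrow> kk (W(box (Suc d) := a)) e = kk W e"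
  by (simp add: kk_def box_inj)

definition ZU :: "'a :: comm_ring_1 \<Rightarrow> 'a \<Rightarrow> nat \<Rightarrow> 'a"
  where "ZU x z d = (\<Sum>W\<in>tabs mh mv (D d) A. wU x z d W)"

text \<open>The number c stored through \<open>UM\<close>: the postponed corner weight is z^2 - (z -
  1)c, which is 1, z or z^2 for c = z + 1, z or 0.\<close>

definition mc :: "'a :: comm_ring_1 \<Rightarrow> nat \<Rightarrow> 'a"
  where "mc z d = (if d = 0 then 0 else if mm (d - 1) = Suc (mm d) then z + 1 else if H (d - 1) then z else 0)"

text \<open>If the preceding diagonal has a layer box, the new letter is forced and admits no
  additional entry. Otherwise a primed letter closes the corner of the inner shape but allows an
  additional unprimed one, with factor z, whereas an unprimed letter leaves the corner open with its
  postponed weight.\<close>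

lemma ZU_H_Suc:
  assumes "H (Suc d)"
  shows "ZU x z (Suc d) = (if H d then x * ZU x z d else
    x * (z + (if d = 0 \<or> mm (d - 1) = mm d then (if d > 0 \<and> H (d - 1) then z else z * z) else 1)) * ZU x z d)"
proof -
  have c: "card (D (Suc d)) = Suc (card (D d))" using assms by (simp add: D_Suc)
  have pr: "(\<Prod>e<Suc d. z ^ kk (W(box (Suc d) := a)) e) = (\<Prod>e<d. z ^ kk W e) * z ^ kk (W(box (Suc d) := a)) d" for W a
    by (simp add: kk_upd)
  have "(\<Sum>a\<in>A. if (H d \<and> mm d = mm (Suc d) \<longrightarrow> mh (W (box d)) a) \<and>
       (H d \<and> mm d = Suc (mm (Suc d)) \<longrightarrow> mv a (W (box d)))
    then wU x z (Suc d) (W(box (Suc d) := a)) else 0) = (if H d then x * wU x z d W else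
    x * (z + (if d = 0 \<or> mm (d - 1) = mm d then (if d > 0 \<and> H (d - 1) then z else z * z) else 1)) * wU x z d W)"
    if W: "W \<in> tabs mh mv (D d) A" for W
  proof (cases "H d")
    case True
    have kd: "kk (W(box (Suc d) := a)) d = kk W d" for a using True by (simp add: kk_def box_inj)
    have kS: "kk (W(box (Suc d) := a)) (Suc d) = (if a = Primed n \<and> mm d \<noteq> Suc (mm (Suc d)) then 1 else 0)" for a
      using True assms by (simp add: kk_def Bel_def)
    from W_box[OF W order_refl True] consider (P) "W (box d) = Primed n" | (U) "W (box d) = Unprimed n" by blast
    then show ?thesis
    proof cases
      case P
      show ?thesis using True assms mm_step[of d]
        by (auto simp: P sum_letters wU_def c pr kd kS mh_def mv_def simp del: prod.lessThan_Suc)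
    next
      case U
      show ?thesis using True assms mm_step[of d]
        by (auto simp: U sum_letters wU_def c pr kd kS mh_def mv_def simp del: prod.lessThan_Suc)
    qed
  next
    case False
    have mmd: "mm d = Suc (mm (Suc d))"
      using l_step[of d] mm_step[of d] False assms by (auto simp: l_eq)
    have kS: "kk (W(box (Suc d) := a)) (Suc d) = (if a = Primed n then 1 else 0)" for a
      using False assms by (simp add: kk_def Bel_def)
    have kd: "kk (W(box (Suc d) := a)) d = (if a \<noteq> Primed n \<and> (d = 0 \<or> mm (d - 1) = mm d) then
        (if d > 0 \<and> H (d - 1) then 1 else 2) else 0)" for a
      using False assms mmd by (simp add: kk_def)
    show ?thesis using False assms
      by (simp add: sum_letters wU_def c pr kd kS power2_eq_square algebra_simps del: prod.lessThan_Suc)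
  qed
  then show ?thesis
    unfolding ZU_def sum_tabs_Suc[OF assms] by (simp add: sum_distrib_left cong: sum.cong)
qed

lemma ZU_notH_Suc:
  assumes "\<not> H (Suc d)"
  shows "ZU x z (Suc d) = (if H d \<or> mm d = mm (Suc d) then ZU x z d else
    (if d = 0 \<or> mm (d - 1) = mm d then (if d > 0 \<and> H (d - 1) then z else z * z) else 1) * ZU x z d)"
proof -
  have D: "D (Suc d) = D d" using assms by (simp add: D_Suc)
  have "wU x z (Suc d) W = (if H d \<or> mm d = mm (Suc d) then wU x z d W else
    (if d = 0 \<or> mm (d - 1) = mm d then (if d > 0 \<and> H (d - 1) then z else z * z) else 1) * wU x z d W)" for W
    using assms mm_step[of d] by (auto simp: wU_def D kk_def power2_eq_square)
  then show ?thesis unfolding ZU_def D by (simp add: sum_distrib_left)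
qed

text \<open>Every later use of the postponed corner weight is linear in it, and the weight itself is
  linear in the pair 1, \<open>mc\<close>. Hence the two states \<open>UT\<close> and
  \<open>UM\<close> remember enough.\<close>

lemma uvec_eq_ZU:
  fixes x b :: "'a :: comm_ring_1"
  defines "z \<equiv> 1 + b * x"
  shows "uvec x b l m d s = (case s of UT \<Rightarrow> if H d then 0 else ZU x z d
    | UM \<Rightarrow> if H d then 0 else mc z d * ZU x z d | UO \<Rightarrow> if H d then ZU x z d else 0)"
proof (induction d arbitrary: s)
  case 0
  show ?case
  proof (cases "H 0")
    case True
    have t: "tabs mh mv {box 0} A = (\<lambda>a. (\<lambda>_. undefined)(box 0 := a)) ` A"
      by (auto simp: tabs_def PiE_def extensional_def box_def image_iff fun_eq_iff)
    have "ZU x z 0 = (\<Sum>a\<in>A. wU x z 0 ((\<lambda>_. undefined)(box 0 := a)))"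
      using True unfolding ZU_def D_0 by (simp only: if_True t) (subst sum.reindex, auto simp: inj_on_def dest: fun_upd_eqD)
    also have "\<dots> = x * (2 + b * x)"
      using True by (simp add: sum_letters wU_def D_0 kk_def Bel_def z_def algebra_simps)
    finally show ?thesis using True by (cases s) (auto simp: l_eq[of 0] m_eq[of 0])
  next
    case False
    then show ?thesis by (cases s) (auto simp: ZU_def wU_def D_0 mc_def l_eq[of 0] m_eq[of 0])
  qed
next
  case (Suc d)
  have mcS: "mc z (Suc d) = (if mm d = Suc (mm (Suc d)) then z + 1 else if H d then z else 0)"
    by (simp add: mc_def)
  have mcd: "mc z d = (if d = 0 \<or> mm (d - 1) = mm d then (if d > 0 \<and> H (d - 1) then z else 0) else z + 1)"
    using mm_step[of "d - 1"] by (cases d) (auto simp: mc_def)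
  show ?case
  proof (cases "H (Suc d)")
    case True
    show ?thesis
    proof (cases "H d")
      case Hd: True
      show ?thesis using True Hd mm_step[of d]
        by (cases s) (auto simp: Suc.IH ZU_H_Suc uK_def l_eq[of d] l_eq[of "Suc d"] m_eq[of d] m_eq[of "Suc d"] Let_def mult.commute)
    next
      case Hd: False
      have "mm d = Suc (mm (Suc d))"
        using l_step[of d] mm_step[of d] Hd True by (auto simp: l_eq)
      then show ?thesis using True Hd
        by (cases s) (auto simp: Suc.IH ZU_H_Suc uK_def l_eq[of d] l_eq[of "Suc d"] m_eq[of d] m_eq[of "Suc d"] Let_def mcd[unfolded z_def] z_def algebra_simps)
    qed
  next
    case False
    show ?thesis
    proof (cases "H d")
      case Hd: True
      have "mm d = mm (Suc d)"
        using l_step[of d] mm_step[of d] Hd False by (auto simp: l_eq)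
      then show ?thesis using False Hd
        by (cases s) (auto simp: Suc.IH ZU_notH_Suc uK_def l_eq[of d] l_eq[of "Suc d"] m_eq[of d] m_eq[of "Suc d"] Let_def mcS[unfolded z_def] z_def algebra_simps)
    next
      case Hd: False
      show ?thesis using mm_step[of d] False Hd
        by (cases s) (auto simp: Suc.IH ZU_notH_Suc uK_def l_eq[of d] l_eq[of "Suc d"] m_eq[of d] m_eq[of "Suc d"] Let_def mcS[unfolded z_def] mcd[unfolded z_def] z_def algebra_simps)
    qed
  qed
qed

text \<open>Letters of the new index that can join a box of the outer shape. In a box of the inner
  shape all earlier entries have smaller index, so no lower bound is imposed, but its right and
  lower neighbours must not be inner boxes.\<close>

definition ExtL :: "(nat \<times> nat \<Rightarrow> letter) \<Rightarrow> nat \<times> nat \<Rightarrow> letter set"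
  where "ExtL W b = {a \<in> A. (b \<notin> SDc m \<longrightarrow> W b < a) \<and>
    ((fst b, Suc (snd b)) \<in> SDc l \<longrightarrow> (fst b, Suc (snd b)) \<notin> SDc m \<and> mh a (W (fst b, Suc (snd b)))) \<and>
    ((Suc (fst b), snd b) \<in> SDc l \<longrightarrow> (Suc (fst b), snd b) \<notin> SDc m \<and> mv a (W (Suc (fst b), snd b)))}"

lemma mem_l: "(i, i + e) \<in> SDc l \<longleftrightarrow> i < mm e \<or> (H e \<and> i = mm e)"
  and mem_m: "(i, i + e) \<in> SDc m \<longleftrightarrow> i < mm e"
  by (auto simp: mem_SDc l_eq m_eq split: if_splits)

lemma ExtL_eq:
  assumes "(i, i + e) \<in> SDc l"
  shows "ExtL W (i, i + e) = {a \<in> A. (i = mm e \<longrightarrow> W (box e) < a) \<and>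
    (i < mm (Suc e) \<or> (H (Suc e) \<and> i = mm (Suc e)) \<longrightarrow> i = mm (Suc e) \<and> mh a (W (box (Suc e)))) \<and>
    (e > 0 \<and> (Suc i < mm (e - 1) \<or> (H (e - 1) \<and> Suc i = mm (e - 1))) \<longrightarrow>
       Suc i = mm (e - 1) \<and> mv a (W (box (e - 1))))}"
proof -
  have r: "(fst (i, i + e), Suc (snd (i, i + e))) = (i, i + Suc e)" by simp
  have 1: "((i, i + e) \<notin> SDc m \<longrightarrow> W (i, i + e) < a) \<longleftrightarrow> (i = mm e \<longrightarrow> W (box e) < a)" for a
  proof -
    have "(i, i + e) \<notin> SDc m \<longleftrightarrow> i = mm e" using assms mem_l[of i e] mem_m[of i e] by auto
    then show ?thesis by (auto simp: box_def)
  qed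
  have 2: "((i, i + Suc e) \<in> SDc l \<longrightarrow> (i, i + Suc e) \<notin> SDc m \<and> mh a (W (i, i + Suc e))) \<longleftrightarrow>
      (i < mm (Suc e) \<or> (H (Suc e) \<and> i = mm (Suc e)) \<longrightarrow> i = mm (Suc e) \<and> mh a (W (box (Suc e))))" for a
    using mem_l[of i "Suc e"] mem_m[of i "Suc e"] by (cases "i = mm (Suc e)") (simp_all add: box_def)
  have 4: "(Suc i, i + e) \<in> SDc c \<longleftrightarrow> e > 0 \<and> (Suc i, Suc i + (e - 1)) \<in> SDc c" for c
    by (cases e) (auto simp: SDc_def)
  have 3: "((Suc i, i + e) \<in> SDc l \<longrightarrow> (Suc i, i + e) \<notin> SDc m \<and> mv a (W (Suc i, i + e))) \<longleftrightarrow>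
      (e > 0 \<and> (Suc i < mm (e - 1) \<or> (H (e - 1) \<and> Suc i = mm (e - 1))) \<longrightarrow>
       Suc i = mm (e - 1) \<and> mv a (W (box (e - 1))))" for a
  proof (cases "e > 0 \<and> Suc i = mm (e - 1)")
    case True
    then have b: "(Suc i, i + e) = box (e - 1)" unfolding box_def by (cases e) auto
    have "(Suc i, i + e) \<in> SDc l \<longleftrightarrow> H (e - 1)" unfolding 4 mem_l using True by simp
    moreover have "(Suc i, i + e) \<notin> SDc m" unfolding 4 mem_m using True by simp
    ultimately show ?thesis unfolding b[symmetric] using True by simp
  next
    case False
    have "(Suc i, i + e) \<in> SDc l \<longleftrightarrow> e > 0 \<and> Suc i < mm (e - 1)" unfolding 4 mem_l using False by blast
    moreover have "(Suc i, i + e) \<in> SDc m \<longleftrightarrow> e > 0 \<and> Suc i < mm (e - 1)" unfolding 4 mem_m by blast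
    ultimately show ?thesis using False by auto
  qed
  show ?thesis
    unfolding ExtL_def r 1 2 by (simp only: fst_conv snd_conv 3)
qed

text \<open>A box that is not the last one on its diagonal is blocked from the right, either by an
  inner box or by a layer box, which is then primed. For the last box the possible neighbours leave
  \<open>kk\<close> choices.\<close>

lemma card_ExtL:
  assumes W: "W \<in> tabs mh mv (D M) A" and "Suc e \<le> M" "(i, i + e) \<in> SDc l"
  shows "card (ExtL W (i, i + e)) = (if Suc i = mm e + (if H e then 1 else 0) then kk W e else 0)"
proof -
  have let_e: "W (box e) = Primed n \<or> W (box e) = Unprimed n" if "H e" using W_box[OF W _ that] assms(2) by simp
  have let_S: "W (box (Suc e)) = Primed n \<or> W (box (Suc e)) = Unprimed n" if "H (Suc e)"
    using W_box[OF W _ that] assms(2) by simp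
  have let_p: "W (box (e - 1)) = Primed n \<or> W (box (e - 1)) = Unprimed n" if "H (e - 1)"
    using W_box[OF W _ that] assms(2) by simp
  have hor: "mh (W (box e)) (W (box (Suc e)))" if "H e" "H (Suc e)" "mm (Suc e) = mm e"
    using tabs_h[OF W, of "mm e" "mm e + e"] that assms(2) by (auto simp: mem_D box_def)
  have ver: "mv (W (box (Suc e))) (W (box e))" if "H e" "H (Suc e)" "mm e = Suc (mm (Suc e))"
    using tabs_v[OF W, of "mm (Suc e)" "mm e + e"] that assms(2) by (auto simp: mem_D box_def)
  have ie: "i < mm e \<or> (H e \<and> i = mm e)" using assms(3) by (simp add: mem_l)
  have msp: "e > 0 \<Longrightarrow> mm (e - 1) = mm e \<or> mm (e - 1) = Suc (mm e)" using mm_step[of "e - 1"] by auto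
  have mse: "mm e = mm (Suc e) \<or> mm e = Suc (mm (Suc e))" by (rule mm_step)
  have lS: "H (Suc e)" if "H e" "mm e = Suc (mm (Suc e))"
    using l_step[of e] that by (auto simp: l_eq split: if_splits)
  have cardA: "card {a \<in> A. P a} = (if P (Primed n) then 1 else 0) + (if P (Unprimed n) then 1 else 0)" for P
  proof -
    have "{a \<in> A. P a} = (if P (Primed n) then {Primed n} else {}) \<union> (if P (Unprimed n) then {Unprimed n} else {})"
      by (auto simp: letters_eq)
    then show ?thesis by simp
  qed
  have mhmv: "\<not> mh (Primed n) (Primed n)" "mh (Primed n) (Unprimed n)" "mh (Unprimed n) (Unprimed n)"
    "\<not> mh (Unprimed n) (Primed n)" "mv (Primed n) (Primed n)" "mv (Primed n) (Unprimed n)"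
    "\<not> mv (Unprimed n) (Unprimed n)" "\<not> mv (Unprimed n) (Primed n)"
    by (simp_all add: mh_def mv_def)
  consider (low) "i < mm (Suc e)" | (old) "mm (Suc e) \<le> i" "i < mm e" | (new) "H e" "i = mm e"
    using ie by linarith
  then show ?thesis
  proof cases
    case low
    then have "ExtL W (i, i + e) = {}" unfolding ExtL_eq[OF assms(3)] by auto
    moreover have "Suc i = mm e + (if H e then 1 else 0) \<longrightarrow> \<not> H e \<and> Suc (mm (Suc e)) \<noteq> mm e"
      using low mse by auto
    ultimately show ?thesis by (auto simp: kk_def)
  next
    case old
    then have i: "mm e = Suc i" "mm (Suc e) = i" using mse by auto
    show ?thesis
    proof (cases "H e")
      case True
      then have HS: "H (Suc e)" using lS i by simp
      then have "W (box (Suc e)) = Primed n"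
        using ver[OF True HS] i let_S[OF HS] let_e[OF True] mhmv by auto
      then have "ExtL W (i, i + e) = {}" unfolding ExtL_eq[OF assms(3)] letters_eq using i HS mhmv by auto
      then show ?thesis using True i by simp
    next
      case False
      have r: "(i < mm (Suc e) \<or> (H (Suc e) \<and> i = mm (Suc e)) \<longrightarrow> i = mm (Suc e) \<and> mh a (W (box (Suc e)))) \<longleftrightarrow>
          \<not> (H (Suc e) \<and> W (box (Suc e)) = Primed n)" if "a = Primed n \<or> a = Unprimed n" for a
      proof (cases "H (Suc e)")
        case True
        from let_S[OF True] that mhmv show ?thesis unfolding i(2) by (elim disjE) simp_all
      qed (simp add: i(2))
      have bl: "(e > 0 \<and> (Suc i < mm (e - 1) \<or> (H (e - 1) \<and> Suc i = mm (e - 1))) \<longrightarrow>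
          Suc i = mm (e - 1) \<and> mv a (W (box (e - 1)))) \<longleftrightarrow>
          (e = 0 \<or> mm (e - 1) = mm e) \<and> (a = Unprimed n \<longrightarrow> \<not> (e > 0 \<and> H (e - 1)))"
        if "a = Primed n \<or> a = Unprimed n" for a
      proof (cases "e > 0 \<and> mm (e - 1) = mm e")
        case True
        show ?thesis
        proof (cases "H (e - 1)")
          case HT: True
          from let_p[OF HT] that mhmv True HT show ?thesis unfolding i(1)[symmetric] by (elim disjE) simp_all
        qed (use True in \<open>simp add: i(1)[symmetric]\<close>)
      next
        case False
        then have "e = 0 \<or> mm (e - 1) = Suc (mm e)" using msp neq0_conv[of e] by blast
        then show ?thesis unfolding i(1)[symmetric] by (elim disjE) auto
      qed
      have ni: "i \<noteq> mm e" using i by simp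
      show ?thesis unfolding ExtL_eq[OF assms(3)] cardA
        by (simp only: r bl simp_thms) (simp add: ni kk_def i False)
    qed
  next
    case new
    have E: "W (box e) = Primed n \<or> W (box e) = Unprimed n" using let_e new by blast
    \<comment> \<open>A right neighbour in the layer is necessarily unprimed, so the additional
      letter \<open>Unprimed n\<close> can be blocked only from below, which is the case
      \<open>Bel e\<close>.\<close>
    have R: "mm e = Suc (mm (Suc e)) \<or> (mm (Suc e) = mm e \<and> \<not> H (Suc e)) \<or>
        (mm (Suc e) = mm e \<and> H (Suc e) \<and> W (box (Suc e)) = Unprimed n)"
    proof (cases "mm (Suc e) = mm e \<and> H (Suc e)")
      case True
      then have "W (box (Suc e)) = Unprimed n"
        using hor[OF new(1)] let_S E mhmv by auto
      then show ?thesis using True by blast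
    qed (use mse in auto)
    have B: "e = 0 \<or> (e > 0 \<and> mm (e - 1) = mm e) \<or> (e > 0 \<and> mm (e - 1) = Suc (mm e) \<and> \<not> H (e - 1)) \<or>
        (e > 0 \<and> mm (e - 1) = Suc (mm e) \<and> H (e - 1) \<and> W (box (e - 1)) = Primed n) \<or>
        (e > 0 \<and> mm (e - 1) = Suc (mm e) \<and> H (e - 1) \<and> W (box (e - 1)) = Unprimed n)"
      using let_p msp neq0_conv[of e] by blast
    have r: "(i < mm (Suc e) \<or> (H (Suc e) \<and> i = mm (Suc e)) \<longrightarrow> i = mm (Suc e) \<and> mh (Unprimed n) (W (box (Suc e))))"
      using R unfolding new(2) by (elim disjE conjE) (simp_all add: mhmv(3))
    have bl: "(e > 0 \<and> (Suc i < mm (e - 1) \<or> (H (e - 1) \<and> Suc i = mm (e - 1))) \<longrightarrow>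
          Suc i = mm (e - 1) \<and> mv (Unprimed n) (W (box (e - 1)))) \<longleftrightarrow> \<not> Bel e"
      using B unfolding new(2) Bel_def by (elim disjE conjE) (simp_all add: mhmv(7,8))
    have lt: "\<not> W (box e) < Primed n" "W (box e) < Unprimed n \<longleftrightarrow> W (box e) = Primed n"
      using E by (elim disjE; simp)+
    show ?thesis unfolding ExtL_eq[OF assms(3)] cardA
      by (simp only: eqTrueI[OF r] bl lt simp_thms) (simp add: new kk_def)
  qed
qed

lemma set_valued_layer:
  fixes x b :: "'a :: comm_ring_1"
  assumes M: "\<And>e. e \<ge> M \<Longrightarrow> l e = 0" "\<And>e. e \<ge> M \<Longrightarrow> m e = 0"
  shows "(\<Sum>W\<in>tabs mh mv (SDc l - SDc m) A. x ^ card (SDc l - SDc m) *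
      (\<Prod>c\<in>SDc l. (1 + b * x) ^ card (ExtL W c))) = uvec x b l m M UT"
proof -
  have nH: "\<not> H M" using assms[of M] by (simp add: H_def)
  have lM: "l \<in> paths M 0" using l M(1) paths_eq_Prof by blast
  have "(\<Prod>c\<in>SDc l. (1 + b * x) ^ card (ExtL W c)) = (\<Prod>e<M. (1 + b * x) ^ kk W e)"
    if W: "W \<in> tabs mh mv (D M) A" for W
    unfolding prod_SDc[OF lM]
  proof (rule prod.cong[OF refl])
    fix e assume e: "e \<in> {..<M}"
    let ?k = "mm e + (if H e then 1 else 0)"
    have le: "nat (l e) = ?k" by (simp add: l_eq nat_eq_iff)
    have "(\<Prod>i<?k. (1 + b * x) ^ card (ExtL W (i, i + e))) =
        (\<Prod>i<?k. if Suc i = ?k then (1 + b * x) ^ kk W e else 1)"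
      using e by (intro prod.cong refl) (subst card_ExtL[OF W], auto simp: mem_SDc l_eq split: if_splits)
    also have "\<dots> = (1 + b * x) ^ kk W e"
    proof (cases "?k = 0")
      case True
      then show ?thesis by (auto simp: kk_def split: if_splits)
    next
      case False
      then obtain k where k: "?k = Suc k" using not0_implies_Suc by blast
      show ?thesis unfolding k by (simp add: prod.delta)
    qed
    finally show "(\<Prod>i<nat (l e). (1 + b * x) ^ card (ExtL W (i, i + e))) = (1 + b * x) ^ kk W e"
      by (simp only: le)
  qed
  then have "(\<Sum>W\<in>tabs mh mv (SDc l - SDc m) A. x ^ card (SDc l - SDc m) *
      (\<Prod>c\<in>SDc l. (1 + b * x) ^ card (ExtL W c))) = ZU x (1 + b * x) M"
  proof -
    assume *: "\<And>W. W \<in> tabs mh mv (D M) A \<Longrightarrow>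
      (\<Prod>c\<in>SDc l. (1 + b * x) ^ card (ExtL W c)) = (\<Prod>e<M. (1 + b * x) ^ kk W e)"
    have "SDc l - SDc m = D M" using M by (rule diff_eq_D)
    then show ?thesis unfolding ZU_def using nH * by (simp add: wU_def)
  qed
  then show ?thesis using nH by (simp add: uvec_eq_ZU)
qed

end

subsection \<open>Branching rules\<close>

text \<open>Two boxes on one diagonal force the box above the second into the layer. Having the same
  index as its neighbours, it would have to be unprimed for the row and primed for the
  column.\<close>

lemma tabs_layer_empty:
  assumes "l \<in> Prof" "m \<in> Prof" "2 \<le> l e - m e"
  shows "tabs mh mv (SDc l - SDc m) {a. index a = n} = {}"
proof (rule ccontr)
  let ?D = "SDc l - SDc m"
  assume "\<not> ?thesis"
  then obtain W where W: "W \<in> tabs mh mv ?D {a. index a = n}" by blast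
  define i where "i = nat (m e)"
  have i: "m e = int i" using Prof_ge[OF assms(2), of e] by (simp add: i_def)
  have 1: "(i, i + e) \<in> ?D" "(Suc i, Suc i + e) \<in> ?D" using i assms(3) unfolding Diff_iff mem_SDc by auto
  have "int i < l (Suc e)" "\<not> int i < m (Suc e)"
    using i assms(3) Prof_step[OF assms(1), of e] Prof_step[OF assms(2), of e] by auto
  then have 2: "(i, Suc (i + e)) \<in> ?D" using mem_SDc[of i "Suc e"] by simp
  have "mh (W (i, i + e)) (W (i, Suc (i + e)))" using tabs_h[OF W 1(1) 2] .
  moreover have "mv (W (i, Suc (i + e))) (W (Suc i, Suc (i + e)))" using tabs_v[OF W 2] 1(2) by simp
  moreover have "index (W b) = n" if "b \<in> ?D" for b using tabs_mem[OF W that] by simp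
  then have "index (W (i, i + e)) = n" "index (W (i, Suc (i + e))) = n" "index (W (Suc i, Suc (i + e))) = n"
    using 1 2 by simp_all
  ultimately show False unfolding letter_idx_cases by (elim disjE) (simp_all add: mh_def mv_def)
qed

lemma uvec_subset:
  assumes "l \<in> paths M 0" "m \<in> paths M 0" "uvec x b l m M s \<noteq> 0"
  shows "SDc m \<subseteq> SDc l \<and> (\<forall>e. l e - m e \<in> {0, 1})"
proof -
  have h: "l e - m e \<in> {0, 1}" for e
    using uvec_support[OF assms(3)] assms(1,2) by (cases "e \<le> M") (auto simp: paths_def)
  have "m e \<le> l e" for e using h[of e] by (elim insertE) auto
  then show ?thesis using h SDc_subset_iff[of m l] paths_ge[OF assms(2)] by simp
qed

lemma dvec_subset:
  assumes "l \<in> paths M 0" "m \<in> paths M 0" "dvec x b l m M s \<noteq> 0"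
  shows "SDc m \<subseteq> SDc l \<and> (\<forall>e. l e - m e \<in> {0, 1})"
proof -
  have h: "l e - m e \<in> {0, 1}" for e
    using dvec_support[OF assms(3)] assms(1,2) by (cases "e \<le> M") (auto simp: paths_def)
  have "m e \<le> l e" for e using h[of e] by (elim insertE) auto
  then show ?thesis using h SDc_subset_iff[of m l] paths_ge[OF assms(2)] by simp
qed

lemma layer_or_large:
  assumes "l \<in> Prof" "m \<in> Prof" "SDc m \<subseteq> SDc l"
  shows "layer l m \<or> (\<exists>e. 2 \<le> l e - m e)"
proof (cases "\<exists>e. 2 \<le> l e - m e")
  case False
  have "m e \<le> l e" for e
    using assms(3) SDc_subset_iff[of m l] Prof_ge[OF assms(2)] Prof_ge[OF assms(1), of e] by force
  then have "l e - m e \<in> {0, 1}" for e using False by (smt (verit) insert_iff)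
  then show ?thesis using assms by (simp add: layer_def)
qed simp

lemma JT_layer:
  assumes "l \<in> paths M 0" "m \<in> paths M 0" "SDc m \<subseteq> SDc l"
  shows "JT bt y {a. index a = n} (SDc l - SDc m) = dvec (y n) bt l m M DZ"
proof -
  have P: "l \<in> Prof" "m \<in> Prof" using assms by (auto simp: Prof_def)
  from layer_or_large[OF P assms(3)] show ?thesis
  proof
    assume "layer l m"
    then show ?thesis using assms(1,2) by (intro layer.bar_layer) (auto simp: paths_def)
  next
    assume "\<exists>e. 2 \<le> l e - m e"
    then obtain e where e: "2 \<le> l e - m e" by blast
    then have "dvec (y n) bt l m M DZ = 0"
    proof (rule_tac ccontr)
      assume "dvec (y n) bt l m M DZ \<noteq> 0"
      then have "l e - m e \<in> {0, 1}" using dvec_subset[OF assms(1,2)] by blast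
      then show False using e by auto
    qed
    then show ?thesis by (simp add: JT_def tabs_layer_empty[OF P e])
  qed
qed

lemma ideals_between:
  assumes "l \<in> paths M 0" "m \<in> Prof"
  shows "bij_betw SDc {r \<in> paths M 0. SDc m \<subseteq> SDc r \<and> SDc r \<subseteq> SDc l}
    {R. ideal SQ R \<and> SDc m \<subseteq> R \<and> R \<subseteq> SDc l}"
proof (rule bij_betw_imageI)
  have sub: "paths M 0 \<subseteq> Prof" by (auto simp: Prof_def)
  show "inj_on SDc {r \<in> paths M 0. SDc m \<subseteq> SDc r \<and> SDc r \<subseteq> SDc l}"
    using SDc_inj sub by (auto intro!: inj_onI)
  show "SDc ` {r \<in> paths M 0. SDc m \<subseteq> SDc r \<and> SDc r \<subseteq> SDc l} = {R. ideal SQ R \<and> SDc m \<subseteq> R \<and> R \<subseteq> SDc l}"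
  proof (intro equalityI subsetI)
    fix R assume "R \<in> {R. ideal SQ R \<and> SDc m \<subseteq> R \<and> R \<subseteq> SDc l}"
    then have R: "ideal SQ R" "SDc m \<subseteq> R" "R \<subseteq> SDc l" by auto
    have "finite R" using R(3) finite_SDc[of l] assms(1) sub finite_subset by blast
    then obtain r where r: "r \<in> Prof" "SDc r = R" using ideal_eq_SDc[OF R(1)] by blast
    have "r e = 0" if "e \<ge> M" for e
    proof -
      have "r e \<le> l e \<or> r e = 0" using SDc_subset_iff[of r l] r R(3) Prof_ge[OF r(1)] by simp
      moreover have "l e = 0" using assms(1) that by (simp add: paths_def)
      ultimately show ?thesis using Prof_ge[OF r(1), of e] by auto
    qed
    then have "r \<in> paths M 0" using r(1) paths_eq_Prof by blast
    then show "R \<in> SDc ` {r \<in> paths M 0. SDc m \<subseteq> SDc r \<and> SDc r \<subseteq> SDc l}" using r(2) R by auto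
  qed (use ideal_SDc sub in auto)
qed

text \<open>Linked boxes carry equal letters, and the letters of the two parts differ in index, so
  no link crosses the border.\<close>

lemma JT_merge:
  assumes "M \<subseteq> R" "R \<subseteq> L" "finite L"
    and V: "V \<in> tabs mh mv (R - M) {a. index a < n}" and W: "W \<in> tabs mh mv (L - R) {a. index a = n}"
  defines "T \<equiv> \<lambda>b. if b \<in> R then V b else W b"
  shows "no_primed_diagonal (L - M) T \<longleftrightarrow> no_primed_diagonal (R - M) V \<and> no_primed_diagonal (L - R) W"
    and "(\<Prod>b\<in>L - M. y (index (T b)) - (if link (L - M) T b then bt else 0)) =
      (\<Prod>b\<in>R - M. y (index (V b)) - (if link (R - M) V b then bt else 0)) *
      (\<Prod>b\<in>L - R. y (index (W b)) - (if link (L - R) W b then bt else 0) :: 'a :: comm_ring_1)"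
proof -
  have D: "L - M = (R - M) \<union> (L - R)" "(R - M) \<inter> (L - R) = {}" using assms(1,2) by auto
  have TV: "T b = V b" if "b \<in> R - M" for b using that by (simp add: T_def)
  have TW: "T b = W b" if "b \<in> L - R" for b using that by (simp add: T_def)
  have iV: "index (V b) < n" if "b \<in> R - M" for b using tabs_mem[OF V that] by simp
  have iW: "index (W b) = n" if "b \<in> L - R" for b using tabs_mem[OF W that] by simp
  show "no_primed_diagonal (L - M) T \<longleftrightarrow> no_primed_diagonal (R - M) V \<and> no_primed_diagonal (L - R) W"
    unfolding no_primed_diagonal_def D(1) using TV TW by (metis UnE UnCI)
  have lV: "link (L - M) T b = link (R - M) V b" if b: "b \<in> R - M" for b
  proof -
    have p: "pre T b = pre V b" by (simp add: pre_def TV[OF b])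
    have "pre V b \<in> L - M \<and> T (pre V b) = V b \<longleftrightarrow> pre V b \<in> R - M \<and> V (pre V b) = V b"
    proof (cases "pre V b \<in> L - R")
      case True
      then have "T (pre V b) \<noteq> V b" using TW[OF True] iW[OF True] iV[OF b] by auto
      then show ?thesis using True by auto
    next
      case False
      then show ?thesis using D TV[of "pre V b"] by auto
    qed
    then show ?thesis unfolding link_def p TV[OF b] by blast
  qed
  have lW: "link (L - M) T b = link (L - R) W b" if b: "b \<in> L - R" for b
  proof -
    have p: "pre T b = pre W b" by (simp add: pre_def TW[OF b])
    have "pre W b \<in> L - M \<and> T (pre W b) = W b \<longleftrightarrow> pre W b \<in> L - R \<and> W (pre W b) = W b"
    proof (cases "pre W b \<in> R - M")
      case True
      then have "T (pre W b) \<noteq> W b" using TV[OF True] iV[OF True] iW[OF b] by auto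
      then show ?thesis using True by auto
    next
      case False
      then show ?thesis using D TW[of "pre W b"] by auto
    qed
    then show ?thesis unfolding link_def p TW[OF b] by blast
  qed
  have fin: "finite (R - M)" "finite (L - R)" using finite_subset[OF assms(2,3)] assms(3) by simp_all
  show "(\<Prod>b\<in>L - M. y (index (T b)) - (if link (L - M) T b then bt else 0)) =
      (\<Prod>b\<in>R - M. y (index (V b)) - (if link (R - M) V b then bt else 0)) *
      (\<Prod>b\<in>L - R. y (index (W b)) - (if link (L - R) W b then bt else 0))"
  proof -
    have "(\<Prod>b\<in>L - M. y (index (T b)) - (if link (L - M) T b then bt else 0)) =
      (\<Prod>b\<in>R - M. y (index (T b)) - (if link (L - M) T b then bt else 0)) *
      (\<Prod>b\<in>L - R. y (index (T b)) - (if link (L - M) T b then bt else 0))"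
      by (subst D(1)) (rule prod.union_disjoint[OF fin D(2)])
    then show ?thesis by (simp only: lV lW TV TW cong: prod.cong)
  qed
qed

definition JJ :: "'a \<Rightarrow> (nat \<Rightarrow> 'a :: comm_ring_1) \<Rightarrow> nat \<Rightarrow> (nat \<Rightarrow> int) \<Rightarrow> (nat \<Rightarrow> int) \<Rightarrow> 'a"
  where "JJ bt y n l m = (if SDc m \<subseteq> SDc l then JT bt y {a. index a < n} (SDc l - SDc m) else 0)"

lemma JT_if:
  assumes "finite D" "finite A"
  shows "JT bt y A D = (\<Sum>V\<in>tabs mh mv D A. if no_primed_diagonal D V
    then \<Prod>b\<in>D. y (index (V b)) - (if link D V b then bt else 0) else 0)"
proof -
  have "{V \<in> tabs mh mv D A. no_primed_diagonal D V} = {V. V \<in> tabs mh mv D A \<and> no_primed_diagonal D V}" by simp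
  then show ?thesis using assms by (simp add: JT_def sum.inter_filter[symmetric])
qed

lemma JJ_Suc:
  assumes l: "l \<in> paths M 0" and m: "m \<in> Prof"
  shows "JJ bt y (Suc n) l m = (\<Sum>r\<in>paths M 0. dvec (y n) bt l r M DZ * JJ bt y n r m)"
proof -
  have P: "paths M 0 \<subseteq> Prof" by (auto simp: Prof_def)
  have fin: "finite (SDc r)" if "r \<in> paths M 0" for r using that P by auto
  let ?S = "{r \<in> paths M 0. SDc m \<subseteq> SDc r \<and> SDc r \<subseteq> SDc l}"
  have "(\<Sum>r\<in>paths M 0. dvec (y n) bt l r M DZ * JJ bt y n r m) =
      (\<Sum>r\<in>?S. dvec (y n) bt l r M DZ * JJ bt y n r m)"
  proof (rule sum.mono_neutral_right)
    show "\<forall>r\<in>paths M 0 - ?S. dvec (y n) bt l r M DZ * JJ bt y n r m = 0"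
    proof
      fix r assume r: "r \<in> paths M 0 - ?S"
      show "dvec (y n) bt l r M DZ * JJ bt y n r m = 0"
      proof (rule ccontr)
        assume nz: "\<not> ?thesis"
        then have "dvec (y n) bt l r M DZ \<noteq> 0" by auto
        then have "SDc r \<subseteq> SDc l" using dvec_subset[OF l] r by blast
        moreover have "SDc m \<subseteq> SDc r" using nz by (auto simp: JJ_def split: if_splits)
        ultimately show False using r by blast
      qed
    qed
  qed auto
  also have "\<dots> = JJ bt y (Suc n) l m"
  proof (cases "SDc m \<subseteq> SDc l")
    case False
    then have e: "?S = {}" by auto
    show ?thesis unfolding e using False by (simp add: JJ_def)
  next
    case True
    define w where "w D V = (if no_primed_diagonal D V
      then \<Prod>b\<in>D. y (index (V b)) - (if link D V b then bt else 0) else 0)" for D V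
    have "JJ bt y (Suc n) l m = (\<Sum>V\<in>tabs mh mv (SDc l - SDc m) {a. index a < Suc n}. w (SDc l - SDc m) V)"
      using True fin[OF l] by (simp add: JJ_def JT_if w_def)
    also have "\<dots> = (\<Sum>R | ideal SQ R \<and> SDc m \<subseteq> R \<and> R \<subseteq> SDc l.
       \<Sum>V\<in>tabs mh mv (R - SDc m) {a. index a < n}. \<Sum>W\<in>tabs mh mv (SDc l - R) {a. index a = n}.
         w (SDc l - SDc m) (\<lambda>b. if b \<in> R then V b else W b))"
      using l m P by (intro sum_layers[OF ideal_SDc ideal_SDc True fin[OF l]]) (auto simp: mh_idx mv_idx)
    also have "\<dots> = (\<Sum>R | ideal SQ R \<and> SDc m \<subseteq> R \<and> R \<subseteq> SDc l.
       \<Sum>V\<in>tabs mh mv (R - SDc m) {a. index a < n}. \<Sum>W\<in>tabs mh mv (SDc l - R) {a. index a = n}.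
         w (R - SDc m) V * w (SDc l - R) W)"
    proof (intro sum.cong refl)
      fix R V W assume R: "R \<in> {R. ideal SQ R \<and> SDc m \<subseteq> R \<and> R \<subseteq> SDc l}"
        and V: "V \<in> tabs mh mv (R - SDc m) {a. index a < n}" and W: "W \<in> tabs mh mv (SDc l - R) {a. index a = n}"
      have R': "SDc m \<subseteq> R" "R \<subseteq> SDc l" using R by auto
      note J = JT_merge[OF R' fin[OF l] V W]
      show "w (SDc l - SDc m) (\<lambda>b. if b \<in> R then V b else W b) = w (R - SDc m) V * w (SDc l - R) W"
        unfolding w_def J(1) J(2) by simp
    qed
    also have "\<dots> = (\<Sum>r\<in>?S. \<Sum>V\<in>tabs mh mv (SDc r - SDc m) {a. index a < n}.
        \<Sum>W\<in>tabs mh mv (SDc l - SDc r) {a. index a = n}. w (SDc r - SDc m) V * w (SDc l - SDc r) W)"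
      by (rule sum.reindex_bij_betw[OF ideals_between[OF l m], symmetric])
    also have "\<dots> = (\<Sum>r\<in>?S. JJ bt y n r m * JT bt y {a. index a = n} (SDc l - SDc r))"
      using fin l by (intro sum.cong refl) (simp add: JJ_def JT_if w_def[symmetric] sum_product)
    also have "\<dots> = (\<Sum>r\<in>?S. dvec (y n) bt l r M DZ * JJ bt y n r m)"
    proof (rule sum.cong[OF refl])
      fix r
      show "JJ bt y n r m * JT bt y {a. index a = n} (SDc l - SDc r) = dvec (y n) bt l r M DZ * JJ bt y n r m" if "r \<in> ?S"
        using JT_layer[OF l, of r bt y n] that by (simp add: mult.commute)
    qed
    finally show ?thesis ..
  qed
  finally show ?thesis ..
qed

lemma tabs_no_letters: "D \<noteq> {} \<Longrightarrow> tabs Rh Rv D {} = {}"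
  by (auto simp: tabs_def)

lemma JJ_0:
  assumes "l \<in> Prof" "m \<in> Prof"
  shows "JJ bt y 0 l m = (if l = m then 1 else 0)"
proof (cases "l = m")
  case True
  then show ?thesis by (simp add: JJ_def JT_if no_primed_diagonal_def)
next
  case False
  then have "SDc l - SDc m \<noteq> {}" if "SDc m \<subseteq> SDc l" using SDc_inj[OF assms] that by blast
  then show ?thesis using False by (auto simp: JJ_def JT_def tabs_no_letters)
qed

text \<open>Additional entries of index \<open>n\<close> can also enter boxes of the inner shape, so
  the weight of the last layer is a product over all boxes of \<open>l\<close>. It still factors
  out, since it depends only on the filling of the layer, and letters of smaller index never join a
  box of the layer.\<close>

lemma GT_Suc:
  assumes lp: "l \<in> paths M 0"
  shows "GT bt x (Suc n) (SDc l) = (\<Sum>r\<in>paths M 0. uvec (x n) bt l r M UT * GT bt x n (SDc r))"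
proof -
  have P: "paths M 0 \<subseteq> Prof" by (auto simp: Prof_def)
  have fin: "finite (SDc r)" if "r \<in> paths M 0" for r using that P by auto
  have id0: "ideal SQ {}" by (simp add: ideal_def)
  have z: "(\<lambda>_. 0) \<in> Prof" "SDc (\<lambda>_. 0) = {}" by (auto simp: Prof_def paths_def SDc_def)
  let ?S = "{r \<in> paths M 0. SDc (\<lambda>_. 0) \<subseteq> SDc r \<and> SDc r \<subseteq> SDc l}"
  define w where "w k D V = (\<Prod>b\<in>D. x (index (V b)) * (\<Prod>a\<in>Ext D V {a. index a < k} b. 1 + bt * x (index a)))"
    for k D V
  have "GT bt x (Suc n) (SDc l) = (\<Sum>V\<in>tabs mh mv (SDc l - {}) {a. index a < Suc n}. w (Suc n) (SDc l) V)"
    by (simp add: GT_def w_def)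
  also have "\<dots> = (\<Sum>R | ideal SQ R \<and> {} \<subseteq> R \<and> R \<subseteq> SDc l.
       \<Sum>V\<in>tabs mh mv (R - {}) {a. index a < n}. \<Sum>W\<in>tabs mh mv (SDc l - R) {a. index a = n}.
         w (Suc n) (SDc l) (\<lambda>b. if b \<in> R then V b else W b))"
    using lp P by (intro sum_layers[OF ideal_SDc id0 _ fin[OF lp]]) (auto simp: mh_idx mv_idx)
  also have "\<dots> = (\<Sum>r\<in>?S. \<Sum>V\<in>tabs mh mv (SDc r) {a. index a < n}.
      \<Sum>W\<in>tabs mh mv (SDc l - SDc r) {a. index a = n}.
         w (Suc n) (SDc l) (\<lambda>b. if b \<in> SDc r then V b else W b))"
    unfolding sum.reindex_bij_betw[OF ideals_between[OF lp z(1)], symmetric, unfolded z(2)] z(2) by simp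
  also have "\<dots> = (\<Sum>r\<in>?S. uvec (x n) bt l r M UT * GT bt x n (SDc r))"
  proof (rule sum.cong[OF refl])
    fix r assume "r \<in> ?S"
    then have r: "r \<in> paths M 0" "SDc r \<subseteq> SDc l" by auto
    have lr: "l \<in> Prof" "r \<in> Prof" using lp r P by auto
    from layer_or_large[OF lr r(2)]
    show "(\<Sum>V\<in>tabs mh mv (SDc r) {a. index a < n}. \<Sum>W\<in>tabs mh mv (SDc l - SDc r) {a. index a = n}.
         w (Suc n) (SDc l) (\<lambda>b. if b \<in> SDc r then V b else W b)) = uvec (x n) bt l r M UT * GT bt x n (SDc r)"
    proof
      assume "\<exists>e. 2 \<le> l e - r e"
      then obtain e where e: "2 \<le> l e - r e" by blast
      then have "uvec (x n) bt l r M UT = 0"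
    proof (rule_tac ccontr)
      assume "uvec (x n) bt l r M UT \<noteq> 0"
      then have "l e - r e \<in> {0, 1}" using uvec_subset[OF lp r(1)] by blast
      then show False using e by auto
    qed
      then show ?thesis by (simp add: tabs_layer_empty[OF lr e])
    next
      assume "layer l r"
      then interpret layer l r n .
      have main: "w (Suc n) (SDc l) (\<lambda>b. if b \<in> SDc r then V b else W b) =
          w n (SDc r) V * (x n ^ card (SDc l - SDc r) * (\<Prod>c\<in>SDc l. (1 + bt * x n) ^ card (ExtL W c)))"
        if V: "V \<in> tabs mh mv (SDc r) {a. index a < n}" and W: "W \<in> tabs mh mv (SDc l - SDc r) A" for V W
      proof -
        define T where "T = (\<lambda>b. if b \<in> SDc r then V b else W b)"
        have TV: "T b = V b" if "b \<in> SDc r" for b using that by (simp add: T_def)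
        have TW: "T b = W b" if "b \<notin> SDc r" for b using that by (simp add: T_def)
        have iV: "index (V b) < n" if "b \<in> SDc r" for b using tabs_mem[OF V that] by simp
        have iW: "index (W b) = n" if "b \<in> SDc l" "b \<notin> SDc r" for b using tabs_mem[OF W, of b] that by simp
        have sub: "b \<in> SDc r \<Longrightarrow> b \<in> SDc l" for b using r(2) by blast
        have small: "mh a c" "mv a c" "a < c" if "index a < index c" for a c
          using mh_idx(2)[OF that] mv_idx(2)[OF that] that by (cases a; cases c; simp)+
        have big: "\<not> mh a c" "\<not> mv a c" "\<not> a < c" if "index c < index a" for a c
          using mh_idx(1)[of a c] mv_idx(1)[of a c] that by (cases a; cases c; force)+
        \<comment> \<open>A comparison between the two parts is decided by the index alone: a letter
          of index \<open>n\<close> fails before an inner neighbour, a smaller one always passes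
          before a layer box.\<close>
        have nbr: "(c \<in> SDc l \<longrightarrow> mh a (T c)) \<longleftrightarrow> (if index a = n then (c \<in> SDc l \<longrightarrow> c \<notin> SDc r \<and> mh a (W c))
              else c \<in> SDc r \<longrightarrow> mh a (V c))"
          "(c \<in> SDc l \<longrightarrow> mv a (T c)) \<longleftrightarrow> (if index a = n then (c \<in> SDc l \<longrightarrow> c \<notin> SDc r \<and> mv a (W c))
              else c \<in> SDc r \<longrightarrow> mv a (V c))" if "index a \<le> n" for a c
          using that TV[of c] TW[of c] iV[of c] iW[of c] sub[of c] small(1,2)[of a "W c"] big(1,2)[of "V c" a]
          by (cases "c \<in> SDc r"; cases "index a = n"; force)+
        \<comment> \<open>The additional entries of an inner box separate into those of smaller
          index, seen by the inner tableau, and those of index \<open>n\<close>, seen by the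
          layer.\<close>
        have E1: "Ext (SDc l) T {a. index a < Suc n} b = Ext (SDc r) V {a. index a < n} b \<union> ExtL W b"
          if b: "b \<in> SDc r" for b
        proof -
          have "a \<in> Ext (SDc l) T {a. index a < Suc n} b \<longleftrightarrow> a \<in> Ext (SDc r) V {a. index a < n} b \<union> ExtL W b" for a
          proof (cases "index a \<le> n")
            case True
            then show ?thesis
              unfolding Ext_def ExtL_def Un_iff mem_Collect_eq nbr[OF True] TV[OF b]
              using b small(3)[of "V b" a] iV[OF b] by (cases "index a = n") auto
          qed (auto simp: Ext_def ExtL_def)
          then show ?thesis by blast
        qed
        have E2: "Ext (SDc l) T {a. index a < Suc n} b = ExtL W b" if b: "b \<in> SDc l - SDc r" for b
        proof -
          have bn: "b \<notin> SDc r" "b \<in> SDc l" using b by auto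
          have "a \<in> Ext (SDc l) T {a. index a < Suc n} b \<longleftrightarrow> a \<in> ExtL W b" for a
          proof (cases "index a = n")
            case True
            then have "index a \<le> n" by simp
            from nbr[OF this] show ?thesis
              unfolding Ext_def ExtL_def mem_Collect_eq TW[OF bn(1)] using True bn by auto
          next
            case False
            then have "\<not> W b < a" if "index a < Suc n" using that iW[OF bn(2,1)] big(3)[of a "W b"] by simp
            then show ?thesis
              unfolding Ext_def ExtL_def mem_Collect_eq TW[OF bn(1)] using False by auto
          qed
          then show ?thesis by blast
        qed
        have xL: "(\<Prod>a\<in>ExtL W b. 1 + bt * x (index a)) = (1 + bt * x n) ^ card (ExtL W b)" for b
        proof -
          have "(\<Prod>a\<in>ExtL W b. 1 + bt * x (index a)) = (\<Prod>a\<in>ExtL W b. 1 + bt * x n)"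
            by (intro prod.cong) (auto simp: ExtL_def)
          then show ?thesis by simp
        qed
        have finE: "finite (ExtL W b)" "finite (Ext (SDc r) V {a. index a < n} b)"
          "ExtL W b \<inter> Ext (SDc r) V {a. index a < n} b = {}" for b
          by (rule finite_subset[OF _ finite_letters(2)[of n]], force simp: ExtL_def)
            (rule finite_subset[OF _ finite_letters(1)[of n]], force simp: Ext_def, force simp: Ext_def ExtL_def)
        have "w (Suc n) (SDc l) T =
          (\<Prod>b\<in>SDc r. x (index (T b)) * (\<Prod>a\<in>Ext (SDc l) T {a. index a < Suc n} b. 1 + bt * x (index a))) *
          (\<Prod>b\<in>SDc l - SDc r. x (index (T b)) * (\<Prod>a\<in>Ext (SDc l) T {a. index a < Suc n} b. 1 + bt * x (index a)))"
          unfolding w_def by (subst prod.subset_diff[OF r(2) fin[OF lp]]) (rule mult.commute)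
        also have "(\<Prod>b\<in>SDc r. x (index (T b)) * (\<Prod>a\<in>Ext (SDc l) T {a. index a < Suc n} b. 1 + bt * x (index a))) =
          w n (SDc r) V * (\<Prod>b\<in>SDc r. (1 + bt * x n) ^ card (ExtL W b))"
          unfolding w_def prod.distrib[symmetric]
        proof (rule prod.cong[OF refl])
          fix b assume b: "b \<in> SDc r"
          have "(\<Prod>a\<in>Ext (SDc r) V {a. index a < n} b \<union> ExtL W b. 1 + bt * x (index a)) =
            (\<Prod>a\<in>Ext (SDc r) V {a. index a < n} b. 1 + bt * x (index a)) * (1 + bt * x n) ^ card (ExtL W b)"
            using finE(3)[of b] by (subst prod.union_disjoint[OF finE(2,1)]) (simp_all add: xL Int_commute)
          then show "x (index (T b)) * (\<Prod>a\<in>Ext (SDc l) T {a. index a < Suc n} b. 1 + bt * x (index a)) =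
            x (index (V b)) * (\<Prod>a\<in>Ext (SDc r) V {a. index a < n} b. 1 + bt * x (index a)) *
            (1 + bt * x n) ^ card (ExtL W b)"
            unfolding E1[OF b] TV[OF b] by (simp add: mult.assoc)
        qed
        also have "(\<Prod>b\<in>SDc l - SDc r. x (index (T b)) * (\<Prod>a\<in>Ext (SDc l) T {a. index a < Suc n} b. 1 + bt * x (index a))) =
          (\<Prod>b\<in>SDc l - SDc r. x n * (1 + bt * x n) ^ card (ExtL W b))"
          by (intro prod.cong refl) (simp add: E2 xL TW iW)
        also have "\<dots> = x n ^ card (SDc l - SDc r) * (\<Prod>b\<in>SDc l - SDc r. (1 + bt * x n) ^ card (ExtL W b))"
          by (simp add: prod.distrib)
        finally have "w (Suc n) (SDc l) T = w n (SDc r) V * (x n ^ card (SDc l - SDc r) *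
            ((\<Prod>b\<in>SDc l - SDc r. (1 + bt * x n) ^ card (ExtL W b)) * (\<Prod>b\<in>SDc r. (1 + bt * x n) ^ card (ExtL W b))))"
          by (simp add: ac_simps)
        then show ?thesis
          unfolding T_def by (subst prod.subset_diff[OF r(2) fin[OF lp], of "\<lambda>c. (1 + bt * x n) ^ card (ExtL W c)"])
      qed
      have "(\<Sum>V\<in>tabs mh mv (SDc r) {a. index a < n}. \<Sum>W\<in>tabs mh mv (SDc l - SDc r) A.
         w (Suc n) (SDc l) (\<lambda>b. if b \<in> SDc r then V b else W b)) =
         (\<Sum>V\<in>tabs mh mv (SDc r) {a. index a < n}. w n (SDc r) V) * (\<Sum>W\<in>tabs mh mv (SDc l - SDc r) A.
           x n ^ card (SDc l - SDc r) * (\<Prod>c\<in>SDc l. (1 + bt * x n) ^ card (ExtL W c)))"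
        by (simp add: main sum_product)
      also have "\<dots> = GT bt x n (SDc r) * uvec (x n) bt l r M UT"
        using lp r(1) by (subst set_valued_layer[where M = M]) (auto simp: paths_def GT_def w_def)
      finally show ?thesis by (simp add: mult.commute)
    qed
  qed
  also have "\<dots> = (\<Sum>r\<in>paths M 0. uvec (x n) bt l r M UT * GT bt x n (SDc r))"
  proof (rule sum.mono_neutral_left)
    show "\<forall>r\<in>paths M 0 - ?S. uvec (x n) bt l r M UT * GT bt x n (SDc r) = 0"
    proof
      fix r assume r: "r \<in> paths M 0 - ?S"
      then have "\<not> SDc r \<subseteq> SDc l" using z(2) by auto
      then have "uvec (x n) bt l r M UT = 0" using uvec_subset[OF lp, of r] r by blast
      then show "uvec (x n) bt l r M UT * GT bt x n (SDc r) = 0" by simp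
    qed
  qed auto
  finally show ?thesis .
qed

lemma GT_0:
  assumes "l \<in> Prof"
  shows "GT bt x 0 (SDc l) = (if l = (\<lambda>_. 0) then 1 else 0)"
proof (cases "l = (\<lambda>_. 0)")
  case True
  then have "SDc l = {}" by (auto simp: SDc_def)
  then show ?thesis using True by (simp add: GT_def)
next
  case False
  have "(\<lambda>_. 0) \<in> Prof" "SDc (\<lambda>_. 0) = {}" by (auto simp: Prof_def paths_def SDc_def)
  then have "SDc l \<noteq> {}" using SDc_inj[OF assms, of "\<lambda>_. 0"] False by auto
  then show ?thesis using False by (simp add: GT_def tabs_no_letters)
qed

section \<open>Schur functions and Pieri rules\<close>

text \<open>A partition is encoded by the function listing its rows.\<close>

definition Part :: "(nat \<Rightarrow> nat) set"
  where "Part = {p. (\<forall>i. p (Suc i) \<le> p i) \<and> (\<exists>R. \<forall>i\<ge>R. p i = 0)}"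

definition YDc :: "(nat \<Rightarrow> nat) \<Rightarrow> (nat \<times> nat) set"
  where "YDc p = {(i, j). j < p i}"

definition psize :: "(nat \<Rightarrow> nat) \<Rightarrow> nat"
  where "psize p = card (YDc p)"

text \<open>\<open>hs\<close> and \<open>vs\<close> say that q/p is a horizontal or a vertical
  strip; the former is expressed by interlacing of the rows.\<close>

definition hs :: "(nat \<Rightarrow> nat) \<Rightarrow> (nat \<Rightarrow> nat) \<Rightarrow> bool"
  where "hs p q \<longleftrightarrow> (\<forall>i. p i \<le> q i \<and> q (Suc i) \<le> p i)"

definition vs :: "(nat \<Rightarrow> nat) \<Rightarrow> (nat \<Rightarrow> nat) \<Rightarrow> bool"
  where "vs p q \<longleftrightarrow> (\<forall>i. p i \<le> q i \<and> q i \<le> Suc (p i))"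

lemma mem_YDc [simp]: "(i, j) \<in> YDc p \<longleftrightarrow> j < p i"
  by (simp add: YDc_def)

lemma YDc_subset_iff: "YDc p \<subseteq> YDc q \<longleftrightarrow> (\<forall>i. p i \<le> q i)"
proof
  assume s: "YDc p \<subseteq> YDc q"
  show "\<forall>i. p i \<le> q i"
  proof (rule allI, rule ccontr)
    fix i assume "\<not> p i \<le> q i"
    then have "(i, q i) \<in> YDc p" by simp
    then have "(i, q i) \<in> YDc q" using s by blast
    then show False by simp
  qed
qed (auto simp: YDc_def intro: less_le_trans)

lemma YDc_inj: "YDc p = YDc q \<Longrightarrow> p = q"
  by (rule ext) (metis YDc_subset_iff order.refl order.antisym)

lemma Part_step: "p \<in> Part \<Longrightarrow> p (Suc i) \<le> p i"
  by (simp add: Part_def)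

lemma Part_antimono: "p \<in> Part \<Longrightarrow> i \<le> j \<Longrightarrow> p j \<le> p i"
  using lift_Suc_antimono_le[of p i j] by (auto simp: Part_def)

lemma Part_bound:
  assumes "finite F" "F \<subseteq> Part"
  obtains R where "\<And>p i. p \<in> F \<Longrightarrow> i \<ge> R \<Longrightarrow> p i = 0"
proof -
  have "\<exists>R. \<forall>p\<in>F. \<forall>i\<ge>R. p i = 0"
    using assms
  proof (induction F rule: finite_induct)
    case (insert p F)
    then obtain R R' where "\<forall>q\<in>F. \<forall>i\<ge>R. q i = 0" "\<forall>i\<ge>R'. p i = 0"
      unfolding Part_def by auto
    then have "\<forall>q\<in>insert p F. \<forall>i\<ge>max R R'. q i = 0" by auto
    then show ?case by blast
  qed simp
  then show ?thesis using that by blast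
qed

lemma YDc_Sigma:
  assumes "\<And>i. i \<ge> R \<Longrightarrow> p i = 0"
  shows "YDc p = (SIGMA i:{..<R}. {..<p i})"
proof -
  have "i < R" if "j < p i" for i j using that assms[of i] by (cases "i < R") auto
  then show ?thesis by (auto simp: YDc_def)
qed

lemma psize_sum: "(\<And>i. i \<ge> R \<Longrightarrow> p i = 0) \<Longrightarrow> psize p = (\<Sum>i<R. p i)"
  unfolding psize_def by (subst YDc_Sigma[of R]) simp_all

lemma finite_YDc [simp]: "p \<in> Part \<Longrightarrow> finite (YDc p)"
  unfolding Part_def using YDc_Sigma[of _ p] by fastforce

lemma psize_mono: "q \<in> Part \<Longrightarrow> (\<And>i. p i \<le> q i) \<Longrightarrow> psize p \<le> psize q"
  unfolding psize_def using YDc_subset_iff by (simp add: card_mono)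

lemma psize_eq_imp_eq:
  assumes "q \<in> Part" "\<And>i. p i \<le> q i" "psize p = psize q"
  shows "p = q"
proof -
  have "YDc p = YDc q"
    using assms YDc_subset_iff by (intro card_subset_eq) (auto simp: psize_def)
  then show ?thesis by (rule YDc_inj)
qed

lemma zero_Part [simp]: "(\<lambda>_. 0) \<in> Part" by (simp add: Part_def)

lemma psize_zero [simp]: "psize (\<lambda>_. 0) = 0" by (simp add: psize_def YDc_def)

lemma YDc_zero [simp]: "YDc (\<lambda>_. 0) = {}" by (simp add: YDc_def)

lemma psize_eq_0: "p \<in> Part \<Longrightarrow> psize p = 0 \<longleftrightarrow> p = (\<lambda>_. 0)"
  using psize_eq_imp_eq[of p "\<lambda>_. 0"] by auto

lemma finite_psize_le: "finite {p \<in> Part. psize p \<le> n}"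
proof (rule finite_imageD)
  show "finite (YDc ` {p \<in> Part. psize p \<le> n})"
  proof (rule finite_subset[of _ "Pow ({..<n} \<times> {..<n})"])
    show "YDc ` {p \<in> Part. psize p \<le> n} \<subseteq> Pow ({..<n} \<times> {..<n})"
    proof clarify
      fix p i j assume p: "p \<in> Part" "psize p \<le> n" and ij: "(i, j) \<in> YDc p"
      have "(\<lambda>k. (k, j)) ` {..i} \<subseteq> YDc p" using ij by clarsimp (meson Part_antimono[OF p(1)] less_le_trans)
      then have "card ((\<lambda>k. (k, j)) ` {..i}) \<le> psize p" unfolding psize_def by (rule card_mono[OF finite_YDc[OF p(1)]])
      then have i: "i < n" using p(2) by (simp add: card_image inj_on_def)
      have "(\<lambda>k. (i, k)) ` {..j} \<subseteq> YDc p" using ij by auto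
      then have "card ((\<lambda>k. (i, k)) ` {..j}) \<le> psize p" unfolding psize_def by (rule card_mono[OF finite_YDc[OF p(1)]])
      then have "j < n" using p(2) by (simp add: card_image inj_on_def)
      then show "i \<in> {..<n} \<and> j \<in> {..<n}" using i by simp
    qed
  qed simp
  show "inj_on YDc {p \<in> Part. psize p \<le> n}" by (rule inj_onI) (rule YDc_inj)
qed

lemma finite_psize_le' [simp]: "finite {p \<in> Part. P p \<and> psize p = n}"
  by (rule finite_subset[OF _ finite_psize_le[of n]]) auto

lemma ideal_YDc: "p \<in> Part \<Longrightarrow> ideal UNIV (YDc p)"
  unfolding ideal_def by (auto simp: YDc_def) (meson Part_step less_le_trans)

lemma ideal_eq_YDc:
  assumes "ideal UNIV I" "finite I"
  obtains p where "p \<in> Part" "YDc p = I"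
proof
  define p where "p i = card {j. (i, j) \<in> I}" for i
  have row: "{j. (i, j) \<in> I} = {..<p i}" for i
    unfolding p_def
  proof (rule downset_nat)
    have "{j. (i, j) \<in> I} \<subseteq> snd ` I" by force
    then show "finite {j. (i, j) \<in> I}" using assms(2) finite_surj by blast
    show "j \<in> {j. (i, j) \<in> I}" if "Suc j \<in> {j. (i, j) \<in> I}" for j
      using that assms(1) unfolding ideal_def by blast
  qed
  then have mem: "(i, j) \<in> I \<longleftrightarrow> j < p i" for i j by blast
  then show "YDc p = I" by (auto simp: YDc_def)
  have "p (Suc i) \<le> p i" for i
  proof (rule ccontr)
    assume "\<not> p (Suc i) \<le> p i"
    then have "(Suc i, p i) \<in> I" by (simp add: mem)
    then have "(i, p i) \<in> I" using assms(1) unfolding ideal_def by blast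
    then show False by (simp add: mem)
  qed
  moreover have "\<exists>R. \<forall>i\<ge>R. p i = 0"
  proof -
    obtain R where R: "fst ` I \<subseteq> {..<R}" using assms(2) finite_nat_iff_bounded by blast
    have "p i = 0" if "i \<ge> R" for i
    proof (rule ccontr)
      assume "p i \<noteq> 0"
      then have "(i, 0) \<in> I" by (simp add: mem)
      then show False using R that by force
    qed
    then show ?thesis by blast
  qed
  ultimately show "p \<in> Part" by (simp add: Part_def)
qed

section \<open>Schur polynomials in finitely many variables\<close>

definition schur_fin :: "nat \<Rightarrow> (nat \<Rightarrow> nat) \<Rightarrow> series"
  where "schur_fin n p = (\<Sum>V\<in>tabs (\<le>) (<) (YDc p) {..<n}. \<Prod>b\<in>YDc p. X (V b))"

text \<open>A constant filling violates only the strictness of columns, so it exists exactly if no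
  two boxes of the layer lie in one column.\<close>

lemma single_layer:
  fixes n :: nat
  assumes r: "r \<in> Part" and p: "p \<in> Part" and s: "YDc r \<subseteq> YDc p"
  shows "tabs (\<le>) (<) (YDc p - YDc r) {n} =
    (if hs r p then {\<lambda>b. if b \<in> YDc p - YDc r then n else undefined} else {})"
proof (cases "hs r p")
  case True
  have no: "\<not> ((i, j) \<in> YDc p - YDc r \<and> (Suc i, j) \<in> YDc p - YDc r)" for i j
  proof
    assume "(i, j) \<in> YDc p - YDc r \<and> (Suc i, j) \<in> YDc p - YDc r"
    then have "j < p (Suc i)" "r i \<le> j" by auto
    then show False using True by (metis hs_def less_le_trans not_less)
  qed
  show ?thesis
  proof (rule set_eqI)
    fix V
    have "V \<in> tabs (\<le>) (<) (YDc p - YDc r) {n} \<longleftrightarrow> V \<in> (YDc p - YDc r) \<rightarrow>\<^sub>E {n}"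
      using no unfolding tabs_def by (auto simp: PiE_iff)
    also have "\<dots> \<longleftrightarrow> V = (\<lambda>b. if b \<in> YDc p - YDc r then n else undefined)"
      by (auto simp: PiE_iff extensional_def fun_eq_iff)
    finally show "V \<in> tabs (\<le>) (<) (YDc p - YDc r) {n} \<longleftrightarrow>
      V \<in> (if hs r p then {\<lambda>b. if b \<in> YDc p - YDc r then n else undefined} else {})"
      using True by simp
  qed
next
  case False
  then obtain i where i: "\<not> p (Suc i) \<le> r i" using s YDc_subset_iff by (auto simp: hs_def)
  have b: "(i, r i) \<in> YDc p - YDc r" "(Suc i, r i) \<in> YDc p - YDc r"
    using i Part_step[OF p, of i] Part_step[OF r, of i] by auto
  have "V \<notin> tabs (\<le>) (<) (YDc p - YDc r) {n}" for V
  proof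
    assume "V \<in> tabs (\<le>) (<) (YDc p - YDc r) {n}"
    from tabs_v[OF this b] tabs_mem[OF this b(1)] tabs_mem[OF this b(2)] show False by simp
  qed
  then show ?thesis using False by auto
qed

lemma finite_hs: "p \<in> Part \<Longrightarrow> finite {r \<in> Part. hs r p}"
  by (rule finite_subset[OF _ finite_psize_le[of "psize p"]]) (auto simp: hs_def intro: psize_mono)

lemma schur_fin_Suc:
  assumes p: "p \<in> Part"
  shows "schur_fin (Suc n) p = (\<Sum>r | r \<in> Part \<and> hs r p. X n ^ (psize p - psize r) * schur_fin n r)"
proof -
  have id0: "ideal UNIV {}" by (simp add: ideal_def)
  let ?w = "\<lambda>D V. \<Prod>b\<in>D. X (V b) :: series"
  have bij: "bij_betw YDc {r \<in> Part. YDc r \<subseteq> YDc p} {R. ideal UNIV R \<and> {} \<subseteq> R \<and> R \<subseteq> YDc p}"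
  proof (rule bij_betw_imageI)
    show "inj_on YDc {r \<in> Part. YDc r \<subseteq> YDc p}" by (rule inj_onI) (rule YDc_inj)
    show "YDc ` {r \<in> Part. YDc r \<subseteq> YDc p} = {R. ideal UNIV R \<and> {} \<subseteq> R \<and> R \<subseteq> YDc p}"
    proof (intro equalityI subsetI)
      fix R assume "R \<in> {R. ideal UNIV R \<and> {} \<subseteq> R \<and> R \<subseteq> YDc p}"
      then have R: "ideal UNIV R" "R \<subseteq> YDc p" by blast+
      then obtain r where "r \<in> Part" "YDc r = R"
        using ideal_eq_YDc finite_subset[OF _ finite_YDc[OF p]] by metis
      then show "R \<in> YDc ` {r \<in> Part. YDc r \<subseteq> YDc p}" using R(2) by blast
    qed (use ideal_YDc in blast)
  qed
  have "schur_fin (Suc n) p = (\<Sum>V\<in>tabs (\<le>) (<) (YDc p - {}) {a. a < Suc n}. ?w (YDc p) V)"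
    by (simp add: schur_fin_def lessThan_def)
  also have "\<dots> = (\<Sum>R | ideal UNIV R \<and> {} \<subseteq> R \<and> R \<subseteq> YDc p.
       \<Sum>V\<in>tabs (\<le>) (<) (R - {}) {a. a < n}. \<Sum>W\<in>tabs (\<le>) (<) (YDc p - R) {a. a = n}.
         ?w (YDc p) (\<lambda>b. if b \<in> R then V b else W b))"
    using p by (intro sum_layers[where idx = "\<lambda>a. a", OF ideal_YDc id0]) auto
  also have "\<dots> = (\<Sum>r | r \<in> Part \<and> YDc r \<subseteq> YDc p.
       \<Sum>V\<in>tabs (\<le>) (<) (YDc r - {}) {a. a < n}. \<Sum>W\<in>tabs (\<le>) (<) (YDc p - YDc r) {a. a = n}.
         ?w (YDc p) (\<lambda>b. if b \<in> YDc r then V b else W b))"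
    by (rule sum.reindex_bij_betw[OF bij, symmetric])
  also have "\<dots> = (\<Sum>r | r \<in> Part \<and> YDc r \<subseteq> YDc p.
       if hs r p then X n ^ (psize p - psize r) * schur_fin n r else 0)"
  proof (rule sum.cong[OF refl])
    fix r assume "r \<in> {r. r \<in> Part \<and> YDc r \<subseteq> YDc p}"
    then have r: "r \<in> Part" "YDc r \<subseteq> YDc p" by auto
    have w: "?w (YDc p) (\<lambda>b. if b \<in> YDc r then V b else if b \<in> YDc p - YDc r then n else undefined) =
        X n ^ (psize p - psize r) * ?w (YDc r) V" for V
    proof -
      have 1: "(\<Prod>b\<in>YDc p - YDc r. X (if b \<in> YDc r then V b else if b \<in> YDc p - YDc r then n else undefined))
        = (\<Prod>b\<in>YDc p - YDc r. X n :: series)" by (rule prod.cong) auto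
      have 2: "(\<Prod>b\<in>YDc r. X (if b \<in> YDc r then V b else if b \<in> YDc p - YDc r then n else undefined))
        = ?w (YDc r) V" by (rule prod.cong) auto
      show ?thesis
        unfolding prod.subset_diff[OF r(2) finite_YDc[OF p]] 1 2
        using r p by (simp add: psize_def card_Diff_subset)
    qed
    have eqs: "{a. a < n} = {..<n}" "{a. a = n} = {n}" by auto
    show "(\<Sum>V\<in>tabs (\<le>) (<) (YDc r - {}) {a. a < n}. \<Sum>W\<in>tabs (\<le>) (<) (YDc p - YDc r) {a. a = n}.
         ?w (YDc p) (\<lambda>b. if b \<in> YDc r then V b else W b)) =
       (if hs r p then X n ^ (psize p - psize r) * schur_fin n r else 0)"
      unfolding eqs single_layer[OF r(1) p r(2)]
      by (simp add: w schur_fin_def sum_distrib_left)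
  qed
  also have "\<dots> = (\<Sum>r | r \<in> Part \<and> hs r p. X n ^ (psize p - psize r) * schur_fin n r)"
  proof (rule sum.mono_neutral_cong_right)
    have "{r. r \<in> Part \<and> YDc r \<subseteq> YDc p} \<subseteq> {r \<in> Part. psize r \<le> psize p}"
      using p by (auto simp: YDc_subset_iff intro: psize_mono)
    then show "finite {r. r \<in> Part \<and> YDc r \<subseteq> YDc p}" by (rule finite_subset[OF _ finite_psize_le])
    show "{r. r \<in> Part \<and> hs r p} \<subseteq> {r. r \<in> Part \<and> YDc r \<subseteq> YDc p}"
      unfolding YDc_subset_iff hs_def by blast
  qed (simp_all, blast?)
  finally show ?thesis .
qed

lemma schur_fin_0: "schur_fin 0 p = (if p = (\<lambda>_. 0) then 1 else 0)"
proof (cases "YDc p = {}")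
  case True
  then show ?thesis using YDc_inj[of p "\<lambda>_. 0"] by (simp add: schur_fin_def)
next
  case False
  then show ?thesis using YDc_zero by (simp add: schur_fin_def tabs_no_letters lessThan_def) (metis YDc_zero)
qed

text \<open>Summing the reflection rule over all rows: minimum plus maximum of two numbers is their
  sum, so the sizes of \<open>m\<close> and \<open>v\<close> appear. The interlacing bounds show
  that both results are partitions.\<close>

lemma psize_swap:
  assumes K: "hs K m" "hs K v" and P: "m \<in> Part" "v \<in> Part"
    and l: "l 0 = max (m 0) (v 0) + j" "\<And>i. l (Suc i) + K i = min (m i) (v i) + max (m (Suc i)) (v (Suc i))"
  shows "psize l + psize K = j + psize m + psize v" "l \<in> Part"
    "psize K \<le> psize m" "psize K \<le> psize v" "K \<in> Part"
proof -
  obtain R where R: "\<And>i. i \<ge> R \<Longrightarrow> m i = 0" "\<And>i. i \<ge> R \<Longrightarrow> v i = 0"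
    using Part_bound[of "{m, v}"] P by (metis empty_subsetI finite.simps insertCI insert_subset)
  have KR: "K i = 0" if "i \<ge> R" for i using K(1) R(1)[OF that] unfolding hs_def by (metis le_zero_eq)
  have lR: "l i = 0" if "i \<ge> Suc R" for i
  proof -
    obtain i' where i': "i = Suc i'" "i' \<ge> R" by (cases i) (use \<open>i \<ge> Suc R\<close> in auto)
    show ?thesis using l(2)[of i'] R(1)[OF i'(2)] R(1)[of i] R(2)[of i] that i'(1) by simp
  qed
  have "(\<Sum>i<Suc R. l i) + (\<Sum>i<R. K i) = l 0 + (\<Sum>i<R. l (Suc i) + K i)"
    by (simp add: sum.lessThan_Suc_shift sum.distrib del: sum.lessThan_Suc)
  also have "\<dots> = j + (\<Sum>i<R. min (m i) (v i)) + (\<Sum>i<Suc R. max (m i) (v i))"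
    by (simp add: l sum.distrib sum.lessThan_Suc_shift del: sum.lessThan_Suc)
  also have "\<dots> = j + (\<Sum>i<R. min (m i) (v i) + max (m i) (v i))"
    using R by (simp add: sum.distrib)
  also have "(\<Sum>i<R. min (m i) (v i) + max (m i) (v i)) = (\<Sum>i<R. m i + v i)"
    by (intro sum.cong refl) (simp add: min_def max_def)
  also have "\<dots> = psize m + psize v" using R by (simp add: sum.distrib psize_sum[of R])
  finally show "psize l + psize K = j + psize m + psize v"
    using psize_sum[of "Suc R" l] psize_sum[of R K] lR KR by simp
  have c: "K i \<le> m i" "K i \<le> v i" "m (Suc i) \<le> K i" "v (Suc i) \<le> K i" for i using K by (auto simp: hs_def)
  have "l (Suc i) \<le> l i" for i
  proof (cases i)
    case 0
    have "l (Suc 0) \<le> min (m 0) (v 0)" using l(2)[of 0] c[of 0] by auto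
    then show ?thesis unfolding 0 l(1) by linarith
  next
    case (Suc i')
    have "l (Suc i) \<le> min (m i) (v i)" using l(2)[of i] c[of i] by auto
    moreover have "max (m i) (v i) \<le> l i" using l(2)[of i'] c[of i'] Suc by auto
    ultimately show ?thesis by linarith
  qed
  then show "l \<in> Part" unfolding Part_def using lR by blast
  have "K (Suc i) \<le> K i" for i using c[of i] c[of "Suc i"] by linarith
  then show "K \<in> Part" unfolding Part_def using KR by blast
  show "psize K \<le> psize m" "psize K \<le> psize v" using P c by (auto intro: psize_mono)
qed

text \<open>The local rule behind the Pieri formula: row \<open>i + 1\<close> of \<open>l\<close> and row \<open>i\<close> of \<open>K\<close> range over the
  same interval, and reflecting it exchanges the two; row \<open>0\<close> of \<open>l\<close> accounts for \<open>j\<close>.\<close>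

lemma strip_exchange:
  fixes x :: "'a :: comm_ring_1"
  assumes P: "m \<in> Part" "v \<in> Part"
  shows "(\<Sum>l | l \<in> Part \<and> hs m l \<and> hs v l \<and> psize l = psize m + k. x ^ (psize l - psize v)) =
    (\<Sum>j\<le>k. \<Sum>K | K \<in> Part \<and> hs K m \<and> hs K v \<and> psize v = psize K + (k - j). x ^ (j + (psize m - psize K)))"
proof -
  let ?S = "\<lambda>j. {K. K \<in> Part \<and> hs K m \<and> hs K v \<and> psize v = psize K + (k - j)}"
  define F where "F K j = (\<lambda>i. case i of 0 \<Rightarrow> max (m 0) (v 0) + j
    | Suc i \<Rightarrow> min (m i) (v i) + max (m (Suc i)) (v (Suc i)) - K i)" for K :: "nat \<Rightarrow> nat" and j :: nat
  define G where "G l = (\<lambda>i. min (m i) (v i) + max (m (Suc i)) (v (Suc i)) - l (Suc i))" for l :: "nat \<Rightarrow> nat"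
  have finS: "finite (?S j)" for j
    by (rule finite_subset[OF _ finite_hs[OF P(1)]]) auto
  have F: "F K j 0 = max (m 0) (v 0) + j" "F K j (Suc i) + K i = min (m i) (v i) + max (m (Suc i)) (v (Suc i))"
    "hs m (F K j)" "hs v (F K j)" "G (F K j) = K" if K: "hs K m" "hs K v" for K j i
  proof -
    have c: "K i \<le> m i" "K i \<le> v i" "m (Suc i) \<le> K i" "v (Suc i) \<le> K i" for i using K by (auto simp: hs_def)
    have a: "F K j (Suc i) + K i = min (m i) (v i) + max (m (Suc i)) (v (Suc i))" for i
      using c[of i] by (simp add: F_def)
    show "F K j (Suc i) + K i = min (m i) (v i) + max (m (Suc i)) (v (Suc i))" by (rule a)
    show b: "F K j 0 = max (m 0) (v 0) + j" by (simp add: F_def)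
    have "m i \<le> F K j i \<and> v i \<le> F K j i \<and> F K j (Suc i) \<le> m i \<and> F K j (Suc i) \<le> v i" for i
    proof (cases i)
      case 0
      then show ?thesis using a[of 0] b c[of 0] unfolding 0 by linarith
    next
      case (Suc i')
      then show ?thesis using a[of i] a[of i'] c[of i] c[of i'] unfolding Suc by linarith
    qed
    then show "hs m (F K j)" "hs v (F K j)" by (auto simp: hs_def)
    have "G (F K j) i = K i" for i using a[of i] unfolding G_def by linarith
    then show "G (F K j) = K" by blast
  qed
  have G: "l 0 = max (m 0) (v 0) + (l 0 - max (m 0) (v 0))"
    "l (Suc i) + G l i = min (m i) (v i) + max (m (Suc i)) (v (Suc i))"
    "hs (G l) m" "hs (G l) v" "F (G l) (l 0 - max (m 0) (v 0)) = l" if L: "hs m l" "hs v l" for l i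
  proof -
    have c: "m i \<le> l i" "v i \<le> l i" "l (Suc i) \<le> m i" "l (Suc i) \<le> v i" for i using L by (auto simp: hs_def)
    have a: "l (Suc i) + G l i = min (m i) (v i) + max (m (Suc i)) (v (Suc i))" for i
      using c[of i] c[of "Suc i"] by (simp add: G_def)
    show "l (Suc i) + G l i = min (m i) (v i) + max (m (Suc i)) (v (Suc i))" by (rule a)
    show b: "l 0 = max (m 0) (v 0) + (l 0 - max (m 0) (v 0))" using c[of 0] by simp
    have "m (Suc i) \<le> G l i \<and> v (Suc i) \<le> G l i \<and> G l i \<le> m i \<and> G l i \<le> v i" for i
      using a[of i] c[of i] c[of "Suc i"] by linarith
    then show "hs (G l) m" "hs (G l) v" by (auto simp: hs_def)
    have "F (G l) (l 0 - max (m 0) (v 0)) i = l i" for i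
      using b a by (cases i) (auto simp: F_def, metis diff_add_inverse2)
    then show "F (G l) (l 0 - max (m 0) (v 0)) = l" by blast
  qed
  have "(\<Sum>j\<le>k. \<Sum>K\<in>?S j. x ^ (j + (psize m - psize K))) =
    (\<Sum>(j, K)\<in>(SIGMA j:{..k}. ?S j). x ^ (j + (psize m - psize K)))"
    by (rule sum.Sigma) (use finS in blast)+
  also have "\<dots> = (\<Sum>l | l \<in> Part \<and> hs m l \<and> hs v l \<and> psize l = psize m + k. x ^ (psize l - psize v))"
  proof (rule sum.reindex_bij_witness[where i = "\<lambda>l. (l 0 - max (m 0) (v 0), G l)" and j = "\<lambda>(j, K). F K j"])
    fix t assume "t \<in> (SIGMA j:{..k}. ?S j)"
    then obtain j K where t: "t = (j, K)" "j \<le> k" "hs K m" "hs K v" "psize v = psize K + (k - j)" by auto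
    note F' = F[OF t(3,4)]
    note s = psize_swap[OF t(3,4) P F'(1)[of j] F'(2)[of j]]
    show "(\<lambda>l. (l 0 - max (m 0) (v 0), G l)) ((\<lambda>(j, K). F K j) t) = t" using F' by (simp add: t(1))
    show "(\<lambda>(j, K). F K j) t \<in> {l. l \<in> Part \<and> hs m l \<and> hs v l \<and> psize l = psize m + k}"
      using F'(3,4)[of j] s(1,2) t(2,5) by (simp add: t(1))
    have e: "psize (F K j) - psize v = j + (psize m - psize K)" using s by linarith
    show "x ^ (psize ((\<lambda>(j, K). F K j) t) - psize v) = (case t of (j, K) \<Rightarrow> x ^ (j + (psize m - psize K)))"
      by (simp add: t(1) e)
  next
    fix l assume "l \<in> {l. l \<in> Part \<and> hs m l \<and> hs v l \<and> psize l = psize m + k}"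
    then have l: "l \<in> Part" "hs m l" "hs v l" "psize l = psize m + k" by auto
    note G' = G[OF l(2,3)]
    note s = psize_swap[OF G'(3,4) P G'(1,2)]
    show "(\<lambda>(j, K). F K j) ((\<lambda>l. (l 0 - max (m 0) (v 0), G l)) l) = l" using G' by simp
    show "(\<lambda>l. (l 0 - max (m 0) (v 0), G l)) l \<in> (SIGMA j:{..k}. ?S j)"
      using G'(3,4) s l(4) by auto
  qed
  finally show ?thesis by simp
qed

section \<open>Complete symmetric functions and their Pieri rule\<close>

definition hsym :: "nat \<Rightarrow> series"
  where "hsym k = Mps (\<lambda>M. if size M = k then 1 else 0)"

definition esym :: "nat \<Rightarrow> series"
  where "esym k = Mps (\<lambda>M. if size M = k \<and> (\<forall>v. count M v \<le> 1) then 1 else 0)"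

lemma res_hsym_0: "res {..<0} (hsym k) = (if k = 0 then 1 else 0)"
  by (rule mps_eqI) (auto simp: mps_nth_res hsym_def one_mps_def)

lemma res_hsym_Suc:
  "res {..<Suc n} (hsym k) = res {..<n} (hsym k) + (if k = 0 then 0 else X n * res {..<Suc n} (hsym (k - 1)))"
proof (rule mps_eqI)
  fix M :: "nat multiset"
  have "set_mset M \<subseteq> {..<Suc n} \<longleftrightarrow> set_mset M \<subseteq> {..<n}" if "n \<notin># M"
    using that by (auto simp: less_Suc_eq)
  moreover have "set_mset (M - {#n#}) \<subseteq> {..<Suc n} \<longleftrightarrow> set_mset M \<subseteq> {..<Suc n}" "size (M - {#n#}) = size M - 1"
    "size M > 0" "\<not> set_mset M \<subseteq> {..<n}" if n: "n \<in># M"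
  proof -
    obtain N where N: "M = add_mset n N" using n by (metis mset_add)
    show "set_mset (M - {#n#}) \<subseteq> {..<Suc n} \<longleftrightarrow> set_mset M \<subseteq> {..<Suc n}" "size (M - {#n#}) = size M - 1"
      "size M > 0" "\<not> set_mset M \<subseteq> {..<n}" by (auto simp: N)
  qed
  ultimately show "mps_nth (res {..<Suc n} (hsym k)) M =
    mps_nth (res {..<n} (hsym k) + (if k = 0 then 0 else X n * res {..<Suc n} (hsym (k - 1)))) M"
    by (cases "n \<in># M") (auto simp: mps_nth_res mps_nth_X_mult hsym_def)
qed

lemma res_hsym_Suc_sum: "res {..<Suc n} (hsym k) = (\<Sum>j\<le>k. X n ^ j * res {..<n} (hsym (k - j)))"
proof (induction k)
  case 0
  show ?case by (subst res_hsym_Suc) simp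
next
  case (Suc k)
  show ?case
    by (subst res_hsym_Suc) (simp add: Suc.IH sum.atMost_Suc_shift sum_distrib_left mult.assoc del: sum.atMost_Suc)
qed

text \<open>Induction on the number of variables: the last variable is split off from both factors,
  the hypothesis adds a strip to the smaller shape K, and \<open>strip_exchange\<close> replaces
  removing a strip and adding one by adding a strip and removing one.\<close>

lemma pieri_h_fin:
  assumes "p \<in> Part"
  shows "res {..<n} (hsym k) * schur_fin n p =
    (\<Sum>q | q \<in> Part \<and> hs p q \<and> psize q = psize p + k. schur_fin n q)"
  using assms
proof (induction n arbitrary: p k)
  case 0
  have "{q. (q \<in> Part \<and> hs p q \<and> psize q = psize p + k) \<and> q = (\<lambda>_. 0)} =
      (if k = 0 \<and> p = (\<lambda>_. 0) then {\<lambda>_. 0} else {})"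
    using psize_eq_0[OF 0] by (auto simp: hs_def)
  then have "(\<Sum>q | q \<in> Part \<and> hs p q \<and> psize q = psize p + k. if q = (\<lambda>_. 0) then 1 else (0 :: series)) =
      (if k = 0 \<and> p = (\<lambda>_. 0) then 1 else 0)"
    by (subst sum.inter_filter[symmetric]) auto
  then show ?case by (simp add: res_hsym_0[unfolded lessThan_0] schur_fin_0)
next
  case (Suc n)
  note p = Suc.prems
  let ?F = "{v \<in> Part. psize v \<le> psize p + k}"
  let ?x = "X n :: series"
  have "res {..<Suc n} (hsym k) * schur_fin (Suc n) p =
    (\<Sum>j\<le>k. \<Sum>K | K \<in> Part \<and> hs K p. ?x ^ (j + (psize p - psize K)) * (res {..<n} (hsym (k - j)) * schur_fin n K))"
    unfolding res_hsym_Suc_sum schur_fin_Suc[OF p] sum_product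
    by (intro sum.cong refl) (simp add: power_add ac_simps)
  also have "\<dots> = (\<Sum>j\<le>k. \<Sum>K | K \<in> Part \<and> hs K p.
      \<Sum>v | v \<in> ?F \<and> hs K v \<and> psize v = psize K + (k - j). ?x ^ (j + (psize p - psize K)) * schur_fin n v)"
  proof (intro sum.cong refl)
    fix j K assume K: "K \<in> {K. K \<in> Part \<and> hs K p}"
    then have "psize K \<le> psize p" using p by (auto simp: hs_def intro: psize_mono)
    then have "{v. v \<in> ?F \<and> hs K v \<and> psize v = psize K + (k - j)} =
        {v. v \<in> Part \<and> hs K v \<and> psize v = psize K + (k - j)}" by auto
    then show "?x ^ (j + (psize p - psize K)) * (res {..<n} (hsym (k - j)) * schur_fin n K) =
      (\<Sum>v | v \<in> ?F \<and> hs K v \<and> psize v = psize K + (k - j). ?x ^ (j + (psize p - psize K)) * schur_fin n v)"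
      using K by (simp add: Suc.IH sum_distrib_left)
  qed
  also have "\<dots> = (\<Sum>j\<le>k. \<Sum>v\<in>?F. \<Sum>K | K \<in> {K \<in> Part. hs K p} \<and> (hs K v \<and> psize v = psize K + (k - j)).
      ?x ^ (j + (psize p - psize K)) * schur_fin n v)"
  proof (rule sum.cong[OF refl])
    fix j
    show "(\<Sum>K | K \<in> Part \<and> hs K p. \<Sum>v | v \<in> ?F \<and> hs K v \<and> psize v = psize K + (k - j).
        ?x ^ (j + (psize p - psize K)) * schur_fin n v) =
      (\<Sum>v\<in>?F. \<Sum>K | K \<in> {K \<in> Part. hs K p} \<and> (hs K v \<and> psize v = psize K + (k - j)).
        ?x ^ (j + (psize p - psize K)) * schur_fin n v)"
      by (rule sum.swap_restrict[OF finite_hs[OF p] finite_psize_le])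
  qed
  also have "\<dots> = (\<Sum>v\<in>?F. (\<Sum>j\<le>k. \<Sum>K | K \<in> Part \<and> hs K p \<and> hs K v \<and> psize v = psize K + (k - j).
      ?x ^ (j + (psize p - psize K))) * schur_fin n v)"
    by (subst sum.swap) (simp add: sum_distrib_right conj_assoc)
  also have "\<dots> = (\<Sum>v\<in>?F. \<Sum>l | l \<in> {l. l \<in> Part \<and> hs p l \<and> psize l = psize p + k} \<and> hs v l.
      ?x ^ (psize l - psize v) * schur_fin n v)"
  proof (intro sum.cong refl)
    fix v assume "v \<in> ?F"
    then have v: "v \<in> Part" by simp
    have e: "{l. l \<in> {l. l \<in> Part \<and> hs p l \<and> psize l = psize p + k} \<and> hs v l} =
      {l. l \<in> Part \<and> hs p l \<and> hs v l \<and> psize l = psize p + k}" by auto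
    show "(\<Sum>j\<le>k. \<Sum>K | K \<in> Part \<and> hs K p \<and> hs K v \<and> psize v = psize K + (k - j).
      ?x ^ (j + (psize p - psize K))) * schur_fin n v =
      (\<Sum>l | l \<in> {l. l \<in> Part \<and> hs p l \<and> psize l = psize p + k} \<and> hs v l. ?x ^ (psize l - psize v) * schur_fin n v)"
      unfolding strip_exchange[OF p v, symmetric] e by (simp add: sum_distrib_right)
  qed
  also have "\<dots> = (\<Sum>l | l \<in> Part \<and> hs p l \<and> psize l = psize p + k. \<Sum>v | v \<in> ?F \<and> hs v l.
      ?x ^ (psize l - psize v) * schur_fin n v)"
    using finite_psize_le by (subst sum.swap_restrict) auto
  also have "\<dots> = (\<Sum>l | l \<in> Part \<and> hs p l \<and> psize l = psize p + k. schur_fin (Suc n) l)"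
  proof (intro sum.cong refl)
    fix l assume l: "l \<in> {l. l \<in> Part \<and> hs p l \<and> psize l = psize p + k}"
    have "{v. v \<in> ?F \<and> hs v l} = {v. v \<in> Part \<and> hs v l}"
      using l psize_mono[of l] by (fastforce simp: hs_def)
    then show "(\<Sum>v | v \<in> ?F \<and> hs v l. ?x ^ (psize l - psize v) * schur_fin n v) = schur_fin (Suc n) l"
      using l by (simp add: schur_fin_Suc)
  qed
  finally show ?case .
qed

section \<open>Generating series of the complete and elementary functions\<close>

definition fmap :: "('a :: comm_ring_1 \<Rightarrow> 'b :: comm_ring_1) \<Rightarrow> 'a fps \<Rightarrow> 'b fps"
  where "fmap h F = Abs_fps (\<lambda>k. h (fps_nth F k))"

lemma fmap_nth [simp]: "fps_nth (fmap h F) k = h (fps_nth F k)"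
  by (simp add: fmap_def)

lemma rhom_fmap: "rhom h \<Longrightarrow> rhom (fmap h)"
proof -
  assume "rhom h"
  then interpret rhom h .
  show ?thesis
    by standard (auto simp: fps_eq_iff fps_mult_nth hom)
qed

lemma fmap_X: "rhom h \<Longrightarrow> fmap h fps_X = fps_X"
  and fmap_const: "rhom h \<Longrightarrow> fmap h (fps_const c) = fps_const (h c)"
  by (auto simp: fps_eq_iff rhom.hom fps_X_def)

lemma fps_eqI_res:
  assumes "\<And>n. fmap (res {..<n :: nat}) F = fmap (res {..<n}) G"
  shows "F = G"
proof (rule fps_ext, rule mps_eqI_res)
  fix k n
  show "res {..<n} (fps_nth F k) = res {..<n} (fps_nth G k)"
    using assms[of n, THEN arg_cong[of _ _ "\<lambda>F. fps_nth F k"]] by simp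
qed

definition Hs :: "series fps" where "Hs = Abs_fps hsym"

definition Es :: "series fps" where "Es = Abs_fps esym"

lemma res_esym_0: "res {..<0} (esym k) = (if k = 0 then 1 else 0)"
  by (rule mps_eqI) (auto simp: mps_nth_res esym_def one_mps_def)

lemma res_esym_Suc:
  "res {..<Suc n} (esym k) = res {..<n} (esym k) + (if k = 0 then 0 else X n * res {..<n} (esym (k - 1)))"
proof (rule mps_eqI)
  fix M :: "nat multiset"
  show "mps_nth (res {..<Suc n} (esym k)) M =
    mps_nth (res {..<n} (esym k) + (if k = 0 then 0 else X n * res {..<n} (esym (k - 1)))) M"
  proof (cases "n \<in># M")
    case True
    then obtain N where N: "M = add_mset n N" by (metis mset_add)
    show ?thesis
    proof (cases "n \<in># N")
      case True
      then have "\<not> count M n \<le> 1" unfolding N by (simp add: count_eq_zero_iff not_le)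
      then have "\<not> (\<forall>v. count M v \<le> 1)" by blast
      then have "mps_nth (esym k) M = 0" unfolding esym_def mps_nth_Mps by simp
      then have 1: "mps_nth (res V (esym k)) M = 0" for V unfolding mps_nth_res by simp
      have "mps_nth (res {..<n} (esym j)) N = 0" for j using True by (auto simp: mps_nth_res)
      then have 2: "mps_nth (X n * res {..<n} (esym j)) M = 0" for j by (simp add: mps_nth_X_mult N)
      show ?thesis using 1 2 by simp
    next
      case False
      then have "count M v \<le> 1 \<longleftrightarrow> count N v \<le> 1" for v
        unfolding N by (cases "v = n") (simp_all add: not_in_iff)
      then have "(\<forall>v. count M v \<le> 1) \<longleftrightarrow> (\<forall>v. count N v \<le> 1)" by blast
      moreover have "set_mset M \<subseteq> {..<Suc n} \<longleftrightarrow> set_mset N \<subseteq> {..<n}" "\<not> set_mset M \<subseteq> {..<n}"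
        using False unfolding N by (auto simp: less_Suc_eq)
      moreover have "size M = Suc (size N)" "n \<in># M" "M - {#n#} = N" "M \<noteq> {#}" by (simp_all add: N)
      ultimately show ?thesis
        unfolding plus_mps_def mps_nth_Mps mps_nth_res by (cases k) (simp_all add: esym_def mps_nth_res mps_nth_X_mult)
    qed
  next
    case False
    then have "set_mset M \<subseteq> {..<Suc n} \<longleftrightarrow> set_mset M \<subseteq> {..<n}" by (auto simp: less_Suc_eq)
    with False show ?thesis by (auto simp: esym_def mps_nth_res mps_nth_X_mult)
  qed
qed

lemma fmap_res_Es: "fmap (res {..<n}) Es = (\<Prod>j<n. 1 + fps_const (X j) * fps_X)"
proof (induction n)
  case 0
  show ?case by (rule fps_ext) (simp add: Es_def res_esym_0[unfolded lessThan_0])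
next
  case (Suc n)
  have "fmap (res {..<Suc n}) Es = (1 + fps_const (X n) * fps_X) * fmap (res {..<n}) Es"
    by (rule fps_ext) (simp only: fmap_nth Es_def fps_nth_Abs_fps res_esym_Suc distrib_right fps_add_nth mult_1_left mult.assoc
        fps_mult_left_const_nth fps_X_mult_nth if_distrib[of "\<lambda>x. X n * x"] mult_zero_right)
  then show ?case by (simp add: Suc mult.commute)
qed

lemma fmap_res_Hs: "(\<Prod>j<n. 1 - fps_const (X j) * fps_X) * fmap (res {..<n}) Hs = 1"
proof (induction n)
  case 0
  have "fmap (res {}) Hs = 1"
    by (rule fps_ext) (simp add: Hs_def res_hsym_0[unfolded lessThan_0])
  then show ?case by simp
next
  case (Suc n)
  have "(1 - fps_const (X n) * fps_X) * fmap (res {..<Suc n}) Hs = fmap (res {..<n}) Hs"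
  proof (rule fps_ext)
    fix k
    show "fps_nth ((1 - fps_const (X n) * fps_X) * fmap (res {..<Suc n}) Hs) k = fps_nth (fmap (res {..<n}) Hs) k"
      using res_hsym_Suc[of n k] by (simp add: Hs_def left_diff_distrib mult.assoc)
  qed
  then show ?case using Suc by (simp add: mult.assoc)
qed

text \<open>In finitely many variables the first factor is the product of the 1 - \<open>X j\<close>
  t and the second is its inverse.\<close>

lemma Es_neg_Hs: "Abs_fps (\<lambda>k. (-1) ^ k * esym k) * Hs = 1"
proof (rule fps_eqI_res)
  fix n
  interpret r: rhom "fmap (res {..<n}) :: series fps \<Rightarrow> _" by (intro rhom_fmap rhom_res)
  interpret r': rhom "res {..<n} :: series \<Rightarrow> _" by (rule rhom_res)
  have "fmap (res {..<n}) (Abs_fps (\<lambda>k. (-1) ^ k * esym k)) =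
      Abs_fps (\<lambda>k. (-1) ^ k * fps_nth (\<Prod>j<n. 1 + fps_const (X j) * fps_X) k)"
    unfolding fmap_res_Es[symmetric] by (rule fps_ext) (simp add: r'.hom Es_def)
  also have "\<dots> = (\<Prod>j<n. 1 - fps_const (X j) * fps_X)"
  proof (induction n)
    case (Suc n)
    let ?P = "\<Prod>j<n. 1 + fps_const (X j) * fps_X :: series fps"
    have "Abs_fps (\<lambda>k. (-1) ^ k * fps_nth (\<Prod>j<Suc n. 1 + fps_const (X j) * fps_X) k) =
      (1 - fps_const (X n) * fps_X) * Abs_fps (\<lambda>k. (-1) ^ k * fps_nth ?P k)"
    proof (rule fps_ext)
      fix k
      show "fps_nth (Abs_fps (\<lambda>k. (-1) ^ k * fps_nth (\<Prod>j<Suc n. 1 + fps_const (X j) * fps_X) k)) k =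
        fps_nth ((1 - fps_const (X n) * fps_X) * Abs_fps (\<lambda>k. (-1) ^ k * fps_nth ?P k)) k"
      proof (cases k)
        case (Suc k')
        have e: "(\<Prod>j<Suc n. 1 + fps_const (X j) * fps_X) = ?P + fps_const (X n) * (fps_X * ?P)"
          by (simp add: algebra_simps)
        show ?thesis unfolding e by (simp add: Suc left_diff_distrib mult.assoc algebra_simps)
      qed (simp add: algebra_simps)
    qed
    then show ?case by (simp only: Suc prod.lessThan_Suc mult.commute[of "1 - fps_const (X n) * fps_X"])
  qed (rule fps_ext, simp)
  finally show "fmap (res {..<n}) (Abs_fps (\<lambda>k. (-1) ^ k * esym k) * Hs) = fmap (res {..<n}) 1"
    by (simp only: r.hom fmap_res_Hs)
qed

lemma esym_hsym_alternating:
  assumes "k > 0"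
  shows "(\<Sum>i\<le>k. (-1) ^ i * (esym i * hsym (k - i))) = 0"
  using Es_neg_Hs[THEN arg_cong[of _ _ "\<lambda>F. fps_nth F k"]] assms
  by (simp add: fps_mult_nth Hs_def atMost_atLeast0 mult.assoc)

text \<open>Toggling \<open>\<kappa>\<close> in the topmost row where \<open>p\<close> and \<open>q\<close> differ is a sign reversing involution.\<close>

lemma sum_hs_vs:
  assumes P: "p \<in> Part" "q \<in> Part" "p \<noteq> q"
  shows "(\<Sum>K | K \<in> Part \<and> hs p K \<and> vs K q. (-1 :: int) ^ (psize q - psize K)) = 0"
proof -
  let ?S = "{K. K \<in> Part \<and> hs p K \<and> vs K q}"
  define r where "r = (LEAST r. p r \<noteq> q r)"
  have ex: "\<exists>r. p r \<noteq> q r" using P(3) by (simp add: fun_eq_iff)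
  have r: "p r \<noteq> q r" unfolding r_def by (rule LeastI_ex[OF ex])
  have below: "p i = q i" if "i < r" for i using not_less_Least[OF that[unfolded r_def]] by simp
  define \<tau> where "\<tau> K = K(r := if K r = q r then q r - 1 else q r)" for K :: "nat \<Rightarrow> nat"
  have key: "\<tau> K \<in> ?S \<and> \<tau> (\<tau> K) = K \<and> (-1 :: int) ^ (psize q - psize (\<tau> K)) = - ((-1) ^ (psize q - psize K))"
    if K: "K \<in> ?S" for K
  proof -
    have c: "p i \<le> K i" "K (Suc i) \<le> p i" "K i \<le> q i" "q i \<le> Suc (K i)" "q (Suc i) \<le> q i" for i
      using K Part_step[OF P(2)] by (auto simp: hs_def vs_def)
    have KP: "K \<in> Part" using K by simp
    have pq: "p r < q r" using c[of r] r by linarith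
    have tr: "\<tau> K r = (if K r = q r then q r - 1 else q r)" "\<tau> K i = (if i = r then \<tau> K r else K i)" for i
      by (auto simp: \<tau>_def)
    have Kr: "K r = q r \<or> K r = q r - 1" using c[of r] by linarith
    \<comment> \<open>Above row \<open>r\<close> the shapes p and q agree and squeeze K between
      them; hence raising row \<open>r\<close> of K to \<open>q r\<close> keeps rows weakly
      decreasing and the strip condition intact.\<close>
    have up: "q r \<le> K i" if "Suc i = r" for i
      using below[of i] c(1,3)[of i] c(5)[of i] that by auto
    have hs: "hs p (\<tau> K)"
      unfolding hs_def
    proof (intro allI conjI)
      fix i
      show "p i \<le> \<tau> K i" using c(1)[of i] pq tr(1) tr(2)[of i] by auto
      show "\<tau> K (Suc i) \<le> p i"
        using c(2)[of i] tr(1) tr(2)[of "Suc i"] up[of i] below[of i] c(3)[of i]  by (cases "Suc i = r") auto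
    qed
    have vs: "vs (\<tau> K) q"
      unfolding vs_def
    proof (intro allI conjI)
      fix i
      show "\<tau> K i \<le> q i" using c(3)[of i] tr(1) tr(2)[of i] by auto
      show "q i \<le> Suc (\<tau> K i)" using c(4)[of i] tr(1) tr(2)[of i] by auto
    qed
    have stp: "\<tau> K (Suc i) \<le> \<tau> K i" for i using hs unfolding hs_def by (meson le_trans)
    obtain R where R: "\<And>i. i \<ge> R \<Longrightarrow> q i = 0"
      using P(2) unfolding Part_def by blast
    have z: "\<tau> K i = 0" "K i = 0" if "i \<ge> R" for i
      using vs c(3)[of i] R[OF that] unfolding vs_def by (metis le_zero_eq)+
    have tP: "\<tau> K \<in> Part" unfolding Part_def using stp z by blast
    have rR: "r < R" using pq R[of r] by (metis not_less0 not_le)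
    have s: "psize f = f r + (\<Sum>i\<in>{..<R} - {r}. f i)" if "\<And>i. i \<ge> R \<Longrightarrow> f i = 0" for f
      using rR by (simp add: psize_sum[OF that] sum.remove)
    have same: "(\<Sum>i\<in>{..<R} - {r}. \<tau> K i) = (\<Sum>i\<in>{..<R} - {r}. K i)"
      by (rule sum.cong) (auto simp: \<tau>_def)
    have le: "psize K \<le> psize q" "psize (\<tau> K) \<le> psize q"
      using P(2) c(3) vs by (auto intro!: psize_mono simp: vs_def)
    have "psize (\<tau> K) + K r = psize K + \<tau> K r" using s[OF z(1)] s[OF z(2)] same by simp
    then have "psize q - psize (\<tau> K) = Suc (psize q - psize K) \<or> psize q - psize K = Suc (psize q - psize (\<tau> K))"
      using tr(1) Kr pq le by (auto split: if_splits)
    then have sg: "(-1 :: int) ^ (psize q - psize (\<tau> K)) = - ((-1) ^ (psize q - psize K))" by auto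
    have "\<tau> (\<tau> K) = K" using Kr pq by (auto simp: \<tau>_def fun_eq_iff)
    then show ?thesis using hs vs tP sg by simp
  qed
  let ?f = "\<lambda>K. (-1 :: int) ^ (psize q - psize K)"
  have "sum ?f ?S = (\<Sum>K\<in>?S. - ?f K)"
    by (rule sum.reindex_bij_witness[of _ \<tau> \<tau>]) (use key in auto)
  then show ?thesis by (simp add: sum_negf)
qed

text \<open>Both sides satisfy the same recursion. The alternating sums of \<open>e i\<close> times
  \<open>h (k - i)\<close> vanish by assumption, those of the corresponding strips vanish by
  \<open>sum_hs_vs\<close>, and the terms with i < k agree by induction, so the terms with i = k
  agree as well.\<close>

lemma pieri_e_from_h:
  fixes F :: "(nat \<Rightarrow> nat) \<Rightarrow> 'a :: comm_ring_1"
  assumes h: "\<And>p k. p \<in> Part \<Longrightarrow> h k * F p = (\<Sum>q | q \<in> Part \<and> hs p q \<and> psize q = psize p + k. F q)"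
    and e0: "e 0 = 1" and alt: "\<And>k :: nat. k > 0 \<Longrightarrow> (\<Sum>i\<le>k. (-1) ^ i * (e i * h (k - i))) = 0"
    and p: "p \<in> Part"
  shows "e k * F p = (\<Sum>q | q \<in> Part \<and> vs p q \<and> psize q = psize p + k. F q)"
  using p
proof (induction k arbitrary: p rule: less_induct)
  case (less k)
  note p = less.prems
  have hs0: "{q. q \<in> Part \<and> hs p q \<and> psize q = psize p} = {p}"
    using psize_eq_imp_eq[of _ p] p Part_step[OF p] by (fastforce simp: hs_def)
  have vs0: "{q. q \<in> Part \<and> vs p q \<and> psize q = psize p} = {p}"
    using psize_eq_imp_eq[of _ p] p by (fastforce simp: vs_def)
  show ?case
  proof (cases "k = 0")
    case True
    then show ?thesis using vs0 by (simp add: e0)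
  next
    case False
    let ?T = "{q \<in> Part. psize q \<le> psize p + k}"
    let ?H = "\<lambda>i. {K. K \<in> Part \<and> hs p K \<and> psize K = psize p + (k - i)}"
    let ?V = "\<lambda>i K. {q. q \<in> Part \<and> vs K q \<and> psize q = psize K + i}"
    have "(\<Sum>i\<le>k. (-1) ^ i * (\<Sum>K\<in>?H i. \<Sum>q\<in>?V i K. F q)) =
      (\<Sum>i\<le>k. (-1) ^ i * (\<Sum>K\<in>?H i. \<Sum>q | q \<in> {q \<in> Part. psize q = psize p + k} \<and> vs K q. F q))"
    proof (intro sum.cong refl arg_cong2[where f = times])
      fix i K assume "i \<in> {..k}" "K \<in> ?H i"
      then show "?V i K = {q. q \<in> {q \<in> Part. psize q = psize p + k} \<and> vs K q}" by auto
    qed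
    also have "\<dots> = (\<Sum>i\<le>k. (-1) ^ i * (\<Sum>q | q \<in> Part \<and> psize q = psize p + k. \<Sum>K | K \<in> ?H i \<and> vs K q. F q))"
    proof (rule sum.cong[OF refl], rule arg_cong[where f = "\<lambda>x. (-1) ^ _ * x"])
      fix i
      show "(\<Sum>K\<in>?H i. \<Sum>q | q \<in> {q \<in> Part. psize q = psize p + k} \<and> vs K q. F q) =
        (\<Sum>q | q \<in> Part \<and> psize q = psize p + k. \<Sum>K | K \<in> ?H i \<and> vs K q. F q)"
        by (rule sum.swap_restrict) (simp_all add: finite_psize_le'[of "\<lambda>_. True", simplified])
    qed
    also have "\<dots> = (\<Sum>q | q \<in> Part \<and> psize q = psize p + k. \<Sum>i\<le>k. \<Sum>K | K \<in> ?H i \<and> vs K q. (-1) ^ i * F q)"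
      unfolding sum_distrib_left by (rule sum.swap)
    also have "\<dots> = 0"
    proof (rule sum.neutral, clarify)
      fix q assume q: "q \<in> Part" "psize q = psize p + k"
      let ?S = "{K. K \<in> Part \<and> hs p K \<and> vs K q}"
      have b: "psize p \<le> psize K \<and> psize K \<le> psize q" if "K \<in> ?S" for K
        using that q(1) psize_mono[of K p] psize_mono[of q K] by (simp add: hs_def vs_def)
      have finS: "finite ?S" using b by (intro finite_subset[OF _ finite_psize_le[of "psize q"]]) auto
      have "(\<Sum>i\<le>k. \<Sum>K | K \<in> ?H i \<and> vs K q. (-1) ^ i * F q) =
        (\<Sum>i\<le>k. \<Sum>K | K \<in> ?S \<and> psize q - psize K = i. (-1) ^ (psize q - psize K) * F q)"
      proof (intro sum.cong refl)
        fix i assume "i \<in> {..k}"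
        then show "{K. K \<in> ?H i \<and> vs K q} = {K. K \<in> ?S \<and> psize q - psize K = i}" using b q by fastforce
      qed auto
      also have "\<dots> = (\<Sum>K\<in>?S. (-1) ^ (psize q - psize K) * F q)"
      proof (rule sum.group[OF finS])
        show "(\<lambda>K. psize q - psize K) ` ?S \<subseteq> {..k}"
        proof (rule image_subsetI)
          fix K assume "K \<in> ?S"
          then show "psize q - psize K \<in> {..k}" unfolding atMost_iff using b[of K] q(2) by linarith
        qed
      qed simp
      also have "\<dots> = of_int (\<Sum>K\<in>?S. (-1) ^ (psize q - psize K)) * F q"
        by (simp add: sum_distrib_right)
      also have "\<dots> = 0"
        using q False by (subst sum_hs_vs[OF p]) auto
      finally show "(\<Sum>i\<le>k. \<Sum>K | K \<in> ?H i \<and> vs K q. (-1) ^ i * F q) = 0" .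
    qed
    finally have A: "(\<Sum>i\<le>k. (-1) ^ i * (\<Sum>K\<in>?H i. \<Sum>q\<in>?V i K. F q)) = 0" .
    have "(\<Sum>i\<le>k. (-1) ^ i * (\<Sum>K\<in>?H i. e i * F K)) = (\<Sum>i\<le>k. (-1) ^ i * (e i * h (k - i))) * F p"
      by (simp add: sum_distrib_right mult.assoc h[OF p] sum_distrib_left)
    then have B: "(\<Sum>i\<le>k. (-1) ^ i * (\<Sum>K\<in>?H i. e i * F K)) = 0" using alt False by simp
    have C: "(\<Sum>i<k. (-1) ^ i * (\<Sum>K\<in>?H i. e i * F K)) = (\<Sum>i<k. (-1) ^ i * (\<Sum>K\<in>?H i. \<Sum>q\<in>?V i K. F q))"
      using less.IH by (intro sum.cong refl arg_cong2[where f = times]) auto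
    have split: "(\<Sum>i\<le>k. f i) = (\<Sum>i<k. f i) + f k" for f :: "nat \<Rightarrow> 'a"
      by (simp add: lessThan_Suc_atMost[symmetric])
    have Hk: "?H k = {p}" using hs0 by simp
    let ?S = "\<Sum>i<k. (-1) ^ i * (\<Sum>K\<in>?H i. \<Sum>q\<in>?V i K. F q)"
    have "?S + (-1) ^ k * (e k * F p) = 0" using B unfolding split C Hk by simp
    moreover have "?S + (-1) ^ k * (\<Sum>q\<in>?V k p. F q) = 0" using A unfolding split Hk by simp
    ultimately have "?S + (-1) ^ k * (e k * F p) = ?S + (-1) ^ k * (\<Sum>q\<in>?V k p. F q)" by (simp only:)
    then have "(-1) ^ k * (e k * F p) = (-1) ^ k * (\<Sum>q\<in>?V k p. F q)" by (simp only: add_left_cancel)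
    then have "(-1) ^ k * ((-1) ^ k * (e k * F p)) = (-1) ^ k * ((-1) ^ k * (\<Sum>q\<in>?V k p. F q))" by simp
    then show ?thesis by (simp add: mult.assoc[symmetric] power_add[symmetric] flip: mult_2)
  qed
qed

section \<open>Lowest monomials and linear independence\<close>

definition row_mset :: "(nat \<times> nat) set \<Rightarrow> nat multiset"
  where "row_mset D = (\<Sum>b\<in>D. {#fst b#})"

text \<open>The index is shifted by 1 so that an additional entry of index 0 raises the height too;
  this matters for set-valued tableaux.\<close>

definition height :: "nat multiset \<Rightarrow> nat"
  where "height A = (\<Sum>a\<in>#A. Suc a)"

lemma height_add: "height (A + B) = height A + height B"
  and height_single [simp]: "height {#a#} = Suc a"
  by (simp_all add: height_def)

lemma height_sum: "height (\<Sum>b\<in>D. f b) = (\<Sum>b\<in>D. height (f b))"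
  by (induction D rule: infinite_finite_induct) (simp_all add: height_add, simp_all add: height_def)

lemma count_row_mset: "finite D \<Longrightarrow> count (row_mset D) i = card {b \<in> D. fst b = i}"
  by (simp add: row_mset_def count_sum sum.inter_filter[symmetric] if_distrib cong: if_cong)

lemma size_row_mset: "size (row_mset D) = card D"
  by (simp add: row_mset_def size_multiset_sum)

text \<open>Triangularity with respect to \<open>height\<close>: \<open>w\<close> is the lowest monomial of \<open>f\<close>.\<close>

definition leading :: "nat multiset \<Rightarrow> series \<Rightarrow> bool"
  where "leading w f \<longleftrightarrow> mps_nth f w \<noteq> 0 \<and> (\<forall>A. mps_nth f A \<noteq> 0 \<longrightarrow> height w < height A \<or> A = w)"

text \<open>At the lowest monomial among the terms with nonzero coefficient, every other such term
  vanishes.\<close>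

lemma leading_coeff_min:
  assumes "finite P" "i \<in> P" "inj_on w P" "\<And>j. j \<in> P \<Longrightarrow> leading (w j) (f j)"
    and min: "\<And>j. j \<in> P \<Longrightarrow> c j \<noteq> 0 \<Longrightarrow> height (w i) \<le> height (w j)"
  shows "mps_nth (\<Sum>j\<in>P. const (c j) * f j) (w i) = c i * mps_nth (f i) (w i)"
proof -
  have "mps_nth (\<Sum>j\<in>P. const (c j) * f j) (w i) = (\<Sum>j\<in>P. if j = i then c i * mps_nth (f i) (w i) else 0)"
    unfolding mps_nth_sum
  proof (intro sum.cong refl)
    fix j assume j: "j \<in> P"
    show "mps_nth (const (c j) * f j) (w i) = (if j = i then c i * mps_nth (f i) (w i) else 0)"
    proof (cases "j = i \<or> c j = 0 \<or> mps_nth (f j) (w i) = 0")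
      case False
      then have "height (w j) < height (w i) \<or> w i = w j" using assms(4)[OF j] unfolding leading_def by blast
      moreover have "w i \<noteq> w j" using assms(2,3) j False by (auto dest: inj_onD)
      ultimately show ?thesis using min[OF j] False by auto
    qed auto
  qed
  then show ?thesis using assms(1,2) by simp
qed

lemma leading_indep:
  assumes "finite P" "inj_on w P" "\<And>j. j \<in> P \<Longrightarrow> leading (w j) (f j)"
    and z: "(\<Sum>j\<in>P. const (c j) * f j) = 0"
  shows "\<forall>j\<in>P. c j = 0"
proof (rule ccontr)
  assume "\<not> (\<forall>j\<in>P. c j = 0)"
  then have "\<exists>i. i \<in> P \<and> c i \<noteq> 0" by blast
  then obtain i where i: "i \<in> P" "c i \<noteq> 0" "\<And>j. j \<in> P \<and> c j \<noteq> 0 \<Longrightarrow> height (w i) \<le> height (w j)"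
    using ex_has_least_nat[of "\<lambda>i. i \<in> P \<and> c i \<noteq> 0" _ "\<lambda>i. height (w i)"] by metis
  have "c i * mps_nth (f i) (w i) = 0"
    using leading_coeff_min[OF assms(1) i(1) assms(2,3), of c] i(3) by (simp add: z)
  then show False using i(1,2) assms(3) by (simp add: leading_def)
qed

section \<open>Partitions as lists and as row functions, conjugation\<close>

definition rowf :: "nat list \<Rightarrow> nat \<Rightarrow> nat"
  where "rowf lam i = (if i < length lam then lam ! i else 0)"

lemma YD_eq: "YD lam = YDc (rowf lam)"
  by (auto simp: YD_def rowf_def split: if_splits)

lemma rowf_Part: "lam \<in> partitions \<Longrightarrow> rowf lam \<in> Part"
  unfolding Part_def
proof (clarify, intro conjI allI exI[of _ "length lam"] impI)
  fix i assume "lam \<in> partitions"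
  then have "sorted_wrt (\<ge>) lam" by (simp add: partitions_def)
  then show "rowf lam (Suc i) \<le> rowf lam i" by (simp add: rowf_def sorted_wrt_iff_nth_less)
qed (simp add: rowf_def)

lemma map_Part:
  assumes p: "p \<in> Part" and n: "\<And>i. i < n \<longleftrightarrow> p i \<noteq> 0"
  shows "map p [0..<n] \<in> partitions" "rowf (map p [0..<n]) = p"
proof -
  show "rowf (map p [0..<n]) = p" using n by (auto simp: rowf_def fun_eq_iff)
  have "0 \<notin> set (map p [0..<n])" using n by force
  then show "map p [0..<n] \<in> partitions"
    using Part_antimono[OF p] by (auto simp: partitions_def sorted_wrt_iff_nth_less)
qed

lemma rowf_inj: "inj_on rowf partitions"
proof (rule inj_onI)
  fix l m assume l: "l \<in> partitions" and m: "m \<in> partitions" and e: "rowf l = rowf m"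
  have "i < length k \<longleftrightarrow> rowf k i \<noteq> 0" if "k \<in> partitions" for i k
    using that nth_mem[of i k] by (cases "k ! i = 0") (auto simp: rowf_def partitions_def)
  then have "i < length l \<longleftrightarrow> i < length m" for i using l m e by metis
  then have len: "length l = length m" by (metis linorder_neqE_nat less_irrefl)
  show "l = m"
    using len e by (intro nth_equalityI) (auto simp: rowf_def fun_eq_iff, metis)
qed

lemma bij_rowf: "bij_betw rowf partitions Part"
proof (rule bij_betw_imageI[OF rowf_inj], intro equalityI subsetI)
  fix p assume p: "p \<in> Part"
  have "finite {i. p i \<noteq> 0}"
  proof -
    obtain R where R: "\<And>i. i \<ge> R \<Longrightarrow> p i = 0" using p unfolding Part_def by blast
    have "{i. p i \<noteq> 0} \<subseteq> {..<R}"
    proof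
      fix i assume "i \<in> {i. p i \<noteq> 0}"
      then show "i \<in> {..<R}" using R[of i] by (cases "i < R") auto
    qed
    then show ?thesis by (rule finite_subset) simp
  qed
  moreover have "i \<in> {i. p i \<noteq> 0}" if "Suc i \<in> {i. p i \<noteq> 0}" for i
    using that Part_step[OF p, of i] by auto
  ultimately have "{i. p i \<noteq> 0} = {..<card {i. p i \<noteq> 0}}" by (rule downset_nat)
  then have "i < card {i. p i \<noteq> 0} \<longleftrightarrow> p i \<noteq> 0" for i by blast
  from map_Part[OF p this] show "p \<in> rowf ` partitions" by (metis imageI)
qed (use rowf_Part in blast)

definition lst :: "(nat \<Rightarrow> nat) \<Rightarrow> nat list"
  where "lst = inv_into partitions rowf"

lemma lst_rowf [simp]: "lam \<in> partitions \<Longrightarrow> lst (rowf lam) = lam"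
  by (simp add: lst_def rowf_inj)

lemma rowf_lst [simp]: "p \<in> Part \<Longrightarrow> rowf (lst p) = p"
  and lst_partitions [simp]: "p \<in> Part \<Longrightarrow> lst p \<in> partitions"
  using bij_rowf unfolding lst_def bij_betw_def by (auto intro: f_inv_into_f inv_into_into)

definition cj :: "(nat \<Rightarrow> nat) \<Rightarrow> nat \<Rightarrow> nat"
  where "cj p j = card {i. j < p i}"

lemma less_cj:
  assumes "p \<in> Part"
  shows "i < cj p j \<longleftrightarrow> j < p i"
proof -
  obtain R where R: "\<And>i. i \<ge> R \<Longrightarrow> p i = 0" using assms unfolding Part_def by blast
  have "{i. j < p i} \<subseteq> {..<R}"
  proof
    fix i assume "i \<in> {i. j < p i}"
    then show "i \<in> {..<R}" using R[of i] by (cases "i < R") auto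
  qed
  then have "finite {i. j < p i}" by (rule finite_subset) simp
  moreover have "i \<in> {i. j < p i}" if "Suc i \<in> {i. j < p i}" for i
    using that Part_step[OF assms, of i] by simp
  ultimately have "{i. j < p i} = {..<cj p j}" unfolding cj_def by (rule downset_nat)
  then show ?thesis by blast
qed

lemma cj_Part:
  assumes p: "p \<in> Part"
  shows "cj p \<in> Part"
proof -
  have "cj p (Suc j) \<le> cj p j" for j
  proof (rule ccontr)
    assume "\<not> cj p (Suc j) \<le> cj p j"
    then have "cj p j < cj p (Suc j)" by simp
    then have "Suc j < p (cj p j)" "\<not> j < p (cj p j)" using less_cj[OF p, of "cj p j"] by blast+
    then show False by simp
  qed
  moreover have "cj p j = 0" if "j \<ge> p 0" for j
    using less_cj[OF p, of 0 j] that by simp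
  ultimately show ?thesis unfolding Part_def by blast
qed

lemma cj_cj:
  assumes p: "p \<in> Part"
  shows "cj (cj p) = p"
proof
  fix i
  have "j < cj (cj p) i \<longleftrightarrow> j < p i" for j
    using less_cj[OF cj_Part[OF p], of j i] less_cj[OF p, of i j] by simp
  then show "cj (cj p) i = p i" by (metis linorder_neqE_nat less_irrefl)
qed

lemma psize_cj:
  assumes p: "p \<in> Part"
  shows "psize (cj p) = psize p"
  unfolding psize_def
  by (rule bij_betw_same_card[of prod.swap], rule bij_betw_byWitness[where f' = prod.swap])
     (auto simp: YDc_def less_cj[OF p])

lemma hs_iff: "p \<in> Part \<Longrightarrow> hs p q \<longleftrightarrow> (\<forall>i j. j < p i \<longrightarrow> j < q i) \<and> (\<forall>i j. j < q (Suc i) \<longrightarrow> j < p i)"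
  unfolding hs_def by (meson le_less_linear less_irrefl less_le_trans)

lemma vs_iff: "vs p q \<longleftrightarrow> (\<forall>i j. j < p i \<longrightarrow> j < q i) \<and> (\<forall>i j. Suc j < q i \<longrightarrow> j < p i)"
proof -
  have "q i \<le> Suc (p i) \<longleftrightarrow> (\<forall>j. Suc j < q i \<longrightarrow> j < p i)" for i
  proof
    assume *: "\<forall>j. Suc j < q i \<longrightarrow> j < p i"
    show "q i \<le> Suc (p i)"
      using *[rule_format, of "p i"] by (cases "q i \<le> Suc (p i)") auto
  qed auto
  moreover have "p i \<le> q i \<longleftrightarrow> (\<forall>j. j < p i \<longrightarrow> j < q i)" for i
    by (meson le_less_linear less_irrefl less_le_trans)
  ultimately show ?thesis unfolding vs_def by blast
qed

lemma vs_cj: "p \<in> Part \<Longrightarrow> q \<in> Part \<Longrightarrow> vs (cj p) (cj q) \<longleftrightarrow> hs p q"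
  by (auto simp: vs_iff hs_iff less_cj)

lemma rowf_conjugate:
  assumes lam: "lam \<in> partitions"
  shows "conjugate lam \<in> partitions" "rowf (conjugate lam) = cj (rowf lam)"
proof -
  let ?p = "rowf lam"
  note p = rowf_Part[OF lam]
  have "{i. i < length lam \<and> j < lam ! i} = {i. j < ?p i}" for j by (auto simp: rowf_def)
  then have c: "length (filter (\<lambda>r. j < r) lam) = cj ?p j" for j by (simp add: length_filter_conv_card cj_def)
  have "conjugate lam = map (cj ?p) [0..<?p 0]"
    unfolding c[symmetric] by (cases lam) (simp_all add: conjugate_def rowf_def)
  moreover have "j < ?p 0 \<longleftrightarrow> cj ?p j \<noteq> 0" for j using less_cj[OF p, of 0 j] by simp
  ultimately show "conjugate lam \<in> partitions" "rowf (conjugate lam) = cj ?p"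
    using map_Part[OF cj_Part[OF p]] by simp_all
qed

section \<open>Schur functions in infinitely many variables\<close>

definition wtY :: "nat list \<Rightarrow> (nat \<times> nat \<Rightarrow> nat) \<Rightarrow> nat multiset"
  where "wtY lam T = (\<Sum>b\<in>YD lam. {#T b#})"

lemma schur_eq: "schur lam = formal_sum (\<lambda>T. const 1 * mon (wtY lam T)) (SSYT lam)"
proof -
  interpret c: rhom "const :: int poly \<Rightarrow> series" by (rule rhom_const)
  show ?thesis by (simp add: schur_def wtY_def c.one prod_mon[symmetric] X_eq_mon)
qed

lemma tabs_SSYT: "tabs (\<le>) (<) (YD lam) {..<n} = {T \<in> SSYT lam. \<forall>b\<in>YD lam. T b < n}"
  by (auto simp: tabs_def SSYT_def PiE_iff)

lemma finite_YD [simp]: "finite (YD lam)"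
  by (rule finite_subset[of _ "SIGMA i:{..<length lam}. {..<lam ! i}"]) (auto simp: YD_def)

lemma wtY_set: "set_mset (wtY lam T) = T ` YD lam"
  by (auto simp: wtY_def set_mset_sum)

lemma SSYT_wt_bound: "set_mset M \<subseteq> {..<n} \<Longrightarrow> {T \<in> SSYT lam. wtY lam T = M} \<subseteq> tabs (\<le>) (<) (YD lam) {..<n}"
  unfolding tabs_SSYT using wtY_set by fastforce

lemma finite_SSYT_wt: "finite {T \<in> SSYT lam. wtY lam T = M}"
proof -
  obtain n where "set_mset M \<subseteq> {..<n}" using finite_nat_iff_bounded finite_set_mset by blast
  then show ?thesis by (rule finite_subset[OF SSYT_wt_bound]) simp
qed

lemma mps_nth_schur: "mps_nth (schur lam) M = of_nat (card {T \<in> SSYT lam. wtY lam T = M})"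
  unfolding schur_eq by (subst mps_nth_weighted) (simp_all add: finite_SSYT_wt)

lemma res_schur: "res {..<n} (schur lam) = schur_fin n (rowf lam)"
proof (rule mps_eqI)
  fix M
  interpret c: rhom "const :: int poly \<Rightarrow> series" by (rule rhom_const)
  have fin: "schur_fin n (rowf lam) = (\<Sum>T\<in>tabs (\<le>) (<) (YD lam) {..<n}. mon (wtY lam T))"
    by (simp add: schur_fin_def YD_eq wtY_def prod_mon[symmetric] X_eq_mon)
  show "mps_nth (res {..<n} (schur lam)) M = mps_nth (schur_fin n (rowf lam)) M"
  proof (cases "set_mset M \<subseteq> {..<n}")
    case True
    have "mps_nth (schur lam) M = mps_nth (\<Sum>T\<in>tabs (\<le>) (<) (YD lam) {..<n}. const 1 * mon (wtY lam T)) M"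
      unfolding schur_eq
      by (rule mps_nth_weighted_subset[OF finite_SSYT_wt _ _ SSYT_wt_bound[OF True]]) (auto simp: tabs_SSYT[symmetric], simp add: tabs_SSYT)
    then show ?thesis using True by (simp add: mps_nth_res fin c.one)
  next
    case False
    have ne: "M \<noteq> wtY lam T" if "T \<in> tabs (\<le>) (<) (YD lam) {..<n}" for T
      using that False wtY_set[of lam T] unfolding tabs_SSYT by fastforce
    have "(\<Sum>T\<in>tabs (\<le>) (<) (YD lam) {..<n}. mps_nth (mon (wtY lam T) :: series) M) = 0"
      by (rule sum.neutral) (simp add: mps_nth_mon ne)
    then show ?thesis using False by (simp add: mps_nth_res fin)
  qed
qed

definition sch :: "(nat \<Rightarrow> nat) \<Rightarrow> series"
  where "sch p = schur (lst p)"

lemma pieri_h: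
  assumes p: "p \<in> Part"
  shows "hsym k * sch p = (\<Sum>q | q \<in> Part \<and> hs p q \<and> psize q = psize p + k. sch q)"
proof (rule mps_eqI_res)
  fix n
  interpret r: rhom "res {..<n} :: series \<Rightarrow> _" by (rule rhom_res)
  show "res {..<n} (hsym k * sch p) = res {..<n} (\<Sum>q | q \<in> Part \<and> hs p q \<and> psize q = psize p + k. sch q)"
    using p by (simp add: r.hom sch_def res_schur pieri_h_fin)
qed

lemma esym_0: "esym 0 = 1"
  by (rule mps_eqI) (auto simp: esym_def one_mps_def)

lemma pieri_e:
  assumes "p \<in> Part"
  shows "esym k * sch p = (\<Sum>q | q \<in> Part \<and> vs p q \<and> psize q = psize p + k. sch q)"
  using pieri_e_from_h[of hsym sch esym, OF pieri_h esym_0 esym_hsym_alternating assms] .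

lemma SSYT_ge_row:
  assumes T: "T \<in> SSYT lam" and "lam \<in> partitions"
  shows "(i, j) \<in> YD lam \<Longrightarrow> i \<le> T (i, j)"
proof (induction i)
  case (Suc i)
  have "(i, j) \<in> YD lam" using Suc.prems Part_step[OF rowf_Part[OF assms(2)], of i] unfolding YD_eq by simp
  moreover from this have "T (i, j) < T (Suc i, j)" using T Suc.prems by (simp add: SSYT_def)
  ultimately show ?case using Suc.IH by simp
qed simp

text \<open>Strict columns force every entry to be at least its row number, and only one tableau
  attains equality everywhere; hence the lowest coefficient is 1.\<close>

lemma leading_schur:
  assumes lam: "lam \<in> partitions"
  shows "leading (row_mset (YD lam)) (schur lam)" "mps_nth (schur lam) (row_mset (YD lam)) = 1"
proof -
  let ?w = "row_mset (YD lam)"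
  have ge: "height ?w < height (wtY lam T) \<or> T = restrict fst (YD lam)" if T: "T \<in> SSYT lam" for T
  proof (cases "\<forall>b\<in>YD lam. T b = fst b")
    case True
    then have "T = restrict fst (YD lam)" using T by (auto simp: SSYT_def extensional_def restrict_def)
    then show ?thesis by blast
  next
    case False
    then obtain b where b: "b \<in> YD lam" "T b \<noteq> fst b" by blast
    have le: "fst b \<le> T b" if "b \<in> YD lam" for b using SSYT_ge_row[OF T lam] that by (cases b) simp
    have "(\<Sum>b\<in>YD lam. Suc (fst b)) < (\<Sum>b\<in>YD lam. Suc (T b))"
      using le le[OF b(1)] b by (intro sum_strict_mono_ex1) (force intro!: bexI[of _ b])+
    then show ?thesis by (simp add: row_mset_def wtY_def height_sum)
  qed
  have top: "restrict fst (YD lam) \<in> SSYT lam" by (auto simp: SSYT_def)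
  have wt: "wtY lam (restrict fst (YD lam)) = ?w"
    unfolding wtY_def row_mset_def by (intro sum.cong refl) simp
  have "{T \<in> SSYT lam. wtY lam T = ?w} = {restrict fst (YD lam)}" using ge top wt by fastforce
  then show one: "mps_nth (schur lam) ?w = 1" by (simp add: mps_nth_schur)
  have "height ?w < height A \<or> A = ?w" if "mps_nth (schur lam) A \<noteq> 0" for A
  proof -
    have "{T \<in> SSYT lam. wtY lam T = A} \<noteq> {}" using that unfolding mps_nth_schur by (metis card.empty of_nat_0)
    then obtain T where "T \<in> SSYT lam" "wtY lam T = A" by blast
    then show ?thesis using ge[of T] wt by auto
  qed
  then show "leading ?w (schur lam)" using one by (simp add: leading_def)
qed

lemma row_mset_YDc: "p \<in> Part \<Longrightarrow> count (row_mset (YDc p)) i = p i"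
proof -
  assume p: "p \<in> Part"
  have "{b \<in> YDc p. fst b = i} = Pair i ` {..<p i}" by (auto simp: YDc_def)
  then show ?thesis by (simp add: count_row_mset p card_image inj_on_def)
qed

lemma leading_sch: "p \<in> Part \<Longrightarrow> leading (row_mset (YDc p)) (sch p)"
  and mps_nth_sch: "p \<in> Part \<Longrightarrow> mps_nth (sch p) (row_mset (YDc p)) = 1"
  using leading_schur[of "lst p"] by (simp_all add: sch_def YD_eq)

lemma inj_row_mset_YDc: "inj_on (\<lambda>p. row_mset (YDc p)) Part"
  by (rule inj_onI) (metis row_mset_YDc ext)

section \<open>The involution \<omega> on the span of the Schur functions\<close>

lemma const_0 [simp]: "const 0 = 0" and const_diff: "const (a - b) = const a - const b"
  using rhom.zero[OF rhom_const] rhom.diff[OF rhom_const] by auto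

text \<open>The description in \<open>\<omega>\<close> denotes something only if the conjugated sum
  does not depend on the chosen expansion. By linear independence, the difference of two expansions
  of one series has only zero coefficients, so conjugating it still gives 0.\<close>

lemma omega_sch:
  assumes P: "finite P" "P \<subseteq> Part"
  shows "\<omega> (\<Sum>p\<in>P. const (c p) * sch p) = (\<Sum>p\<in>P. const (c p) * sch (cj p))"
proof -
  have conj: "schur (conjugate lam) = sch (cj (rowf lam))" if "lam \<in> partitions" for lam
    using rowf_conjugate[OF that] by (metis lst_rowf sch_def)
  have tr: "(\<Sum>lam\<in>Q. const (d lam) * schur lam) = (\<Sum>p\<in>rowf ` Q. const (d (lst p)) * sch p)"
    "(\<Sum>lam\<in>Q. const (d lam) * schur (conjugate lam)) = (\<Sum>p\<in>rowf ` Q. const (d (lst p)) * sch (cj p))"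
    if "Q \<subseteq> partitions" for Q d
  proof -
    have i: "inj_on rowf Q" using rowf_inj that by (rule inj_on_subset)
    show "(\<Sum>lam\<in>Q. const (d lam) * schur lam) = (\<Sum>p\<in>rowf ` Q. const (d (lst p)) * sch p)"
      unfolding sum.reindex[OF i] using that by (intro sum.cong refl) (auto simp: sch_def)
    show "(\<Sum>lam\<in>Q. const (d lam) * schur (conjugate lam)) = (\<Sum>p\<in>rowf ` Q. const (d (lst p)) * sch (cj p))"
      unfolding sum.reindex[OF i] using that conj by (intro sum.cong refl) (auto simp: subset_iff)
  qed
  have uniq: "(\<Sum>p\<in>Q. const (d p) * sch (cj p)) = (\<Sum>p\<in>P. const (c p) * sch (cj p))"
    if Q: "finite Q" "Q \<subseteq> Part" and e: "(\<Sum>p\<in>Q. const (d p) * sch p) = (\<Sum>p\<in>P. const (c p) * sch p)" for Q d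
  proof -
    define a where "a p = (if p \<in> P then c p else 0) - (if p \<in> Q then d p else 0)" for p
    have split: "(\<Sum>p\<in>P \<union> Q. const (a p) * F p) = (\<Sum>p\<in>P. const (c p) * F p) - (\<Sum>p\<in>Q. const (d p) * F p)"
      for F :: "(nat \<Rightarrow> nat) \<Rightarrow> series"
    proof -
      have "(\<Sum>p\<in>P \<union> Q. const (a p) * F p) = (\<Sum>p\<in>P \<union> Q. if p \<in> P then const (c p) * F p else 0)
          - (\<Sum>p\<in>P \<union> Q. if p \<in> Q then const (d p) * F p else 0)"
        unfolding sum_subtractf[symmetric] by (intro sum.cong refl) (simp add: a_def const_diff left_diff_distrib)
      also have "(\<Sum>p\<in>P \<union> Q. if p \<in> P then const (c p) * F p else 0) = (\<Sum>p\<in>P. const (c p) * F p)"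
        using P(1) Q(1) by (intro sum.mono_neutral_cong_right) auto
      also have "(\<Sum>p\<in>P \<union> Q. if p \<in> Q then const (d p) * F p else 0) = (\<Sum>p\<in>Q. const (d p) * F p)"
        using P(1) Q(1) by (intro sum.mono_neutral_cong_right) auto
      finally show ?thesis .
    qed
    have PQ: "finite (P \<union> Q)" "P \<union> Q \<subseteq> Part" using P Q by auto
    have "\<forall>p\<in>P \<union> Q. a p = 0"
    proof (rule leading_indep[OF PQ(1), where w = "\<lambda>p. row_mset (YDc p)" and f = sch])
      show "inj_on (\<lambda>p. row_mset (YDc p)) (P \<union> Q)" using inj_row_mset_YDc PQ(2) by (rule inj_on_subset)
      show "leading (row_mset (YDc p)) (sch p)" if "p \<in> P \<union> Q" for p using that PQ(2) leading_sch by blast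
      show "(\<Sum>p\<in>P \<union> Q. const (a p) * sch p) = 0" by (simp add: split e)
    qed
    then have "(\<Sum>p\<in>P \<union> Q. const (a p) * sch (cj p)) = 0" by (intro sum.neutral) simp
    then show ?thesis by (simp add: split)
  qed
  show ?thesis
    unfolding \<omega>_def
  proof (rule the_equality, intro exI conjI)
    show "finite (lst ` P)" "lst ` P \<subseteq> partitions" using P by auto
    have "rowf ` lst ` P = P" using P(2) by (force simp: image_image)
    moreover have "(\<Sum>p\<in>P. const (c (rowf (lst p))) * F p) = (\<Sum>p\<in>P. const (c p) * F p)" for F :: "_ \<Rightarrow> series"
      using P(2) by (intro sum.cong refl) (auto simp: subset_iff)
    ultimately show "(\<Sum>p\<in>P. const (c p) * sch p) = (\<Sum>lam\<in>lst ` P. const (c (rowf lam)) * schur lam)"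
      "(\<Sum>p\<in>P. const (c p) * sch (cj p)) = (\<Sum>lam\<in>lst ` P. const (c (rowf lam)) * schur (conjugate lam))"
      using tr[of "lst ` P" "\<lambda>lam. c (rowf lam)"] \<open>lst ` P \<subseteq> partitions\<close> by simp_all
  next
    fix g
    assume "\<exists>Q d. finite Q \<and> Q \<subseteq> partitions \<and> (\<Sum>p\<in>P. const (c p) * sch p) = (\<Sum>lam\<in>Q. const (d lam) * schur lam) \<and>
      g = (\<Sum>lam\<in>Q. const (d lam) * schur (conjugate lam))"
    then obtain Q d where Q: "finite Q" "Q \<subseteq> partitions"
      "(\<Sum>p\<in>P. const (c p) * sch p) = (\<Sum>lam\<in>Q. const (d lam) * schur lam)"
      "g = (\<Sum>lam\<in>Q. const (d lam) * schur (conjugate lam))" by blast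
    show "g = (\<Sum>p\<in>P. const (c p) * sch (cj p))"
      unfolding Q(4) tr(2)[OF Q(2)]
    proof (rule uniq)
      show "finite (rowf ` Q)" "rowf ` Q \<subseteq> Part" using Q(1,2) rowf_Part by auto
      show "(\<Sum>p\<in>rowf ` Q. const (d (lst p)) * sch p) = (\<Sum>p\<in>P. const (c p) * sch p)"
        using Q(3) tr(1)[OF Q(2)] by simp
    qed
  qed
qed

definition symspan :: "series set"
  where "symspan = {f. \<exists>P c. finite P \<and> P \<subseteq> Part \<and> f = (\<Sum>p\<in>P. const (c p) * sch p)}"

lemma symspan_add:
  assumes "f \<in> symspan" "g \<in> symspan"
  shows "f + g \<in> symspan" "\<omega> (f + g) = \<omega> f + \<omega> g"
proof -
  obtain P c where P: "finite P" "P \<subseteq> Part" "f = (\<Sum>p\<in>P. const (c p) * sch p)" using assms(1) by (auto simp: symspan_def)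
  obtain Q d where Q: "finite Q" "Q \<subseteq> Part" "g = (\<Sum>p\<in>Q. const (d p) * sch p)" using assms(2) by (auto simp: symspan_def)
  define a where "a p = (if p \<in> P then c p else 0) + (if p \<in> Q then d p else 0)" for p
  have split: "(\<Sum>p\<in>P. const (c p) * F p) + (\<Sum>p\<in>Q. const (d p) * F p) = (\<Sum>p\<in>P \<union> Q. const (a p) * F p)"
    for F :: "(nat \<Rightarrow> nat) \<Rightarrow> series"
  proof -
    have "(\<Sum>p\<in>P \<union> Q. const (a p) * F p) = (\<Sum>p\<in>P \<union> Q. if p \<in> P then const (c p) * F p else 0)
        + (\<Sum>p\<in>P \<union> Q. if p \<in> Q then const (d p) * F p else 0)"
      unfolding sum.distrib[symmetric]
      by (intro sum.cong refl) (simp add: a_def rhom.add[OF rhom_const] distrib_right)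
    also have "(\<Sum>p\<in>P \<union> Q. if p \<in> P then const (c p) * F p else 0) = (\<Sum>p\<in>P. const (c p) * F p)"
      using P(1) Q(1) by (intro sum.mono_neutral_cong_right) auto
    also have "(\<Sum>p\<in>P \<union> Q. if p \<in> Q then const (d p) * F p else 0) = (\<Sum>p\<in>Q. const (d p) * F p)"
      using P(1) Q(1) by (intro sum.mono_neutral_cong_right) auto
    finally show ?thesis by simp
  qed
  show "f + g \<in> symspan"
    unfolding symspan_def P(3) Q(3) split using P Q by blast
  have "\<omega> (f + g) = (\<Sum>p\<in>P \<union> Q. const (a p) * sch (cj p))"
    unfolding P(3) Q(3) split using P Q by (intro omega_sch) auto
  then show "\<omega> (f + g) = \<omega> f + \<omega> g"
    unfolding split[symmetric] using P Q by (simp add: omega_sch)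
qed

lemma symspan_const_mult:
  assumes "f \<in> symspan"
  shows "const a * f \<in> symspan" "\<omega> (const a * f) = const a * \<omega> f"
proof -
  obtain P c where P: "finite P" "P \<subseteq> Part" "f = (\<Sum>p\<in>P. const (c p) * sch p)" using assms by (auto simp: symspan_def)
  have e: "const a * (\<Sum>p\<in>P. const (c p) * F p) = (\<Sum>p\<in>P. const (a * c p) * F p)" for F :: "_ \<Rightarrow> series"
    by (simp add: sum_distrib_left rhom.mult[OF rhom_const] mult.assoc)
  show "const a * f \<in> symspan"
    unfolding symspan_def
  proof (rule CollectI, intro exI conjI)
    show "const a * f = (\<Sum>p\<in>P. const (a * c p) * sch p)" by (simp only: P(3) e)
  qed (rule P)+
  show "\<omega> (const a * f) = const a * \<omega> f" by (simp only: P(3) e omega_sch[OF P(1,2)])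
qed

lemma symspan_0: "0 \<in> symspan" "\<omega> 0 = 0"
  using omega_sch[of "{}" "\<lambda>_. 0"] by (simp_all add: symspan_def) (metis finite.emptyI empty_subsetI sum.empty)

lemma symspan_sum:
  assumes "\<And>i. i \<in> I \<Longrightarrow> f i \<in> symspan"
  shows "sum f I \<in> symspan \<and> \<omega> (sum f I) = (\<Sum>i\<in>I. \<omega> (f i))"
  using assms by (induction I rule: infinite_finite_induct) (simp_all add: symspan_0 symspan_add)

lemma symspan_sch: "p \<in> Part \<Longrightarrow> sch p \<in> symspan" "p \<in> Part \<Longrightarrow> \<omega> (sch p) = sch (cj p)"
proof -
  assume p: "p \<in> Part"
  have e: "sch p = (\<Sum>q\<in>{p}. const 1 * sch q)" by (simp add: rhom.one[OF rhom_const])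
  show "sch p \<in> symspan"
    unfolding symspan_def
  proof (rule CollectI, intro exI conjI)
    show "finite {p}" "{p} \<subseteq> Part" using p by simp_all
  qed (rule e)
  show "\<omega> (sch p) = sch (cj p)" using omega_sch[of "{p}" "\<lambda>_. 1"] p by (simp add: rhom.one[OF rhom_const])
qed

lemma symspan_induct [consumes 1, case_names sch add scale zero]:
  assumes "f \<in> symspan" "\<And>p. p \<in> Part \<Longrightarrow> Q (sch p)"
    "\<And>f g. f \<in> symspan \<Longrightarrow> g \<in> symspan \<Longrightarrow> Q f \<Longrightarrow> Q g \<Longrightarrow> Q (f + g)"
    "\<And>a f. f \<in> symspan \<Longrightarrow> Q f \<Longrightarrow> Q (const a * f)" "Q 0"
  shows "Q f"
proof -
  obtain P c where P: "finite P" "P \<subseteq> Part" "f = (\<Sum>p\<in>P. const (c p) * sch p)" using assms(1) by (auto simp: symspan_def)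
  have "(\<Sum>p\<in>P. const (c p) * sch p) \<in> symspan \<and> Q (\<Sum>p\<in>P. const (c p) * sch p)"
    using P(1,2)
    by (induction P rule: finite_induct)
       (simp_all add: assms symspan_0 symspan_add symspan_sch symspan_const_mult)
  then show ?thesis using P(3) by simp
qed

lemma omega_symspan: "f \<in> symspan \<Longrightarrow> \<omega> f \<in> symspan \<and> \<omega> (\<omega> f) = f"
  by (induction rule: symspan_induct)
     (simp_all add: symspan_sch cj_Part cj_cj symspan_add symspan_const_mult symspan_0)

lemma bij_cj_strips:
  assumes "p \<in> Part"
  shows "bij_betw cj {q. q \<in> Part \<and> hs p q \<and> psize q = n} {q. q \<in> Part \<and> vs (cj p) q \<and> psize q = n}"
  by (rule bij_betw_byWitness[where f' = cj])
     (use assms vs_cj[OF assms] in \<open>auto simp: cj_cj cj_Part psize_cj vs_cj[OF assms, symmetric]\<close>)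

text \<open>On Schur functions this is the pair of Pieri rules together with the fact that
  conjugation exchanges horizontal and vertical strips.\<close>

lemma omega_hsym_mult: "f \<in> symspan \<Longrightarrow> hsym k * f \<in> symspan \<and> \<omega> (hsym k * f) = esym k * \<omega> f"
proof (induction rule: symspan_induct)
  case (sch p)
  have *: "(\<Sum>q | q \<in> Part \<and> hs p q \<and> psize q = psize p + k. sch q) \<in> symspan \<and>
    \<omega> (\<Sum>q | q \<in> Part \<and> hs p q \<and> psize q = psize p + k. sch q) =
      (\<Sum>q | q \<in> Part \<and> hs p q \<and> psize q = psize p + k. \<omega> (sch q))"
    by (rule symspan_sum) (simp add: symspan_sch)
  have "(\<Sum>q | q \<in> Part \<and> hs p q \<and> psize q = psize p + k. \<omega> (sch q)) =
    (\<Sum>q | q \<in> Part \<and> hs p q \<and> psize q = psize p + k. sch (cj q))"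
    by (intro sum.cong refl) (simp add: symspan_sch)
  also have "\<dots> = esym k * \<omega> (sch p)"
    using sch by (simp add: sum.reindex_bij_betw[OF bij_cj_strips] symspan_sch pieri_e cj_Part psize_cj)
  finally show ?case using * sch by (simp add: pieri_h)
next
  case (scale a f)
  then show ?case using symspan_const_mult[of "hsym k * f" a] symspan_const_mult[of f a]
    by (simp add: mult.left_commute)
qed (simp_all add: distrib_left symspan_add symspan_0)

text \<open>Obtained from the rule for \<open>hsym\<close> because \<omega> is an involution on
  \<open>symspan\<close>.\<close>

lemma omega_esym_mult:
  assumes f: "f \<in> symspan"
  shows "esym k * f \<in> symspan" "\<omega> (esym k * f) = hsym k * \<omega> f"
proof -
  note w = omega_symspan[OF f]
  have "\<omega> (hsym k * \<omega> f) = esym k * f" "hsym k * \<omega> f \<in> symspan" using omega_hsym_mult[of "\<omega> f" k] w by auto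
  then show "esym k * f \<in> symspan" "\<omega> (esym k * f) = hsym k * \<omega> f"
    using omega_symspan[of "hsym k * \<omega> f"] by auto
qed

text \<open>Needed because the lowest coefficient of \<open>GQ\<close> is only a positive integer.
  The lowest Schur function in the expansion has lowest coefficient 1, so its coefficient is
  \<open>c\<close> times a coefficient of f; subtracting that multiple shortens the
  expansion.\<close>

lemma symspan_divide:
  assumes "const (of_nat c) * f \<in> symspan" "c > 0"
  shows "f \<in> symspan"
proof -
  obtain P d where P: "finite P" "P \<subseteq> Part" "const (of_nat c) * f = (\<Sum>p\<in>P. const (d p) * sch p)"
    using assms(1) by (auto simp: symspan_def)
  show ?thesis
    using P
  proof (induction "card P" arbitrary: P f rule: less_induct)
    case less
    show ?case
    proof (cases "P = {}")
      case True
      have "f = 0"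
      proof (rule mps_eqI)
        fix M
        have "of_nat c * mps_nth f M = 0"
          using less.prems(3)[THEN arg_cong[of _ _ "\<lambda>f. mps_nth f M"]] True by simp
        then show "mps_nth f M = mps_nth 0 M" using assms(2) by simp
      qed
      then show ?thesis by (simp add: symspan_0)
    next
      case False
      then obtain p where p: "p \<in> P" "\<And>q. q \<in> P \<Longrightarrow> height (row_mset (YDc p)) \<le> height (row_mset (YDc q))"
        using ex_has_least_nat[of "\<lambda>p. p \<in> P" _ "\<lambda>p. height (row_mset (YDc p))"] by (metis ex_in_conv)
      have pP: "p \<in> Part" using p(1) less.prems(2) by blast
      define a where "a = mps_nth f (row_mset (YDc p))"
      have "of_nat c * a = mps_nth (const (of_nat c) * f) (row_mset (YDc p))" by (simp add: a_def)
      also have "\<dots> = d p * mps_nth (sch p) (row_mset (YDc p))"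
        unfolding less.prems(3)
        by (rule leading_coeff_min[OF less.prems(1) p(1), where w = "\<lambda>p. row_mset (YDc p)" and f = sch])
           (use less.prems(2) leading_sch p(2) inj_on_subset[OF inj_row_mset_YDc less.prems(2)] in auto)
      finally have a: "d p = of_nat c * a" by (simp add: mps_nth_sch pP)
      let ?g = "f - const a * sch p"
      have "const (of_nat c) * ?g = (\<Sum>p\<in>P. const (d p) * sch p) - const (d p) * sch p"
        by (simp add: right_diff_distrib less.prems(3) a rhom.mult[OF rhom_const] mult.assoc)
      also have "\<dots> = (\<Sum>p\<in>P - {p}. const (d p) * sch p)"
        using less.prems(1) p(1) by (simp add: sum.remove)
      finally have "?g \<in> symspan"
        using less.prems p(1) by (intro less.hyps[of "P - {p}"] card_Diff1_less) auto
      then have "?g + const a * sch p \<in> symspan"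
        by (intro symspan_add symspan_const_mult symspan_sch pP)
      then show ?thesis by simp
    qed
  qed
qed

section \<open>The Cauchy kernel and the Pieri rule for \<open>jp\<close>\<close>

text \<open>The multiplicativity of composition that is needed for products of linear factors, over
  an arbitrary commutative coefficient ring. As U has no constant term, the i-th power of U starts
  in degree i, which makes all sums finite.\<close>

lemma fps_X_mult_compose:
  fixes U :: "'a :: comm_ring_1 fps"
  assumes U: "fps_nth U 0 = 0"
  shows "(fps_X * F) oo U = U * (F oo U)"
proof (rule fps_ext)
  fix n
  have z: "fps_nth (U ^ i) m = 0" if "m < i" for i m
    using startsby_zero_power_prefix[OF U] that by blast
  have "fps_nth ((fps_X * F) oo U) n = (\<Sum>i\<le>Suc n. fps_nth (fps_X * F) i * fps_nth (U ^ i) n)"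
    by (simp add: fps_compose_nth atMost_atLeast0 z del: power_Suc)
  also have "\<dots> = (\<Sum>i\<le>n. fps_nth F i * fps_nth (U ^ Suc i) n)"
    by (subst sum.atMost_Suc_shift) (simp del: power_Suc)
  also have "\<dots> = (\<Sum>i\<le>n. fps_nth F i * (\<Sum>j\<le>n. fps_nth U j * fps_nth (U ^ i) (n - j)))"
    by (simp add: fps_mult_nth atMost_atLeast0)
  also have "\<dots> = (\<Sum>i\<le>n. \<Sum>j\<le>n. fps_nth U j * (fps_nth F i * fps_nth (U ^ i) (n - j)))"
    by (simp add: sum_distrib_left mult.left_commute)
  also have "\<dots> = (\<Sum>j\<le>n. fps_nth U j * (\<Sum>i\<le>n. fps_nth F i * fps_nth (U ^ i) (n - j)))"
    by (subst sum.swap) (simp add: sum_distrib_left)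
  also have "\<dots> = (\<Sum>j\<le>n. fps_nth U j * (\<Sum>i\<le>n - j. fps_nth F i * fps_nth (U ^ i) (n - j)))"
    by (intro sum.cong refl arg_cong2[where f = times] sum.mono_neutral_right) (auto simp: z)
  also have "\<dots> = fps_nth (U * (F oo U)) n"
    by (simp add: fps_mult_nth fps_compose_nth atMost_atLeast0)
  finally show "fps_nth ((fps_X * F) oo U) n = fps_nth (U * (F oo U)) n" .
qed

lemma linear_factors_compose:
  fixes U :: "'a :: comm_ring_1 fps" and n :: nat
  assumes U: "fps_nth U 0 = 0"
  shows "((\<Prod>j<n. 1 + fps_const (c j) * fps_X) * F) oo U = (\<Prod>j<n. 1 + fps_const (c j) * U) * (F oo U)"
proof (induction n arbitrary: F)
  case (Suc n)
  have e: "(1 + fps_const (c n) * fps_X) * F = F + fps_const (c n) * (fps_X * F)"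
    by (simp add: distrib_right mult.assoc)
  have "((1 + fps_const (c n) * fps_X) * F) oo U = (1 + fps_const (c n) * U) * (F oo U)"
    unfolding e fps_compose_add_distrib fps_const_mult_apply_left[symmetric] fps_X_mult_compose[OF U]
    by (simp add: distrib_right mult.assoc)
  then show ?case using Suc[of "(1 + fps_const (c n) * fps_X) * F"] by (simp add: mult.assoc)
qed simp

lemma fmap_compose:
  assumes "rhom h"
  shows "fmap h (F oo U) = fmap h F oo fmap h U"
proof -
  interpret rhom h by (rule assms)
  interpret f: rhom "fmap h" by (rule rhom_fmap[OF assms])
  show ?thesis
    by (rule fps_ext) (simp add: fps_compose_nth hom f.power[symmetric])
qed

section \<open>The series \<open>Qp\<close> and the eigenvalue of the transfer operators\<close>

definition V0 :: "int poly fps" where "V0 = Abs_fps (\<lambda>k. (- \<beta>) ^ k)"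

lemma V0: "(1 + fps_const \<beta> * fps_X) * V0 = 1"
proof (rule fps_ext)
  fix k show "fps_nth ((1 + fps_const \<beta> * fps_X) * V0) k = fps_nth 1 k"
    by (cases k) (simp_all add: V0_def distrib_right mult.assoc)
qed

abbreviation VS :: "series fps" where "VS \<equiv> fmap const V0"

text \<open>\<open>US\<close> is the series \<open>t / (1 + \<beta> t)\<close>.\<close>

definition US :: "series fps" where "US = fps_X * VS"

lemma VS: "(1 + fps_const (const \<beta>) * fps_X) * VS = 1"
proof -
  interpret f: rhom "fmap const :: _ \<Rightarrow> series fps" by (intro rhom_fmap rhom_const)
  show ?thesis
    using V0[THEN arg_cong[of _ _ "fmap const :: _ \<Rightarrow> series fps"]]
    by (simp only: f.hom fmap_X[OF rhom_const] fmap_const[OF rhom_const])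
qed

lemma US: "(1 + fps_const (const \<beta>) * fps_X) * US = fps_X"
  using VS by (simp add: US_def mult.left_commute)

lemma US_0: "fps_nth US 0 = 0" by (simp add: US_def)

lemma US_eq: "US = fmap const (fps_X * V0)"
  by (simp add: US_def rhom.mult[OF rhom_fmap[OF rhom_const]] fmap_X[OF rhom_const])

lemma fmap_res_US: "fmap (res V) US = US"
  by (rule fps_ext) (simp add: US_eq)

definition Qp :: "series fps" where "Qp = Es * (Hs oo US)"

definition Qq :: "series fps" where "Qq = Hs * (Es oo US)"

lemma Hs_compose: "(\<Prod>j<n. 1 - fps_const (X j) * US) * (fmap (res {..<n}) Hs oo US) = 1"
proof -
  have m: "fps_const (- X j) = - fps_const (X j :: series)" for j by simp
  show ?thesis
    using linear_factors_compose[OF US_0, where n = n and c = "\<lambda>j. - X j" and F = "fmap (res {..<n}) Hs"] fmap_res_Hs[of n]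
    by (simp only: m mult_minus_left add_uminus_conv_diff fps_compose_1)
qed

text \<open>Each factor is (1 + \<beta>t)(1 - yt/(1 + \<beta>t)), which brings in the substitution
  \<open>US\<close>.\<close>

lemma Pieri_factor:
  "(\<Prod>j<n. 1 + fps_const (const \<beta>) * fps_X - fps_X * fps_const (X j)) =
    (1 + fps_const (const \<beta>) * fps_X) ^ n * (\<Prod>j<n. 1 - fps_const (X j) * US :: series fps)"
proof -
  have "1 + fps_const (const \<beta>) * fps_X - fps_X * fps_const (X j) =
      (1 + fps_const (const \<beta>) * fps_X) * (1 - fps_const (X j) * US)" for j :: nat
  proof -
    have "(1 + fps_const (const \<beta>) * fps_X) * (1 - fps_const (X j) * US) =
      1 + fps_const (const \<beta>) * fps_X - fps_const (X j) * ((1 + fps_const (const \<beta>) * fps_X) * US)"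
      by (simp only: right_diff_distrib mult.left_commute mult_1_right)
    then show ?thesis unfolding US by (simp only: mult.commute[of "fps_const (X j)"])
  qed
  then show ?thesis by (simp add: prod.distrib)
qed

text \<open>Identifies the quotient of the two products in \<open>eigenvector\<close> with
  \<open>Qp\<close> restricted to n variables.\<close>

lemma fmap_res_Qp:
  "(\<Prod>j<n. 1 + fps_const (const \<beta>) * fps_X - fps_X * fps_const (X j)) * fmap (res {..<n}) Qp =
    (\<Prod>j<n. (1 + fps_X * fps_const (X j)) * (1 + fps_const (const \<beta>) * fps_X))"
proof -
  interpret f: rhom "fmap (res {..<n}) :: series fps \<Rightarrow> _" by (intro rhom_fmap rhom_res)
  have "fmap (res {..<n}) Qp = (\<Prod>j<n. 1 + fps_const (X j) * fps_X) * (fmap (res {..<n}) Hs oo US)"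
    by (simp only: Qp_def f.mult fmap_res_Es fmap_compose[OF rhom_res] fmap_res_US)
  then have "(\<Prod>j<n. 1 + fps_const (const \<beta>) * fps_X - fps_X * fps_const (X j)) * fmap (res {..<n}) Qp =
    ((1 + fps_const (const \<beta>) * fps_X) ^ n * (\<Prod>j<n. 1 + fps_const (X j) * fps_X)) *
      ((\<Prod>j<n. 1 - fps_const (X j) * US) * (fmap (res {..<n}) Hs oo US))"
    unfolding Pieri_factor by (simp only: ac_simps)
  also have "\<dots> = (\<Prod>j<n. (1 + fps_X * fps_const (X j)) * (1 + fps_const (const \<beta>) * fps_X))"
    unfolding Hs_compose by (simp add: prod.distrib mult.commute)
  finally show ?thesis .
qed

text \<open>Allows the product to be cancelled in a divisibility without any appeal to the absence
  of zero divisors.\<close>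

lemma Pieri_unit:
  "\<exists>G. (\<Prod>j<n. 1 + fps_const (const \<beta>) * fps_X - fps_X * fps_const (X j)) * G = (1 :: series fps)"
proof
  let ?W = "1 + fps_const (const \<beta>) * fps_X :: series fps"
  have "(?W ^ n * (\<Prod>j<n. 1 - fps_const (X j) * US)) * (VS ^ n * (fmap (res {..<n}) Hs oo US)) =
    (?W * VS) ^ n * ((\<Prod>j<n. 1 - fps_const (X j) * US) * (fmap (res {..<n}) Hs oo US))"
    by (simp only: power_mult_distrib ac_simps)
  then show "(\<Prod>j<n. ?W - fps_X * fps_const (X j)) * (VS ^ n * (fmap (res {..<n}) Hs oo US)) = 1"
    by (simp only: Pieri_factor Hs_compose VS power_one mult_1_left)
qed

section \<open>The Pieri rule for the combinatorial \<open>jp\<close>\<close>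

lemma rhom_JJ:
  assumes "rhom h"
  shows "h (JJ b y n l m) = JJ (h b) (\<lambda>i. h (y i)) n l m"
proof -
  interpret rhom h by (rule assms)
  have i: "h (if P then b else 0) = (if P then h b else 0)" for P by (simp add: zero)
  show ?thesis by (simp add: JJ_def JT_def hom i)
qed

lemma JJ_cong: "(\<And>i. i < n \<Longrightarrow> y i = y' i) \<Longrightarrow> JJ b y n l m = JJ b y' n l m"
  unfolding JJ_def JT_def
proof (intro if_cong sum.cong refl prod.cong arg_cong2[where f = "(-)"])
  fix V c
  assume y: "\<And>i. i < n \<Longrightarrow> y i = y' i" and c: "c \<in> SDc l - SDc m"
    and "V \<in> {V. V \<in> tabs mh mv (SDc l - SDc m) {a. index a < n} \<and> no_primed_diagonal (SDc l - SDc m) V}"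
  then have "V \<in> tabs mh mv (SDc l - SDc m) {a. index a < n}" by blast
  from tabs_mem[OF this c] show "y (index (V c)) = y' (index (V c))" using y by simp
qed

lemma rhom_GT:
  assumes "rhom h"
  shows "h (GT b y n D) = GT (h b) (\<lambda>i. h (y i)) n D"
proof -
  interpret rhom h by (rule assms)
  show ?thesis by (simp add: GT_def hom)
qed

lemma GT_cong: "(\<And>i. i < n \<Longrightarrow> y i = y' i) \<Longrightarrow> GT b y n D = GT b y' n D"
  unfolding GT_def
proof (intro sum.cong refl prod.cong arg_cong2[where f = times])
  fix V b assume y: "\<And>i. i < n \<Longrightarrow> y i = y' i" and V: "V \<in> tabs mh mv D {a. index a < n}" "b \<in> D"
  show "y (index (V b)) = y' (index (V b))" using y tabs_mem[OF V] by simp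
  fix a assume "a \<in> Ext D V {a. index a < n} b"
  then show "1 + b * y (index a) = 1 + b * y' (index a)" for b using y by (simp add: Ext_def)
qed

abbreviation z0 :: "nat \<Rightarrow> int" where "z0 \<equiv> \<lambda>_. 0"

lemma z0: "z0 \<in> Prof" "z0 \<in> paths M 0" "SDc z0 = {}"
  by (auto simp: Prof_def paths_def SDc_def)

abbreviation JX :: "nat \<Rightarrow> (nat \<Rightarrow> int) \<Rightarrow> series"
  where "JX n l \<equiv> JJ (const \<beta>) X n l z0"

lemma res_JX: "res {..<n} (JX n l) = JX n l"
  unfolding rhom_JJ[OF rhom_res] by (auto simp: res_X intro!: JJ_cong)

lemma res_GT: "res {..<n} (GT (const \<beta>) X n D) = GT (const \<beta>) X n D"
  unfolding rhom_GT[OF rhom_res] by (auto simp: res_X intro!: GT_cong)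

definition ucoeff :: "nat \<Rightarrow> (nat \<Rightarrow> int) \<Rightarrow> (nat \<Rightarrow> int) \<Rightarrow> nat \<Rightarrow> int poly"
  where "ucoeff a l nu M = fps_nth (uvec fps_X (fps_const \<beta>) l nu M UT) a"

text \<open>The variable of the set-valued layer is taken to be \<open>fps_X\<close>, with
  coefficients in \<open>series\<close>. The error of \<open>eigenvector\<close> is then divisible
  by a power of \<open>fps_X\<close> beyond degree \<open>a\<close>, so the coefficient at
  \<open>a\<close> gives an exact identity.\<close>

lemma pieri_Qp_fin:
  assumes nu: "nu \<in> paths M 0" and a: "a + card (SDc nu) \<le> M"
  shows "(\<Sum>l\<in>paths M 0. const (ucoeff a l nu M) * JX m l) = res {..<m} (fps_nth Qp a) * JX m nu"
proof -
  let ?b = "fps_const (const \<beta>) :: series fps" and ?y = "\<lambda>j. fps_const (X j) :: series fps"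
  have fc: "rhom (fps_const :: series \<Rightarrow> _)" by standard simp_all
  have JJ: "JJ ?b ?y k l z0 = fps_const (JX k l)" for k l by (simp add: rhom_JJ[OF fc])
  let ?S = "\<Sum>l\<in>paths M 0. uvec fps_X ?b l nu M UT * fps_const (JX m l)"
  let ?P = "\<Prod>j<m. 1 + ?b * fps_X - fps_X * ?y j"
  let ?k = "nat (int M + 1 - (\<Sum>e<M. nu e))"
  have Pf: "l \<in> Prof" if "l \<in> paths M 0" for l using that by (auto simp: Prof_def)
  have "fps_X ^ ?k dvd ?P * (\<Sum>l\<in>paths M 0. uvec fps_X ?b l nu M UT * JJ ?b ?y m l z0)
      - (\<Prod>j<m. (1 + fps_X * ?y j) * (1 + ?b * fps_X)) * JJ ?b ?y m nu z0"
    by (rule eigenvector[OF _ _ nu]) (simp_all add: JJ_0 Pf z0(1) JJ_Suc)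
  then have "fps_X ^ ?k dvd ?P * ?S - (?P * fmap (res {..<m}) Qp) * fps_const (JX m nu)"
    unfolding JJ fmap_res_Qp .
  then have d: "fps_X ^ ?k dvd ?P * (?S - fmap (res {..<m}) Qp * fps_const (JX m nu))"
    by (simp only: right_diff_distrib mult.assoc)
  obtain G where G: "?P * G = 1" using Pieri_unit by blast
  have "fps_X ^ ?k dvd G * (?P * (?S - fmap (res {..<m}) Qp * fps_const (JX m nu)))"
    using d by (rule dvd_mult)
  also have "G * (?P * (?S - fmap (res {..<m}) Qp * fps_const (JX m nu))) =
      (?P * G) * (?S - fmap (res {..<m}) Qp * fps_const (JX m nu))" by (simp only: ac_simps)
  finally have "fps_X ^ ?k dvd ?S - fmap (res {..<m}) Qp * fps_const (JX m nu)" by (simp only: G mult_1_left)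
  then obtain F where F: "?S - fmap (res {..<m}) Qp * fps_const (JX m nu) = fps_X ^ ?k * F" by (rule dvdE)
  \<comment> \<open>The bound on \<open>M\<close> puts the degree \<open>a\<close> below the order
    of the error term.\<close>
  have "a < ?k" using a card_SDc[OF nu] by simp
  then have "fps_nth (?S - fmap (res {..<m}) Qp * fps_const (JX m nu)) a = 0"
    unfolding F by (simp add: fps_X_power_mult_nth)
  then have "(\<Sum>l\<in>paths M 0. fps_nth (uvec fps_X ?b l nu M UT) a * JX m l) = res {..<m} (fps_nth Qp a) * JX m nu"
    by (simp add: fps_sum_nth)
  moreover have "fps_nth (uvec fps_X ?b l nu M UT) a = const (ucoeff a l nu M)" for l
  proof -
    have "uvec fps_X ?b l nu M UT = fmap const (uvec fps_X (fps_const \<beta>) l nu M UT)"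
      by (simp add: rhom_uvec[OF rhom_fmap[OF rhom_const]] fmap_X[OF rhom_const] fmap_const[OF rhom_const])
    then show ?thesis by (simp add: ucoeff_def)
  qed
  ultimately show ?thesis by simp
qed

definition sp :: "(nat \<Rightarrow> int) \<Rightarrow> nat list"
  where "sp = inv_into strict_partitions prof"

lemma sp: "l \<in> Prof \<Longrightarrow> sp l \<in> strict_partitions" "l \<in> Prof \<Longrightarrow> prof (sp l) = l"
  using bij_prof unfolding sp_def bij_betw_def by (auto intro: inv_into_into f_inv_into_f)

lemma sp_prof: "lam \<in> strict_partitions \<Longrightarrow> sp (prof lam) = lam"
  using bij_prof unfolding sp_def bij_betw_def by (auto intro: inv_into_f_f)

lemma SD_sp: "l \<in> Prof \<Longrightarrow> SD (sp l) = SDc l"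
  using SD_eq_SDc[of "sp l"] sp[of l] by simp

lemma Nil_strict [simp]: "[] \<in> strict_partitions" "SD [] = {}"
  by (auto simp: strict_partitions_def SD_def)

definition Jc :: "(nat \<Rightarrow> int) \<Rightarrow> series"
  where "Jc l = jp_comb (sp l) []"

lemma res_Jc:
  assumes l: "l \<in> Prof"
  shows "res {..<n} (Jc l) = JX n l"
proof (rule mps_eqI)
  fix M
  show "mps_nth (res {..<n} (Jc l)) M = mps_nth (JX n l) M"
  proof (cases "set_mset M \<subseteq> {..<n}")
    case True
    then show ?thesis
      using mps_nth_jp_comb_eq_JT[of "sp l" "[]" M n] sp[OF l]
      by (simp add: mps_nth_res Jc_def JJ_def z0 SD_sp[OF l])
  next
    case False
    then show ?thesis using res_JX[of n l] by (metis mps_nth_res)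
  qed
qed

lemma pieri_Qp:
  assumes nu: "nu \<in> paths M 0" and a: "a + card (SDc nu) \<le> M"
  shows "fps_nth Qp a * Jc nu = (\<Sum>l\<in>paths M 0. const (ucoeff a l nu M) * Jc l)"
proof (rule mps_eqI_res)
  fix m
  interpret r: rhom "res {..<m} :: series \<Rightarrow> _" by (rule rhom_res)
  have Pf: "l \<in> Prof" if "l \<in> paths M 0" for l using that by (auto simp: Prof_def)
  show "res {..<m} (fps_nth Qp a * Jc nu) = res {..<m} (\<Sum>l\<in>paths M 0. const (ucoeff a l nu M) * Jc l)"
    using pieri_Qp_fin[OF assms, of m] nu by (simp add: r.hom res_Jc Pf)
qed

lemma Jc_z0: "Jc z0 = 1"
proof (rule mps_eqI_res)
  fix m
  show "res {..<m} (Jc z0) = res {..<m} 1"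
    by (simp add: res_Jc z0 JJ_def JT_def rhom.one[OF rhom_res] no_primed_diagonal_def)
qed

lemma GQ_small:
  assumes "lam \<in> strict_partitions" "mps_nth (GQ lam) A \<noteq> 0"
  shows "card (SD lam) \<le> size A"
proof -
  have "{T \<in> SSVT lam. wtS lam T = A} \<noteq> {}"
    using assms(2) unfolding mps_nth_GQ[OF assms(1)] by (metis card.empty mult_zero_left of_nat_0)
  then obtain T where T: "T \<in> SSVT lam" "wtS lam T = A" by blast
  have "1 \<le> card (T b)" if "b \<in> SD lam" for b
    using T(1) that unfolding SSVT_def by (auto simp: Suc_le_eq card_gt_0_iff)
  then have "(\<Sum>b\<in>SD lam. 1) \<le> (\<Sum>b\<in>SD lam. card (T b))" by (intro sum_mono)
  then show ?thesis unfolding T(2)[symmetric] wtS_def by (simp add: size_multiset_sum)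
qed

text \<open>Splitting off the last variable produces the same matrix \<open>ucoeff\<close> on both
  sides: on \<open>GQ\<close> through the branching rule \<open>GT_Suc\<close>, and on the product
  through \<open>pieri_Qp\<close>.\<close>

lemma prod_Qp:
  assumes "set_mset A \<subseteq> {..<n}" "size A \<le> M"
  shows "(\<Prod>i<n. fps_nth Qp (count A i)) = (\<Sum>l\<in>paths M 0. const (mps_nth (GQ (sp l)) A) * Jc l)"
  using assms
proof (induction n arbitrary: A)
  have Pf: "l \<in> Prof" if "l \<in> paths M 0" for l using that by (auto simp: Prof_def)
  have GT: "mps_nth (GQ (sp l)) B = mps_nth (GT (const \<beta>) X n (SDc l)) B"
    if "l \<in> paths M 0" "set_mset B \<subseteq> {..<n}" for l B n
    using mps_nth_GQ_eq_GT[OF sp(1)[OF Pf[OF that(1)]] that(2)] by (simp add: SD_sp[OF Pf[OF that(1)]])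
  {
    case 0
    then have "mps_nth (GQ (sp l)) A = (if l = z0 then 1 else 0)" if "l \<in> paths M 0" for l
      using that by (simp add: GT[of l _ 0] GT_0 Pf mps_nth_one)
    then have "(\<Sum>l\<in>paths M 0. const (mps_nth (GQ (sp l)) A) * Jc l) = (\<Sum>l\<in>paths M 0. if l = z0 then Jc l else 0)"
      by (intro sum.cong refl) (simp add: rhom.one[OF rhom_const])
    then show ?case using finite_paths z0(2)[of M] by (simp add: Jc_z0)
  next
    case (Suc n)
    let ?a = "count A n" and ?A = "filter_mset (\<lambda>j. j \<noteq> n) A"
    have vA: "set_mset ?A \<subseteq> {..<n}" using Suc.prems(1) by (auto simp: less_Suc_eq)
    have sz: "size A = size ?A + ?a"
      using multiset_partition[of A "\<lambda>j. j \<noteq> n"] by (metis filter_eq_replicate_mset not_not size_replicate_mset size_union)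
    have step: "mps_nth (GQ (sp l)) A = (\<Sum>nu\<in>paths M 0. mps_nth (GQ (sp nu)) ?A * ucoeff ?a l nu M)"
      if l: "l \<in> paths M 0" for l
    proof -
      have "mps_nth (GQ (sp l)) A =
        (\<Sum>nu\<in>paths M 0. mps_nth (GT (const \<beta>) X n (SDc nu) * uvec (X n) (const \<beta>) l nu M UT) A)"
        unfolding GT[OF l Suc.prems(1)] GT_Suc[OF l] mps_nth_sum by (simp add: mult.commute)
      also have "\<dots> = (\<Sum>nu\<in>paths M 0. mps_nth (GQ (sp nu)) ?A * ucoeff ?a l nu M)"
      proof (rule sum.cong[OF refl])
        fix nu assume nu: "nu \<in> paths M 0"
        have u: "uvec (X n) (const \<beta>) l nu M UT = uni n (uvec fps_X (fps_const \<beta>) l nu M UT)"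
          by (simp add: rhom_uvec[OF rhom_uni] uni_X uni_const)
        have "mps_nth (GT (const \<beta>) X n (SDc nu)) N = 0" if "n \<in># N" for N
          using that by (subst res_GT[symmetric]) (auto simp: mps_nth_res)
        then show "mps_nth (GT (const \<beta>) X n (SDc nu) * uvec (X n) (const \<beta>) l nu M UT) A =
            mps_nth (GQ (sp nu)) ?A * ucoeff ?a l nu M"
          unfolding u by (subst mps_nth_mult_uni) (simp_all only: GT[OF nu vA] ucoeff_def)
      qed
      finally show ?thesis .
    qed
    have "(\<Prod>i<Suc n. fps_nth Qp (count A i)) = fps_nth Qp ?a * (\<Prod>i<n. fps_nth Qp (count ?A i))"
      by (simp add: mult.commute)
    also have "\<dots> = (\<Sum>nu\<in>paths M 0. const (mps_nth (GQ (sp nu)) ?A) * (fps_nth Qp ?a * Jc nu))"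
      using Suc.IH[OF vA] Suc.prems(2) sz by (simp add: sum_distrib_left mult.left_commute)
    also have "\<dots> = (\<Sum>nu\<in>paths M 0. const (mps_nth (GQ (sp nu)) ?A) * (\<Sum>l\<in>paths M 0. const (ucoeff ?a l nu M) * Jc l))"
    proof (rule sum.cong[OF refl])
      fix nu assume nu: "nu \<in> paths M 0"
      show "const (mps_nth (GQ (sp nu)) ?A) * (fps_nth Qp ?a * Jc nu) =
        const (mps_nth (GQ (sp nu)) ?A) * (\<Sum>l\<in>paths M 0. const (ucoeff ?a l nu M) * Jc l)"
      proof (cases "mps_nth (GQ (sp nu)) ?A = 0")
        case False
        \<comment> \<open>A shape occurs at the monomial \<open>?A\<close> only if it has at most
          \<open>size ?A\<close> boxes; this supplies the size condition of
          \<open>pieri_Qp\<close>.\<close>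
        then have "card (SDc nu) \<le> size ?A" using GQ_small[OF sp(1)[OF Pf[OF nu]]] SD_sp[OF Pf[OF nu]] by simp
        then show ?thesis using sz Suc.prems(2) by (subst pieri_Qp[OF nu]) auto
      qed simp
    qed
    also have "\<dots> = (\<Sum>l\<in>paths M 0. \<Sum>nu\<in>paths M 0. const (mps_nth (GQ (sp nu)) ?A * ucoeff ?a l nu M) * Jc l)"
      unfolding sum_distrib_left by (subst sum.swap) (simp add: rhom.mult[OF rhom_const] mult.assoc)
    also have "\<dots> = (\<Sum>l\<in>paths M 0. const (mps_nth (GQ (sp l)) A) * Jc l)"
      by (intro sum.cong refl) (simp add: step rhom.sum[OF rhom_const] sum_distrib_right)
    finally show ?case .
  }
qed

section \<open>Coefficients of the Cauchy kernel\<close>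

definition kern :: "nat \<times> nat \<Rightarrow> series2"
  where "kern p = (1 - bar (X (Inl (fst p))) * X (Inr (snd p))) * mps_inv (1 - X (Inl (fst p)) * X (Inr (snd p)))"

lemma bar_mult: "bar (X v) * (1 + const \<beta> * X v) = - X v"
proof -
  have "(1 + const \<beta> * X v) * mps_inv (1 + const \<beta> * X v) = 1"
    by (rule mps_inv_works) (simp add: mps_nth_one mps_nth_X)
  then show ?thesis by (simp add: bar_def mult.assoc mult.commute[of "mps_inv _"])
qed

lemma kern_mult: "kern (i, j) * (1 - X (Inl i) * X (Inr j)) = 1 - bar (X (Inl i)) * X (Inr j)"
proof -
  have "(1 - X (Inl i) * X (Inr j)) * mps_inv (1 - X (Inl i) * X (Inr j)) = (1 :: series2)"
    by (rule mps_inv_works) (simp add: mps_nth_one mps_nth_X)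
  then show ?thesis by (simp add: kern_def mult.assoc mult.commute[of "mps_inv _"])
qed

definition vars :: "nat \<Rightarrow> (nat + nat) set"
  where "vars N = Inl ` {..<N} \<union> Inr ` {..<N}"

text \<open>Setting the x variable to 0 also kills its \<open>bar\<close>, so a factor becomes 1
  once one of its two variables is set to 0. Hence only finitely many factors affect a given
  monomial.\<close>

lemma res_kern:
  assumes "p \<notin> {..<N} \<times> {..<N}"
  shows "res (vars N) (kern p) = 1"
proof -
  obtain i j where p: "p = (i, j)" by (cases p)
  interpret r: rhom "res (vars N) :: series2 \<Rightarrow> _" by (rule rhom_res)
  have b: "res (vars N) (bar (X (Inl i))) = 0" if "Inl i \<notin> vars N"
    using bar_mult[of "Inl i", THEN arg_cong[of _ _ "res (vars N)"]] that by (simp add: r.hom res_X)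
  have ij: "Inl i \<notin> vars N \<or> Inr j \<notin> vars N" using assms by (auto simp: p vars_def)
  then have z1: "res (vars N) (X (Inl i)) * res (vars N) (X (Inr j)) = (0 :: series2)"
    by (auto simp: res_X)
  have z2: "res (vars N) (bar (X (Inl i))) * res (vars N) (X (Inr j)) = 0"
    using ij b by (cases "Inl i \<in> vars N") (simp_all add: res_X)
  show ?thesis
    using kern_mult[of i j, THEN arg_cong[of _ _ "res (vars N)"]] unfolding p by (simp add: r.hom z1 z2)
qed

lemma prod_kern_stable:
  assumes "finite G" "{..<N} \<times> {..<N} \<subseteq> G" "set_mset M \<subseteq> vars N"
  shows "mps_nth (prod kern G) M = mps_nth (prod kern ({..<N} \<times> {..<N})) M"
proof -
  interpret r: rhom "res (vars N) :: series2 \<Rightarrow> _" by (rule rhom_res)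
  have "res (vars N) (prod kern G) = res (vars N) (prod kern ({..<N} \<times> {..<N}))"
    unfolding r.prod using assms res_kern by (intro prod.mono_neutral_right) auto
  from arg_cong[OF this, of "\<lambda>f. mps_nth f M"] show ?thesis
    using assms(3) by (simp only: mps_nth_res if_True)
qed

lemma vars_ex: "\<exists>N. set_mset M \<subseteq> vars N"
proof -
  obtain A B :: "nat multiset" where M: "M = two A B" by (rule two_ex)
  obtain a b where "set_mset A \<subseteq> {..<a}" "set_mset B \<subseteq> {..<b}"
    using finite_nat_iff_bounded finite_set_mset by meson
  then have "set_mset A \<subseteq> {..<max a b}" "set_mset B \<subseteq> {..<max a b}" by (auto simp: less_max_iff_disj)
  then have "Inl ` set_mset A \<union> Inr ` set_mset B \<subseteq> vars (max a b)"
    unfolding vars_def by (intro Un_mono image_mono)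
  then have "set_mset M \<subseteq> vars (max a b)" by (simp add: M two_def)
  then show ?thesis by blast
qed

lemma mps_nth_kernel:
  assumes M: "set_mset M \<subseteq> vars N"
  shows "mps_nth cauchy_kernel M = mps_nth (prod kern ({..<N} \<times> {..<N})) M"
proof -
  \<comment> \<open>A bound is chosen separately for each monomial, so that the infinite product can
    be defined coefficientwise from finite ones.\<close>
  define NN where "NN M = (SOME N. set_mset M \<subseteq> vars N)" for M :: "(nat + nat) multiset"
  have NN: "set_mset M \<subseteq> vars (NN M)" for M unfolding NN_def by (rule someI_ex[OF vars_ex[of M]])
  define p where "p = Mps (\<lambda>M. mps_nth (prod kern ({..<NN M} \<times> {..<NN M})) M)"
  have "formal_has_prod kern UNIV p"
  proof (rule formal_has_prodI)
    fix M
    show "\<exists>F. finite F \<and> F \<subseteq> UNIV \<and> (\<forall>G. finite G \<longrightarrow> F \<subseteq> G \<longrightarrow> G \<subseteq> UNIV \<longrightarrow> mps_nth (prod kern G) M = mps_nth p M)"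
    proof (intro exI conjI allI impI)
      fix G assume "finite G" "{..<NN M} \<times> {..<NN M} \<subseteq> G"
      from prod_kern_stable[OF this NN] show "mps_nth (prod kern G) M = mps_nth p M" by (simp only: p_def mps_nth_Mps)
    qed simp_all
  qed
  moreover have "cauchy_kernel = formal_prod kern UNIV"
    unfolding cauchy_kernel_def by (rule arg_cong[of _ _ "\<lambda>f. formal_prod f UNIV"], rule ext) (simp add: kern_def case_prod_unfold)
  ultimately have "cauchy_kernel = p" by (simp add: formal_prod_eqI)
  let ?K = "max N (NN M)"
  have sub: "{..<N} \<times> {..<N} \<subseteq> {..<?K} \<times> {..<?K}" "{..<NN M} \<times> {..<NN M} \<subseteq> {..<?K} \<times> {..<?K}" by auto
  have fin: "finite ({..<?K} \<times> {..<?K})" by simp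
  show ?thesis
    unfolding \<open>cauchy_kernel = p\<close> p_def mps_nth_Mps
    using prod_kern_stable[OF fin sub(1) M] prod_kern_stable[OF fin sub(2) NN] by (rule trans[OF sym, rotated])
qed

text \<open>For fixed i the denominators give H at the variable \<open>X i\<close>, and the
  numerators give E at \<open>X i\<close> / (1 + \<beta> \<open>X i\<close>), both in the first N
  variables of y.\<close>

lemma curry_kern_row: "(\<Prod>j<N. curry_mps (kern (i, j))) = uni i (fmap (res {..<N}) Qq)"
proof -
  interpret c: rhom "curry_mps :: series2 \<Rightarrow> _" by (rule rhom_curry)
  interpret u: rhom "uni i :: series fps \<Rightarrow> _" by (rule rhom_uni)
  interpret f: rhom "fmap (res {..<N}) :: series fps \<Rightarrow> _" by (intro rhom_fmap rhom_res)
  let ?x = "X i :: (nat, series) mps" and ?b = "const (const \<beta>) :: (nat, series) mps"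
  let ?y = "\<lambda>j. const (X j) :: (nat, series) mps"
  define v where "v = uni i VS"
  have v: "(1 + ?b * ?x) * v = 1"
    using VS[THEN arg_cong[of _ _ "uni i"]] by (simp only: u.hom uni_const uni_X v_def)
  have w: "uni i US = ?x * v" by (simp add: US_def u.mult uni_X v_def)
  have "curry_mps (bar (X (Inl i))) * (1 + ?b * ?x) = - ?x"
    using bar_mult[of "Inl i :: nat + nat", THEN arg_cong[of _ _ curry_mps]]
    by (simp only: c.hom curry_const curry_X_Inl)
  then have "curry_mps (bar (X (Inl i))) * ((1 + ?b * ?x) * v) = - ?x * v" by (simp only: mult.assoc[symmetric])
  then have bar: "curry_mps (bar (X (Inl i))) = - uni i US" by (simp add: v w)
  have "curry_mps (kern (i, j)) * (1 - ?x * ?y j) = 1 + uni i US * ?y j" for j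
    using kern_mult[of i j, THEN arg_cong[of _ _ curry_mps]]
    by (simp only: c.hom curry_X_Inl curry_X_Inr bar) simp
  then have KD: "(\<Prod>j<N. curry_mps (kern (i, j))) * (\<Prod>j<N. 1 - ?x * ?y j) = (\<Prod>j<N. 1 + uni i US * ?y j)"
    by (simp add: prod.distrib[symmetric])
  have D: "(\<Prod>j<N. 1 - ?x * ?y j) * uni i (fmap (res {..<N}) Hs) = 1"
    using fmap_res_Hs[of N, THEN arg_cong[of _ _ "uni i"]]
    by (simp only: u.hom uni_X uni_const mult.commute[of _ ?x])
  have "fmap (res {..<N}) Qq = fmap (res {..<N}) Hs * (\<Prod>j<N. 1 + fps_const (X j) * US)"
    using linear_factors_compose[OF US_0, where n = N and c = X and F = 1]
    by (simp add: Qq_def f.mult fmap_compose[OF rhom_res] fmap_res_US fmap_res_Es)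
  then have "uni i (fmap (res {..<N}) Qq) = uni i (fmap (res {..<N}) Hs) * (\<Prod>j<N. 1 + uni i US * ?y j)"
    by (simp only: u.hom uni_const mult.commute[of _ "uni i US"])
  also have "\<dots> = (\<Prod>j<N. curry_mps (kern (i, j))) * ((\<Prod>j<N. 1 - ?x * ?y j) * uni i (fmap (res {..<N}) Hs))"
    unfolding KD[symmetric] by (simp only: ac_simps)
  finally show ?thesis by (simp only: D mult_1_right)
qed

lemma kernel_coeff:
  assumes A: "set_mset A \<subseteq> {..<N}" and B: "set_mset B \<subseteq> {..<N}"
  shows "mps_nth cauchy_kernel (two A B) = mps_nth (\<Prod>i<N. fps_nth Qq (count A i)) B"
proof -
  interpret c: rhom "curry_mps :: series2 \<Rightarrow> _" by (rule rhom_curry)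
  interpret r: rhom "res {..<N} :: series \<Rightarrow> _" by (rule rhom_res)
  have "set_mset (two A B) \<subseteq> vars N" using A B unfolding two_def vars_def by auto
  then have "mps_nth cauchy_kernel (two A B) = mps_nth (mps_nth (curry_mps (prod kern ({..<N} \<times> {..<N}))) A) B"
    by (simp only: mps_nth_kernel mps_nth_curry)
  also have "curry_mps (prod kern ({..<N} \<times> {..<N})) = (\<Prod>i<N. uni i (fmap (res {..<N}) Qq))"
    unfolding c.prod curry_kern_row[symmetric] by (simp add: prod.cartesian_product)
  also have "mps_nth \<dots> A = res {..<N} (\<Prod>i<N. fps_nth Qq (count A i))"
    by (subst mps_nth_prod_uni[OF _ A]) (simp_all add: r.prod)
  finally show ?thesis using B by (simp add: mps_nth_res)
qed

section \<open>The image of the products of \<open>Qp\<close> under \<omega>\<close>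

lemma compose_US_nth: "fps_nth (F oo US) m = (\<Sum>k\<le>m. const (fps_nth ((fps_X * V0) ^ k) m) * fps_nth F k)"
proof -
  interpret f: rhom "fmap const :: _ \<Rightarrow> series fps" by (intro rhom_fmap rhom_const)
  show ?thesis
    by (simp add: fps_compose_nth US_eq f.power[symmetric] atMost_atLeast0 mult.commute del: fmap_nth)
       (simp add: mult.commute)
qed

text \<open>Each coefficient of \<open>Qp\<close> is a finite combination of products of
  \<open>esym i\<close> and \<open>hsym k\<close> with scalars from the ground ring, and \<omega>
  exchanges the two kinds of factors.\<close>

lemma omega_Qp_mult:
  assumes f: "f \<in> symspan"
  shows "fps_nth Qp a * f \<in> symspan \<and> \<omega> (fps_nth Qp a * f) = fps_nth Qq a * \<omega> f"
proof -
  let ?c = "\<lambda>i k. fps_nth ((fps_X * V0) ^ k) (a - i)"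
  have expand: "fps_nth (F * (G oo US)) a * g =
      (\<Sum>i\<le>a. \<Sum>k\<le>a - i. fps_nth F i * (const (?c i k) * (fps_nth G k * g)))" for F G :: "series fps" and g
    by (simp add: fps_mult_nth compose_US_nth atMost_atLeast0 sum_distrib_left sum_distrib_right mult.assoc)
  have t: "esym i * (const (?c i k) * (hsym k * f)) \<in> symspan \<and>
      \<omega> (esym i * (const (?c i k) * (hsym k * f))) = hsym i * (const (?c i k) * (esym k * \<omega> f))" for i k
    using omega_hsym_mult[OF f, of k] symspan_const_mult[of "hsym k * f" "?c i k"]
      omega_esym_mult[of "const (?c i k) * (hsym k * f)" i] by simp
  have inner: "(\<Sum>k\<le>a - i. esym i * (const (?c i k) * (hsym k * f))) \<in> symspan \<and>
      \<omega> (\<Sum>k\<le>a - i. esym i * (const (?c i k) * (hsym k * f))) =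
      (\<Sum>k\<le>a - i. hsym i * (const (?c i k) * (esym k * \<omega> f)))" for i
    using symspan_sum[of "{..a - i}" "\<lambda>k. esym i * (const (?c i k) * (hsym k * f))"] t by simp
  have "(\<Sum>i\<le>a. \<Sum>k\<le>a - i. esym i * (const (?c i k) * (hsym k * f))) \<in> symspan \<and>
      \<omega> (\<Sum>i\<le>a. \<Sum>k\<le>a - i. esym i * (const (?c i k) * (hsym k * f))) =
      (\<Sum>i\<le>a. \<Sum>k\<le>a - i. hsym i * (const (?c i k) * (esym k * \<omega> f)))"
    using symspan_sum[of "{..a}" "\<lambda>i. \<Sum>k\<le>a - i. esym i * (const (?c i k) * (hsym k * f))"] inner by simp
  then show ?thesis unfolding Qp_def Qq_def expand by (simp only: Es_def Hs_def fps_nth_Abs_fps)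
qed

lemma symspan_1: "1 \<in> symspan" "\<omega> 1 = 1"
proof -
  have "sch (\<lambda>_. 0) = 1"
  proof (rule mps_eqI_res)
    fix n
    show "res {..<n} (sch (\<lambda>_. 0)) = res {..<n} 1"
      by (simp add: sch_def res_schur schur_fin_def rhom.one[OF rhom_res])
  qed
  moreover have "cj (\<lambda>_. 0) = (\<lambda>_. 0)" by (simp add: cj_def fun_eq_iff)
  ultimately show "1 \<in> symspan" "\<omega> 1 = 1" using symspan_sch[OF zero_Part] by simp_all
qed

lemma omega_prod_Qp:
  "(\<Prod>i<n. fps_nth Qp (a i)) \<in> symspan \<and> \<omega> (\<Prod>i<n. fps_nth Qp (a i)) = (\<Prod>i<(n :: nat). fps_nth Qq (a i))"
proof (induction n)
  case (Suc n)
  then show ?case using omega_Qp_mult[of "\<Prod>i<n. fps_nth Qp (a i)" "a n"] by (simp add: mult.commute)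
qed (simp add: symspan_1)

section \<open>Leading monomials of \<open>GQ\<close> and \<open>jp\<close>\<close>

lemma mh_mv_index: "mh a b \<Longrightarrow> mv b c \<Longrightarrow> index a < index c"
  by (cases a; cases b; cases c) (auto simp: mh_def mv_def)

lemma mem_SD: "(i, j) \<in> SD lam \<longleftrightarrow> i < length lam \<and> i \<le> j \<and> j - i < lam ! i"
  by (auto simp: SD_def) (metis le_add_diff_inverse)

text \<open>From (i, i) to (i + 1, i + 1) the path goes one step right and one step down. The box in
  between cannot repeat the index in both directions, so the index strictly grows along the main
  diagonal; rows then only increase it.\<close>

lemma tabs_index_ge_row:
  assumes lam: "lam \<in> strict_partitions" and V: "V \<in> tabs mh mv (SD lam) A" and b: "(i, j) \<in> SD lam"
  shows "i \<le> index (V (i, j))"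
proof -
  have up: "(i, j) \<in> SD lam" if "(Suc i, j) \<in> SD lam" for i j
    using ideal_SD[OF lam] that by (auto simp: ideal_def SQ_def mem_SD)
  have dg: "(i, i) \<in> SD lam" if "(i, j) \<in> SD lam" for i j using that by (auto simp: mem_SD)
  have "(i, i) \<in> SD lam \<Longrightarrow> i \<le> index (V (i, i))" for i
  proof (induction i)
    case (Suc i)
    have m: "(i, Suc i) \<in> SD lam" using up[OF Suc.prems] .
    have "index (V (i, i)) < index (V (Suc i, Suc i))"
      using tabs_h[OF V dg[OF m] m] tabs_v[OF V m Suc.prems] by (rule mh_mv_index)
    then show ?case using Suc.IH[OF dg[OF m]] by simp
  qed simp
  from this[OF dg[OF b]] have d: "i \<le> index (V (i, i))" .
  show ?thesis
  proof (cases "i = j")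
    case False
    then have "i < j" using b by (simp add: mem_SD)
    then have "mh (V (i, i)) (V (i, j))"
      using tabs_row[OF convex_ideal[OF ideal_SD[OF lam]] V dg[OF b] b] by simp
    then show ?thesis using d mh_idx(1) le_trans by blast
  qed (use d in simp)
qed

lemma SSVT_index_ge_row:
  assumes lam: "lam \<in> strict_partitions" and T: "T \<in> SSVT lam" and b: "b \<in> SD lam" and a: "a \<in> T b"
  shows "fst b \<le> index a"
proof -
  note iff = SSVT_iff[OF refl convex_ideal[OF ideal_SD[OF lam]], THEN iffD1, OF T]
  \<comment> \<open>A selection of one entry from each box that picks \<open>a\<close> in box
    \<open>b\<close> is a marked tableau, to which the previous lemma applies.\<close>
  define V where "V = restrict (\<lambda>c. if c = b then a else (SOME a. a \<in> T c)) (SD lam)"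
  have V: "V c \<in> T c" if c: "c \<in> SD lam" for c
  proof (cases "c = b")
    case False
    have "\<exists>a. a \<in> T c" using iff c by blast
    from someI_ex[OF this] show ?thesis using False c by (simp add: V_def)
  qed (use a b in \<open>simp add: V_def\<close>)
  have "V \<in> tabs mh mv (SD lam) UNIV"
    unfolding tabs_def
  proof (intro CollectI conjI allI impI)
    show "V \<in> SD lam \<rightarrow>\<^sub>E UNIV" by (simp add: V_def)
    show "mh (V (i, j)) (V (i, Suc j))" if "(i, j) \<in> SD lam" "(i, Suc j) \<in> SD lam" for i j
      using iff that V[OF that(1)] V[OF that(2)] by blast
    show "mv (V (i, j)) (V (Suc i, j))" if "(i, j) \<in> SD lam" "(Suc i, j) \<in> SD lam" for i j
      using iff that V[OF that(1)] V[OF that(2)] by blast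
  qed
  from tabs_index_ge_row[OF lam this, of "fst b" "snd b"] b show ?thesis by (simp add: V_def)
qed

lemma strict_imp_partition: "lam \<in> strict_partitions \<Longrightarrow> lam \<in> partitions"
  unfolding strict_partitions_def partitions_def by (auto elim: sorted_wrt_mono_rel[rotated])

lemma count_row_mset_SD: "count (row_mset (SD lam)) i = rowf lam i"
proof -
  have "{b \<in> SD lam. fst b = i} = (\<lambda>j. (i, i + j)) ` {..<rowf lam i}"
    by (auto simp: SD_def rowf_def split: if_splits)
  then show ?thesis by (simp add: count_row_mset card_image inj_on_def)
qed

lemma row_mset_SD_inj:
  assumes "lam \<in> strict_partitions" "mu \<in> strict_partitions" "row_mset (SD lam) = row_mset (SD mu)"
  shows "lam = mu"
proof -
  have "rowf lam = rowf mu" using assms(3) count_row_mset_SD by (metis ext)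
  then show ?thesis using rowf_inj assms(1,2) strict_imp_partition by (meson inj_onD)
qed

lemma superstandard_tabs:
  "restrict (\<lambda>b. Unprimed (fst b)) (SD lam) \<in> tabs mh mv (SD lam) UNIV"
  by (auto simp: tabs_def mh_def mv_def)

text \<open>Every box contributes at least its row number plus 1 to the height, and an additional
  entry or a larger index contributes more. Several tableaux may share the lowest weight, because
  letters may be marked, so the coefficient is only a positive integer.\<close>

lemma leading_GQ:
  assumes lam: "lam \<in> strict_partitions"
  shows "leading (row_mset (SD lam)) (GQ lam)"
    "\<exists>c > 0. mps_nth (GQ lam) (row_mset (SD lam)) = of_nat c"
proof -
  let ?w = "row_mset (SD lam)"
  have ge: "height ?w < height (wtS lam T) \<or> wtS lam T = ?w" if T: "T \<in> SSVT lam" for T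
  proof -
    let ?h = "\<lambda>b. \<Sum>a\<in>T b. Suc (index a)"
    have b: "Suc (fst b) < ?h b \<or> (Suc (fst b) = ?h b \<and> (\<Sum>a\<in>T b. {#index a#}) = {#fst b#})"
      if b: "b \<in> SD lam" for b
    proof -
      have fT: "finite (T b)" "T b \<noteq> {}" using T b by (auto simp: SSVT_def)
      then obtain a where a: "a \<in> T b" by blast
      have s: "?h b = Suc (index a) + (\<Sum>a\<in>T b - {a}. Suc (index a))" using fT(1) a by (rule sum.remove)
      have i: "fst b \<le> index a" by (rule SSVT_index_ge_row[OF lam T b a])
      show ?thesis
      proof (cases "T b - {a} = {}")
        case True
        then have "T b = {a}" using a by blast
        then show ?thesis using i by auto
      next
        case False
        then have "0 < (\<Sum>a\<in>T b - {a}. Suc (index a))" using fT(1) by (intro sum_pos) auto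
        then show ?thesis using s i by simp
      qed
    qed
    show ?thesis
    proof (cases "\<forall>b\<in>SD lam. (\<Sum>a\<in>T b. {#index a#}) = {#fst b#}")
      case True
      then show ?thesis unfolding wtS_def row_mset_def by (simp cong: sum.cong)
    next
      case False
      then obtain c where c: "c \<in> SD lam" "(\<Sum>a\<in>T c. {#index a#}) \<noteq> {#fst c#}" by blast
      have "(\<Sum>b\<in>SD lam. Suc (fst b)) < (\<Sum>b\<in>SD lam. ?h b)"
      proof (rule sum_strict_mono_ex1)
        show "\<forall>b\<in>SD lam. Suc (fst b) \<le> ?h b" using b by (metis le_eq_less_or_eq)
        show "\<exists>b\<in>SD lam. Suc (fst b) < ?h b" using b[OF c(1)] c by blast
      qed simp
      then show ?thesis unfolding wtS_def row_mset_def by (simp add: height_sum)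
    qed
  qed
  let ?T = "restrict (\<lambda>b. {Unprimed (fst b)}) (SD lam)"
  have "?T \<in> SSVT lam"
    by (rule SSVT_iff[OF refl convex_ideal[OF ideal_SD[OF lam]], THEN iffD2]) (auto simp: mh_def mv_def)
  moreover have "wtS lam ?T = ?w" unfolding wtS_def row_mset_def by (intro sum.cong refl) simp
  ultimately have "?T \<in> {T \<in> SSVT lam. wtS lam T = ?w}" by blast
  then have "card {T \<in> SSVT lam. wtS lam T = ?w} > 0"
    using finite_SSVT_wt[OF lam] by (subst card_gt_0_iff) blast
  moreover have "mps_nth (GQ lam) ?w = of_nat (card {T \<in> SSVT lam. wtS lam T = ?w})"
    by (simp add: mps_nth_GQ[OF lam] size_row_mset card_SD)
  ultimately show ex: "\<exists>c > 0. mps_nth (GQ lam) ?w = of_nat c" by blast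
  have "height ?w < height A \<or> A = ?w" if "mps_nth (GQ lam) A \<noteq> 0" for A
  proof -
    have "{T \<in> SSVT lam. wtS lam T = A} \<noteq> {}"
      using that unfolding mps_nth_GQ[OF lam] by (metis card.empty mult_zero_left of_nat_0)
    then obtain T where "T \<in> SSVT lam" "wtS lam T = A" by blast
    then show ?thesis using ge by blast
  qed
  then show "leading ?w (GQ lam)" unfolding leading_def using ex by auto
qed

lemma jp_comb_Nil_nth:
  assumes "lam \<in> strict_partitions"
  shows "mps_nth (jp_comb lam []) M =
    of_nat (card {t \<in> SBT (SD lam). wtB t = M}) * (- \<beta>) ^ (card (SD lam) - size M)"
  using mps_nth_jp_comb[OF assms Nil_strict(1), of M] by simp

text \<open>All bar tableaux of one weight come with the same power of -\<beta>, so nothing cancels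
  and a single tableau makes the coefficient nonzero.\<close>

lemma jp_comb_Nil_nonzero:
  assumes lam: "lam \<in> strict_partitions"
    and Bs: "Bs \<in> bars (SD lam) (restrict (\<lambda>b. Unprimed (fst b)) (SD lam))"
  shows "mps_nth (jp_comb lam []) (\<Sum>B\<in>Bs. {#fst (SOME b. b \<in> B)#}) \<noteq> 0"
proof -
  let ?V = "restrict (\<lambda>b. Unprimed (fst b)) (SD lam)"
  let ?M = "\<Sum>B\<in>Bs. {#fst (SOME b. b \<in> B)#}"
  have "wtB (?V, Bs) = ?M"
    unfolding wtB_def fst_conv snd_conv
  proof (rule sum.cong[OF refl])
    fix B assume B: "B \<in> Bs"
    have "B \<noteq> {}" "B \<subseteq> SD lam" using Bs B by (auto simp: bars_def partition_on_def)
    then obtain b where b: "b \<in> B" by blast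
    have s: "(SOME b. b \<in> B) \<in> B" using b by (rule someI)
    have "is_bar ?V B" using Bs B by (simp add: bars_def)
    then have "?V c = ?V (SOME b. b \<in> B)" if "c \<in> B" for c using that s unfolding is_bar_def by blast
    then have "?V ` B = {?V (SOME b. b \<in> B)}" using s by (intro equalityI subsetI; force)
    then have "index (the_elem (?V ` B)) = fst (SOME b. b \<in> B)" using s \<open>B \<subseteq> SD lam\<close> by auto
    then show "{#index (the_elem (?V ` B))#} = {#fst (SOME b. b \<in> B)#}" by simp
  qed
  moreover have "(?V, Bs) \<in> SBT (SD lam)"
    using superstandard_tabs Bs by (simp add: SBT_def no_primed_diagonal_def)
  ultimately have "(?V, Bs) \<in> {t \<in> SBT (SD lam). wtB t = ?M}" by blast
  moreover have "finite {t \<in> SBT (SD lam). wtB t = ?M}" using finite_SBT_wt by simp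
  ultimately have "card {t \<in> SBT (SD lam). wtB t = ?M} \<noteq> 0" by auto
  then show ?thesis by (simp add: jp_comb_Nil_nth[OF lam] \<beta>_def)
qed

lemma jp_comb_Nil_row_mset:
  assumes lam: "lam \<in> strict_partitions"
  shows "mps_nth (jp_comb lam []) (row_mset (SD lam)) \<noteq> 0"
proof -
  let ?Bs = "(\<lambda>b. {b}) ` SD lam"
  have "is_bar V {b}" for V b
    unfolding is_bar_def by (rule conjI, rule exI[of _ "fst b"], rule exI[of _ "snd b"], rule exI[of _ 1]) auto
  then have "?Bs \<in> bars (SD lam) (restrict (\<lambda>b. Unprimed (fst b)) (SD lam))"
    by (auto simp: bars_def partition_on_def disjoint_def)
  from jp_comb_Nil_nonzero[OF lam this] show ?thesis
    by (simp add: row_mset_def sum.reindex inj_on_def)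
qed

text \<open>Taking each row as one bar shows that every shape with a given number of rows contains
  one and the same monomial. This makes the candidates in \<open>jp_expansion_unique\<close> finite
  in number.\<close>

lemma jp_comb_Nil_rows:
  assumes lam: "lam \<in> strict_partitions"
  shows "mps_nth (jp_comb lam []) (\<Sum>i<length lam. {#i#}) \<noteq> 0"
proof -
  let ?R = "\<lambda>i. {(i, i + k) | k. k < lam ! i}"
  let ?Bs = "?R ` {..<length lam}"
  have pos: "lam ! i > 0" if "i < length lam" for i
    using lam nth_mem[OF that] by (cases "lam ! i") (auto simp: strict_partitions_def)
  have mem: "(i, i) \<in> ?R i" if "i < length lam" for i using pos[OF that] by auto
  have inj: "inj_on ?R {..<length lam}"
  proof (rule inj_onI)
    fix i k assume i: "i \<in> {..<length lam}" and e: "?R i = ?R k"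
    have "(i, i) \<in> ?R k" unfolding e[symmetric] using i by (intro mem) simp
    then show "i = k" by blast
  qed
  have "?Bs \<in> bars (SD lam) (restrict (\<lambda>b. Unprimed (fst b)) (SD lam))"
    unfolding bars_def
  proof (intro CollectI conjI ballI)
    show "partition_on (SD lam) ?Bs"
      unfolding partition_on_def
    proof (intro conjI)
      show "\<Union> ?Bs = SD lam" by (auto simp: SD_def)
      show "disjoint ?Bs" by (auto simp: disjoint_def)
      show "{} \<notin> ?Bs" using mem by blast
    qed
    fix B assume "B \<in> ?Bs"
    then obtain i where i: "i < length lam" "B = ?R i" by blast
    have "\<exists>i j n. B = {(i, j + k) | k. k < n} \<or> B = {(i + k, j) | k. k < n}" using i(2) by blast
    moreover have "\<forall>b\<in>B. \<forall>b'\<in>B. restrict (\<lambda>b. Unprimed (fst b)) (SD lam) b = restrict (\<lambda>b. Unprimed (fst b)) (SD lam) b'"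
      using i by (auto simp: mem_SD)
    ultimately show "is_bar (restrict (\<lambda>b. Unprimed (fst b)) (SD lam)) B" unfolding is_bar_def by blast
  qed
  from jp_comb_Nil_nonzero[OF lam this]
  have "mps_nth (jp_comb lam []) (\<Sum>i<length lam. {#fst (SOME b. b \<in> ?R i)#}) \<noteq> 0"
    unfolding sum.reindex[OF inj] o_def .
  moreover have "(\<Sum>i<length lam. {#fst (SOME b. b \<in> ?R i)#}) = (\<Sum>i<length lam. {#i#})"
  proof (rule sum.cong[OF refl])
    fix i assume "i \<in> {..<length lam}"
    then have "(SOME b. b \<in> ?R i) \<in> ?R i" using mem[of i] by (intro someI[of "\<lambda>b. b \<in> ?R i" "(i, i)"]) simp
    then have "fst (SOME b. b \<in> ?R i) = i" by force
    then show "{#fst (SOME b. b \<in> ?R i)#} = {#i#}" by simp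
  qed
  ultimately show ?thesis by simp
qed

text \<open>The degree is the number of bars, hence at most the number of boxes. In top degree all
  bars are single boxes and the lowest monomial is that of the rows; in lower degree the only
  control is that a tableau with k rows uses an index of at least k - 1.\<close>

lemma jp_comb_Nil_support:
  assumes lam: "lam \<in> strict_partitions" and nz: "mps_nth (jp_comb lam []) A \<noteq> 0"
  shows "size A \<le> card (SD lam)" "set_mset A \<subseteq> {..<n} \<Longrightarrow> length lam \<le> n"
    "size A = card (SD lam) \<Longrightarrow> height (row_mset (SD lam)) < height A \<or> A = row_mset (SD lam)"
proof -
  have "{t \<in> SBT (SD lam). wtB t = A} \<noteq> {}"
    using nz unfolding jp_comb_Nil_nth[OF lam] by (metis card.empty mult_zero_left of_nat_0)
  then obtain V Bs where t: "V \<in> tabs mh mv (SD lam) UNIV" "Bs \<in> bars (SD lam) V" "wtB (V, Bs) = A"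
    by (auto simp: SBT_def)
  have part: "partition_on (SD lam) Bs" and bar: "\<And>B. B \<in> Bs \<Longrightarrow> is_bar V B" using t(2) by (auto simp: bars_def)
  have B: "finite B" "B \<noteq> {}" "B \<subseteq> SD lam" if "B \<in> Bs" for B
    using part that finite_subset[OF _ finite_SD[of lam], of B] by (auto simp: partition_on_def)
  have finBs: "finite Bs" using part by (rule finite_elements[OF finite_SD])
  have cardD: "card (SD lam) = (\<Sum>B\<in>Bs. card B)" using part B(1) by (rule product_partition)
  have ge1: "1 \<le> card B" if "B \<in> Bs" for B using B[OF that] by (simp add: Suc_le_eq card_gt_0_iff)
  have szA: "size A = card Bs" using t(3) size_wtB[of "(V, Bs)"] by simp
  show "size A \<le> card (SD lam)" unfolding szA cardD using sum_mono[of Bs "\<lambda>_. 1" card] ge1 by simp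
  have val: "the_elem (V ` B) = V b" if "B \<in> Bs" "b \<in> B" for B b
  proof -
    have "V c = V b" if "c \<in> B" for c using bar[OF \<open>B \<in> Bs\<close>] that \<open>b \<in> B\<close> unfolding is_bar_def by blast
    then have "V ` B = {V b}" using \<open>b \<in> B\<close> by (intro equalityI subsetI; force)
    then show ?thesis by simp
  qed
  show "length lam \<le> n" if n: "set_mset A \<subseteq> {..<n}"
  proof (cases "length lam")
    case (Suc k)
    have "lam ! k > 0" using lam nth_mem[of k lam] Suc by (cases "lam ! k") (auto simp: strict_partitions_def)
    then have k: "(k, k) \<in> SD lam" using Suc by (simp add: mem_SD)
    then obtain B0 where B0: "B0 \<in> Bs" "(k, k) \<in> B0" using part by (auto simp: partition_on_def)
    have "index (V (k, k)) \<in># A"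
      using t(3) B0 val[OF B0] finBs by (auto simp: wtB_def set_mset_sum intro!: bexI[of _ B0])
    then have "index (V (k, k)) < n" using n by auto
    then show ?thesis using tabs_index_ge_row[OF lam t(1) k] Suc by simp
  qed simp
  show "height (row_mset (SD lam)) < height A \<or> A = row_mset (SD lam)" if sz: "size A = card (SD lam)"
  proof -
    have one: "card B = 1" if "B \<in> Bs" for B
    proof (rule ccontr)
      assume "card B \<noteq> 1"
      then have "(\<Sum>B\<in>Bs. 1) < (\<Sum>B\<in>Bs. card B)"
        using ge1 that finBs by (intro sum_strict_mono_ex1) (auto intro!: bexI[of _ B] simp: le_neq_implies_less)
      then show False using sz szA cardD by simp
    qed
    have "Bs = (\<lambda>b. {b}) ` SD lam"
    proof (intro equalityI subsetI)
      fix C assume C: "C \<in> Bs"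
      then obtain b where "C = {b}" using one card_1_singletonE by blast
      then show "C \<in> (\<lambda>b. {b}) ` SD lam" using B(3)[OF C] by blast
    next
      fix C assume "C \<in> (\<lambda>b. {b}) ` SD lam"
      then obtain b where b: "C = {b}" "b \<in> SD lam" by blast
      then obtain C' where C': "C' \<in> Bs" "b \<in> C'" using part unfolding partition_on_def by blast
      then have "C' = {b}" using one[OF C'(1)] card_1_singletonE by blast
      then show "C \<in> Bs" using C' b by simp
    qed
    then have A: "A = (\<Sum>b\<in>SD lam. {#index (V b)#})"
      using t(3) by (simp add: wtB_def sum.reindex inj_on_def)
    have le: "fst b \<le> index (V b)" if "b \<in> SD lam" for b
      using tabs_index_ge_row[OF lam t(1), of "fst b" "snd b"] that by simp
    show ?thesis
    proof (cases "\<forall>b\<in>SD lam. index (V b) = fst b")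
      case True
      then show ?thesis unfolding A row_mset_def by (simp cong: sum.cong)
    next
      case False
      then obtain c where c: "c \<in> SD lam" "index (V c) \<noteq> fst c" by blast
      have "(\<Sum>b\<in>SD lam. Suc (fst b)) < (\<Sum>b\<in>SD lam. Suc (index (V b)))"
      proof (rule sum_strict_mono_ex1)
        show "\<forall>b\<in>SD lam. Suc (fst b) \<le> Suc (index (V b))" using le by simp
        show "\<exists>b\<in>SD lam. Suc (fst b) < Suc (index (V b))" using le[OF c(1)] c by (intro bexI[of _ c]) simp_all
      qed simp
      then show ?thesis unfolding A row_mset_def by (simp add: height_sum)
    qed
  qed
qed

section \<open>Symmetry\<close>

text \<open>Invariance under all injective relabellings of the variables. Stated as equality of two
  ring homomorphisms, it is inherited by sums and products at once.\<close>

definition symmetric :: "series \<Rightarrow> bool"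
  where "symmetric f \<longleftrightarrow> (\<forall>\<pi>. inj \<pi> \<longrightarrow> res (range \<pi>) f = rename \<pi> f)"

lemma symmetric_add: "symmetric f \<Longrightarrow> symmetric g \<Longrightarrow> symmetric (f + g)"
  and symmetric_mult: "symmetric f \<Longrightarrow> symmetric g \<Longrightarrow> symmetric (f * g)"
  and symmetric_const: "symmetric (const c)"
  unfolding symmetric_def
  by (simp_all add: rhom.add[OF rhom_rename] rhom.add[OF rhom_res] rhom.mult[OF rhom_rename] rhom.mult[OF rhom_res] rename_const)

lemma symmetric_sum: "(\<And>i. i \<in> I \<Longrightarrow> symmetric (f i)) \<Longrightarrow> symmetric (sum f I)"
  by (induction I rule: infinite_finite_induct) (simp_all add: symmetric_add symmetric_const[of 0, simplified])

lemma symmetric_prod: "(\<And>i. i \<in> I \<Longrightarrow> symmetric (f i)) \<Longrightarrow> symmetric (prod f I)"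
  by (induction I rule: infinite_finite_induct)
     (simp_all add: symmetric_mult symmetric_const[of 1, simplified rhom.one[OF rhom_const]])

lemma symmetricI:
  assumes "\<And>\<pi> M. inj \<pi> \<Longrightarrow> mps_nth f (image_mset \<pi> M) = mps_nth f M"
  shows "symmetric f"
  unfolding symmetric_def
proof (intro allI impI)
  fix \<pi> :: "nat \<Rightarrow> nat" assume \<pi>: "inj \<pi>"
  show "res (range \<pi>) f = rename \<pi> f"
  proof (rule mps_eqI)
    fix M
    show "mps_nth (res (range \<pi>) f) M = mps_nth (rename \<pi> f) M"
    proof (cases "set_mset M \<subseteq> range \<pi>")
      case True
      then obtain N where N: "M = image_mset \<pi> N" by (rule image_mset_ex)
      show ?thesis using True unfolding N by (simp add: mps_nth_res assms[OF \<pi>] mps_nth_rename_image[OF \<pi>])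
    next
      case False
      then show ?thesis by (simp add: mps_nth_res mps_nth_rename_notin)
    qed
  qed
qed

lemma symmetricD:
  assumes "symmetric f" "inj \<pi>"
  shows "mps_nth f (image_mset \<pi> M) = mps_nth f M"
proof -
  have "mps_nth (res (range \<pi>) f) (image_mset \<pi> M) = mps_nth (rename \<pi> f) (image_mset \<pi> M)"
    using assms by (simp add: symmetric_def)
  moreover have "set_mset (image_mset \<pi> M) \<subseteq> range \<pi>" by auto
  ultimately show ?thesis by (simp add: mps_nth_res mps_nth_rename_image[OF assms(2)])
qed

lemma symmetric_hsym: "symmetric (hsym k)"
  by (rule symmetricI) (simp add: hsym_def)

lemma symmetric_esym: "symmetric (esym k)"
proof (rule symmetricI)
  fix \<pi> :: "nat \<Rightarrow> nat" and M assume \<pi>: "inj \<pi>"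
  have c: "count (image_mset \<pi> M) (\<pi> v) = count M v" for v
    by (induction M) (use \<pi> in \<open>auto dest: injD\<close>)
  have "(\<forall>v. count (image_mset \<pi> M) v \<le> 1) \<longleftrightarrow> (\<forall>v. count M v \<le> 1)"
  proof
    assume "\<forall>v. count (image_mset \<pi> M) v \<le> 1"
    then show "\<forall>v. count M v \<le> 1" by (metis c)
  next
    assume *: "\<forall>v. count M v \<le> 1"
    show "\<forall>v. count (image_mset \<pi> M) v \<le> 1"
    proof
      fix v
      show "count (image_mset \<pi> M) v \<le> 1"
      proof (cases "v \<in># image_mset \<pi> M")
        case True
        then obtain u where "v = \<pi> u" by auto
        then show ?thesis using * c by simp
      next
        case False
        then have "count (image_mset \<pi> M) v = 0" by (rule not_in_iff[THEN iffD1])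
        then show ?thesis by simp
      qed
    qed
  qed
  then show "mps_nth (esym k) (image_mset \<pi> M) = mps_nth (esym k) M" by (simp add: esym_def)
qed

lemma symmetric_Qp: "symmetric (fps_nth Qp a)"
  unfolding Qp_def fps_mult_nth compose_US_nth Es_def Hs_def fps_nth_Abs_fps
  by (intro symmetric_sum symmetric_mult symmetric_const symmetric_hsym symmetric_esym)

lemma symmetric_divide:
  assumes "symmetric (const (of_nat c) * f)" "c > 0"
  shows "symmetric f"
proof (rule symmetricI)
  fix \<pi> :: "nat \<Rightarrow> nat" and M assume "inj \<pi>"
  from symmetricD[OF assms(1) this, of M] show "mps_nth f (image_mset \<pi> M) = mps_nth f M"
    using assms(2) by simp
qed

section \<open>The dual functions\<close>

text \<open>At the lowest monomial of \<open>GQ\<close>, \<open>prod_Qp\<close> expresses a product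
  of coefficients of \<open>Qp\<close> as a positive integer multiple of \<open>Jc l\<close> plus
  terms \<open>Jc k\<close> of smaller height. Solving for \<open>Jc l\<close> by induction on the
  height carries both properties over, with a division by that integer at the end.\<close>

lemma Jc_symspan:
  assumes "l \<in> Prof"
  shows "Jc l \<in> symspan \<and> symmetric (Jc l)"
  using assms
proof (induction "height (row_mset (SDc l))" arbitrary: l rule: less_induct)
  case less
  note l = less.prems
  let ?A = "row_mset (SDc l)"
  define M where "M = size ?A"
  obtain n where n: "set_mset ?A \<subseteq> {..<n}" using finite_nat_iff_bounded finite_set_mset by blast
  have Pf: "k \<in> Prof" if "k \<in> paths M 0" for k using that by (auto simp: Prof_def)
  have lM: "l \<in> paths M 0" using l by (rule paths_card) (simp add: M_def size_row_mset)
  let ?g = "\<lambda>k. mps_nth (GQ (sp k)) ?A"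
  obtain c where c: "c > 0" "?g l = of_nat c" using leading_GQ(2)[OF sp(1)[OF l]] SD_sp[OF l] by auto
  have "(\<Prod>i<n. fps_nth Qp (count ?A i)) = const (?g l) * Jc l + (\<Sum>k\<in>paths M 0 - {l}. const (?g k) * Jc k)"
    unfolding prod_Qp[OF n order.refl] M_def[symmetric] using finite_paths lM by (rule sum.remove)
  then have e: "const (of_nat c) * Jc l =
      (\<Prod>i<n. fps_nth Qp (count ?A i)) + const (-1) * (\<Sum>k\<in>paths M 0 - {l}. const (?g k) * Jc k)"
    by (simp add: c rhom.uminus[OF rhom_const] rhom.one[OF rhom_const])
  have k: "const (?g k) * Jc k \<in> symspan \<and> symmetric (const (?g k) * Jc k)" if k: "k \<in> paths M 0 - {l}" for k
  proof (cases "?g k = 0")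
    case True
    then show ?thesis using symspan_0(1) symmetric_const[of 0] by simp
  next
    case False
    have kP: "k \<in> Prof" using k Pf by blast
    have "height (row_mset (SDc k)) < height ?A \<or> ?A = row_mset (SDc k)"
      using leading_GQ(1)[OF sp(1)[OF kP]] False unfolding leading_def SD_sp[OF kP] by blast
    moreover have "?A \<noteq> row_mset (SDc k)"
    proof
      assume "?A = row_mset (SDc k)"
      then have "sp l = sp k" using sp(1)[OF l] sp(1)[OF kP] by (intro row_mset_SD_inj) (simp_all add: SD_sp l kP)
      then have "prof (sp l) = prof (sp k)" by (rule arg_cong)
      then have "l = k" unfolding sp(2)[OF l] sp(2)[OF kP] .
      then show False using k by blast
    qed
    ultimately have "Jc k \<in> symspan \<and> symmetric (Jc k)" using less.hyps kP by blast
    then show ?thesis using symspan_const_mult symmetric_mult symmetric_const by blast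
  qed
  have s: "(\<Sum>k\<in>paths M 0 - {l}. const (?g k) * Jc k) \<in> symspan"
    using symspan_sum[of "paths M 0 - {l}" "\<lambda>k. const (?g k) * Jc k"] k by blast
  have s': "symmetric (\<Sum>k\<in>paths M 0 - {l}. const (?g k) * Jc k)" by (rule symmetric_sum) (use k in blast)
  have "const (of_nat c) * Jc l \<in> symspan"
    unfolding e using omega_prod_Qp s by (intro symspan_add symspan_const_mult) auto
  moreover have "symmetric (const (of_nat c) * Jc l)"
    unfolding e by (intro symmetric_add symmetric_mult symmetric_const symmetric_prod symmetric_Qp s')
  ultimately show ?case using symspan_divide symmetric_divide c(1) by blast
qed

text \<open>The difference of two expansions of one series sums to 0, so at each monomial only
  finitely many terms survive, and a lone surviving term must vanish.\<close>

lemma nth_product_sum_zero: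
  assumes "formal_has_sum (\<lambda>i. in_x (F i) * in_y (g i)) I s" "formal_has_sum (\<lambda>i. in_x (F i) * in_y (g' i)) I s"
  shows "finite {i \<in> I. mps_nth (F i) A * (mps_nth (g i) B - mps_nth (g' i) B) \<noteq> 0}"
    "\<lbrakk>k \<in> I; \<And>i. i \<in> I \<Longrightarrow> i \<noteq> k \<Longrightarrow> mps_nth (F i) A * (mps_nth (g i) B - mps_nth (g' i) B) = 0\<rbrakk>
      \<Longrightarrow> mps_nth (F k) A * (mps_nth (g k) B - mps_nth (g' k) B) = 0"
proof -
  let ?d = "\<lambda>i. in_x (F i) * in_y (g i) - in_x (F i) * in_y (g' i)"
  have "formal_has_sum ?d I 0"
    unfolding formal_has_sum_def
  proof
    fix M
    show "\<forall>\<^sub>F E in finite_subsets_at_top I. mps_nth (\<Sum>i\<in>E. ?d i) M = mps_nth 0 M"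
      using assms[unfolded formal_has_sum_def, rule_format, of M]
      by eventually_elim (simp only: sum_subtractf mps_nth_diff mps_nth_zero diff_self)
  qed
  note d = this
  have nth: "mps_nth (?d i) (two A B) = mps_nth (F i) A * (mps_nth (g i) B - mps_nth (g' i) B)" for i
    by (simp add: mps_nth_in_x_in_y right_diff_distrib)
  show "finite {i \<in> I. mps_nth (F i) A * (mps_nth (g i) B - mps_nth (g' i) B) \<noteq> 0}"
    using formal_has_sum_finite[OF d, of "two A B"] unfolding nth .
  show "mps_nth (F k) A * (mps_nth (g k) B - mps_nth (g' k) B) = 0"
    if "k \<in> I" "\<And>i. i \<in> I \<Longrightarrow> i \<noteq> k \<Longrightarrow> mps_nth (F i) A * (mps_nth (g i) B - mps_nth (g' i) B) = 0"
    using formal_has_sum_nth[OF d, of "{k}" "two A B"] that unfolding nth by auto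
qed

text \<open>Among the shapes where the coefficients differ at \<open>B\<close>, one of least height
  is isolated by its lowest monomial: no other such shape occurs there.\<close>

lemma GQ_expansion_unique:
  assumes "formal_has_sum (\<lambda>lam. in_x (GQ lam) * in_y (g lam)) strict_partitions s"
    "formal_has_sum (\<lambda>lam. in_x (GQ lam) * in_y (g' lam)) strict_partitions s"
    and lam: "lam \<in> strict_partitions"
  shows "g lam = g' lam"
proof (rule mps_eqI, rule ccontr)
  fix B assume ne: "mps_nth (g lam) B \<noteq> mps_nth (g' lam) B"
  let ?P = "\<lambda>k. k \<in> strict_partitions \<and> mps_nth (g k) B - mps_nth (g' k) B \<noteq> 0"
  have "?P lam" using ne lam by simp
  then obtain k where k: "?P k" "\<And>i. ?P i \<Longrightarrow> height (row_mset (SD k)) \<le> height (row_mset (SD i))"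
    using ex_has_least_nat[of ?P lam "\<lambda>k. height (row_mset (SD k))"] by blast
  have "mps_nth (GQ k) (row_mset (SD k)) * (mps_nth (g k) B - mps_nth (g' k) B) = 0"
  proof (rule nth_product_sum_zero(2)[OF assms(1,2)])
    fix i assume i: "i \<in> strict_partitions" "i \<noteq> k"
    show "mps_nth (GQ i) (row_mset (SD k)) * (mps_nth (g i) B - mps_nth (g' i) B) = 0"
    proof (rule ccontr)
      assume nz: "mps_nth (GQ i) (row_mset (SD k)) * (mps_nth (g i) B - mps_nth (g' i) B) \<noteq> 0"
      then have "mps_nth (GQ i) (row_mset (SD k)) \<noteq> 0" "?P i" using i(1) by auto
      then have "height (row_mset (SD i)) < height (row_mset (SD k)) \<or> row_mset (SD k) = row_mset (SD i)"
        using leading_GQ(1)[OF i(1)] unfolding leading_def by blast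
      then show False using k(2)[OF \<open>?P i\<close>] row_mset_SD_inj[of k i] k(1) i by auto
    qed
  qed (use k(1) in blast)
  then show False using k(1) leading_GQ(1)[of k] by (simp add: leading_def)
qed

text \<open>Applying \<omega> to \<open>prod_Qp\<close> turns \<open>Qp\<close> into
  \<open>Qq\<close>, whose products are the coefficients of the kernel. Hence the images of the
  combinatorial functions satisfy the identity that determines \<open>gp\<close>.\<close>

lemma gp_eq: "gp = (\<lambda>lam. if lam \<in> strict_partitions then \<omega> (jp_comb lam []) else 0)"
  unfolding gp_def
proof (rule the_equality)
  let ?g = "\<lambda>lam. if lam \<in> strict_partitions then \<omega> (jp_comb lam []) else 0"
  have "formal_has_sum (\<lambda>lam. in_x (GQ lam) * in_y (?g lam)) strict_partitions cauchy_kernel"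
  proof (rule formal_has_sumI)
    fix W :: "(nat + nat) multiset"
    obtain A B where W: "W = two A B" by (rule two_ex)
    define M where "M = size A"
    obtain N where N: "set_mset (A + B) \<subseteq> {..<N}" using finite_nat_iff_bounded finite_set_mset by blast
    have Pf: "k \<in> Prof" if "k \<in> paths M 0" for k using that by (auto simp: Prof_def)
    have inj: "inj_on sp (paths M 0)" by (rule inj_on_inverseI[of _ prof]) (simp add: sp Pf)
    have sub: "sp ` paths M 0 \<subseteq> strict_partitions" using sp(1) Pf by blast
    have out: "mps_nth (in_x (GQ lam) * in_y (?g lam)) W = 0" if "lam \<in> strict_partitions - sp ` paths M 0" for lam
    proof -
      have lam: "lam \<in> strict_partitions" using that by blast
      have "mps_nth (GQ lam) A = 0"
      proof (rule ccontr)
        assume "mps_nth (GQ lam) A \<noteq> 0"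
        then have "card (SDc (prof lam)) \<le> M" using GQ_small[OF lam] SD_eq_SDc[OF lam] by (simp add: M_def)
        then have "prof lam \<in> paths M 0" using prof_in_Prof[OF lam] by (intro paths_card)
        then show False using that sp_prof[OF lam] by (metis DiffD2 imageI)
      qed
      then show ?thesis by (simp add: W mps_nth_in_x_in_y)
    qed
    have span: "const (mps_nth (GQ (sp l)) A) * Jc l \<in> symspan" if "l \<in> paths M 0" for l
      using Jc_symspan[OF Pf[OF that]] symspan_const_mult by blast
    have "mps_nth cauchy_kernel W = mps_nth (\<omega> (\<Prod>i<N. fps_nth Qp (count A i))) B"
      unfolding W using N omega_prod_Qp[of "count A" N] by (simp add: kernel_coeff)
    also have "(\<Prod>i<N. fps_nth Qp (count A i)) = (\<Sum>l\<in>paths M 0. const (mps_nth (GQ (sp l)) A) * Jc l)"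
      using N by (intro prod_Qp) (simp_all add: M_def)
    also have "\<omega> \<dots> = (\<Sum>l\<in>paths M 0. \<omega> (const (mps_nth (GQ (sp l)) A) * Jc l))"
      using symspan_sum[of "paths M 0" "\<lambda>l. const (mps_nth (GQ (sp l)) A) * Jc l"] span by blast
    also have "\<dots> = (\<Sum>l\<in>paths M 0. const (mps_nth (GQ (sp l)) A) * \<omega> (Jc l))"
      by (intro sum.cong refl symspan_const_mult) (use Jc_symspan Pf in blast)
    also have "mps_nth \<dots> B = (\<Sum>l\<in>paths M 0. mps_nth (in_x (GQ (sp l)) * in_y (?g (sp l))) W)"
      unfolding mps_nth_sum by (intro sum.cong refl) (simp add: W mps_nth_in_x_in_y sp(1) Pf Jc_def)
    also have "\<dots> = (\<Sum>lam\<in>sp ` paths M 0. mps_nth (in_x (GQ lam) * in_y (?g lam)) W)"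
      by (simp only: sum.reindex[OF inj] o_def)
    finally have total: "mps_nth cauchy_kernel W = (\<Sum>i\<in>sp ` paths M 0. mps_nth (in_x (GQ i) * in_y (?g i)) W)" .
    show "\<exists>F. finite F \<and> F \<subseteq> strict_partitions \<and>
      (\<forall>i\<in>strict_partitions - F. mps_nth (in_x (GQ i) * in_y (?g i)) W = 0) \<and>
      mps_nth cauchy_kernel W = (\<Sum>i\<in>F. mps_nth (in_x (GQ i) * in_y (?g i)) W)"
      by (intro exI[of _ "sp ` paths M 0"] conjI ballI finite_imageI finite_paths sub out total)
  qed
  then show *: "(\<forall>lam. lam \<notin> strict_partitions \<longrightarrow> ?g lam = 0) \<and>
    formal_has_sum (\<lambda>lam. in_x (GQ lam) * in_y (?g lam)) strict_partitions cauchy_kernel" by simp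
  fix g assume g: "(\<forall>lam. lam \<notin> strict_partitions \<longrightarrow> g lam = 0) \<and>
    formal_has_sum (\<lambda>lam. in_x (GQ lam) * in_y (g lam)) strict_partitions cauchy_kernel"
  show "g = ?g"
  proof
    fix lam show "g lam = ?g lam"
      using GQ_expansion_unique[OF g[THEN conjunct2] *[THEN conjunct2], of lam] g by (cases "lam \<in> strict_partitions") auto
  qed
qed

text \<open>The \<omega> in \<open>jp\<close> undoes the one in \<open>gp_eq\<close>.\<close>

lemma jp_eq:
  assumes lam: "lam \<in> strict_partitions"
  shows "jp lam = jp_comb lam []"
proof -
  have "jp_comb lam [] \<in> symspan"
    using Jc_symspan[OF prof_in_Prof[OF lam]] sp_prof[OF lam] by (simp add: Jc_def)
  then show ?thesis using omega_symspan lam by (simp add: jp_def gp_eq)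
qed

text \<open>Large shapes reach down to small degrees, so the lowest monomial alone isolates nothing.
  The differing shapes with at most as many rows as \<open>mu\<close> form a finite set; one of
  largest size, and among those of least height, is isolated by its row monomial: every shape
  occurring there has few enough rows and, by maximality, the same size.\<close>

lemma jp_expansion_unique:
  assumes "formal_has_sum (\<lambda>mu. in_x (jp mu) * in_y (g mu)) strict_partitions s"
    "formal_has_sum (\<lambda>mu. in_x (jp mu) * in_y (g' mu)) strict_partitions s"
    and mu: "mu \<in> strict_partitions"
  shows "g mu = g' mu"
proof (rule mps_eqI, rule ccontr)
  fix B assume ne: "mps_nth (g mu) B \<noteq> mps_nth (g' mu) B"
  let ?c = "\<lambda>k. mps_nth (g k) B - mps_nth (g' k) B"
  define S where "S = {k \<in> strict_partitions. length k \<le> length mu \<and> ?c k \<noteq> 0}"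
  \<comment> \<open>All shapes with \<open>m\<close> rows have a nonzero coefficient at the monomial
    of the rows, and only finitely many terms of the expansion survive there.\<close>
  have "finite {k \<in> strict_partitions. length k = m \<and> ?c k \<noteq> 0}" for m
  proof (rule finite_subset[OF _ nth_product_sum_zero(1)[OF assms(1,2), of "\<Sum>i<m. {#i#}" B]])
    show "{k \<in> strict_partitions. length k = m \<and> ?c k \<noteq> 0} \<subseteq>
      {k \<in> strict_partitions. mps_nth (jp k) (\<Sum>i<m. {#i#}) * ?c k \<noteq> 0}"
      using jp_comb_Nil_rows jp_eq by auto
  qed
  then have "finite (\<Union>m\<le>length mu. {k \<in> strict_partitions. length k = m \<and> ?c k \<noteq> 0})" by blast
  then have finS: "finite S" by (rule finite_subset[rotated]) (auto simp: S_def)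
  have muS: "mu \<in> S" using mu ne by (simp add: S_def)
  define K where "K = Max ((\<lambda>k. card (SD k)) ` S)"
  have "K \<in> (\<lambda>k. card (SD k)) ` S" unfolding K_def using finS muS by (intro Max_in) auto
  then obtain k0 where k0: "k0 \<in> S \<and> card (SD k0) = K" by blast
  have leK: "card (SD k) \<le> K" if "k \<in> S" for k unfolding K_def using finS that by (intro Max_ge) auto
  obtain k where k: "k \<in> S" "card (SD k) = K"
    "\<And>i. i \<in> S \<and> card (SD i) = K \<Longrightarrow> height (row_mset (SD k)) \<le> height (row_mset (SD i))"
    using ex_has_least_nat[of "\<lambda>k. k \<in> S \<and> card (SD k) = K" k0 "\<lambda>k. height (row_mset (SD k))"] k0 by blast
  have ks: "k \<in> strict_partitions" "length k \<le> length mu" "?c k \<noteq> 0" using k(1) by (auto simp: S_def)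
  let ?A = "row_mset (SD k)"
  have vars: "set_mset ?A \<subseteq> {..<length mu}"
  proof
    fix i assume "i \<in># ?A"
    then have "rowf k i \<noteq> 0" using count_row_mset_SD[of k i] by (metis not_in_iff)
    then show "i \<in> {..<length mu}" using ks(2) by (auto simp: rowf_def split: if_splits)
  qed
  have "mps_nth (jp k) ?A * ?c k = 0"
  proof (rule nth_product_sum_zero(2)[OF assms(1,2) ks(1)])
    fix i assume i: "i \<in> strict_partitions" "i \<noteq> k"
    show "mps_nth (jp i) ?A * ?c i = 0"
    proof (rule ccontr)
      assume "mps_nth (jp i) ?A * ?c i \<noteq> 0"
      then have nz: "mps_nth (jp_comb i []) ?A \<noteq> 0" "?c i \<noteq> 0" by (auto simp: jp_eq[OF i(1)])
      note sup = jp_comb_Nil_support[OF i(1) nz(1)]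
      have iS: "i \<in> S" using i(1) sup(2)[OF vars] nz(2) by (simp add: S_def)
      have sz: "size ?A = card (SD i)" using sup(1) leK[OF iS] k(2) by (simp add: size_row_mset)
      then have iK: "card (SD i) = K" using k(2) by (simp add: size_row_mset)
      show False using sup(3)[OF sz] k(3)[of i] iS iK row_mset_SD_inj[OF ks(1) i(1)] i(2) by auto
    qed
  qed
  then show False using ks jp_comb_Nil_row_mset[OF ks(1)] jp_eq[OF ks(1)] by simp
qed

section \<open>Coproduct of the combinatorial \<open>jp\<close> and the skew functions\<close>

lemma JJ_add:
  assumes l: "l \<in> paths M 0" and m: "m \<in> Prof"
  shows "JJ b v (n + k) l m = (\<Sum>r\<in>paths M 0. JJ b (\<lambda>i. v (n + i)) k l r * JJ b v n r m)"
  using l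
proof (induction k arbitrary: l)
  have Pf: "r \<in> Prof" if "r \<in> paths M 0" for r using that by (auto simp: Prof_def)
  {
    case 0
    have "(\<Sum>r\<in>paths M 0. JJ b (\<lambda>i. v (n + i)) 0 l r * JJ b v n r m) =
      (\<Sum>r\<in>paths M 0. if r = l then JJ b v n l m else 0)"
      using 0 by (intro sum.cong refl) (auto simp: JJ_0 Pf)
    then show ?case using 0 finite_paths by simp
  next
    case (Suc k)
    have "JJ b v (n + Suc k) l m = (\<Sum>s\<in>paths M 0. dvec (v (n + k)) b l s M DZ *
        (\<Sum>r\<in>paths M 0. JJ b (\<lambda>i. v (n + i)) k s r * JJ b v n r m))"
      by (simp add: JJ_Suc[OF Suc.prems m] Suc.IH)
    also have "\<dots> = (\<Sum>r\<in>paths M 0. \<Sum>s\<in>paths M 0. dvec (v (n + k)) b l s M DZ *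
        JJ b (\<lambda>i. v (n + i)) k s r * JJ b v n r m)"
      by (simp add: sum_distrib_left mult.assoc) (rule sum.swap)
    also have "\<dots> = (\<Sum>r\<in>paths M 0. JJ b (\<lambda>i. v (n + i)) (Suc k) l r * JJ b v n r m)"
      by (intro sum.cong refl) (simp add: JJ_Suc[OF Suc.prems Pf] sum_distrib_right)
    finally show ?case .
  }
qed

text \<open>Splitting the first \<open>n + m\<close> variables into \<open>n\<close> and \<open>m\<close> factors the tableau sum; symmetry
  then turns this splitting into the interleaving used by \<^const>\<open>in_xy\<close>.\<close>

lemma jp_coproduct_nth:
  assumes lam: "lam \<in> strict_partitions" and A: "set_mset A \<subseteq> {..<n}" and B: "set_mset B \<subseteq> {..<m}"
    and M: "card (SD lam) \<le> M"
  shows "mps_nth (in_xy (jp_comb lam [])) (two A B) =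
    (\<Sum>r\<in>paths M 0. mps_nth (jp_comb (sp r) []) A * mps_nth (jp_comb lam (sp r)) B)"
proof -
  define L where "L = prof lam"
  have L: "L \<in> Prof" "L \<in> paths M 0" "sp L = lam" "SDc L = SD lam"
    using prof_in_Prof[OF lam] paths_card[of "prof lam" M] M SD_eq_SDc[OF lam] sp_prof[OF lam] by (auto simp: L_def)
  have Pf: "r \<in> Prof" if "r \<in> paths M 0" for r using that by (auto simp: Prof_def)
  \<comment> \<open>\<open>\<phi>\<close> sends the first \<open>n\<close> variables to x and the
    others to y; followed by \<open>sum_encode\<close>, it is the injective relabelling that
    compares this block splitting with the interleaved one.\<close>
  define \<phi> :: "nat \<Rightarrow> nat + nat" where "\<phi> k = (if k < n then Inl k else Inr (k - n))" for k
  have \<phi>: "inj \<phi>" by (rule injI) (auto simp: \<phi>_def split: if_splits)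
  have "inj sum_encode" "inj (sum_decode :: nat \<Rightarrow> nat + nat)"
    using bij_sum_encode bij_sum_decode by (simp_all add: bij_betw_def)
  then have \<pi>: "inj (sum_encode \<circ> \<phi>)" using \<phi> by (simp add: inj_compose)
  define N where "N = A + image_mset (\<lambda>k. n + k) B"
  have A': "image_mset \<phi> A = image_mset Inl A" using A by (intro image_mset_cong) (auto simp: \<phi>_def)
  have \<phi>N: "image_mset \<phi> N = two A B" by (simp add: N_def two_def A' image_mset.compositionality comp_def) (simp add: \<phi>_def)
  have vN: "set_mset N \<subseteq> {..<n + m}" using A B by (auto simp: N_def)
  have "two A B = image_mset sum_decode (image_mset (sum_encode \<circ> \<phi>) N)"
    by (simp add: \<phi>N[symmetric] image_mset.compositionality comp_def)
  then have "mps_nth (in_xy (Jc L)) (two A B) = mps_nth (Jc L) N"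
    using \<open>inj sum_decode\<close> symmetricD[OF Jc_symspan[OF L(1), THEN conjunct2] \<pi>]
    by (simp only: in_xy_def mps_nth_rename_image)
  also have "\<dots> = mps_nth (res {..<n + m} (Jc L)) N" using vN by (simp add: mps_nth_res)
  also have "\<dots> = mps_nth (rename \<phi> (JX (n + m) L)) (two A B)"
    unfolding res_Jc[OF L(1)] \<phi>N[symmetric] mps_nth_rename_image[OF \<phi>] ..
  also have "rename \<phi> (JX (n + m) L) = (\<Sum>r\<in>paths M 0. in_x (JX n r) * in_y (JJ (const \<beta>) X m L r))"
  proof -
    have "rename \<phi> (JX (n + m) L) = JJ (const \<beta>) (\<lambda>k. X (\<phi> k)) (n + m) L z0"
      by (simp add: rhom_JJ[OF rhom_rename[OF \<phi>]] rename_const[OF \<phi>] rename_X[OF \<phi>])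
    also have "\<dots> = (\<Sum>r\<in>paths M 0. JJ (const \<beta>) (\<lambda>i. X (\<phi> (n + i))) m L r * JJ (const \<beta>) (\<lambda>k. X (\<phi> k)) n r z0)"
      by (rule JJ_add[OF L(2) z0(1)])
    also have "\<dots> = (\<Sum>r\<in>paths M 0. in_x (JX n r) * in_y (JJ (const \<beta>) X m L r))"
    proof (rule sum.cong[OF refl])
      fix r
      have x: "JJ (const \<beta>) (\<lambda>k. X (\<phi> k)) n r z0 = in_x (JX n r)"
        by (simp add: in_x_def rhom_JJ[OF rhom_rename] rename_const rename_X) (rule JJ_cong, simp add: \<phi>_def)
      have y: "JJ (const \<beta>) (\<lambda>i. X (\<phi> (n + i))) m L r = in_y (JJ (const \<beta>) X m L r)"
        by (simp add: in_y_def rhom_JJ[OF rhom_rename] rename_const rename_X \<phi>_def)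
      show "JJ (const \<beta>) (\<lambda>i. X (\<phi> (n + i))) m L r * JJ (const \<beta>) (\<lambda>k. X (\<phi> k)) n r z0 =
        in_x (JX n r) * in_y (JJ (const \<beta>) X m L r)"
        unfolding x y by (rule mult.commute)
    qed
    finally show ?thesis .
  qed
  also have "mps_nth \<dots> (two A B) = (\<Sum>r\<in>paths M 0. mps_nth (JX n r) A * mps_nth (JJ (const \<beta>) X m L r) B)"
    by (simp add: mps_nth_in_x_in_y)
  also have "\<dots> = (\<Sum>r\<in>paths M 0. mps_nth (jp_comb (sp r) []) A * mps_nth (jp_comb lam (sp r)) B)"
  proof (rule sum.cong[OF refl])
    fix r assume "r \<in> paths M 0"
    then have r: "r \<in> Prof" by (rule Pf)
    have 1: "mps_nth (JX n r) A = mps_nth (jp_comb (sp r) []) A"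
      unfolding res_Jc[OF r, symmetric] using A by (simp add: mps_nth_res Jc_def)
    have 2: "mps_nth (JJ (const \<beta>) X m L r) B = mps_nth (jp_comb lam (sp r)) B"
    proof (cases "SDc r \<subseteq> SD lam")
      case True
      then show ?thesis
        using mps_nth_jp_comb_eq_JT[OF lam sp(1)[OF r] _ B] by (simp add: JJ_def L(4) SD_sp[OF r])
    next
      case False
      then show ?thesis by (simp add: JJ_def L(4) jp_comb_def SD_sp[OF r])
    qed
    show "mps_nth (JX n r) A * mps_nth (JJ (const \<beta>) X m L r) B =
      mps_nth (jp_comb (sp r) []) A * mps_nth (jp_comb lam (sp r)) B" unfolding 1 2 ..
  qed
  finally show ?thesis by (simp add: Jc_def L(3))
qed

text \<open>The coproduct formula exhibits \<open>jp_comb lam\<close> as one solution of the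
  defining identity, where only shapes inside \<open>lam\<close> contribute, and
  \<open>jp_expansion_unique\<close> rules out any other.\<close>

lemma jp_skew_eq:
  assumes lam: "lam \<in> strict_partitions"
  shows "jp_skew lam = (\<lambda>mu. if mu \<in> strict_partitions then jp_comb lam mu else 0)"
  unfolding jp_skew_def
proof (rule the_equality)
  let ?J = "\<lambda>mu. if mu \<in> strict_partitions then jp_comb lam mu else 0"
  have "formal_has_sum (\<lambda>mu. in_x (jp mu) * in_y (?J mu)) strict_partitions (in_xy (jp lam))"
  proof (rule formal_has_sumI)
    fix W :: "(nat + nat) multiset"
    obtain A B where W: "W = two A B" by (rule two_ex)
    obtain n where N: "set_mset (A + B) \<subseteq> {..<n}" using finite_nat_iff_bounded finite_set_mset by blast
    define M where "M = card (SD lam)"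
    have Pf: "k \<in> Prof" if "k \<in> paths M 0" for k using that by (auto simp: Prof_def)
    have inj: "inj_on sp (paths M 0)" by (rule inj_on_inverseI[of _ prof]) (simp add: sp Pf)
    have sub: "sp ` paths M 0 \<subseteq> strict_partitions" using sp(1) Pf by blast
    have out: "mps_nth (in_x (jp mu) * in_y (?J mu)) W = 0" if "mu \<in> strict_partitions - sp ` paths M 0" for mu
    proof -
      have mu: "mu \<in> strict_partitions" using that by blast
      have "\<not> SD mu \<subseteq> SD lam"
      proof
        assume "SD mu \<subseteq> SD lam"
        then have "card (SDc (prof mu)) \<le> M" using card_mono[OF finite_SD] SD_eq_SDc[OF mu] by (simp add: M_def)
        then have "prof mu \<in> paths M 0" using prof_in_Prof[OF mu] by (intro paths_card)
        then show False using that sp_prof[OF mu] by (metis DiffD2 imageI)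
      qed
      then show ?thesis by (simp add: W mps_nth_in_x_in_y jp_comb_def)
    qed
    have "mps_nth (in_xy (jp lam)) W = (\<Sum>r\<in>paths M 0. mps_nth (jp_comb (sp r) []) A * mps_nth (jp_comb lam (sp r)) B)"
      unfolding W jp_eq[OF lam] using N by (intro jp_coproduct_nth[OF lam, of _ n _ n]) (simp_all add: M_def)
    also have "\<dots> = (\<Sum>r\<in>paths M 0. mps_nth (in_x (jp (sp r)) * in_y (?J (sp r))) W)"
      by (intro sum.cong refl) (simp add: W mps_nth_in_x_in_y sp(1) Pf jp_eq)
    also have "\<dots> = (\<Sum>mu\<in>sp ` paths M 0. mps_nth (in_x (jp mu) * in_y (?J mu)) W)"
      by (simp only: sum.reindex[OF inj] o_def)
    finally have total: "mps_nth (in_xy (jp lam)) W = (\<Sum>i\<in>sp ` paths M 0. mps_nth (in_x (jp i) * in_y (?J i)) W)" .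
    show "\<exists>F. finite F \<and> F \<subseteq> strict_partitions \<and>
      (\<forall>i\<in>strict_partitions - F. mps_nth (in_x (jp i) * in_y (?J i)) W = 0) \<and>
      mps_nth (in_xy (jp lam)) W = (\<Sum>i\<in>F. mps_nth (in_x (jp i) * in_y (?J i)) W)"
      by (intro exI[of _ "sp ` paths M 0"] conjI ballI finite_imageI finite_paths sub out total)
  qed
  then show *: "(\<forall>mu. mu \<notin> strict_partitions \<longrightarrow> ?J mu = 0) \<and>
    formal_has_sum (\<lambda>mu. in_x (jp mu) * in_y (?J mu)) strict_partitions (in_xy (jp lam))" by simp
  fix g assume g: "(\<forall>mu. mu \<notin> strict_partitions \<longrightarrow> g mu = 0) \<and>
    formal_has_sum (\<lambda>mu. in_x (jp mu) * in_y (g mu)) strict_partitions (in_xy (jp lam))"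
  show "g = ?J"
  proof
    fix mu show "g mu = ?J mu"
      using jp_expansion_unique[OF g[THEN conjunct2] *[THEN conjunct2], of mu] g by (cases "mu \<in> strict_partitions") auto
  qed
qed

theorem theorem4p20:
  assumes "mu \<in> strict_partitions" and "lam \<in> strict_partitions"
  shows "jp_skew lam mu = jp_comb lam mu"
  using assms by (simp add: jp_skew_eq)

end
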